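(* For every fixed integer $r\ge 2$ and each $\mathsf{R}\in\{\mathsf{TS},\mathsf{TJ}\}$, \textsc{D$r$DSR} under $\mathsf{R}$ is $\mathtt{PSPACE}$-complete on bipartite graphs.
   Context: Graphs are finite, simple, undirected. For an integer $r\ge1$, a distance-$r$ dominating set (D$r$DS) of $G$ is a set $D\subseteq V(G)$ such that every vertex is at distance at most $r$ from some vertex of $D$. A $\mathsf{TJ}$-sequence between D$r$DSs $D_s,D_t$ is a sequence $D_s=D_0,\dots,D_q=D_t$ of D$r$DSs with $D_i\setminus D_{i+1}=\{x_i\}$, $D_{i+1}\setminus D_i=\{y_i\}$; a $\mathsf{TS}$-sequence additionally requires $x_iy_i\in E(G)$. \textsc{D$r$DSR} under $\mathsf{R}$: given $G$ and D$r$DSs $D_s,D_t$, decide whether an $\mathsf{R}$-sequence between them exists. *)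

theory Defs
  imports
    "HOL-Computational_Algebra.Polynomial"
    "Graph_Theory.Pair_Digraph"
    "Graph_Theory.Shortest_Path"
begin

section \<open>Deterministic multi-tape Turing machines\<close>

text \<open>
  Tapes are infinite to the right only; a head that is told to move left from cell 0 stays there.
  States and tape symbols are natural numbers below \<open>num_states\<close> and \<open>num_symbols\<close>. Symbol 0 is
  the blank, and 1 and 2 represent the bits. The values of \<open>delta\<close> outside these finite ranges are
  irrelevant, so a well-formed machine is a finite object.
\<close>

datatype direction = Left | Stay | Right

record tm =
  num_tapes :: nat
  num_states :: nat
  num_symbols :: nat
  start_state :: nat
  accept_state :: nat
  reject_state :: nat
  delta :: "nat \<Rightarrow> nat list \<Rightarrow> nat \<times> (nat \<times> direction) list"

definition wf_tm :: "tm \<Rightarrow> bool" where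
  "wf_tm M \<longleftrightarrow>
     1 \<le> num_tapes M \<and> 3 \<le> num_symbols M \<and>
     start_state M < num_states M \<and> accept_state M < num_states M \<and>
     reject_state M < num_states M \<and> accept_state M \<noteq> reject_state M \<and>
     (\<forall>q < num_states M. \<forall>ss. length ss = num_tapes M \<and> set ss \<subseteq> {..<num_symbols M} \<longrightarrow>
        fst (delta M q ss) < num_states M \<and>
        length (snd (delta M q ss)) = num_tapes M \<and>
        fst ` set (snd (delta M q ss)) \<subseteq> {..<num_symbols M})"

text \<open>A tape is its contents together with the head position.\<close>

type_synonym tape = "(nat \<Rightarrow> nat) \<times> nat"

type_synonym config = "nat \<times> tape list"

definition read_tape :: "tape \<Rightarrow> nat" where
  "read_tape tp = fst tp (snd tp)"

fun act_tape :: "nat \<times> direction \<Rightarrow> tape \<Rightarrow> tape" where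
  "act_tape (s, d) (c, h) =
     (c(h := s), case d of Left \<Rightarrow> h - 1 | Stay \<Rightarrow> h | Right \<Rightarrow> Suc h)"

definition halted :: "tm \<Rightarrow> config \<Rightarrow> bool" where
  "halted M cf \<longleftrightarrow> fst cf \<in> {accept_state M, reject_state M}"

definition step :: "tm \<Rightarrow> config \<Rightarrow> config" where
  "step M cf =
     (if halted M cf then cf
      else let (q, as) = delta M (fst cf) (map read_tape (snd cf))
           in (q, map2 act_tape as (snd cf)))"

definition string_contents :: "bool list \<Rightarrow> nat \<Rightarrow> nat" where
  "string_contents x i = (if i < length x then (if x ! i then 2 else 1) else 0)"

text \<open>The input is on the first tape; all other tapes are blank.\<close>

definition init_config :: "tm \<Rightarrow> bool list \<Rightarrow> config" where
  "init_config M x =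
     (start_state M, (string_contents x, 0) # replicate (num_tapes M - 1) ((\<lambda>_. 0), 0))"

definition run :: "tm \<Rightarrow> bool list \<Rightarrow> nat \<Rightarrow> config" where
  "run M x t = (step M ^^ t) (init_config M x)"


section \<open>Polynomial space and polynomial-time reductions\<close>

definition decides :: "tm \<Rightarrow> bool list set \<Rightarrow> bool" where
  "decides M A \<longleftrightarrow>
     (\<forall>x. \<exists>t. fst (run M x t) = (if x \<in> A then accept_state M else reject_state M))"

text \<open>
  Every head only ever visits the first \<open>s\<close> cells of its tape. The input tape is counted as well;
  this makes no difference for polynomial bounds.
\<close>

definition runs_in_space :: "tm \<Rightarrow> bool list \<Rightarrow> nat \<Rightarrow> bool" where
  "runs_in_space M x s \<longleftrightarrow> (\<forall>t. \<forall>tp \<in> set (snd (run M x t)). snd tp < s)"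

definition PSPACE :: "bool list set set" where
  "PSPACE = {A. \<exists>M (p :: nat poly). wf_tm M \<and> decides M A \<and>
                  (\<forall>x. runs_in_space M x (poly p (length x)))}"

text \<open>The output is the contents of the last tape on halting, in either halting state.\<close>

definition polytime_computable :: "(bool list \<Rightarrow> bool list) \<Rightarrow> bool" where
  "polytime_computable f \<longleftrightarrow>
     (\<exists>M (p :: nat poly). wf_tm M \<and>
        (\<forall>x. \<exists>t \<le> poly p (length x).
            halted M (run M x t) \<and> fst (last (snd (run M x t))) = string_contents (f x)))"

definition polytime_reducible :: "bool list set \<Rightarrow> bool list set \<Rightarrow> bool"  (infix \<open>\<le>\<^sub>P\<close> 50) where
  "A \<le>\<^sub>P B \<longleftrightarrow> (\<exists>f. polytime_computable f \<and> (\<forall>x. x \<in> A \<longleftrightarrow> f x \<in> B))"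

definition PSPACE_complete :: "bool list set \<Rightarrow> bool" where
  "PSPACE_complete B \<longleftrightarrow> B \<in> PSPACE \<and> (\<forall>A \<in> PSPACE. A \<le>\<^sub>P B)"


section \<open>Distance-\<open>r\<close> dominating set reconfiguration\<close>

text \<open>
  Finite simple undirected graphs are those satisfying \<^const>\<open>pair_graph\<close>: finite, loop-free digraphs
  without parallel arcs and with a symmetric arc relation.
\<close>

definition bipartite :: "'a pair_pre_digraph \<Rightarrow> bool" where
  "bipartite G \<longleftrightarrow>
     (\<exists>X Y. pverts G = X \<union> Y \<and> X \<inter> Y = {} \<and> parcs G \<subseteq> X \<times> Y \<union> Y \<times> X)"

definition graph_dist :: "'a pair_pre_digraph \<Rightarrow> 'a \<Rightarrow> 'a \<Rightarrow> ereal" where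
  "graph_dist G u v = wf_digraph.\<mu> (with_proj G) (\<lambda>_. 1) u v"

definition dist_dominating_set :: "nat \<Rightarrow> 'a pair_pre_digraph \<Rightarrow> 'a set \<Rightarrow> bool" where
  "dist_dominating_set r G D \<longleftrightarrow>
     D \<subseteq> pverts G \<and> (\<forall>v \<in> pverts G. \<exists>u \<in> D. graph_dist G u v \<le> ereal (real r))"

datatype reconf_rule = TS | TJ

fun reconf_move :: "reconf_rule \<Rightarrow> 'a pair_pre_digraph \<Rightarrow> 'a set \<Rightarrow> 'a set \<Rightarrow> bool" where
  "reconf_move TJ G D D' \<longleftrightarrow> (\<exists>x y. D - D' = {x} \<and> D' - D = {y})"
| "reconf_move TS G D D' \<longleftrightarrow> (\<exists>x y. D - D' = {x} \<and> D' - D = {y} \<and> (x, y) \<in> parcs G)"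

definition reconfigurable ::
  "nat \<Rightarrow> reconf_rule \<Rightarrow> 'a pair_pre_digraph \<Rightarrow> 'a set \<Rightarrow> 'a set \<Rightarrow> bool" where
  "reconfigurable r R G Ds Dt \<longleftrightarrow>
     (\<exists>q D. D 0 = Ds \<and> D q = Dt \<and>
        (\<forall>i \<le> q. dist_dominating_set r G (D i)) \<and>
        (\<forall>i < q. reconf_move R G (D i) (D (Suc i))))"

text \<open>
  An instance with vertex set \<open>{..<n}\<close> is encoded as \<open>n\<close> in unary, followed by a separator, the
  rows of the adjacency matrix, and the characteristic vectors of the two sets.
\<close>

definition encode_instance :: "nat pair_pre_digraph \<Rightarrow> nat set \<Rightarrow> nat set \<Rightarrow> bool list" where
  "encode_instance G Ds Dt =
     (let n = card (pverts G) in
        replicate n True @ [False] @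
        concat (map (\<lambda>u. map (\<lambda>v. (u, v) \<in> parcs G) [0..<n]) [0..<n]) @
        map (\<lambda>v. v \<in> Ds) [0..<n] @ map (\<lambda>v. v \<in> Dt) [0..<n])"

lemma encode_instance_inject:
  fixes G H :: "nat pair_pre_digraph"
  assumes G: "pair_wf_digraph G" "pverts G = {..<n}" "Ds \<subseteq> {..<n}" "Dt \<subseteq> {..<n}"
    and H: "pair_wf_digraph H" "pverts H = {..<m}" "Ds' \<subseteq> {..<m}" "Dt' \<subseteq> {..<m}"
    and eq: "encode_instance G Ds Dt = encode_instance H Ds' Dt'"
  shows "G = H \<and> Ds = Ds' \<and> Dt = Dt'"
proof -
  have unary: "takeWhile id (replicate k True @ False # xs) = replicate k True" for k xs
    by (induction k) auto
  have "takeWhile id (encode_instance G Ds Dt) = replicate n True"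
       "takeWhile id (encode_instance H Ds' Dt') = replicate m True"
    using G(2) H(2) by (simp_all add: encode_instance_def unary)
  with eq have nm: "n = m"
    by (metis length_replicate)
  define rows where
    "rows K = map (\<lambda>u. map (\<lambda>v. (u, v) \<in> parcs K) [0..<n]) [0..<n]" for K :: "nat pair_pre_digraph"
  have len: "length (concat (rows G)) = length (concat (rows H))"
    by (simp add: rows_def length_concat comp_def)
  have "concat (rows G) @ map (\<lambda>v. v \<in> Ds) [0..<n] @ map (\<lambda>v. v \<in> Dt) [0..<n] =
        concat (rows H) @ map (\<lambda>v. v \<in> Ds') [0..<n] @ map (\<lambda>v. v \<in> Dt') [0..<n]"
    using eq G(2) H(2) nm by (simp add: encode_instance_def rows_def)
  with len have conc: "concat (rows G) = concat (rows H)"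
    and s: "map (\<lambda>v. v \<in> Ds) [0..<n] = map (\<lambda>v. v \<in> Ds') [0..<n]"
    and t: "map (\<lambda>v. v \<in> Dt) [0..<n] = map (\<lambda>v. v \<in> Dt') [0..<n]"
    by simp_all
  from conc have "rows G = rows H"
    by (rule concat_injective) (auto simp: rows_def set_zip)
  hence arcs: "(u, v) \<in> parcs G \<longleftrightarrow> (u, v) \<in> parcs H" if "u < n" "v < n" for u v
    using that by (simp add: rows_def)
  have "parcs G \<subseteq> {..<n} \<times> {..<n}" "parcs H \<subseteq> {..<n} \<times> {..<n}"
    using pair_wf_digraph.in_arcsD1[OF G(1)] pair_wf_digraph.in_arcsD2[OF G(1)]
      pair_wf_digraph.in_arcsD1[OF H(1)] pair_wf_digraph.in_arcsD2[OF H(1)] G(2) H(2) nm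
    by auto
  with arcs have "parcs G = parcs H"
    by auto
  moreover have "Ds = Ds'" "Dt = Dt'"
    using s t G(3,4) H(3,4) nm by auto
  ultimately show ?thesis
    using G(2) H(2) nm by simp
qed

definition DrDSR_bipartite :: "nat \<Rightarrow> reconf_rule \<Rightarrow> bool list set" where
  "DrDSR_bipartite r R =
     {encode_instance G Ds Dt | G Ds Dt.
        pair_graph G \<and> (\<exists>n. pverts G = {..<n}) \<and> bipartite G \<and>
        dist_dominating_set r G Ds \<and> dist_dominating_set r G Dt \<and>
        reconfigurable r R G Ds Dt}"

end

theory Submission
  imports Defs
begin

text \<open>
  Membership: whether one dominating set can be reached from another in at most \<open>2 ^ B\<close> moves is the
  outcome of a game in which one player repeatedly names a midpoint and the other chooses a half
  (Savitch's argument); a game of polynomial length whose winning condition is a bounded arithmetic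
  formula can be evaluated in polynomial space. Hardness: a space-bounded Turing machine is turned
  into a CNF formula with two copies of the configuration, and single flips of variables can change
  a copy only while it is free, so a walk through the satisfying assignments simulates the machine;
  although it may go backwards, determinism makes acceptance an invariant of the walk. Flips become
  token moves in a bipartite graph whose clause vertices are at distance \<open>r\<close> from their literals.
  The Turing machines needed in both parts are obtained by compiling bounded arithmetic formulas.
\<close>

section \<open>Structured programs and their compilation to Turing machines\<close>

text \<open>Both classes are defined through explicit machines, so every algorithm has to end as a
  transition table. Only two main programs are written: one prints the bits of a definable word, one
  evaluates a quantified definable predicate. Afterwards everything about resources is a question of
  definability.

  Reachability may need exponentially many moves and is no bounded formula; hence the game, whose
  moves form a second bit array beside the input. Bipartiteness belongs to the language, and it is
  settled in the same game by naming a colouring.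

  One instance has to serve both rules. The forward direction uses slides only, which are also
  jumps; the converse uses only that moves are jumps, so tokens may leap anywhere. Counting pins
  them down: \<open>nv + 1\<close> disjoint zones each need a token, and there are
  \<open>nv + 1\<close> tokens. A token between the two literals of a variable leaves that variable
  without a value, so the converse is proved for partial assignments, where a clause holds only by a
  literal with a defined value.\<close>

type_synonym store = "nat \<Rightarrow> tape"

text \<open>Tests see only the scanned symbol of one tape, so each test becomes a single transition;
  \<open>w\<close> and \<open>P\<close> may be arbitrary because they turn into finite
  tables.\<close>

datatype com =
    Act nat "nat \<Rightarrow> nat" direction
  | Seq com com
  | Cond nat "nat \<Rightarrow> bool" com com
  | Loop nat "nat \<Rightarrow> bool" com

abbreviation scan :: "store \<Rightarrow> nat \<Rightarrow> nat" where
  "scan \<sigma> j \<equiv> read_tape (\<sigma> j)"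

text \<open>
  In \<open>big I c \<sigma> t \<tau>\<close>, the number \<open>t\<close> counts the steps of the compiled machine, and every store
  from which such a step is taken satisfies \<open>I\<close>.
\<close>

inductive big :: "(store \<Rightarrow> bool) \<Rightarrow> com \<Rightarrow> store \<Rightarrow> nat \<Rightarrow> store \<Rightarrow> bool" for I where
  Act: "I \<sigma> \<Longrightarrow> big I (Act j w d) \<sigma> 1 (\<sigma>(j := act_tape (w (scan \<sigma> j), d) (\<sigma> j)))"
| Seq: "big I c \<sigma> t \<tau> \<Longrightarrow> big I c' \<tau> t' \<upsilon> \<Longrightarrow> big I (Seq c c') \<sigma> (t + t') \<upsilon>"
| CondT: "P (scan \<sigma> j) \<Longrightarrow> I \<sigma> \<Longrightarrow> big I c \<sigma> t \<tau> \<Longrightarrow> I \<tau> \<Longrightarrow> big I (Cond j P c c') \<sigma> (t + 2) \<tau>"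
| CondF: "\<not> P (scan \<sigma> j) \<Longrightarrow> I \<sigma> \<Longrightarrow> big I c' \<sigma> t \<tau> \<Longrightarrow> big I (Cond j P c c') \<sigma> (t + 1) \<tau>"
| LoopF: "\<not> P (scan \<sigma> j) \<Longrightarrow> I \<sigma> \<Longrightarrow> big I (Loop j P c) \<sigma> 1 \<sigma>"
| LoopT: "P (scan \<sigma> j) \<Longrightarrow> I \<sigma> \<Longrightarrow> big I c \<sigma> t \<tau> \<Longrightarrow> I \<tau> \<Longrightarrow> big I (Loop j P c) \<tau> t' \<upsilon> \<Longrightarrow>
    big I (Loop j P c) \<sigma> (t + t' + 2) \<upsilon>"

lemma act_tape_head: "snd (act_tape (s, d) tp) \<le> Suc (snd tp)"
  by (cases tp) (auto split: direction.splits)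

lemma big_head: "big I c \<sigma> t \<tau> \<Longrightarrow> snd (\<tau> j) \<le> snd (\<sigma> j) + t"
proof (induction rule: big.induct)
  case (Act \<sigma> i w d)
  then show ?case using act_tape_head[of "w (scan \<sigma> i)" d "\<sigma> i"] by auto
qed auto

text \<open>A head moves at most one cell per step, so a phase of \<open>t\<close> steps cannot go
  further than \<open>t\<close> beyond its start. This turns time bounds of short phases into space
  bounds.\<close>

lemma big_strengthen:
  assumes "big I c \<sigma> t \<tau>" "\<And>\<upsilon>. \<forall>j. snd (\<upsilon> j) \<le> h j + t \<Longrightarrow> J \<upsilon>" "\<forall>j. snd (\<sigma> j) \<le> h j"
  shows "big J c \<sigma> t \<tau>"
  using assms
proof (induction arbitrary: h rule: big.induct)
  case (Act \<sigma> j w d)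
  then show ?case by (intro big.Act Act.prems(1)) (auto intro: le_SucI)
next
  case (Seq c \<sigma> t \<tau> c' t' \<upsilon>)
  have 1: "big J c \<sigma> t \<tau>"
    using Seq.prems(2) by (intro Seq.IH(1)[of h] Seq.prems(1)) (auto intro: order_trans)
  have 2: "\<forall>j. snd (\<tau> j) \<le> h j + t"
    using big_head[OF Seq.hyps(1)] Seq.prems(2) by (meson add_mono order_refl order_trans)
  have "big J c' \<tau> t' \<upsilon>"
    using 2 by (intro Seq.IH(2)[of "\<lambda>j. h j + t"] Seq.prems(1)) (auto simp: add.assoc)
  with 1 show ?case by (rule big.Seq)
next
  case (CondT P \<sigma> j c t \<tau> c')
  have 1: "big J c \<sigma> t \<tau>"
    using CondT.prems(2) by (intro CondT.IH[of h] CondT.prems(1)) (auto intro: order_trans)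
  have 2: "\<forall>j. snd (\<tau> j) \<le> h j + t"
    using big_head[OF CondT.hyps(3)] CondT.prems(2) by (meson add_mono order_refl order_trans)
  show ?case
    using CondT.hyps 1 2 CondT.prems(2)
    by (intro big.CondT CondT.prems(1)) (auto simp: trans_le_add1 intro: order_trans)
next
  case (CondF P \<sigma> j c' t \<tau> c)
  have 1: "big J c' \<sigma> t \<tau>"
    using CondF.prems(2) by (intro CondF.IH[of h] CondF.prems(1)) (auto intro: order_trans)
  then show ?case
    using CondF.hyps CondF.prems(2)
    by (intro big.CondF CondF.prems(1)) (auto simp: trans_le_add1 intro: le_SucI)
next
  case (LoopF P \<sigma> j c)
  then show ?case
    by (intro big.LoopF LoopF.prems(1)) (auto intro: le_SucI)
next
  case (LoopT P \<sigma> j c t \<tau> t' \<upsilon>)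
  have 1: "big J c \<sigma> t \<tau>"
    using LoopT.prems(2) by (intro LoopT.IH(1)[of h] LoopT.prems(1)) (auto intro: order_trans)
  have 2: "\<forall>j. snd (\<tau> j) \<le> h j + t"
    using big_head[OF LoopT.hyps(3)] LoopT.prems(2) by (meson add_mono order_refl order_trans)
  have 3: "big J (Loop j P c) \<tau> t' \<upsilon>"
    using 2
    by (intro LoopT.IH(2)[of "\<lambda>j. h j + t"] LoopT.prems(1)) (auto simp: add.assoc intro: order_trans)
  show ?case
    using LoopT.hyps 1 2 3 LoopT.prems(2)
    by (intro big.LoopT LoopT.prems(1)) (auto simp: trans_le_add1 add.assoc intro: order_trans)
qed

section \<open>Compilation to instruction lists\<close>

type_synonym instr = "nat \<times> (nat \<Rightarrow> nat \<times> direction \<times> nat)"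

fun sz :: "com \<Rightarrow> nat" where
  "sz (Act j w d) = 1"
| "sz (Seq c c') = sz c + sz c'"
| "sz (Cond j P c c') = sz c + sz c' + 2"
| "sz (Loop j P c) = sz c + 2"

text \<open>The argument \<open>a\<close> is the address of the first instruction; jump targets are
  absolute. An unconditional jump is an instruction that rewrites the scanned symbol of tape 0 in
  place.\<close>

fun compile :: "com \<Rightarrow> nat \<Rightarrow> instr list" where
  "compile (Act j w d) a = [(j, \<lambda>s. (w s, d, Suc a))]"
| "compile (Seq c c') a = compile c a @ compile c' (a + sz c)"
| "compile (Cond j P c c') a =
     [(j, \<lambda>s. (s, Stay, if P s then Suc a else a + sz c + 2))] @ compile c (Suc a) @
     [(0, \<lambda>s. (s, Stay, a + sz c + sz c' + 2))] @ compile c' (a + sz c + 2)"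
| "compile (Loop j P c) a =
     [(j, \<lambda>s. (s, Stay, if P s then Suc a else a + sz c + 2))] @ compile c (Suc a) @
     [(0, \<lambda>s. (s, Stay, a))]"

lemma length_compile [simp]: "length (compile c a) = sz c"
  by (induction c arbitrary: a) auto

definition code_at :: "instr list \<Rightarrow> nat \<Rightarrow> instr list \<Rightarrow> bool" where
  "code_at code a is \<longleftrightarrow> (\<exists>xs ys. code = xs @ is @ ys \<and> length xs = a)"

lemma code_at_append:
  "code_at code a (is @ js) \<longleftrightarrow> code_at code a is \<and> code_at code (a + length is) js"
  unfolding code_at_def
proof safe
  fix xs ys
  show "\<exists>xs' ys'. xs @ (is @ js) @ ys = xs' @ is @ ys' \<and> length xs' = length xs"
    by force
  show "\<exists>xs' ys'. xs @ (is @ js) @ ys = xs' @ js @ ys' \<and> length xs' = length xs + length is"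
    by (intro exI[of _ "xs @ is"] exI[of _ ys]) simp
next
  fix xs ys xs' ys'
  assume *: "xs @ is @ ys = xs' @ js @ ys'" "length xs' = length xs + length is"
  then have "(xs @ is) @ ys = xs' @ (js @ ys')" "length (xs @ is) = length xs'" by simp_all
  then have "xs @ is = xs' \<and> ys = js @ ys'" using append_eq_append_conv by metis
  then have "ys = js @ ys'" by blast
  then show "\<exists>xsa ysa. xs @ is @ ys = xsa @ (is @ js) @ ysa \<and> length xsa = length xs" by force
qed

lemma code_at_single: "code_at code a [i] \<Longrightarrow> a < length code \<and> code ! a = i"
  by (auto simp: code_at_def nth_append)

fun mstep :: "instr list \<Rightarrow> nat \<times> store \<Rightarrow> nat \<times> store" where
  "mstep code (q, \<sigma>) =
     (let (j, f) = code ! q; (s, d, q') = f (scan \<sigma> j) in (q', \<sigma>(j := act_tape (s, d) (\<sigma> j))))"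

inductive mpath :: "instr list \<Rightarrow> (store \<Rightarrow> bool) \<Rightarrow> nat \<Rightarrow> nat \<times> store \<Rightarrow> nat \<times> store \<Rightarrow> bool"
  for code I where
  mpath_0: "mpath code I 0 cf cf"
| mpath_Suc: "q < length code \<Longrightarrow> I \<sigma> \<Longrightarrow> mpath code I n (mstep code (q, \<sigma>)) cf \<Longrightarrow>
    mpath code I (Suc n) (q, \<sigma>) cf"

lemma mpath_trans: "mpath code I m a b \<Longrightarrow> mpath code I n b c \<Longrightarrow> mpath code I (m + n) a c"
  by (induction rule: mpath.induct) (auto intro: mpath.intros)

lemma mpath_1: "q < length code \<Longrightarrow> I \<sigma> \<Longrightarrow> mpath code I 1 (q, \<sigma>) (mstep code (q, \<sigma>))"
  by (metis One_nat_def mpath.intros)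

lemma act_tape_idle [simp]: "act_tape (read_tape tp, Stay) tp = tp"
  by (cases tp) (simp add: read_tape_def)

lemma comp_correct:
  "big I c \<sigma> t \<tau> \<Longrightarrow> code_at code a (compile c a) \<Longrightarrow> mpath code I t (a, \<sigma>) (a + sz c, \<tau>)"
proof (induction arbitrary: a rule: big.induct)
  case (Act \<sigma> j w d)
  then show ?case
    using mpath_1[of a code I \<sigma>] code_at_single[OF Act.prems[unfolded compile.simps]]
    by (simp add: fun_upd_def)
next
  case (Seq c \<sigma> t \<tau> c' t' \<upsilon>)
  then show ?case
    by (auto simp: code_at_append add.assoc[symmetric] intro: mpath_trans)
next
  case (CondT P \<sigma> j c t \<tau> c')
  note at = CondT.prems[unfolded compile.simps code_at_append]
  have 1: "mpath code I 1 (a, \<sigma>) (Suc a, \<sigma>)"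
    using mpath_1[of a code I \<sigma>] code_at_single[OF conjunct1[OF at]] CondT.hyps by simp
  have 2: "mpath code I t (Suc a, \<sigma>) (Suc a + sz c, \<tau>)"
    using at by (intro CondT.IH) simp
  have "code_at code (Suc a + sz c) [(0, \<lambda>s. (s, Stay, a + sz c + sz c' + 2))]"
    using at by simp
  from code_at_single[OF this]
  have 3: "mpath code I 1 (Suc a + sz c, \<tau>) (a + sz c + sz c' + 2, \<tau>)"
    using mpath_1[of "Suc a + sz c" code I \<tau>] CondT.hyps by simp
  show ?case using mpath_trans[OF 1 mpath_trans[OF 2 3]] by (simp add: ac_simps)
next
  case (CondF P \<sigma> j c' t \<tau> c)
  note at = CondF.prems[unfolded compile.simps code_at_append]
  have 1: "mpath code I 1 (a, \<sigma>) (a + sz c + 2, \<sigma>)"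
    using mpath_1[of a code I \<sigma>] code_at_single[OF conjunct1[OF at]] CondF.hyps by simp
  have 2: "mpath code I t (a + sz c + 2, \<sigma>) (a + sz c + 2 + sz c', \<tau>)"
    using at by (intro CondF.IH) (simp add: ac_simps)
  show ?case using mpath_trans[OF 1 2] by (simp add: ac_simps)
next
  case (LoopF P \<sigma> j c)
  then show ?case
    using mpath_1[of a code I \<sigma>]
      code_at_single[OF conjunct1[OF LoopF.prems[unfolded compile.simps code_at_append]]] by simp
next
  case (LoopT P \<sigma> j c t \<tau> t' \<upsilon>)
  note at = LoopT.prems[unfolded compile.simps code_at_append]
  have 1: "mpath code I 1 (a, \<sigma>) (Suc a, \<sigma>)"
    using mpath_1[of a code I \<sigma>] code_at_single[OF conjunct1[OF at]] LoopT.hyps by simp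
  have 2: "mpath code I t (Suc a, \<sigma>) (Suc a + sz c, \<tau>)"
    using at by (intro LoopT.IH) simp
  have "code_at code (Suc a + sz c) [(0, \<lambda>s. (s, Stay, a))]"
    using at by simp
  from code_at_single[OF this]
  have 3: "mpath code I 1 (Suc a + sz c, \<tau>) (a, \<tau>)"
    using mpath_1[of "Suc a + sz c" code I \<tau>] LoopT.hyps by simp
  show ?case
    using mpath_trans[OF 1 mpath_trans[OF 2 mpath_trans[OF 3 LoopT.IH(2)[OF LoopT.prems]]]]
    by (simp add: ac_simps)
qed

text \<open>Six symbols suffice: blank, the two bits, and the copies of these three shifted by 3,
  which mark cell 0 of a tape.\<close>

fun wf_com :: "nat \<Rightarrow> com \<Rightarrow> bool" where
  "wf_com K (Act j w d) \<longleftrightarrow> j < K \<and> (\<forall>s<6. w s < 6)"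
| "wf_com K (Seq c c') \<longleftrightarrow> wf_com K c \<and> wf_com K c'"
| "wf_com K (Cond j P c c') \<longleftrightarrow> j < K \<and> wf_com K c \<and> wf_com K c'"
| "wf_com K (Loop j P c) \<longleftrightarrow> j < K \<and> wf_com K c"

definition wf_instr :: "nat \<Rightarrow> nat \<Rightarrow> instr \<Rightarrow> bool" where
  "wf_instr K N i \<longleftrightarrow> fst i < K \<and> (\<forall>s<6. fst (snd i s) < 6 \<and> snd (snd (snd i s)) < N)"

lemma wf_comp: "wf_com K c \<Longrightarrow> a + sz c < N \<Longrightarrow> i \<in> set (compile c a) \<Longrightarrow> wf_instr K N i"
proof (induction c arbitrary: a)
  case (Seq c1 c2)
  then show ?case using Seq.IH(1)[of a] Seq.IH(2)[of "a + sz c1"] by auto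
next
  case (Cond j P c1 c2)
  then show ?case using Cond.IH(1)[of "Suc a"] Cond.IH(2)[of "a + sz c1 + 2"]
    by (auto simp: wf_instr_def)
next
  case (Loop j P c)
  then show ?case using Loop.IH[of "Suc a"] by (auto simp: wf_instr_def)
qed (auto simp: wf_instr_def)

text \<open>Tape 0 of a store is the output tape and becomes the last tape of the machine.\<close>

definition tapes_of :: "nat \<Rightarrow> store \<Rightarrow> tape list" where
  "tapes_of K \<sigma> = map \<sigma> ([1..<K] @ [0])"

definition tape_pos :: "nat \<Rightarrow> nat \<Rightarrow> nat" where
  "tape_pos K j = (if j = 0 then K - 1 else j - 1)"

text \<open>Addresses serve as states, and the two addresses past the end are the halting states.
  There \<open>delta\<close> idles, since well-formedness also constrains it in halting
  states.\<close>

definition tm_of :: "nat \<Rightarrow> instr list \<Rightarrow> tm" where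
  "tm_of K code =
     \<lparr>num_tapes = K, num_states = length code + 2, num_symbols = 6, start_state = 0,
      accept_state = length code, reject_state = Suc (length code),
      delta = (\<lambda>q ss. if q < length code
         then let (j, f) = code ! q; (s, d, q') = f (ss ! tape_pos K j)
              in (q', map (\<lambda>i. if i = tape_pos K j then (s, d) else (ss ! i, Stay)) [0..<K])
         else (q, map (\<lambda>s. (s, Stay)) ss))\<rparr>"

lemma wf_tm_of:
  assumes "K \<ge> 1" "\<forall>i \<in> set code. wf_instr K (length code + 2) i"
  shows "wf_tm (tm_of K code)"
proof -
  have 1: "fst (delta (tm_of K code) q ss) < length code + 2 \<and>
        length (snd (delta (tm_of K code) q ss)) = K \<and>
        fst ` set (snd (delta (tm_of K code) q ss)) \<subseteq> {..<6}"
    if q: "q < length code + 2" and ss: "length ss = K" "set ss \<subseteq> {..<6}" for q ss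
  proof (cases "q < length code")
    case True
    obtain j f where jf: "code ! q = (j, f)" by fastforce
    have w: "wf_instr K (length code + 2) (j, f)" using assms(2) True jf by (metis nth_mem)
    then have "tape_pos K j < K" using assms(1) by (auto simp: wf_instr_def tape_pos_def)
    then have 2: "ss ! tape_pos K j < 6" using ss nth_mem by fastforce
    obtain s d q' where f: "f (ss ! tape_pos K j) = (s, d, q')" using prod_cases3 by blast
    have "s < 6" "q' < length code + 2" using w 2 f by (auto simp: wf_instr_def)
    moreover have "set (map (\<lambda>i. if i = tape_pos K j then (s, d) else (ss ! i, Stay)) [0..<K])
        \<subseteq> insert (s, d) ((\<lambda>s. (s, Stay)) ` set ss)"
      using ss(1) by (auto split: if_splits)
    moreover have "ss ! i < 6" if "i < length ss" for i using ss that nth_mem by fastforce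
    ultimately show ?thesis using True jf f ss
      by (auto simp: tm_of_def)
  qed (use q ss in \<open>auto simp: tm_of_def\<close>)
  show ?thesis
    unfolding wf_tm_def using 1 assms(1) by (simp add: tm_of_def)
qed

lemma length_tapes_of: "K \<ge> 1 \<Longrightarrow> length (tapes_of K \<sigma>) = K"
  by (simp add: tapes_of_def)

lemma nth_tapes_of:
  "i < K \<Longrightarrow> tapes_of K \<sigma> ! i = \<sigma> (if i = K - 1 then 0 else Suc i)"
  by (auto simp: tapes_of_def nth_append)

lemma step_tm_of:
  assumes K: "K \<ge> 1" and wf: "\<forall>i \<in> set code. wf_instr K (length code + 2) i" and q: "q < length code"
  shows "step (tm_of K code) (q, tapes_of K \<sigma>) =
    (fst (mstep code (q, \<sigma>)), tapes_of K (snd (mstep code (q, \<sigma>))))"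
proof -
  obtain j f where jf: "code ! q = (j, f)" by fastforce
  have j: "j < K" using wf q jf by (metis fst_conv nth_mem wf_instr_def)
  then have p: "tape_pos K j < K" by (auto simp: tape_pos_def)
  have tj: "tapes_of K \<sigma> ! tape_pos K j = \<sigma> j"
    using j by (auto simp: nth_tapes_of tape_pos_def)
  obtain s d q' where f: "f (scan \<sigma> j) = (s, d, q')" using prod_cases3 by blast
  have rd: "map read_tape (tapes_of K \<sigma>) ! tape_pos K j = scan \<sigma> j"
    using p tj K by (simp add: length_tapes_of)
  have eq: "map2 act_tape
      (map (\<lambda>i. if i = tape_pos K j then (s, d) else (map read_tape (tapes_of K \<sigma>) ! i, Stay)) [0..<K])
      (tapes_of K \<sigma>) = tapes_of K (\<sigma>(j := act_tape (s, d) (\<sigma> j)))"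
    (is "?l = ?r")
  proof (rule nth_equalityI)
    show "length ?l = length ?r" using K by (simp add: length_tapes_of)
    fix i assume "i < length ?l"
    then have i: "i < K" using K by (simp add: length_tapes_of)
    show "?l ! i = ?r ! i"
    proof (cases "i = tape_pos K j")
      case True
      then show ?thesis using i K j tj
        by (auto simp: length_tapes_of nth_tapes_of tape_pos_def)
    next
      case False
      then have "(if i = K - 1 then 0 else Suc i) \<noteq> j"
        using i j by (auto simp: tape_pos_def split: if_splits)
      then show ?thesis using False i K
        by (simp add: length_tapes_of nth_tapes_of)
    qed
  qed
  show ?thesis
    using q jf f rd eq by (simp add: step_def halted_def tm_of_def Let_def)
qed

text \<open>The machine has no tapes from \<open>K\<close> on. Giving them the contents of a marked
  blank tape makes the store after initialisation independent of \<open>K\<close>, see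
  \<open>ready\<close>.\<close>

definition init_store :: "nat \<Rightarrow> bool list \<Rightarrow> store" where
  "init_store K x j =
     (if j = 1 then (string_contents x, 0)
      else if j < K then (\<lambda>_. 0, 0) else (\<lambda>i. if i = 0 then 3 else 0, 0))"

lemma init_config_tm_of:
  assumes "K \<ge> 2"
  shows "init_config (tm_of K code) x = (0, tapes_of K (init_store K x))"
proof -
  have "(string_contents x, 0) # replicate (K - 1) (\<lambda>_. 0, 0) = tapes_of K (init_store K x)"
    (is "?l = ?r")
  proof (rule nth_equalityI)
    show "length ?l = length ?r" using assms by (simp add: length_tapes_of)
    fix i assume i: "i < length ?l"
    show "?l ! i = ?r ! i"
      using assms i by (cases i) (auto simp: nth_tapes_of init_store_def)
  qed
  then show ?thesis by (simp add: init_config_def tm_of_def)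
qed

lemma mpath_run:
  assumes "K \<ge> 2" and wf: "\<forall>i \<in> set code. wf_instr K (length code + 2) i"
    and "mpath code I n (q, \<sigma>) (q', \<tau>)" "run (tm_of K code) x m = (q, tapes_of K \<sigma>)"
  shows "run (tm_of K code) x (m + n) = (q', tapes_of K \<tau>) \<and>
    (\<forall>i<n. \<exists>p \<upsilon>. run (tm_of K code) x (m + i) = (p, tapes_of K \<upsilon>) \<and> I \<upsilon>)"
  using assms(3,4)
proof (induction n "(q, \<sigma>)" "(q', \<tau>)" arbitrary: q \<sigma> m rule: mpath.induct)
  case mpath_0
  then show ?case by simp
next
  case (mpath_Suc q \<sigma> n)
  obtain p \<upsilon> where m: "mstep code (q, \<sigma>) = (p, \<upsilon>)" by fastforce
  have "run (tm_of K code) x (Suc m) = (p, tapes_of K \<upsilon>)"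
    using step_tm_of[OF _ wf mpath_Suc.hyps(1), of \<sigma>] assms(1) mpath_Suc.prems m
    by (simp add: run_def)
  from mpath_Suc.hyps(4)[OF m this]
  have 1: "run (tm_of K code) x (Suc m + n) = (q', tapes_of K \<tau>)"
    and 2: "\<forall>i<n. \<exists>p \<upsilon>. run (tm_of K code) x (Suc m + i) = (p, tapes_of K \<upsilon>) \<and> I \<upsilon>" by auto
  have "\<exists>p \<upsilon>. run (tm_of K code) x (m + i) = (p, tapes_of K \<upsilon>) \<and> I \<upsilon>" if "i < Suc n" for i
    using that 2 mpath_Suc.hyps(2) mpath_Suc.prems by (cases i) auto
  with 1 show ?case by simp
qed

text \<open>Tape 4 is the truth register; the added instruction turns its symbol into the
  verdict.\<close>

definition final_code :: "com \<Rightarrow> instr list" where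
  "final_code c = compile c 0 @ [(4, \<lambda>s. (s, Stay, if s = 1 then sz c + 1 else sz c + 2))]"

lemma final_code_run:
  assumes K: "K \<ge> 5" and c: "wf_com K c"
    and big: "big I c (init_store K x) t \<tau>" and I: "I \<tau>"
  defines "M \<equiv> tm_of K (final_code c)"
  shows "wf_tm M"
    "run M x (Suc t) = (if scan \<tau> 4 = 1 then accept_state M else reject_state M, tapes_of K \<tau>)"
    "i \<le> t \<Longrightarrow> \<exists>p \<upsilon>. run M x i = (p, tapes_of K \<upsilon>) \<and> I \<upsilon>"
proof -
  have wf: "\<forall>i \<in> set (final_code c). wf_instr K (length (final_code c) + 2) i"
    using wf_comp[OF c, of 0 "length (final_code c) + 2"] K
    by (auto simp: final_code_def) (auto simp: wf_instr_def)
  then show "wf_tm M" unfolding M_def using K by (intro wf_tm_of) auto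
  have "code_at (final_code c) 0 (compile c 0)"
    by (auto simp: code_at_def final_code_def)
  from comp_correct[OF big this]
  have 1: "mpath (final_code c) I t (0, init_store K x) (sz c, \<tau>)" by simp
  have 2: "mpath (final_code c) I 1 (sz c, \<tau>) (if scan \<tau> 4 = 1 then sz c + 1 else sz c + 2, \<tau>)"
    using mpath_1[of "sz c" "final_code c" I \<tau>] I by (simp add: final_code_def nth_append)
  have 0: "run M x 0 = (0, tapes_of K (init_store K x))"
    using K by (simp add: run_def M_def init_config_tm_of)
  note 3 = mpath_run[OF _ wf mpath_trans[OF 1 2] 0[unfolded M_def]]
  show "run M x (Suc t) = (if scan \<tau> 4 = 1 then accept_state M else reject_state M, tapes_of K \<tau>)"
    using 3 K by (simp add: M_def tm_of_def final_code_def)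
  show "\<exists>p \<upsilon>. run M x i = (p, tapes_of K \<upsilon>) \<and> I \<upsilon>" if "i \<le> t"
    using 3 K that by (simp add: M_def)
qed

section \<open>Transfer to the complexity classes\<close>

lemma step_halted: "halted M cf \<Longrightarrow> step M cf = cf"
  by (simp add: step_def)

lemma run_halted: "halted M (run M x t) \<Longrightarrow> run M x (t + n) = run M x t"
  by (induction n) (simp_all add: run_def step_halted)

lemma run_halted_le: "halted M (run M x t) \<Longrightarrow> t \<le> t' \<Longrightarrow> run M x t' = run M x t"
  using run_halted[of M x t "t' - t"] by simp

theorem PSPACE_I:
  fixes p :: "nat poly"
  assumes "K \<ge> 5" "wf_com K c"
    and "\<And>x. \<exists>t \<tau>. big (I x) c (init_store K x) t \<tau> \<and> I x \<tau> \<and> (scan \<tau> 4 = 1 \<longleftrightarrow> x \<in> A)"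
    and I: "\<And>x \<tau> j. I x \<tau> \<Longrightarrow> j < K \<Longrightarrow> snd (\<tau> j) < poly p (length x)"
  shows "A \<in> PSPACE"
proof -
  define M where "M = tm_of K (final_code c)"
  have wf: "wf_tm M" using assms(3)[of undefined] final_code_run(1)[OF assms(1,2)] M_def by blast
  have "decides M A \<and> (\<forall>x. runs_in_space M x (poly p (length x)))"
    unfolding decides_def runs_in_space_def
  proof (intro conjI allI ballI)
    fix x
    obtain t \<tau> where t: "big (I x) c (init_store K x) t \<tau>" "I x \<tau>" "scan \<tau> 4 = 1 \<longleftrightarrow> x \<in> A"
      using assms(3) by blast
    note run = final_code_run[OF assms(1,2) t(1,2), folded M_def]
    show "\<exists>t. fst (run M x t) = (if x \<in> A then accept_state M else reject_state M)"
      using run(2) t(3) by (intro exI[of _ "Suc t"]) auto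
    fix n tp assume tp: "tp \<in> set (snd (run M x n))"
    have h: "halted M (run M x (Suc t))" using run(2) by (simp add: halted_def)
    \<comment> \<open>Past the halting time the configuration is frozen, so
      \<open>I x \<tau>\<close> covers all later times.\<close>
    have "\<exists>q \<upsilon>. run M x n = (q, tapes_of K \<upsilon>) \<and> I x \<upsilon>"
    proof (cases "n \<le> t")
      case False
      then have "run M x n = run M x (Suc t)" by (intro run_halted_le[OF h]) auto
      then show ?thesis using run(2) t(2) by auto
    qed (use run(3) in blast)
    then obtain q \<upsilon> where "run M x n = (q, tapes_of K \<upsilon>)" "I x \<upsilon>" by blast
    with tp I[of x \<upsilon>] assms(1) show "snd tp < poly p (length x)"
      by (auto simp: tapes_of_def)
  qed
  with wf show ?thesis unfolding PSPACE_def by blast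
qed

theorem polytime_computable_I:
  fixes p :: "nat poly"
  assumes "K \<ge> 5" "wf_com K c"
    and "\<And>x. \<exists>t \<tau>. big (\<lambda>_. True) c (init_store K x) t \<tau> \<and> t \<le> poly p (length x) \<and>
                   fst (\<tau> 0) = string_contents (f x)"
  shows "polytime_computable f"
proof -
  define M where "M = tm_of K (final_code c)"
  have wf: "wf_tm M" using assms(3)[of undefined] final_code_run(1)[OF assms(1,2)] M_def by blast
  have "\<exists>t \<le> poly (p + 1) (length x).
      halted M (run M x t) \<and> fst (last (snd (run M x t))) = string_contents (f x)" for x
  proof -
    obtain t \<tau> where t: "big (\<lambda>_. True) c (init_store K x) t \<tau>" "t \<le> poly p (length x)"
      "fst (\<tau> 0) = string_contents (f x)"
      using assms(3) by blast
    note run = final_code_run[OF assms(1,2) t(1), folded M_def]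
    show ?thesis
      using run(2) t(2,3) by (intro exI[of _ "Suc t"]) (auto simp: halted_def tapes_of_def)
  qed
  with wf show ?thesis unfolding polytime_computable_def by blast
qed

section \<open>Bounded arithmetic formulas and their evaluation\<close>

datatype trm = Var nat | Cst nat | Add trm trm | Mul trm trm

text \<open>\<open>Bit False\<close> queries the input and \<open>Bit True\<close> a second array,
  later the moves of a game. Since quantifiers are bounded by terms, one counter tape per nesting
  level suffices for evaluation.\<close>

datatype fm = Le trm trm | Bit bool trm | Neg fm | Conj fm fm | Ex trm fm

fun tval :: "(nat \<Rightarrow> nat) \<Rightarrow> trm \<Rightarrow> nat" where
  "tval e (Var n) = e n"
| "tval e (Cst c) = c"
| "tval e (Add s t) = tval e s + tval e t"
| "tval e (Mul s t) = tval e s * tval e t"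

fun fval :: "(bool \<Rightarrow> nat \<Rightarrow> bool) \<Rightarrow> (nat \<Rightarrow> nat) \<Rightarrow> fm \<Rightarrow> bool" where
  "fval a e (Le s t) \<longleftrightarrow> tval e s \<le> tval e t"
| "fval a e (Bit b t) \<longleftrightarrow> a b (tval e t)"
| "fval a e (Neg \<phi>) \<longleftrightarrow> \<not> fval a e \<phi>"
| "fval a e (Conj \<phi> \<psi>) \<longleftrightarrow> fval a e \<phi> \<and> fval a e \<psi>"
| "fval a e (Ex t \<phi>) \<longleftrightarrow> (\<exists>i<tval e t. fval a (case_nat i e) \<phi>)"

section \<open>Polynomially bounded functions\<close>

definition polyb :: "(nat \<Rightarrow> nat) \<Rightarrow> bool" where
  "polyb f \<longleftrightarrow> (\<exists>p :: nat poly. \<forall>m. f m \<le> poly p m)"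

lemma polyb_const [intro]: "polyb (\<lambda>_. c)"
  unfolding polyb_def by (intro exI[of _ "[:c:]"]) simp

lemma polyb_id [intro]: "polyb (\<lambda>m. m)"
  unfolding polyb_def by (intro exI[of _ "[:0, 1:]"]) simp

lemma polyb_add [intro]: "polyb f \<Longrightarrow> polyb g \<Longrightarrow> polyb (\<lambda>m. f m + g m)"
  unfolding polyb_def by (metis add_mono poly_add)

lemma polyb_mult [intro]: "polyb f \<Longrightarrow> polyb g \<Longrightarrow> polyb (\<lambda>m. f m * g m)"
  unfolding polyb_def by (metis mult_le_mono poly_mult)

lemma poly_nat_mono: "x \<le> y \<Longrightarrow> poly p x \<le> poly p (y :: nat)"
  by (induction p) (auto intro: mult_le_mono)

lemma polyb_poly [intro]: "polyb f \<Longrightarrow> polyb (\<lambda>m. poly p (f m))"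
  unfolding polyb_def by (metis poly_nat_mono poly_pcompose)

lemma polyb_tval: "(\<And>n. polyb (f n)) \<Longrightarrow> polyb (\<lambda>M. tval (\<lambda>n. f n M) t)"
  by (induction t) auto

lemma tval_mono: "(\<And>n. e n \<le> e' n) \<Longrightarrow> tval e t \<le> tval e' t"
  by (induction t) (auto intro: add_mono mult_le_mono)

lemma tval_le: "(\<And>n. e n \<le> M) \<Longrightarrow> tval e t \<le> tval (\<lambda>_. M) t"
  by (rule tval_mono)


text \<open>An upper bound composes better than the exact step count of \<open>big\<close>. The
  store invariant is dropped here; bounds on the heads are recovered from the time by
  \<open>big_strengthen\<close>.\<close>

definition runs :: "com \<Rightarrow> store \<Rightarrow> nat \<Rightarrow> store \<Rightarrow> bool" where
  "runs c \<sigma> T \<tau> \<longleftrightarrow> (\<exists>t\<le>T. big (\<lambda>_. True) c \<sigma> t \<tau>)"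

lemma runs_mono: "runs c \<sigma> T \<tau> \<Longrightarrow> T \<le> T' \<Longrightarrow> runs c \<sigma> T' \<tau>"
  unfolding runs_def by (meson order_trans)

lemma runs_Act:
  "\<tau> = \<sigma>(j := act_tape (w (scan \<sigma> j), d) (\<sigma> j)) \<Longrightarrow> 1 \<le> T \<Longrightarrow> runs (Act j w d) \<sigma> T \<tau>"
  unfolding runs_def by (blast intro: big.Act)

lemma runs_Seq:
  "runs c \<sigma> T \<tau> \<Longrightarrow> runs c' \<tau> T' \<upsilon> \<Longrightarrow> T + T' \<le> T'' \<Longrightarrow> runs (Seq c c') \<sigma> T'' \<upsilon>"
  unfolding runs_def by (meson add_mono big.Seq order_trans)

lemma runs_Cond:
  "(P (scan \<sigma> j) \<Longrightarrow> runs c \<sigma> T \<tau>) \<Longrightarrow> (\<not> P (scan \<sigma> j) \<Longrightarrow> runs c' \<sigma> T \<tau>) \<Longrightarrow> T + 2 \<le> T' \<Longrightarrow>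
    runs (Cond j P c c') \<sigma> T' \<tau>"
proof (cases "P (scan \<sigma> j)")
  case True
  assume *: "P (scan \<sigma> j) \<Longrightarrow> runs c \<sigma> T \<tau>" "T + 2 \<le> T'"
  then obtain t where "t \<le> T" "big (\<lambda>_. True) c \<sigma> t \<tau>" using True unfolding runs_def by blast
  moreover from this have "big (\<lambda>_. True) (Cond j P c c') \<sigma> (t + 2) \<tau>"
    by (intro big.CondT True TrueI)
  ultimately show ?thesis
    using * unfolding runs_def by (intro exI[of _ "t + 2"]) auto
next
  case False
  assume *: "\<not> P (scan \<sigma> j) \<Longrightarrow> runs c' \<sigma> T \<tau>" "T + 2 \<le> T'"
  then obtain t where "t \<le> T" "big (\<lambda>_. True) c' \<sigma> t \<tau>" using False unfolding runs_def by blast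
  moreover from this have "big (\<lambda>_. True) (Cond j P c c') \<sigma> (t + 1) \<tau>"
    by (intro big.CondF False TrueI)
  ultimately show ?thesis
    using * unfolding runs_def by (intro exI[of _ "t + 1"]) auto
qed

lemma runs_LoopF: "\<not> P (scan \<sigma> j) \<Longrightarrow> 1 \<le> T \<Longrightarrow> runs (Loop j P c) \<sigma> T \<sigma>"
  unfolding runs_def by (blast intro: big.LoopF)

lemma runs_LoopT:
  assumes "P (scan \<sigma> j)" "runs c \<sigma> T \<tau>" "runs (Loop j P c) \<tau> T' \<upsilon>" "T + T' + 2 \<le> T''"
  shows "runs (Loop j P c) \<sigma> T'' \<upsilon>"
proof -
  obtain t t' where "t \<le> T" "big (\<lambda>_. True) c \<sigma> t \<tau>" "t' \<le> T'" "big (\<lambda>_. True) (Loop j P c) \<tau> t' \<upsilon>"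
    using assms(2,3) unfolding runs_def by blast
  moreover from this have "big (\<lambda>_. True) (Loop j P c) \<sigma> (t + t' + 2) \<upsilon>"
    using assms(1) by (intro big.LoopT TrueI)
  ultimately show ?thesis using assms(4) unfolding runs_def
    by (intro exI[of _ "t + t' + 2"]) auto
qed

text \<open>
  A marked tape carries a symbol \<open>\<ge> 3\<close> exactly in cell 0, so that its head can find the left end.
  Such tapes serve as counters, the value being the head position, and as random access arrays.
\<close>

definition marked :: "(nat \<Rightarrow> nat) \<Rightarrow> bool" where
  "marked c \<longleftrightarrow> 3 \<le> c 0 \<and> (\<forall>i>0. c i < 3)"

definition ctr :: "nat \<Rightarrow> nat" where
  "ctr i = (if i = 0 then 3 else 0)"

lemma marked_ctr [simp]: "marked ctr"
  by (simp add: marked_def ctr_def)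

lemma marked_scan: "marked c \<Longrightarrow> read_tape (c, h) < 3 \<longleftrightarrow> h \<noteq> 0"
  by (cases h) (auto simp: marked_def read_tape_def)

text \<open>Tapes 0 to 4 have fixed roles: output, input, second array, a loop counter or stack, and
  the truth register. The counters for variables and scratch values follow.\<close>

abbreviation lv :: "nat \<Rightarrow> nat" where "lv l \<equiv> 5 + l"

abbreviation Move :: "nat \<Rightarrow> direction \<Rightarrow> com" where "Move j d \<equiv> Act j (\<lambda>s. s) d"

abbreviation Skip :: com where "Skip \<equiv> Move 4 Stay"

text \<open>Symbols below 3 mean that the head is not in cell 0. The decrement precedes the body, so
  the body sees the counter values \<open>n - 1\<close> down to 0.\<close>

abbreviation While0 :: "nat \<Rightarrow> com \<Rightarrow> com" where "While0 j c \<equiv> Loop j (\<lambda>s. s < 3) (Seq (Move j Left) c)"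

definition mv :: "direction \<Rightarrow> nat \<Rightarrow> nat \<Rightarrow> nat" where
  "mv r n h = (case r of Left \<Rightarrow> h - n | Stay \<Rightarrow> h | Right \<Rightarrow> h + n)"

lemma mv_mv [simp]: "mv r a (mv r b h) = mv r (a + b) h"
  by (cases r) (simp_all add: mv_def)

lemma mv_0 [simp]: "mv r 0 h = h"
  by (simp add: mv_def split: direction.splits)

lemma mv_simps [simp]: "mv Left n h = h - n" "mv Right n h = h + n" "mv Stay n h = h"
  by (simp_all add: mv_def)

lemma act_tape_move: "act_tape (read_tape tp, d) tp = (fst tp, mv d 1 (snd tp))"
  by (cases tp) (auto simp: read_tape_def mv_def split: direction.splits)

lemma runs_Move: "\<tau> = \<sigma>(j := (fst (\<sigma> j), mv d 1 (snd (\<sigma> j)))) \<Longrightarrow> 1 \<le> T \<Longrightarrow> runs (Move j d) \<sigma> T \<tau>"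
  by (rule runs_Act) (simp_all only: act_tape_move)

lemma runs_Skip: "1 \<le> T \<Longrightarrow> runs Skip \<sigma> T \<sigma>"
  by (rule runs_Move) simp_all

text \<open>\<open>S i\<close> is the store when the counter stands at \<open>i\<close>. One round
  costs \<open>B\<close> for the body, one step for the decrement, and two for the test and the jump
  back.\<close>

lemma runs_countdown:
  assumes "\<And>i. i \<le> n \<Longrightarrow> snd (S i j) = i" "\<And>i. i \<le> n \<Longrightarrow> fst (S i j) = c" "marked c"
    and "\<And>i. i < n \<Longrightarrow> runs b ((S (Suc i))(j := (c, i))) B (S i)"
    and "n * (B + 3) + 1 \<le> T"
  shows "runs (While0 j b) (S n) T (S 0)"
  using assms
proof (induction n arbitrary: T)
  case 0
  have "S 0 j = (c, 0)" using 0(1,2)[of 0] by (simp add: prod_eq_iff)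
  then show ?case using 0(5) marked_scan[OF 0(3)] by (intro runs_LoopF) simp_all
next
  case (Suc n)
  have S: "S (Suc n) j = (c, Suc n)" using Suc.prems(1,2)[of "Suc n"] by (simp add: prod_eq_iff)
  have "runs (Move j Left) (S (Suc n)) 1 ((S (Suc n))(j := (c, n)))"
    by (rule runs_Move) (simp_all add: S)
  from runs_Seq[OF this Suc.prems(4)[OF lessI] order_refl]
  have "runs (Seq (Move j Left) b) (S (Suc n)) (1 + B) (S n)" .
  moreover have "runs (While0 j b) (S n) (n * (B + 3) + 1) (S 0)"
    by (rule Suc.IH[OF Suc.prems(1,2,3,4) order_refl]) simp_all
  moreover have "scan (S (Suc n)) j < 3"
    using marked_scan[OF Suc.prems(3)] S by simp
  moreover have "1 + B + (n * (B + 3) + 1) + 2 \<le> T"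
    using Suc.prems(5) by simp
  ultimately show ?case
    by (meson runs_LoopT)
qed

text \<open>
  At quantifier depth \<open>k\<close>, the de Bruijn variable \<open>n\<close> lives on tape \<open>lv (k - 1 - n)\<close>; the
  tapes from \<open>lv m\<close> on are free. \<open>addT k m d r t\<close> moves the head of tape \<open>d\<close> in direction \<open>r\<close> by
  the value of \<open>t\<close>. Since moving left from cell 0 has no effect, \<open>r = Left\<close> is truncated subtraction.
\<close>

fun addT :: "nat \<Rightarrow> nat \<Rightarrow> nat \<Rightarrow> direction \<Rightarrow> trm \<Rightarrow> com" where
  "addT k m d r (Var n) =
     (if n < k then
        Seq (While0 (lv (k - 1 - n)) (Seq (Move d r) (Move (lv m) Right)))
            (While0 (lv m) (Move (lv (k - 1 - n)) Right))
      else Skip)"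
| "addT k m d r (Cst c) = (Seq (Move d r) ^^ c) Skip"
| "addT k m d r (Add s t) = Seq (addT k m d r s) (addT k m d r t)"
| "addT k m d r (Mul s t) =
     Seq (addT k (Suc m) (lv m) Right s) (While0 (lv m) (addT k (Suc m) d r t))"

text \<open>Variables from \<open>k\<close> on have no tape and therefore must be 0. Scratch tapes
  have to be at 0 on entry; every program leaves them so.\<close>

definition env_ok :: "nat \<Rightarrow> nat \<Rightarrow> (nat \<Rightarrow> nat) \<Rightarrow> store \<Rightarrow> bool" where
  "env_ok k m e \<sigma> \<longleftrightarrow> (\<forall>n<k. \<sigma> (lv (k - 1 - n)) = (ctr, e n)) \<and> (\<forall>n\<ge>k. e n = 0) \<and>
     (\<forall>l\<ge>m. \<sigma> (lv l) = (ctr, 0))"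

lemma env_ok_upd:
  "env_ok k m e \<sigma> \<Longrightarrow> d < 5 \<or> lv k \<le> d \<and> d < lv m \<Longrightarrow> env_ok k m e (\<sigma>(d := v))"
  by (auto simp: env_ok_def)

lemma env_ok_Suc: "env_ok k m e \<sigma> \<Longrightarrow> env_ok k (Suc m) e \<sigma>"
  by (auto simp: env_ok_def)

definition shifted :: "nat \<Rightarrow> direction \<Rightarrow> nat \<Rightarrow> store \<Rightarrow> store" where
  "shifted d r n \<sigma> = \<sigma>(d := (fst (\<sigma> d), mv r n (snd (\<sigma> d))))"

text \<open>Reading a counter destroys it, so a variable is moved to a scratch tape and then back. A
  product keeps its first factor on the scratch tape \<open>lv m\<close> as a loop counter and
  passes on \<open>Suc m\<close>, which protects it. The polynomial is uniform in tapes and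
  direction and depends on the largest variable value only.\<close>

lemma addT_correct:
  "\<exists>p :: nat poly. \<forall>M k m d r e \<sigma>. env_ok k m e \<sigma> \<longrightarrow> k \<le> m \<longrightarrow> d < 5 \<or> lv k \<le> d \<and> d < lv m \<longrightarrow>
     (\<forall>n. e n \<le> M) \<longrightarrow> runs (addT k m d r t) \<sigma> (poly p M) (shifted d r (tval e t) \<sigma>)"
proof (induction t)
  case (Var n)
  have "runs (addT k m d r (Var n)) \<sigma> (5 * M + 1 + (4 * M + 1)) (shifted d r (tval e (Var n)) \<sigma>)"
    if env: "env_ok k m e \<sigma>" and km: "k \<le> m" and d: "d < 5 \<or> lv k \<le> d \<and> d < lv m"
      and M: "\<forall>n. e n \<le> M" for M k m d r e \<sigma>
  proof (cases "n < k")
    case True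
    define j p v where "j = lv (k - 1 - n)" and "p = lv m" and "v = e n"
    have ne: "j \<noteq> d" "p \<noteq> d" "j \<noteq> p" using True d km by (auto simp: j_def p_def)
    have \<sigma>: "\<sigma> j = (ctr, v)" "\<sigma> p = (ctr, 0)" using env True by (auto simp: env_ok_def j_def p_def v_def)
    have v: "v \<le> M" using M by (simp add: v_def)
    \<comment> \<open>What counter \<open>j\<close> has lost so far is both added to tape
      \<open>d\<close> and saved on the scratch tape \<open>p\<close>.\<close>
    define S where "S i = (shifted d r (v - i) \<sigma>)(j := (ctr, i), p := (ctr, v - i))" for i
    have Sv: "S v = \<sigma>" unfolding S_def shifted_def using \<sigma> ne by (auto simp: fun_eq_iff)
    have 1: "runs (While0 j (Seq (Move d r) (Move p Right))) (S v) (5 * M + 1) (S 0)"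
    proof (rule runs_countdown[where c = ctr and B = 2])
      fix i assume i: "i < v"
      have "Suc (v - Suc i) = v - i" using i by simp
      then have "mv r (Suc 0) (mv r (v - Suc i) h) = mv r (v - i) h" for h by simp
      then show "runs (Seq (Move d r) (Move p Right)) ((S (Suc i))(j := (ctr, i))) 2 (S i)"
        using ne i
        by (intro runs_Seq[OF runs_Move[OF refl order_refl] runs_Move[OF _ order_refl]])
          (auto simp: S_def shifted_def fun_eq_iff)
    qed (use ne v in \<open>auto simp: S_def shifted_def\<close>)
    define S' where "S' i = (shifted d r v \<sigma>)(j := (ctr, v - i), p := (ctr, i))" for i
    have S': "S' v = S 0" unfolding S_def S'_def by simp
    have "runs (While0 p (Move j Right)) (S' v) (4 * M + 1) (S' 0)"
      by (rule runs_countdown[where c = ctr and B = 1])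
        (use ne v in \<open>auto simp: S'_def shifted_def fun_eq_iff intro!: runs_Move\<close>)
    moreover have "S' 0 = shifted d r v \<sigma>"
      unfolding S'_def shifted_def using ne \<sigma> by (auto simp: fun_eq_iff)
    ultimately have "runs (While0 p (Move j Right)) (S 0) (4 * M + 1) (shifted d r v \<sigma>)"
      using S' by simp
    from runs_Seq[OF 1[unfolded Sv] this order_refl]
    have "runs (Seq (While0 j (Seq (Move d r) (Move p Right))) (While0 p (Move j Right)))
        \<sigma> (5 * M + 1 + (4 * M + 1)) (shifted d r v \<sigma>)" .
    then show ?thesis using True by (simp add: j_def p_def v_def)
  next
    case False
    then have "e n = 0" using env by (simp add: env_ok_def)
    then show ?thesis using False by (simp add: shifted_def runs_Skip)
  qed
  then show ?case by (intro exI[of _ "[:2, 9:]"]) (simp add: algebra_simps)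
next
  case (Cst c)
  have "runs ((Seq (Move d r) ^^ c) Skip) \<sigma> (c + 1) (shifted d r c \<sigma>)" for d r \<sigma>
  proof (induction c arbitrary: \<sigma>)
    case (Suc c)
    have "shifted d r (Suc c) \<sigma> = shifted d r c (shifted d r 1 \<sigma>)"
      by (simp add: shifted_def)
    moreover have "runs (Move d r) \<sigma> 1 (shifted d r 1 \<sigma>)"
      unfolding shifted_def by (rule runs_Move) simp_all
    ultimately show ?case
      using runs_Seq[OF _ Suc[of "shifted d r 1 \<sigma>"]] by simp
  qed (simp add: runs_Skip shifted_def)
  then show ?case by (intro exI[of _ "[:c + 1:]"]) simp
next
  case (Add s t)
  obtain p q :: "nat poly" where
    p: "\<And>M k m d r e \<sigma>. env_ok k m e \<sigma> \<Longrightarrow> k \<le> m \<Longrightarrow> d < 5 \<or> lv k \<le> d \<and> d < lv m \<Longrightarrow>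
     (\<forall>n. e n \<le> M) \<Longrightarrow> runs (addT k m d r s) \<sigma> (poly p M) (shifted d r (tval e s) \<sigma>)" and
    q: "\<And>M k m d r e \<sigma>. env_ok k m e \<sigma> \<Longrightarrow> k \<le> m \<Longrightarrow> d < 5 \<or> lv k \<le> d \<and> d < lv m \<Longrightarrow>
     (\<forall>n. e n \<le> M) \<Longrightarrow> runs (addT k m d r t) \<sigma> (poly q M) (shifted d r (tval e t) \<sigma>)"
    using Add by blast
  have "runs (addT k m d r (Add s t)) \<sigma> (poly (p + q) M) (shifted d r (tval e (Add s t)) \<sigma>)"
    if env: "env_ok k m e \<sigma>" and km: "k \<le> m" and d: "d < 5 \<or> lv k \<le> d \<and> d < lv m"
      and M: "\<forall>n. e n \<le> M" for M k m d r e \<sigma>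
  proof -
    have "shifted d r (tval e (Add s t)) \<sigma> = shifted d r (tval e t) (shifted d r (tval e s) \<sigma>)"
      by (simp add: shifted_def add.commute)
    moreover have "env_ok k m e (shifted d r (tval e s) \<sigma>)"
      unfolding shifted_def by (rule env_ok_upd[OF env d])
    ultimately show ?thesis
      using p[OF env km d M, of r] q[OF _ km d M, of "shifted d r (tval e s) \<sigma>" r]
      by (auto intro: runs_Seq)
  qed
  then show ?case by blast
next
  case (Mul s t)
  obtain p q :: "nat poly" where
    p: "\<And>M k m d r e \<sigma>. env_ok k m e \<sigma> \<Longrightarrow> k \<le> m \<Longrightarrow> d < 5 \<or> lv k \<le> d \<and> d < lv m \<Longrightarrow>
     (\<forall>n. e n \<le> M) \<Longrightarrow> runs (addT k m d r s) \<sigma> (poly p M) (shifted d r (tval e s) \<sigma>)" and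
    q: "\<And>M k m d r e \<sigma>. env_ok k m e \<sigma> \<Longrightarrow> k \<le> m \<Longrightarrow> d < 5 \<or> lv k \<le> d \<and> d < lv m \<Longrightarrow>
     (\<forall>n. e n \<le> M) \<Longrightarrow> runs (addT k m d r t) \<sigma> (poly q M) (shifted d r (tval e t) \<sigma>)"
    using Mul by blast
  define T where "T M = poly p M + (tval (\<lambda>_. M) s * (poly q M + 3) + 1)" for M
  have "runs (addT k m d r (Mul s t)) \<sigma> (T M) (shifted d r (tval e (Mul s t)) \<sigma>)"
    if env: "env_ok k m e \<sigma>" and km: "k \<le> m" and d: "d < 5 \<or> lv k \<le> d \<and> d < lv m"
      and M: "\<forall>n. e n \<le> M" for M k m d r e \<sigma>
  proof -
    define j v w where "j = lv m" and "v = tval e s" and "w = tval e t"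
    have ne: "j \<noteq> d" using d by (auto simp: j_def)
    have \<sigma>: "\<sigma> j = (ctr, 0)" using env by (auto simp: env_ok_def j_def)
    have d': "d < 5 \<or> lv k \<le> d \<and> d < lv (Suc m)" "j < 5 \<or> lv k \<le> j \<and> j < lv (Suc m)"
      using d km by (auto simp: j_def)
    have km': "k \<le> Suc m" using km by simp
    define S where "S i = (shifted d r ((v - i) * w) \<sigma>)(j := (ctr, i))" for i
    have S_env: "env_ok k (Suc m) e (S i)" for i
      unfolding S_def shifted_def using env_ok_upd[OF env_ok_upd[OF env_ok_Suc[OF env] d'(1)] d'(2)] .
    have Sv: "shifted j Right v \<sigma> = S v"
      using ne \<sigma> by (auto simp: S_def shifted_def fun_eq_iff)
    have 1: "runs (addT k (Suc m) j Right s) \<sigma> (poly p M) (S v)"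
      using p[OF env_ok_Suc[OF env] km' d'(2) M, of Right] Sv by (simp add: v_def)
    have v: "v \<le> tval (\<lambda>_. M) s" unfolding v_def using M by (intro tval_le) auto
    have "runs (While0 j (addT k (Suc m) d r t)) (S v) (tval (\<lambda>_. M) s * (poly q M + 3) + 1) (S 0)"
    proof (rule runs_countdown[where c = ctr and B = "poly q M"])
      fix i assume i: "i < v"
      have "(v - i) * w = w + (v - Suc i) * w" using i by (simp add: Suc_diff_Suc[symmetric])
      then have "S i = shifted d r w ((S (Suc i))(j := (ctr, i)))"
        using ne by (auto simp: S_def shifted_def fun_eq_iff)
      then show "runs (addT k (Suc m) d r t) ((S (Suc i))(j := (ctr, i))) (poly q M) (S i)"
        using q[where r = r and \<sigma> = "(S (Suc i))(j := (ctr, i))", OF env_ok_upd[OF S_env d'(2)] km' d'(1) M] by (simp add: w_def)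
    qed (use v in \<open>auto simp: S_def\<close>)
    moreover have "S 0 = shifted d r (v * w) \<sigma>"
      using ne \<sigma> by (auto simp: S_def shifted_def fun_eq_iff)
    ultimately show ?thesis
      using runs_Seq[OF 1, of _ _ _ "T M"] by (simp add: T_def j_def v_def w_def)
  qed
  moreover have "polyb T"
    unfolding T_def by (intro polyb_add polyb_mult polyb_const polyb_tval polyb_poly polyb_id)
  ultimately show ?case
    unfolding polyb_def by (meson runs_mono)
qed

section \<open>The truth register and the evaluation of formulas\<close>

definition flg :: "bool \<Rightarrow> tape" where
  "flg b = ((\<lambda>_. 0)(0 := of_bool b), 0)"

definition set_flag :: "bool \<Rightarrow> com" where "set_flag b = Act 4 (\<lambda>_. of_bool b) Stay"

lemma scan_flg_1 [simp]: "read_tape (flg b) = 1 \<longleftrightarrow> b" "read_tape (flg b) = Suc 0 \<longleftrightarrow> b"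
  by (simp_all add: flg_def read_tape_def)

lemma scan_flg: "read_tape (flg b) = of_bool b"
  by (simp add: flg_def read_tape_def)

lemma runs_set_flag: "\<sigma> 4 = flg b' \<Longrightarrow> 1 \<le> T \<Longrightarrow> runs (set_flag b) \<sigma> T (\<sigma>(4 := flg b))"
  unfolding set_flag_def by (rule runs_Act) (simp_all add: flg_def)

lemma runs_flag_test:
  assumes "\<sigma> 4 = flg b"
  shows "runs (Cond j P (set_flag x) (set_flag (\<not> x))) \<sigma> 3 (\<sigma>(4 := flg (P (scan \<sigma> j) \<longleftrightarrow> x)))"
proof (rule runs_Cond[where T = 1])
  show "runs (set_flag x) \<sigma> 1 (\<sigma>(4 := flg (P (scan \<sigma> j) \<longleftrightarrow> x)))" if "P (scan \<sigma> j)"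
    using runs_set_flag[of \<sigma> b 1 x, OF assms] that by simp
  show "runs (set_flag (\<not> x)) \<sigma> 1 (\<sigma>(4 := flg (P (scan \<sigma> j) \<longleftrightarrow> x)))" if "\<not> P (scan \<sigma> j)"
    using runs_set_flag[of \<sigma> b 1 "\<not> x", OF assms] that by simp
qed simp

text \<open>\<open>s \<le> t\<close> is decided by truncated subtraction, which ends in cell 0
  exactly in that case. A set bit is the symbol 2 or its marked copy 5. \<open>Ex\<close> counts
  candidates down; a hit empties the counter, which ends the search with the register still
  true.\<close>

fun evalF :: "nat \<Rightarrow> fm \<Rightarrow> com" where
  "evalF k (Le s t) =
     Seq (addT k (Suc k) (lv k) Right s) (Seq (addT k (Suc k) (lv k) Left t)
      (Seq (Cond (lv k) (\<lambda>s. s < 3) (set_flag False) (set_flag True)) (While0 (lv k) Skip)))"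
| "evalF k (Bit b t) = (let j = if b then 2 else 1 in
     Seq (addT k k j Right t)
       (Seq (Cond j (\<lambda>s. s = 2 \<or> s = 5) (set_flag True) (set_flag False)) (While0 j Skip)))"
| "evalF k (Neg \<phi>) = Seq (evalF k \<phi>) (Act 4 (\<lambda>s. 1 - s) Stay)"
| "evalF k (Conj \<phi> \<psi>) = Seq (evalF k \<phi>) (Cond 4 (\<lambda>s. s = 1) (evalF k \<psi>) Skip)"
| "evalF k (Ex t \<phi>) =
     Seq (addT k (Suc k) (lv k) Right t) (Seq (set_flag False)
      (While0 (lv k) (Seq (evalF (Suc k) \<phi>) (Cond 4 (\<lambda>s. s = 1) (While0 (lv k) Skip) Skip))))"

definition arrays_ok :: "(bool \<Rightarrow> nat \<Rightarrow> bool) \<Rightarrow> store \<Rightarrow> bool" where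
  "arrays_ok a \<sigma> \<longleftrightarrow> (\<forall>b. \<exists>c. \<sigma> (if b then 2 else 1) = (c, 0) \<and> marked c \<and>
     (\<forall>i. a b i \<longleftrightarrow> c i = 2 \<or> c i = 5))"

lemma arrays_ok_upd: "arrays_ok a \<sigma> \<Longrightarrow> 3 \<le> j \<Longrightarrow> arrays_ok a (\<sigma>(j := v))"
  unfolding arrays_ok_def by (auto split: if_splits)

lemma arrays_ok_cong: "arrays_ok a \<sigma> \<Longrightarrow> \<sigma>' 1 = \<sigma> 1 \<Longrightarrow> \<sigma>' 2 = \<sigma> 2 \<Longrightarrow> arrays_ok a \<sigma>'"
  unfolding arrays_ok_def by (metis (full_types))

lemma runs_rewind:
  assumes "fst (\<sigma> j) = c" "marked c" "4 * snd (\<sigma> j) + 1 \<le> T" "\<tau> = \<sigma>(j := (c, 0))"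
  shows "runs (While0 j Skip) \<sigma> T \<tau>"
proof -
  have "runs (While0 j Skip) (\<sigma>(j := (c, snd (\<sigma> j)))) T (\<sigma>(j := (c, 0)))"
    by (rule runs_countdown[where S = "\<lambda>i. \<sigma>(j := (c, i))" and c = c and B = 1])
      (use assms in \<open>auto intro: runs_Skip\<close>)
  then show ?thesis using assms by (simp add: fun_upd_idem prod_eq_iff)
qed

text \<open>Only the largest variable value \<open>M\<close> enters the bound. Below a quantifier
  the new variable is less than its bounding term, so \<open>M + V M\<close> takes the place of
  \<open>M\<close>, which keeps the bound polynomial.\<close>

lemma evalF_correct:
  "\<exists>p :: nat poly. \<forall>M k a e \<sigma> b. env_ok k k e \<sigma> \<longrightarrow> arrays_ok a \<sigma> \<longrightarrow> \<sigma> 4 = flg b \<longrightarrow>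
     (\<forall>n. e n \<le> M) \<longrightarrow> runs (evalF k \<phi>) \<sigma> (poly p M) (\<sigma>(4 := flg (fval a e \<phi>)))"
proof (induction \<phi>)
  case (Le s t)
  obtain p where
    p: "\<And>M k m d r e \<sigma>. env_ok k m e \<sigma> \<Longrightarrow> k \<le> m \<Longrightarrow> d < 5 \<or> lv k \<le> d \<and> d < lv m \<Longrightarrow>
     (\<forall>n. e n \<le> M) \<Longrightarrow> runs (addT k m d r s) \<sigma> (poly p M) (shifted d r (tval e s) \<sigma>)"
    using addT_correct[of s] by blast
  obtain q where
    q: "\<And>M k m d r e \<sigma>. env_ok k m e \<sigma> \<Longrightarrow> k \<le> m \<Longrightarrow> d < 5 \<or> lv k \<le> d \<and> d < lv m \<Longrightarrow>
     (\<forall>n. e n \<le> M) \<Longrightarrow> runs (addT k m d r t) \<sigma> (poly q M) (shifted d r (tval e t) \<sigma>)"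
    using addT_correct[of t] by blast
  define T where "T M = poly p M + (poly q M + (3 + (4 * tval (\<lambda>_. M) s + 1)))" for M
  have "runs (evalF k (Le s t)) \<sigma> (T M) (\<sigma>(4 := flg (fval a e (Le s t))))"
    if env: "env_ok k k e \<sigma>" and fl: "\<sigma> 4 = flg b" and M: "\<forall>n. e n \<le> M" for M k a e \<sigma> b
  proof -
    define j where "j = lv k"
    have \<sigma>: "\<sigma> j = (ctr, 0)" using env by (auto simp: env_ok_def j_def)
    have j: "j < 5 \<or> lv k \<le> j \<and> j < lv (Suc k)" "4 \<noteq> j" by (auto simp: j_def)
    define \<sigma>1 where "\<sigma>1 = \<sigma>(j := (ctr, tval e s))"
    define \<sigma>2 where "\<sigma>2 = \<sigma>(j := (ctr, tval e s - tval e t))"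
    have env1: "env_ok k (Suc k) e \<sigma>1"
      unfolding \<sigma>1_def by (rule env_ok_upd[OF env_ok_Suc[OF env] j(1)])
    have 1: "runs (addT k (Suc k) j Right s) \<sigma> (poly p M) \<sigma>1"
      using p[OF env_ok_Suc[OF env] _ j(1) M, of Right] \<sigma> by (simp add: shifted_def \<sigma>1_def)
    have 2: "runs (addT k (Suc k) j Left t) \<sigma>1 (poly q M) \<sigma>2"
      using q[OF env1 _ j(1) M, of Left] \<sigma> by (simp add: shifted_def \<sigma>1_def \<sigma>2_def)
    have "\<sigma>2 4 = flg b" using fl j by (simp add: \<sigma>2_def)
    from runs_flag_test[of \<sigma>2 b j "\<lambda>s. s < 3" False, OF this]
    have 3: "runs (Cond j (\<lambda>s. s < 3) (set_flag False) (set_flag True)) \<sigma>2 3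
        (\<sigma>2(4 := flg (tval e s \<le> tval e t)))"
      by (simp add: \<sigma>2_def marked_scan)
    have "tval e s \<le> tval (\<lambda>_. M) s" using M by (intro tval_le) auto
    then have 4: "runs (While0 j Skip) (\<sigma>2(4 := flg (tval e s \<le> tval e t))) (4 * tval (\<lambda>_. M) s + 1)
        (\<sigma>(4 := flg (fval a e (Le s t))))"
      using j \<sigma> by (intro runs_rewind[where c = ctr]) (auto simp: \<sigma>2_def fun_eq_iff)
    show ?thesis
      unfolding evalF.simps T_def j_def[symmetric]
      by (rule runs_Seq[OF 1 runs_Seq[OF 2 runs_Seq[OF 3 4 order_refl] order_refl] order_refl])
  qed
  moreover have "polyb T"
    unfolding T_def by (intro polyb_add polyb_mult polyb_const polyb_tval polyb_poly polyb_id)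
  ultimately show ?case
    unfolding polyb_def by (meson runs_mono)
next
  case (Bit bb t)
  obtain q where
    q: "\<And>M k m d r e \<sigma>. env_ok k m e \<sigma> \<Longrightarrow> k \<le> m \<Longrightarrow> d < 5 \<or> lv k \<le> d \<and> d < lv m \<Longrightarrow>
     (\<forall>n. e n \<le> M) \<Longrightarrow> runs (addT k m d r t) \<sigma> (poly q M) (shifted d r (tval e t) \<sigma>)"
    using addT_correct[of t] by blast
  define T where "T M = poly q M + (3 + (4 * tval (\<lambda>_. M) t + 1))" for M
  have "runs (evalF k (Bit bb t)) \<sigma> (T M) (\<sigma>(4 := flg (fval a e (Bit bb t))))"
    if env: "env_ok k k e \<sigma>" and arr: "arrays_ok a \<sigma>" and fl: "\<sigma> 4 = flg b"
      and M: "\<forall>n. e n \<le> M" for M k a e \<sigma> b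
  proof -
    define j :: nat where "j = (if bb then 2 else 1)"
    obtain c where c: "\<sigma> j = (c, 0)" "marked c" "\<And>i. a bb i \<longleftrightarrow> c i = 2 \<or> c i = 5"
      using arr unfolding arrays_ok_def j_def by blast
    have j: "j < 5 \<or> lv k \<le> j \<and> j < lv k" "4 \<noteq> j" by (auto simp: j_def)
    define \<sigma>1 where "\<sigma>1 = \<sigma>(j := (c, tval e t))"
    have 1: "runs (addT k k j Right t) \<sigma> (poly q M) \<sigma>1"
      using q[OF env _ j(1) M, of Right] c by (simp add: shifted_def \<sigma>1_def)
    have "\<sigma>1 4 = flg b" using fl j by (simp add: \<sigma>1_def)
    from runs_flag_test[of \<sigma>1 b j "\<lambda>s. s = 2 \<or> s = 5" True, OF this]
    have 2: "runs (Cond j (\<lambda>s. s = 2 \<or> s = 5) (set_flag True) (set_flag False)) \<sigma>1 3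
        (\<sigma>1(4 := flg (fval a e (Bit bb t))))"
      using c(3) by (simp add: \<sigma>1_def read_tape_def)
    have "tval e t \<le> tval (\<lambda>_. M) t" using M by (intro tval_le) auto
    then have 3: "runs (While0 j Skip) (\<sigma>1(4 := flg (fval a e (Bit bb t)))) (4 * tval (\<lambda>_. M) t + 1)
        (\<sigma>(4 := flg (fval a e (Bit bb t))))"
      using j c by (intro runs_rewind[where c = c]) (auto simp: \<sigma>1_def fun_eq_iff)
    show ?thesis
      unfolding evalF.simps T_def Let_def j_def[symmetric]
      by (rule runs_Seq[OF 1 runs_Seq[OF 2 3 order_refl] order_refl])
  qed
  moreover have "polyb T"
    unfolding T_def by (intro polyb_add polyb_mult polyb_const polyb_tval polyb_poly polyb_id)
  ultimately show ?case
    unfolding polyb_def by (meson runs_mono)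
next
  case (Neg \<phi>)
  then obtain p where p: "\<And>M k a e \<sigma> b. env_ok k k e \<sigma> \<Longrightarrow> arrays_ok a \<sigma> \<Longrightarrow> \<sigma> 4 = flg b \<Longrightarrow>
     (\<forall>n. e n \<le> M) \<Longrightarrow> runs (evalF k \<phi>) \<sigma> (poly p M) (\<sigma>(4 := flg (fval a e \<phi>)))"
    by blast
  have "runs (evalF k (Neg \<phi>)) \<sigma> (poly (p + 1) M) (\<sigma>(4 := flg (fval a e (Neg \<phi>))))"
    if "env_ok k k e \<sigma>" "arrays_ok a \<sigma>" "\<sigma> 4 = flg b" "\<forall>n. e n \<le> M" for M k a e \<sigma> b
  proof -
    have "runs (Act 4 (\<lambda>s. 1 - s) Stay) (\<sigma>(4 := flg (fval a e \<phi>))) 1 (\<sigma>(4 := flg (fval a e (Neg \<phi>))))"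
      by (rule runs_Act) (auto simp: flg_def read_tape_def)
    with p[OF that] show ?thesis by (auto intro: runs_Seq)
  qed
  then show ?case by blast
next
  case (Conj \<phi> \<psi>)
  then obtain p q where p: "\<And>M k a e \<sigma> b. env_ok k k e \<sigma> \<Longrightarrow> arrays_ok a \<sigma> \<Longrightarrow> \<sigma> 4 = flg b \<Longrightarrow>
     (\<forall>n. e n \<le> M) \<Longrightarrow> runs (evalF k \<phi>) \<sigma> (poly p M) (\<sigma>(4 := flg (fval a e \<phi>)))"
    and q: "\<And>M k a e \<sigma> b. env_ok k k e \<sigma> \<Longrightarrow> arrays_ok a \<sigma> \<Longrightarrow> \<sigma> 4 = flg b \<Longrightarrow>
     (\<forall>n. e n \<le> M) \<Longrightarrow> runs (evalF k \<psi>) \<sigma> (poly q M) (\<sigma>(4 := flg (fval a e \<psi>)))"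
    by blast
  have "runs (evalF k (Conj \<phi> \<psi>)) \<sigma> (poly (p + (q + 3)) M) (\<sigma>(4 := flg (fval a e (Conj \<phi> \<psi>))))"
    if env: "env_ok k k e \<sigma>" and arr: "arrays_ok a \<sigma>" and fl: "\<sigma> 4 = flg b"
      and M: "\<forall>n. e n \<le> M" for M k a e \<sigma> b
  proof -
    let ?\<sigma> = "\<sigma>(4 := flg (fval a e \<phi>))"
    have ok: "env_ok k k e ?\<sigma>" "arrays_ok a ?\<sigma>" "?\<sigma> 4 = flg (fval a e \<phi>)"
      using env_ok_upd[OF env] arrays_ok_upd[OF arr] by auto
    have "runs (Cond 4 (\<lambda>s. s = 1) (evalF k \<psi>) Skip) ?\<sigma> (poly (q + 3) M)
        (\<sigma>(4 := flg (fval a e (Conj \<phi> \<psi>))))"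
    proof (rule runs_Cond[where T = "poly q M + 1"])
      assume "scan ?\<sigma> 4 = 1"
      then show "runs (evalF k \<psi>) ?\<sigma> (poly q M + 1) (\<sigma>(4 := flg (fval a e (Conj \<phi> \<psi>))))"
        using runs_mono[OF q[where \<sigma> = ?\<sigma>, OF ok M], of "poly q M + 1"]
        by (cases "fval a e \<phi>") simp_all
    next
      assume "scan ?\<sigma> 4 \<noteq> 1"
      then show "runs Skip ?\<sigma> (poly q M + 1) (\<sigma>(4 := flg (fval a e (Conj \<phi> \<psi>))))"
        using runs_Skip[of "poly q M + 1" ?\<sigma>] by (cases "fval a e \<phi>") simp_all
    qed simp
    with p[OF env arr fl M] show ?thesis by (auto intro: runs_Seq)
  qed
  then show ?case by blast
next
  case (Ex t \<phi>)
  then obtain p where p: "\<And>M k a e \<sigma> b. env_ok k k e \<sigma> \<Longrightarrow> arrays_ok a \<sigma> \<Longrightarrow> \<sigma> 4 = flg b \<Longrightarrow>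
     (\<forall>n. e n \<le> M) \<Longrightarrow> runs (evalF k \<phi>) \<sigma> (poly p M) (\<sigma>(4 := flg (fval a e \<phi>)))"
    by blast
  obtain q where
    q: "\<And>M k m d r e \<sigma>. env_ok k m e \<sigma> \<Longrightarrow> k \<le> m \<Longrightarrow> d < 5 \<or> lv k \<le> d \<and> d < lv m \<Longrightarrow>
     (\<forall>n. e n \<le> M) \<Longrightarrow> runs (addT k m d r t) \<sigma> (poly q M) (shifted d r (tval e t) \<sigma>)"
    using addT_correct[of t] by blast
  define V where "V M = tval (\<lambda>_. M) t" for M
  define T where "T M = poly q M + (1 + (V M * (poly p (M + V M) + 4 * V M + 10) + 1))" for M
  have "runs (evalF k (Ex t \<phi>)) \<sigma> (T M) (\<sigma>(4 := flg (fval a e (Ex t \<phi>))))"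
    if env: "env_ok k k e \<sigma>" and arr: "arrays_ok a \<sigma>" and fl: "\<sigma> 4 = flg b"
      and M: "\<forall>n. e n \<le> M" for M k a e \<sigma> b
  proof -
    define j where "j = lv k"
    have \<sigma>: "\<sigma> j = (ctr, 0)" using env by (auto simp: env_ok_def j_def)
    have j: "j < 5 \<or> lv k \<le> j \<and> j < lv (Suc k)" "4 \<noteq> j" "3 \<le> j" by (auto simp: j_def)
    define S where "S i b = \<sigma>(j := (ctr, i), 4 := flg b)" for i b
    define B where "B = poly p (M + V M) + 4 * V M + 8"
    define body where "body = Seq (evalF (Suc k) \<phi>) (Cond 4 (\<lambda>s. s = 1) (While0 j Skip) Skip)"
    have S_upd [simp]: "(S i b)(j := (ctr, i')) = S i' b" "(S i b)(4 := flg b') = S i b'"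
      "S i b j = (ctr, i)" "S i b 4 = flg b" for i i' b b'
      using j by (auto simp: S_def fun_eq_iff)
    have S_env: "env_ok (Suc k) (Suc k) (case_nat i e) (S i b)" for i b
      using env unfolding env_ok_def S_def j_def
      by (auto split: nat.splits simp: not_less)
    have S_arr: "arrays_ok a (S i b)" for i b
      unfolding S_def by (intro arrays_ok_upd arr j) simp
    have loop: "runs (While0 j body) (S i False) (i * (B + 2) + 1)
        (S 0 (\<exists>l<i. fval a (case_nat l e) \<phi>))" if "i \<le> V M" for i
      using that
    proof (induction i)
      case 0
      then show ?case by (auto intro!: runs_LoopF simp: marked_scan)
    next
      case (Suc i)
      let ?b = "fval a (case_nat i e) \<phi>"
      have "case_nat i e n \<le> M + V M" for n using Suc.prems M by (auto split: nat.splits intro: trans_le_add1)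
      then have 1: "runs (evalF (Suc k) \<phi>) (S i False) (poly p (M + V M)) (S i ?b)"
        using p[OF S_env S_arr, of i False] by simp
      have 0: "runs (Move j Left) (S (Suc i) False) 1 (S i False)"
        by (rule runs_Move) auto
      \<comment> \<open>After a hit the counter is at 0 and the remaining loop is one failing test;
        otherwise the register is false again and the induction hypothesis applies.\<close>
      have 2: "runs (Cond 4 (\<lambda>s. s = 1) (While0 j Skip) Skip) (S i ?b) (4 * V M + 3) (S (if ?b then 0 else i) ?b)"
        using Suc.prems
        by (intro runs_Cond[where T = "4 * V M + 1"]) (auto intro!: runs_rewind runs_Skip)
      have 3: "runs (Seq (Move j Left) body) (S (Suc i) False) B (S (if ?b then 0 else i) ?b)"
        unfolding body_def B_def by (rule runs_Seq[OF 0 runs_Seq[OF 1 2 order_refl]]) simp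
      have "runs (While0 j body) (S (if ?b then 0 else i) ?b) (i * (B + 2) + 1)
          (S 0 (\<exists>l<Suc i. fval a (case_nat l e) \<phi>))"
      proof (cases ?b)
        case True
        then have ex: "(\<exists>l<Suc i. fval a (case_nat l e) \<phi>) = True" by blast
        show ?thesis
          unfolding ex using True by (auto simp: marked_scan intro!: runs_LoopF)
      next
        case False
        then show ?thesis using Suc by (simp add: less_Suc_eq ex_disj_distrib conj_disj_distribR)
      qed
      from runs_LoopT[where P = "\<lambda>s. s < 3", OF _ 3 this] show ?case
        by (simp add: marked_scan)
    qed
    have v: "tval e t \<le> V M" unfolding V_def using M by (intro tval_le) auto
    have 1: "runs (addT k (Suc k) j Right t) \<sigma> (poly q M) (\<sigma>(j := (ctr, tval e t)))"
      using q[OF env_ok_Suc[OF env] _ j(1) M, of Right] \<sigma> by (simp add: shifted_def)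
    have 2: "runs (set_flag False) (\<sigma>(j := (ctr, tval e t))) 1 (S (tval e t) False)"
      unfolding S_def by (rule runs_set_flag) (use j fl in auto)
    have 3: "runs (While0 j body) (S (tval e t) False) (V M * (B + 2) + 1)
        (S 0 (fval a e (Ex t \<phi>)))"
      unfolding fval.simps by (rule runs_mono[OF loop[OF v]]) (intro add_mono mult_le_mono order_refl v)
    have 4: "S 0 (fval a e (Ex t \<phi>)) = \<sigma>(4 := flg (fval a e (Ex t \<phi>)))"
      using \<sigma> j by (auto simp: S_def fun_eq_iff)
    show ?thesis
      unfolding evalF.simps j_def[symmetric] body_def[symmetric] 4[symmetric]
      by (rule runs_Seq[OF 1 runs_Seq[OF 2 3 order_refl]]) (simp add: T_def B_def)
  qed
  moreover have "polyb T"
    unfolding T_def V_def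
    by (intro polyb_add polyb_mult polyb_const polyb_tval polyb_poly polyb_id)
  ultimately show ?case
    unfolding polyb_def by (meson runs_mono)
qed

section \<open>Definable predicates\<close>

definition pt :: "((nat \<Rightarrow> nat) \<Rightarrow> nat) \<Rightarrow> bool" where
  "pt t \<longleftrightarrow> (\<exists>s. \<forall>e. tval e s = t e)"

text \<open>A semantic notion: closure rules are resolved against unfolded HOL definitions, so that
  no formula ever has to be written out.\<close>

definition dp :: "((bool \<Rightarrow> nat \<Rightarrow> bool) \<Rightarrow> (nat \<Rightarrow> nat) \<Rightarrow> bool) \<Rightarrow> bool" where
  "dp P \<longleftrightarrow> (\<exists>\<phi>. \<forall>a e. fval a e \<phi> \<longleftrightarrow> P a e)"

lemma pt_var: "pt (\<lambda>e. e n)"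
  unfolding pt_def by (intro exI[of _ "Var n"]) simp

lemma pt_const: "pt (\<lambda>e. c)"
  unfolding pt_def by (intro exI[of _ "Cst c"]) simp

lemma pt_add: "pt s \<Longrightarrow> pt t \<Longrightarrow> pt (\<lambda>e. s e + t e)"
  unfolding pt_def by (metis tval.simps(3))

lemma pt_mult: "pt s \<Longrightarrow> pt t \<Longrightarrow> pt (\<lambda>e. s e * t e)"
  unfolding pt_def by (metis tval.simps(4))

lemma pt_Suc: "pt t \<Longrightarrow> pt (\<lambda>e. Suc (t e))"
  using pt_add[of t "\<lambda>_. 1"] pt_const by simp

lemma pt_poly: "pt t \<Longrightarrow> pt (\<lambda>e. poly p (t e))" for p :: "nat poly"
  by (induction p) (auto intro: pt_const pt_add pt_mult)

lemmas pt_rules = pt_var pt_const pt_add pt_mult pt_Suc pt_poly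

lemma dp_cong: "dp P \<Longrightarrow> (\<And>a e. P a e = Q a e) \<Longrightarrow> dp Q"
  unfolding dp_def by simp

lemma dp_bit: "pt t \<Longrightarrow> dp (\<lambda>a e. a b (t e))"
  unfolding pt_def dp_def by (metis fval.simps(2))

lemma dp_le: "pt s \<Longrightarrow> pt t \<Longrightarrow> dp (\<lambda>a e. s e \<le> t e)"
  unfolding pt_def dp_def by (metis fval.simps(1))

lemma dp_neg: "dp P \<Longrightarrow> dp (\<lambda>a e. \<not> P a e)"
  unfolding dp_def by (metis fval.simps(3))

lemma dp_conj: "dp P \<Longrightarrow> dp Q \<Longrightarrow> dp (\<lambda>a e. P a e \<and> Q a e)"
  unfolding dp_def by (metis fval.simps(4))

lemma dp_disj: "dp P \<Longrightarrow> dp Q \<Longrightarrow> dp (\<lambda>a e. P a e \<or> Q a e)"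
  by (rule dp_cong[OF dp_neg[OF dp_conj[OF dp_neg[of P] dp_neg[of Q]]]]) auto

lemma dp_imp: "dp P \<Longrightarrow> dp Q \<Longrightarrow> dp (\<lambda>a e. P a e \<longrightarrow> Q a e)"
  by (rule dp_cong[OF dp_disj[OF dp_neg[of P], of Q]]) auto

lemma dp_iff: "dp P \<Longrightarrow> dp Q \<Longrightarrow> dp (\<lambda>a e. P a e \<longleftrightarrow> Q a e)"
  by (rule dp_cong[OF dp_conj[OF dp_imp[of P Q] dp_imp[of Q P]]]) blast+

lemma dp_less: "pt s \<Longrightarrow> pt t \<Longrightarrow> dp (\<lambda>a e. s e < t e)"
  using dp_neg[OF dp_le[of t s]] by (simp add: not_le)

lemma dp_eq: "pt s \<Longrightarrow> pt t \<Longrightarrow> dp (\<lambda>a e. s e = t e)"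
  using dp_conj[OF dp_le[of s t] dp_le[of t s]] by (simp add: eq_iff)

lemma dp_const: "dp (\<lambda>a e. b)"
  using dp_eq[OF pt_const[of "0 :: nat"] pt_const[of "if b then 0 else 1 :: nat"]]
  by (simp split: if_splits)

text \<open>As in the de Bruijn semantics of \<open>Ex\<close>, the premise finds the bound variable
  in slot 0 and the old environment one slot higher. Backward resolution thus computes the
  indices.\<close>

lemma dp_ex:
  assumes "pt t" "dp (\<lambda>a e. P a (\<lambda>n. e (Suc n)) (e 0))"
  shows "dp (\<lambda>a e. \<exists>i<t e. P a e i)"
proof -
  obtain s \<phi> where "\<forall>e. tval e s = t e" "\<forall>a e. fval a e \<phi> \<longleftrightarrow> P a (\<lambda>n. e (Suc n)) (e 0)"
    using assms unfolding pt_def dp_def by blast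
  then show ?thesis unfolding dp_def by (intro exI[of _ "Ex s \<phi>"]) simp
qed

lemma dp_all:
  assumes "pt t" "dp (\<lambda>a e. P a (\<lambda>n. e (Suc n)) (e 0))"
  shows "dp (\<lambda>a e. \<forall>i<t e. P a e i)"
  using dp_neg[OF dp_ex[OF assms(1) dp_neg[OF assms(2)]]] by simp

lemmas dp_rules = dp_ex dp_all dp_conj dp_disj dp_imp dp_iff dp_neg dp_le dp_less dp_eq dp_bit dp_const

text \<open>Finite case distinction, which makes arbitrary functions on a finite domain definable.\<close>

lemma dp_fin:
  assumes "pt t" "\<And>c. c < (K :: nat) \<Longrightarrow> dp (P c)"
  shows "dp (\<lambda>a e. t e < K \<and> P (t e) a e)"
  using assms(2)
proof (induction K)
  case 0
  then show ?case using dp_const[of False] by simp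
next
  case (Suc K)
  have "dp (\<lambda>a e. t e < K \<and> P (t e) a e)" "dp (P K)" using Suc by simp_all
  from dp_disj[OF this(1) dp_conj[OF dp_eq[OF assms(1) pt_const[of K]] this(2)]]
  show ?case by (rule dp_cong) (auto simp: less_Suc_eq)
qed

section \<open>Substitution of terms into definable predicates\<close>

fun tsub :: "(nat \<Rightarrow> trm) \<Rightarrow> trm \<Rightarrow> trm" where
  "tsub s (Var n) = s n"
| "tsub s (Cst c) = Cst c"
| "tsub s (Add t u) = Add (tsub s t) (tsub s u)"
| "tsub s (Mul t u) = Mul (tsub s t) (tsub s u)"

definition tlift :: "(nat \<Rightarrow> trm) \<Rightarrow> nat \<Rightarrow> trm" where
  "tlift s = case_nat (Var 0) (\<lambda>n. tsub (\<lambda>m. Var (Suc m)) (s n))"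

fun fsub :: "(nat \<Rightarrow> trm) \<Rightarrow> fm \<Rightarrow> fm" where
  "fsub s (Le t u) = Le (tsub s t) (tsub s u)"
| "fsub s (Bit b t) = Bit b (tsub s t)"
| "fsub s (Neg \<phi>) = Neg (fsub s \<phi>)"
| "fsub s (Conj \<phi> \<psi>) = Conj (fsub s \<phi>) (fsub s \<psi>)"
| "fsub s (Ex t \<phi>) = Ex (tsub s t) (fsub (tlift s) \<phi>)"

lemma tval_tsub: "tval e (tsub s t) = tval (\<lambda>n. tval e (s n)) t"
  by (induction t) auto

lemma tval_tlift: "(\<lambda>n. tval (case_nat i e) (tlift s n)) = case_nat i (\<lambda>n. tval e (s n))"
  by (auto simp: fun_eq_iff tlift_def tval_tsub split: nat.splits)

lemma fval_fsub: "fval a e (fsub s \<phi>) = fval a (\<lambda>n. tval e (s n)) \<phi>"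
  by (induction \<phi> arbitrary: e s) (auto simp: tval_tsub tval_tlift)

lemma dp_subst:
  assumes "dp P" "\<And>n. pt (s n)"
  shows "dp (\<lambda>a e. P a (\<lambda>n. s n e))"
proof -
  obtain s' where "\<And>n e. tval e (s' n) = s n e" using assms(2) unfolding pt_def by metis
  then show ?thesis using assms(1) unfolding dp_def by (metis (no_types, lifting) fval_fsub ext)
qed

text \<open>A predicate is shown definable once in the variables \<open>e 0\<close>,
  \<open>e 1\<close>, ... and can then be used with arbitrary terms, in particular below further
  quantifiers.\<close>

lemma dp_inst:
  assumes "dp P" "list_all pt ts"
  shows "dp (\<lambda>a e. P a (\<lambda>n. if n < length ts then (ts ! n) e else 0))"
proof -
  have "pt (\<lambda>e. if n < length ts then (ts ! n) e else 0)" for n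
    using assms(2) pt_const[of 0] by (cases "n < length ts") (auto simp: list_all_length)
  from dp_subst[OF assms(1) this] show ?thesis .
qed

section \<open>Definable output is computable in polynomial time\<close>

definition env1 :: "nat \<Rightarrow> nat \<Rightarrow> nat" where
  "env1 L = case_nat L (\<lambda>_. 0)"

definition env2 :: "nat \<Rightarrow> nat \<Rightarrow> nat \<Rightarrow> nat" where
  "env2 i L = case_nat i (env1 L)"

definition inp :: "bool list \<Rightarrow> bool \<Rightarrow> nat \<Rightarrow> bool" where
  "inp x b i \<longleftrightarrow> \<not> b \<and> i < length x \<and> x ! i"

lemma env1_simps [simp]: "env1 L 0 = L" "env1 L (Suc n) = 0"
  by (simp_all add: env1_def)

lemma env2_simps [simp]: "env2 i L 0 = i" "env2 i L (Suc n) = env1 L n"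
  by (simp_all add: env2_def)

text \<open>The number of tapes that a program needs is never computed: all sufficiently large
  \<open>K\<close> are suitable, and the filter takes care of the maxima.\<close>

lemma ev_wf:
  "eventually (\<lambda>K. wf_com K (Seq c c')) at_top \<longleftrightarrow>
     eventually (\<lambda>K. wf_com K c) at_top \<and> eventually (\<lambda>K. wf_com K c') at_top"
  "eventually (\<lambda>K. wf_com K (Cond j P c c')) at_top \<longleftrightarrow>
     eventually (\<lambda>K. wf_com K c) at_top \<and> eventually (\<lambda>K. wf_com K c') at_top"
  "eventually (\<lambda>K. wf_com K (Loop j P c)) at_top \<longleftrightarrow> eventually (\<lambda>K. wf_com K c) at_top"
  "eventually (\<lambda>K. wf_com K (Act j w d)) at_top \<longleftrightarrow> (\<forall>s<6. w s < 6)"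
  using eventually_gt_at_top[of j] by (simp_all add: eventually_conj_iff)

lemma ev_wf_addT: "eventually (\<lambda>K. wf_com K (addT k m d r t)) at_top"
proof (induction t arbitrary: k m d r)
  case (Cst c)
  show ?case by (induction c) (simp_all only: addT.simps funpow.simps o_apply id_apply ev_wf, simp_all)
qed (simp_all only: addT.simps ev_wf split: if_split, simp_all)

lemma ev_wf_evalF: "eventually (\<lambda>K. wf_com K (evalF k \<phi>)) at_top"
  by (induction \<phi> arbitrary: k)
    (simp_all only: evalF.simps Let_def ev_wf set_flag_def, simp_all add: ev_wf_addT less_imp_diff_less)

definition mark :: "nat \<Rightarrow> com" where
  "mark j = Act j (\<lambda>s. if s < 3 then s + 3 else s) Stay"

text \<open>Tape 0 stays unmarked because it must hold the plain output, and tape 4 because its head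
  never moves. The loop measures the input and leaves its length on tape 5, the variable of depth 0.
  The end of the input is a blank, which reads 3 if it lies in cell 0.\<close>

definition init_prog :: "nat \<Rightarrow> com" where
  "init_prog K =
     Seq (foldr Seq (map mark ([1, 2, 3] @ [5..<K])) Skip)
      (Seq (Loop 1 (\<lambda>s. s \<noteq> 0 \<and> s \<noteq> 3) (Seq (Move 1 Right) (Move 5 Right))) (While0 1 Skip))"

definition ready :: "bool list \<Rightarrow> store" where
  "ready x j = (if j = 0 then (\<lambda>_. 0, 0)
     else if j = 1 then (\<lambda>i. string_contents x i + (if i = 0 then 3 else 0), 0)
     else if j = 4 then flg False else if j = 5 then (ctr, length x) else (ctr, 0))"

lemma wf_init_prog: "K \<ge> 6 \<Longrightarrow> wf_com K (init_prog K)"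
proof -
  assume K: "K \<ge> 6"
  have "wf_com K (foldr Seq (map mark js) Skip)" if "set js \<subseteq> {..<K}" for js
    using that K by (induction js) (auto simp: mark_def)
  moreover have "set ([1, 2, 3] @ [5..<K]) \<subseteq> {..<K}" using K by auto
  ultimately have "wf_com K (foldr Seq (map mark ([1, 2, 3] @ [5..<K])) Skip)" by blast
  then show ?thesis using K by (simp add: init_prog_def)
qed

lemma runs_marks:
  "distinct js \<Longrightarrow> (\<forall>j \<in> set js. snd (\<sigma> j) = 0 \<and> fst (\<sigma> j) 0 < 3) \<Longrightarrow>
    runs (foldr Seq (map mark js) Skip) \<sigma> (length js + 1)
      (\<lambda>j. if j \<in> set js then (\<lambda>i. fst (\<sigma> j) i + (if i = 0 then 3 else 0), 0) else \<sigma> j)"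
proof (induction js arbitrary: \<sigma>)
  case Nil
  then show ?case by (simp add: runs_Skip)
next
  case (Cons l js)
  define \<sigma>' where "\<sigma>' = \<sigma>(l := (\<lambda>i. fst (\<sigma> l) i + (if i = 0 then 3 else 0), 0))"
  have 1: "runs (mark l) \<sigma> 1 \<sigma>'"
    unfolding mark_def
  proof (rule runs_Act)
    show "\<sigma>' = \<sigma>(l := act_tape (if scan \<sigma> l < 3 then scan \<sigma> l + 3 else scan \<sigma> l, Stay) (\<sigma> l))"
      using Cons.prems(2) by (cases "\<sigma> l") (auto simp: \<sigma>'_def read_tape_def fun_eq_iff)
  qed simp
  have "runs (foldr Seq (map mark js) Skip) \<sigma>' (length js + 1)
      (\<lambda>j. if j \<in> set js then (\<lambda>i. fst (\<sigma>' j) i + (if i = 0 then 3 else 0), 0) else \<sigma>' j)"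
    using Cons.prems by (intro Cons.IH) (auto simp: \<sigma>'_def)
  moreover have "(\<lambda>j. if j \<in> set js then (\<lambda>i. fst (\<sigma>' j) i + (if i = 0 then 3 else 0), 0) else \<sigma>' j) =
      (\<lambda>j. if j \<in> set (l # js) then (\<lambda>i. fst (\<sigma> j) i + (if i = 0 then 3 else 0), 0) else \<sigma> j)"
    using Cons.prems(1) by (auto simp: \<sigma>'_def fun_eq_iff)
  ultimately have 2: "runs (foldr Seq (map mark js) Skip) \<sigma>' (length js + 1)
      (\<lambda>j. if j \<in> set (l # js) then (\<lambda>i. fst (\<sigma> j) i + (if i = 0 then 3 else 0), 0) else \<sigma> j)"
    by simp
  show ?case
    unfolding list.map foldr.simps o_apply by (rule runs_Seq[OF 1 2]) simp
qed

lemma runs_init_prog: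
  assumes "K \<ge> 6"
  shows "runs (init_prog K) (init_store K x) (K + 20 + 10 * length x) (ready x)"
proof -
  define L where "L = length x"
  define c where "c i = string_contents x i + (if i = 0 then 3 else 0)" for i
  have c: "marked c" by (auto simp: marked_def c_def string_contents_def)
  have c_blank: "c i \<noteq> 0 \<and> c i \<noteq> 3 \<longleftrightarrow> i < L" for i
    by (auto simp: c_def string_contents_def L_def)
  define S where "S i = (ready x)(1 := (c, L - i), 5 := (ctr, L - i))" for i
  have 1: "runs (foldr Seq (map mark ([1, 2, 3] @ [5..<K])) Skip) (init_store K x) (K + 1) (S L)"
  proof -
    have "length ([1, 2, 3] @ [5..<K]) + 1 \<le> K + 1" using assms by simp
    moreover have "(\<lambda>j. if j \<in> set ([1, 2, 3] @ [5..<K])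
        then (\<lambda>i. fst (init_store K x j) i + (if i = 0 then 3 else 0), 0) else init_store K x j) = S L"
      using assms by (auto simp: fun_eq_iff init_store_def S_def ready_def c_def ctr_def flg_def)
    ultimately show ?thesis
      using runs_mono[OF runs_marks[of "[1, 2, 3] @ [5..<K]" "init_store K x"]] assms
      by (auto simp: init_store_def string_contents_def)
  qed
  have 2: "runs (Loop 1 (\<lambda>s. s \<noteq> 0 \<and> s \<noteq> 3) (Seq (Move 1 Right) (Move 5 Right))) (S i) (4 * i + 1) (S 0)"
    if "i \<le> L" for i
    using that
  proof (induction i)
    case 0
    show ?case using c_blank[of L] by (intro runs_LoopF) (auto simp: S_def read_tape_def)
  next
    case (Suc i)
    have "runs (Seq (Move 1 Right) (Move 5 Right)) (S (Suc i)) 2 (S i)"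
      using Suc.prems
      by (intro runs_Seq[OF runs_Move[OF refl order_refl] runs_Move[OF _ order_refl]])
        (auto simp: S_def fun_eq_iff)
    then show ?case
    proof (rule runs_LoopT[rotated])
      show "scan (S (Suc i)) 1 \<noteq> 0 \<and> scan (S (Suc i)) 1 \<noteq> 3"
        using c_blank[of "L - Suc i"] Suc.prems by (simp add: S_def read_tape_def)
      show "runs (Loop 1 (\<lambda>s. s \<noteq> 0 \<and> s \<noteq> 3) (Seq (Move 1 Right) (Move 5 Right))) (S i) (4 * i + 1) (S 0)"
        using Suc by simp
    qed simp
  qed
  have 3: "runs (While0 1 Skip) (S 0) (4 * L + 1) (ready x)"
    by (rule runs_rewind[OF _ c]) (auto simp: S_def ready_def L_def c_def fun_eq_iff)
  show ?thesis
    unfolding init_prog_def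
    by (rule runs_Seq[OF 1 runs_Seq[OF 2[OF order_refl] 3 order_refl]]) (simp add: L_def)
qed

lemma arrays_ok_ready: "arrays_ok (inp x) (ready x)"
  by (auto simp: arrays_ok_def ready_def marked_def string_contents_def inp_def ctr_def)

text \<open>Each output bit is evaluated on its own and written from left to right. Tape 3 counts
  the bits still to come and tape 6 holds the current position: at depth 2, variables 0 and 1 live
  on tapes 6 and 5, that is, position and input length.\<close>

theorem polytime_computable_definable:
  assumes "dp P" "pt N"
  shows "polytime_computable (\<lambda>x. map (\<lambda>i. P (inp x) (env2 i (length x))) [0..<N (env1 (length x))])"
proof -
  obtain \<phi> where \<phi>: "\<And>a e. fval a e \<phi> = P a e" using assms(1) unfolding dp_def by blast
  obtain t where t: "\<And>e. tval e t = N e" using assms(2) unfolding pt_def by blast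
  obtain p where
    p: "\<And>M k m d r e \<sigma>. env_ok k m e \<sigma> \<Longrightarrow> k \<le> m \<Longrightarrow> d < 5 \<or> lv k \<le> d \<and> d < lv m \<Longrightarrow>
     (\<forall>n. e n \<le> M) \<Longrightarrow> runs (addT k m d r t) \<sigma> (poly p M) (shifted d r (tval e t) \<sigma>)"
    using addT_correct[of t] by blast
  obtain q where q: "\<And>M k a e \<sigma> b. env_ok k k e \<sigma> \<Longrightarrow> arrays_ok a \<sigma> \<Longrightarrow> \<sigma> 4 = flg b \<Longrightarrow>
     (\<forall>n. e n \<le> M) \<Longrightarrow> runs (evalF k \<phi>) \<sigma> (poly q M) (\<sigma>(4 := flg (fval a e \<phi>)))"
    using evalF_correct[of \<phi>] by blast
  define wr where "wr = Cond 4 (\<lambda>s. s = 1) (Act 0 (\<lambda>_. 2) Right) (Act 0 (\<lambda>_. 1) Right)"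
  define body where "body = Seq (evalF 2 \<phi>) (Seq wr (Move 6 Right))"
  define c where "c K = Seq (init_prog K) (Seq (addT 1 1 3 Right t) (While0 3 body))" for K
  have "eventually (\<lambda>K. wf_com K (addT 1 1 3 Right t) \<and> wf_com K (While0 3 body) \<and> K \<ge> 7) at_top"
    unfolding eventually_conj_iff body_def wr_def ev_wf
    by (auto simp: ev_wf_addT ev_wf_evalF eventually_ge_at_top)
  then obtain K where K: "wf_com K (addT 1 1 3 Right t)" "wf_com K (While0 3 body)" "K \<ge> 7"
    unfolding eventually_at_top_linorder by blast
  then have wf: "wf_com K (c K)" unfolding c_def by (simp add: wf_init_prog)
  define V where "V L = tval (\<lambda>_. L) t" for L
  define T where "T L = K + 20 + 10 * L + (poly p L + (V L * (poly q (L + V L) + 4 + 3) + 1))" for L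
  have run: "\<exists>\<tau>. runs (c K) (init_store K x) (T (length x)) \<tau> \<and> fst (\<tau> 0) =
      string_contents (map (\<lambda>i. P (inp x) (env2 i (length x))) [0..<N (env1 (length x))])" for x
  proof -
    define L where "L = length x"
    define n where "n = N (env1 L)"
    define f where "f i = P (inp x) (env2 i L)" for i
    have nV: "n \<le> V L" unfolding n_def V_def t[symmetric] by (rule tval_le) (auto simp: env1_def split: nat.splits)
    have env: "env_ok 1 1 (env1 L) (ready x)"
      by (auto simp: env_ok_def ready_def L_def env1_def split: nat.splits)
    \<comment> \<open>With \<open>i\<close> bits to come, the register still shows the bit computed
      last, at position \<open>n - Suc i\<close>; before the first one it is false.\<close>
    define S where "S i = (ready x)(0 := (string_contents (map f [0..<n - i]), n - i),
      3 := (ctr, i), 4 := flg (i < n \<and> f (n - Suc i)), 6 := (ctr, n - i))" for i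
    have "shifted 3 Right n (ready x) = S n"
      by (auto simp: shifted_def S_def ready_def fun_eq_iff string_contents_def)
    then have 1: "runs (addT 1 1 3 Right t) (ready x) (poly p L) (S n)"
      using p[OF env, of 3 L Right] by (simp add: t n_def env1_def split: nat.splits)
    have 2: "runs (While0 3 body) (S n) (V L * (poly q (L + V L) + 4 + 3) + 1) (S 0)"
    proof (rule runs_countdown[where c = ctr and B = "poly q (L + V L) + 4"])
      fix i assume i: "i < n"
      define \<sigma> where "\<sigma> = (S (Suc i))(3 := (ctr, i))"
      define \<sigma>' where "\<sigma>' = \<sigma>(4 := flg (f (n - Suc i)))"
      have e: "env_ok 2 2 (env2 (n - Suc i) L) \<sigma>"
        by (auto simp: env_ok_def \<sigma>_def S_def ready_def L_def env2_def env1_def less_Suc_eq numeral_2_eq_2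
            split: nat.splits)
      have a: "arrays_ok (inp x) \<sigma>"
        by (rule arrays_ok_cong[OF arrays_ok_ready]) (simp_all add: \<sigma>_def S_def)
      have "\<forall>l. env2 (n - Suc i) L l \<le> L + V L"
        using nV by (auto simp: env2_def env1_def split: nat.splits)
      from q[OF e a _ this]
      have 1: "runs (evalF 2 \<phi>) \<sigma> (poly q (L + V L)) \<sigma>'"
        by (simp add: \<sigma>_def \<sigma>'_def S_def \<phi> f_def)
      define \<sigma>'' where "\<sigma>'' = (S i)(6 := (ctr, n - Suc i))"
      have ni: "n - i = Suc (n - Suc i)" using i by simp
      have sc: "(string_contents (map f [0..<n - Suc i]))(n - Suc i := v) =
          string_contents (map f [0..<n - i])" if "v = (if f (n - Suc i) then 2 else 1)" for v
        using that unfolding ni by (auto simp: string_contents_def fun_eq_iff nth_append)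
      have "runs wr \<sigma>' 3 \<sigma>''"
        unfolding wr_def
      proof (rule runs_Cond[where T = 1])
        assume "scan \<sigma>' 4 = 1"
        then have fi: "f (n - Suc i)" by (simp add: \<sigma>'_def)
        show "runs (Act 0 (\<lambda>_. 2) Right) \<sigma>' 1 \<sigma>''"
          by (rule runs_Act)
            (use i fi sc in \<open>auto simp: \<sigma>''_def \<sigma>'_def \<sigma>_def S_def fun_eq_iff ni\<close>)
      next
        assume "scan \<sigma>' 4 \<noteq> 1"
        then have fi: "\<not> f (n - Suc i)" by (simp add: \<sigma>'_def)
        show "runs (Act 0 (\<lambda>_. 1) Right) \<sigma>' 1 \<sigma>''"
          by (rule runs_Act)
            (use i fi sc in \<open>auto simp: \<sigma>''_def \<sigma>'_def \<sigma>_def S_def fun_eq_iff ni\<close>)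
      qed simp
      moreover have "runs (Move 6 Right) \<sigma>'' 1 (S i)"
        by (rule runs_Move) (use i in \<open>auto simp: \<sigma>''_def S_def fun_eq_iff\<close>)
      ultimately have "runs (Seq wr (Move 6 Right)) \<sigma>' 4 (S i)" by (rule runs_Seq) simp
      with 1 show "runs body ((S (Suc i))(3 := (ctr, i))) (poly q (L + V L) + 4) (S i)"
        unfolding body_def \<sigma>_def[symmetric] by (rule runs_Seq) simp
    next
      show "n * (poly q (L + V L) + 4 + 3) + 1 \<le> V L * (poly q (L + V L) + 4 + 3) + 1"
        by (intro add_mono mult_le_mono nV order_refl)
    qed (auto simp: S_def)
    have "runs (c K) (init_store K x) (T L) (S 0)"
      unfolding c_def
      by (rule runs_Seq[OF runs_init_prog runs_Seq[OF 1 2 order_refl]])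
        (use K in \<open>simp_all add: T_def L_def\<close>)
    moreover have "fst (S 0 0) = string_contents (map f [0..<n])" by (simp add: S_def)
    ultimately show ?thesis unfolding L_def n_def f_def by blast
  qed
  have "polyb T"
    unfolding T_def V_def by (intro polyb_add polyb_mult polyb_const polyb_tval polyb_poly polyb_id)
  then obtain b :: "nat poly" where b: "\<And>L. T L \<le> poly b L" unfolding polyb_def by blast
  show ?thesis
  proof (rule polytime_computable_I[OF _ wf, of b])
    show "5 \<le> K" using K by simp
    fix x
    show "\<exists>t \<tau>. big (\<lambda>_. True) (c K) (init_store K x) t \<tau> \<and> t \<le> poly b (length x) \<and> fst (\<tau> 0) =
      string_contents (map (\<lambda>i. P (inp x) (env2 i (length x))) [0..<N (env1 (length x))])"
      using run[of x] b[of "length x"] unfolding runs_def by (meson order_trans)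
  qed
qed

section \<open>Quantified definable predicates are decidable in polynomial space\<close>

text \<open>
  With a negated conjunction at every node, the levels of the tree alternate between existential and
  universal quantification.
\<close>

fun game :: "nat \<Rightarrow> (bool list \<Rightarrow> bool) \<Rightarrow> bool list \<Rightarrow> bool" where
  "game 0 \<Phi> bs \<longleftrightarrow> \<Phi> bs"
| "game (Suc k) \<Phi> bs \<longleftrightarrow> \<not> (game k \<Phi> (bs @ [False]) \<and> game k \<Phi> (bs @ [True]))"

text \<open>Moves are numbered from 1 because cell 0 of their tape holds the end marker.\<close>

definition prefix_list :: "(nat \<Rightarrow> bool) \<Rightarrow> nat \<Rightarrow> bool list" where
  "prefix_list f i = map f [1..<Suc i]"

lemma prefix_list_0 [simp]: "prefix_list f 0 = []"
  and length_prefix_list [simp]: "length (prefix_list f i) = i"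
  by (simp_all add: prefix_list_def)

lemma nth_prefix_list: "k < i \<Longrightarrow> prefix_list f i ! k = f (Suc k)"
  by (simp add: prefix_list_def del: upt_Suc)

lemma prefix_list_Suc: "prefix_list f (Suc i) = prefix_list f i @ [f (Suc i)]"
  by (simp add: prefix_list_def)

lemma prefix_list_cong: "(\<And>j. 0 < j \<Longrightarrow> j \<le> i \<Longrightarrow> f j = f' j) \<Longrightarrow> prefix_list f i = prefix_list f' i"
  unfolding prefix_list_def by (intro map_cong) auto

text \<open>
  The tree is traversed depth first. If the current leaf is \<open>f\<close> and the values of the left siblings
  of its ancestors are stored in \<open>g\<close>, then \<open>answer m \<Phi> f g i v\<close> is the value of the root, where
  \<open>v\<close> is the value of the ancestor at depth \<open>i\<close>.
\<close>

fun answer :: "nat \<Rightarrow> (bool list \<Rightarrow> bool) \<Rightarrow> (nat \<Rightarrow> bool) \<Rightarrow> (nat \<Rightarrow> bool) \<Rightarrow> nat \<Rightarrow> bool \<Rightarrow> bool" where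
  "answer m \<Phi> f g 0 v = v"
| "answer m \<Phi> f g (Suc i) v =
     answer m \<Phi> f g i (\<not> (if f (Suc i) then g (Suc i) \<and> v
       else v \<and> game (m - Suc i) \<Phi> (prefix_list f i @ [True])))"

lemma answer_cong:
  "(\<And>j. 0 < j \<Longrightarrow> j \<le> i \<Longrightarrow> f j = f' j \<and> g j = g' j) \<Longrightarrow> answer m \<Phi> f g i v = answer m \<Phi> f' g' i v"
proof (induction i arbitrary: v)
  case (Suc i)
  have "prefix_list f i = prefix_list f' i" using Suc.prems by (intro prefix_list_cong) auto
  then show ?case using Suc.prems[of "Suc i"] Suc.IH Suc.prems by simp
qed simp

text \<open>On levels where the leaf goes left, no stored value is consulted, so the evaluation
  amounts to the game value of the whole subtree. Depth 0 gives correctness at the first leaf; other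
  depths show that turning to a right sibling preserves the answer.\<close>

lemma answer_zeros:
  assumes "i \<le> m" "\<And>j. i < j \<Longrightarrow> j \<le> m \<Longrightarrow> \<not> f j"
  shows "answer m \<Phi> f g m (\<Phi> (prefix_list f m)) = answer m \<Phi> f g i (game (m - i) \<Phi> (prefix_list f i))"
  using assms
proof (induction i rule: inc_induct)
  case base
  then show ?case by (simp)
next
  case (step i)
  have "m - i = Suc (m - Suc i)" using step.hyps by simp
  moreover have "\<not> f (Suc i)" using step by simp
  ultimately show ?case using step by (simp add: prefix_list_Suc)
qed

text \<open>The leaf as a binary number, top move first. It grows by one per round, which makes the
  traversal terminate.\<close>

fun num :: "(nat \<Rightarrow> bool) \<Rightarrow> nat \<Rightarrow> nat" where
  "num f 0 = 0"
| "num f (Suc i) = 2 * num f i + of_bool (f (Suc i))"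

lemma num_less: "num f i < 2 ^ i"
  by (induction i) auto

lemma num_cong: "(\<And>j. 0 < j \<Longrightarrow> j \<le> i \<Longrightarrow> f j = f' j) \<Longrightarrow> num f i = num f' i"
  by (induction i) auto

lemma num_zeros: "i \<le> m \<Longrightarrow> (\<And>j. i < j \<Longrightarrow> j \<le> m \<Longrightarrow> \<not> f j) \<Longrightarrow> num f m = num f i * 2 ^ (m - i)"
proof (induction i rule: inc_induct)
  case (step i)
  have "m - i = Suc (m - Suc i)" using step.hyps by simp
  moreover have "\<not> f (Suc i)" using step by simp
  ultimately show ?case using step by simp
qed simp

text \<open>The moves are written as 1 and 2 so that the blank after cell \<open>m\<close> ends the
  list.\<close>

definition bits_tape :: "nat \<Rightarrow> (nat \<Rightarrow> bool) \<Rightarrow> nat \<Rightarrow> nat" where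
  "bits_tape m f i = (if i = 0 then 3 else if i \<le> m then (if f i then 2 else 1) else 0)"

definition acc_tape :: "(nat \<Rightarrow> bool) \<Rightarrow> nat \<Rightarrow> nat" where
  "acc_tape g i = (if i = 0 then 3 else of_bool (g i))"

definition St :: "bool list \<Rightarrow> nat \<Rightarrow> (nat \<Rightarrow> bool) \<Rightarrow> (nat \<Rightarrow> bool) \<Rightarrow> nat \<Rightarrow> nat \<Rightarrow> bool \<Rightarrow> store" where
  "St x m f g i j v = (ready x)(2 := (bits_tape m f, i), 3 := (acc_tape g, j), 4 := flg v)"

lemma St_simps [simp]:
  "St x m f g i j v 2 = (bits_tape m f, i)" "St x m f g i j v 3 = (acc_tape g, j)"
  "St x m f g i j v 4 = flg v"
  "(St x m f g i j v)(4 := flg v') = St x m f g i j v'"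
  "(St x m f g i j v)(2 := (bits_tape m f', i')) = St x m f' g i' j v"
  "(St x m f g i j v)(3 := (acc_tape g', j')) = St x m f g' i j' v"
  by (auto simp: St_def fun_eq_iff)

lemma marked_bits [simp]: "marked (bits_tape m f)" and marked_acc [simp]: "marked (acc_tape g)"
  by (auto simp: marked_def bits_tape_def acc_tape_def)

text \<open>Climbs as long as the current node is a right child. The parent is the negated
  conjunction with the stored left value, hence true if that value is false. Moves that are left
  behind are reset, and the climb stops at a left child or at the marker.\<close>

definition up_prog :: com where
  "up_prog = Loop 2 (\<lambda>s. s = 2)
     (Seq (Cond 3 (\<lambda>s. s = 1) (Act 4 (\<lambda>s. 1 - s) Stay) (set_flag True))
       (Seq (Act 2 (\<lambda>_. 1) Left) (Move 3 Left)))"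

text \<open>The climb is the carry of a binary increment: all bits after \<open>i'\<close> were set,
  which is what the equation for \<open>num\<close> records.\<close>

lemma runs_up_prog:
  assumes "i \<le> m"
  shows "\<exists>i' f' v'. runs up_prog (St x m f g i i v) (7 * i + 1) (St x m f' g i' i' v') \<and> i' \<le> i \<and>
    (i' > 0 \<longrightarrow> \<not> f i') \<and> answer m \<Phi> f g i v = answer m \<Phi> f g i' v' \<and>
    (\<forall>j. f' j \<longleftrightarrow> f j \<and> (j \<le> i' \<or> i < j)) \<and> num f i + 1 = (num f i' + 1) * 2 ^ (i - i')"
  using assms
proof (induction i arbitrary: f v)
  case 0
  have "runs up_prog (St x m f g 0 0 v) 1 (St x m f g 0 0 v)"
    unfolding up_prog_def by (rule runs_LoopF) (simp_all add: read_tape_def bits_tape_def)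
  then show ?case by (intro exI[of _ 0] exI[of _ f] exI[of _ v]) auto
next
  case (Suc i)
  show ?case
  proof (cases "f (Suc i)")
    case False
    have "runs up_prog (St x m f g (Suc i) (Suc i) v) (7 * Suc i + 1) (St x m f g (Suc i) (Suc i) v)"
      unfolding up_prog_def
      by (rule runs_LoopF) (use Suc.prems False in \<open>simp_all add: read_tape_def bits_tape_def\<close>)
    then show ?thesis using False
      by (intro exI[of _ "Suc i"] exI[of _ f] exI[of _ v]) (auto simp: not_less_eq_eq le_less_linear)
  next
    case True
    define w where "w = (\<not> (g (Suc i) \<and> v))"
    define h where "h = f(Suc i := False)"
    obtain i' f' v' where IH: "runs up_prog (St x m h g i i w) (7 * i + 1) (St x m f' g i' i' v')"
      "i' \<le> i" "i' > 0 \<longrightarrow> \<not> h i'" "answer m \<Phi> h g i w = answer m \<Phi> h g i' v'"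
      "\<forall>j. f' j \<longleftrightarrow> h j \<and> (j \<le> i' \<or> i < j)" "num h i + 1 = (num h i' + 1) * 2 ^ (i - i')"
      using Suc.IH[of h w] Suc.prems by auto
    have 1: "runs (Cond 3 (\<lambda>s. s = 1) (Act 4 (\<lambda>s. 1 - s) Stay) (set_flag True))
        (St x m f g (Suc i) (Suc i) v) 3 (St x m f g (Suc i) (Suc i) w)"
    proof (rule runs_Cond[where T = 1])
      assume "scan (St x m f g (Suc i) (Suc i) v) 3 = 1"
      then have "g (Suc i)" by (cases "g (Suc i)") (simp_all add: read_tape_def acc_tape_def)
      then have "w = (\<not> v)" by (simp add: w_def)
      moreover have "act_tape (1 - read_tape (flg v), Stay) (flg v) = flg (\<not> v)"
        by (simp only: scan_flg) (cases v; simp add: flg_def)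
      ultimately have "St x m f g (Suc i) (Suc i) w = (St x m f g (Suc i) (Suc i) v)(4 :=
          act_tape (1 - scan (St x m f g (Suc i) (Suc i) v) 4, Stay) (St x m f g (Suc i) (Suc i) v 4))"
        by simp
      then show "runs (Act 4 (\<lambda>s. 1 - s) Stay) (St x m f g (Suc i) (Suc i) v) 1
          (St x m f g (Suc i) (Suc i) w)"
        by (rule runs_Act) simp
    next
      assume "scan (St x m f g (Suc i) (Suc i) v) 3 \<noteq> 1"
      then have "w" by (cases "g (Suc i)") (simp_all add: read_tape_def acc_tape_def w_def)
      then show "runs (set_flag True) (St x m f g (Suc i) (Suc i) v) 1 (St x m f g (Suc i) (Suc i) w)"
        using runs_set_flag[of "St x m f g (Suc i) (Suc i) v" v 1 True] by simp
    qed simp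
    have 2: "runs (Act 2 (\<lambda>_. 1) Left) (St x m f g (Suc i) (Suc i) w) 1 (St x m h g i (Suc i) w)"
    proof (rule runs_Act)
      have "(bits_tape m f)(Suc i := 1) = bits_tape m h"
        using Suc.prems by (auto simp: fun_eq_iff bits_tape_def h_def)
      then show "St x m h g i (Suc i) w = (St x m f g (Suc i) (Suc i) w)(2 := act_tape (1, Left)
          (St x m f g (Suc i) (Suc i) w 2))"
        by simp
    qed simp
    have 3: "runs (Move 3 Left) (St x m h g i (Suc i) w) 1 (St x m h g i i w)"
      by (rule runs_Move) simp_all
    have "runs up_prog (St x m f g (Suc i) (Suc i) v) (7 * Suc i + 1) (St x m f' g i' i' v')"
      unfolding up_prog_def
      by (rule runs_LoopT[OF _ runs_Seq[OF 1 runs_Seq[OF 2 3 order_refl] order_refl] IH(1)[unfolded up_prog_def]])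
        (use True Suc.prems in \<open>simp_all add: read_tape_def bits_tape_def\<close>)
    moreover have "answer m \<Phi> f g (Suc i) v = answer m \<Phi> f g i' v'"
    proof -
      have "answer m \<Phi> f g (Suc i) v = answer m \<Phi> f g i w" using True by (simp add: w_def)
      also have "\<dots> = answer m \<Phi> h g i w" by (rule answer_cong) (auto simp: h_def)
      also have "\<dots> = answer m \<Phi> h g i' v'" by (rule IH(4))
      also have "\<dots> = answer m \<Phi> f g i' v'" by (rule answer_cong) (use IH(2) in \<open>auto simp: h_def\<close>)
      finally show ?thesis .
    qed
    moreover have "num f (Suc i) + 1 = (num f i' + 1) * 2 ^ (Suc i - i')"
    proof -
      have "num f i = num h i" "num f i' = num h i'"
        using IH(2) by (auto simp: h_def intro!: num_cong)
      then have "num f (Suc i) + 1 = (num h i + 1) * 2" using True by simp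
      also have "\<dots> = (num f i' + 1) * 2 ^ (i - i') * 2"
        using IH(6) \<open>num f i' = num h i'\<close> by simp
      also have "\<dots> = (num f i' + 1) * 2 ^ (Suc i - i')"
        using IH(2) by (simp add: Suc_diff_le)
      finally show ?thesis .
    qed
    moreover have "\<forall>j. f' j \<longleftrightarrow> f j \<and> (j \<le> i' \<or> Suc i < j)"
    proof
      fix j show "f' j \<longleftrightarrow> f j \<and> (j \<le> i' \<or> Suc i < j)"
        using IH(2) spec[OF IH(5), of j] by (cases "j = Suc i") (auto simp: h_def)
    qed
    moreover have "i' > 0 \<longrightarrow> \<not> f i'" using IH(2,3) by (auto simp: h_def)
    moreover have "i' \<le> Suc i" using IH(2) by simp
    ultimately show ?thesis by (intro exI conjI)
  qed
qed

text \<open>One leaf per round. The forward loop stops on the blank behind the last move, one cell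
  too far, hence the two moves to the left. After the climb, a left child gets its value saved on
  tape 3 and is replaced by its right sibling; at the marker, the register holds the value of the
  root.\<close>

definition game_body :: "fm \<Rightarrow> com" where
  "game_body \<phi> =
     Seq (While0 2 Skip) (Seq (While0 3 Skip) (Seq (evalF 1 \<phi>)
      (Seq (Loop 2 (\<lambda>s. s \<noteq> 0) (Seq (Move 2 Right) (Move 3 Right)))
      (Seq (Seq (Move 2 Left) (Move 3 Left)) (Seq up_prog
        (Cond 2 (\<lambda>s. s = 1)
          (Seq (Cond 4 (\<lambda>s. s = 1) (Act 3 (\<lambda>_. 1) Stay) (Act 3 (\<lambda>_. 0) Stay)) (Act 2 (\<lambda>_. 2) Stay))
          Skip))))))"

definition arr :: "bool list \<Rightarrow> bool list \<Rightarrow> bool \<Rightarrow> nat \<Rightarrow> bool" where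
  "arr x bs b i \<longleftrightarrow> (if b then 0 < i \<and> i \<le> length bs \<and> bs ! (i - 1) else i < length x \<and> x ! i)"

lemma arrays_ok_St: "arrays_ok (arr x (prefix_list f m)) (St x m f g 0 j v)"
proof -
  have "\<exists>c. ready x 1 = (c, 0) \<and> marked c \<and> (\<forall>i. inp x False i \<longleftrightarrow> c i = 2 \<or> c i = 5)"
    using arrays_ok_ready[of x] unfolding arrays_ok_def by (metis (full_types))
  moreover have "inp x False i = arr x (prefix_list f m) False i" for i
    by (simp add: inp_def arr_def)
  moreover have "arr x (prefix_list f m) True i \<longleftrightarrow> bits_tape m f i = 2 \<or> bits_tape m f i = 5" for i
    by (auto simp: arr_def bits_tape_def nth_prefix_list)
  moreover have "St x m f g 0 j v 1 = ready x 1" by (simp add: St_def)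
  ultimately show ?thesis
    unfolding arrays_ok_def by (metis (full_types) St_simps(1) marked_bits)
qed

lemma env_ok_St: "env_ok 1 1 (env1 (length x)) (St x m f g i j v)"
  by (auto simp: env_ok_def St_def ready_def env1_def split: nat.splits)

text \<open>A round either ends with the value of the root or advances to the next leaf without
  changing the answer. The heads of tapes 2 and 3 are arbitrary at the start, because they differ
  before the first round and agree later.\<close>

lemma runs_game_body:
  fixes x :: "bool list"
  assumes q: "\<forall>M k a e \<sigma> b. env_ok k k e \<sigma> \<longrightarrow> arrays_ok a \<sigma> \<longrightarrow> \<sigma> 4 = flg b \<longrightarrow>
      (\<forall>n. e n \<le> M) \<longrightarrow> runs (evalF k \<phi>) \<sigma> (poly q M) (\<sigma>(4 := flg (fval a e \<phi>)))"
    and ij: "i \<le> m" "j \<le> m"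
  defines "\<Phi> \<equiv> \<lambda>bs. fval (arr x bs) (env1 (length x)) \<phi>"
  shows "\<exists>i' f' g' v'. runs (game_body \<phi>) (St x m f g i j v) (poly q (length x) + 20 * m + 30) (St x m f' g' i' i' v') \<and>
    i' \<le> m \<and> (if i' = 0 then v' = answer m \<Phi> f g m (\<Phi> (prefix_list f m)) else
      answer m \<Phi> f' g' m (\<Phi> (prefix_list f' m)) = answer m \<Phi> f g m (\<Phi> (prefix_list f m)) \<and>
      num f' m = Suc (num f m))"
proof -
  define u where "u = \<Phi> (prefix_list f m)"
  have 1: "runs (While0 2 Skip) (St x m f g i j v) (4 * m + 1) (St x m f g 0 j v)"
    by (rule runs_rewind[where c = "bits_tape m f"]) (use ij in auto)
  have 2: "runs (While0 3 Skip) (St x m f g 0 j v) (4 * m + 1) (St x m f g 0 0 v)"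
    by (rule runs_rewind[where c = "acc_tape g"]) (use ij in auto)
  have "\<forall>n. env1 (length x) n \<le> length x" by (auto simp: env1_def split: nat.splits)
  from q[rule_format, OF env_ok_St arrays_ok_St _ this[rule_format]]
  have 3: "runs (evalF 1 \<phi>) (St x m f g 0 0 v) (poly q (length x)) (St x m f g 0 0 u)"
    unfolding u_def \<Phi>_def by (metis St_simps(3,4))
  \<comment> \<open>Here \<open>l\<close> is the distance to the blank in cell
    \<open>Suc m\<close>.\<close>
  have "runs (Loop 2 (\<lambda>s. s \<noteq> 0) (Seq (Move 2 Right) (Move 3 Right)))
      (St x m f g (Suc m - l) (Suc m - l) u) (4 * l + 1) (St x m f g (Suc m) (Suc m) u)" if "l \<le> Suc m" for l
    using that
  proof (induction l)
    case 0
    have "runs (Loop 2 (\<lambda>s. s \<noteq> 0) (Seq (Move 2 Right) (Move 3 Right)))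
        (St x m f g (Suc m) (Suc m) u) 1 (St x m f g (Suc m) (Suc m) u)"
      by (rule runs_LoopF) (auto simp: read_tape_def bits_tape_def)
    then show ?case by simp
  next
    case (Suc l)
    have "runs (Seq (Move 2 Right) (Move 3 Right)) (St x m f g (Suc m - Suc l) (Suc m - Suc l) u) 2
        (St x m f g (Suc m - l) (Suc m - l) u)"
      using Suc.prems
      by (intro runs_Seq[OF runs_Move[OF refl order_refl] runs_Move[OF _ order_refl]])
        (auto simp: Suc_diff_le)
    then show ?case
    proof (rule runs_LoopT[rotated])
      show "scan (St x m f g (Suc m - Suc l) (Suc m - Suc l) u) 2 \<noteq> 0"
        by (simp add: read_tape_def bits_tape_def)
      show "runs (Loop 2 (\<lambda>s. s \<noteq> 0) (Seq (Move 2 Right) (Move 3 Right)))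
          (St x m f g (Suc m - l) (Suc m - l) u) (4 * l + 1) (St x m f g (Suc m) (Suc m) u)"
        using Suc by simp
    qed simp
  qed
  from this[of "Suc m"]
  have 4: "runs (Loop 2 (\<lambda>s. s \<noteq> 0) (Seq (Move 2 Right) (Move 3 Right)))
      (St x m f g 0 0 u) (4 * Suc m + 1) (St x m f g (Suc m) (Suc m) u)"
    by simp
  have 5: "runs (Seq (Move 2 Left) (Move 3 Left)) (St x m f g (Suc m) (Suc m) u) 2 (St x m f g m m u)"
    by (intro runs_Seq[OF runs_Move[OF refl order_refl] runs_Move[OF _ order_refl]]) auto
  obtain i' f1 v' where 6: "runs up_prog (St x m f g m m u) (7 * m + 1) (St x m f1 g i' i' v')"
    and i': "i' \<le> m" "i' > 0 \<longrightarrow> \<not> f i'" and ans: "answer m \<Phi> f g m u = answer m \<Phi> f g i' v'"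
    and f1: "\<And>j. f1 j \<longleftrightarrow> f j \<and> (j \<le> i' \<or> m < j)" and n: "num f m + 1 = (num f i' + 1) * 2 ^ (m - i')"
    using runs_up_prog[OF order_refl, of x m f g u \<Phi>] by blast
  \<comment> \<open>The increment: the bits after \<open>i'\<close> have been cleared by the climb,
    and now bit \<open>i'\<close> is set.\<close>
  define f' where "f' = (if i' = 0 then f1 else f1(i' := True))"
  define g' where "g' = (if i' = 0 then g else g(i' := v'))"
  have 7: "runs (Cond 2 (\<lambda>s. s = 1)
      (Seq (Cond 4 (\<lambda>s. s = 1) (Act 3 (\<lambda>_. 1) Stay) (Act 3 (\<lambda>_. 0) Stay)) (Act 2 (\<lambda>_. 2) Stay)) Skip)
      (St x m f1 g i' i' v') 6 (St x m f' g' i' i' v')"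
  proof (rule runs_Cond[where T = 4])
    assume "scan (St x m f1 g i' i' v') 2 = 1"
    then have pos: "i' > 0" by (cases i') (auto simp: read_tape_def bits_tape_def)
    have a: "(acc_tape g)(i' := of_bool v') = acc_tape g'"
      using pos by (auto simp: acc_tape_def g'_def fun_eq_iff)
    have b: "(bits_tape m f1)(i' := 2) = bits_tape m f'"
      using pos i' by (auto simp: bits_tape_def f'_def fun_eq_iff)
    have "runs (Cond 4 (\<lambda>s. s = 1) (Act 3 (\<lambda>_. 1) Stay) (Act 3 (\<lambda>_. 0) Stay))
        (St x m f1 g i' i' v') 3 (St x m f1 g' i' i' v')"
    proof (rule runs_Cond[where T = 1])
      assume "scan (St x m f1 g i' i' v') 4 = 1"
      then show "runs (Act 3 (\<lambda>_. 1) Stay) (St x m f1 g i' i' v') 1 (St x m f1 g' i' i' v')"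
        using a by (intro runs_Act) (simp_all del: One_nat_def)
    next
      assume "scan (St x m f1 g i' i' v') 4 \<noteq> 1"
      then show "runs (Act 3 (\<lambda>_. 0) Stay) (St x m f1 g i' i' v') 1 (St x m f1 g' i' i' v')"
        using a by (intro runs_Act) (simp_all del: One_nat_def)
    qed simp
    moreover have "runs (Act 2 (\<lambda>_. 2) Stay) (St x m f1 g' i' i' v') 1 (St x m f' g' i' i' v')"
      using b by (intro runs_Act) simp_all
    ultimately show "runs (Seq (Cond 4 (\<lambda>s. s = 1) (Act 3 (\<lambda>_. 1) Stay) (Act 3 (\<lambda>_. 0) Stay))
        (Act 2 (\<lambda>_. 2) Stay)) (St x m f1 g i' i' v') 4 (St x m f' g' i' i' v')"
      by (rule runs_Seq) simp
  next
    assume "scan (St x m f1 g i' i' v') 2 \<noteq> 1"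
    then have "i' = 0" using i' f1[of i'] by (auto simp: read_tape_def bits_tape_def split: if_splits)
    then show "runs Skip (St x m f1 g i' i' v') 4 (St x m f' g' i' i' v')"
      by (simp add: f'_def g'_def runs_Skip)
  qed simp
  have run: "runs (game_body \<phi>) (St x m f g i j v) (poly q (length x) + 20 * m + 30) (St x m f' g' i' i' v')"
    unfolding game_body_def
    by (rule runs_Seq[OF 1 runs_Seq[OF 2 runs_Seq[OF 3 runs_Seq[OF 4 runs_Seq[OF 5 runs_Seq[OF 6 7
        order_refl] order_refl] order_refl] order_refl] order_refl]]) simp
  show ?thesis
  proof (cases "i' = 0")
    case True
    then show ?thesis using run ans u_def
      by (intro exI[of _ i'] exI[of _ f'] exI[of _ g'] exI[of _ v']) simp
  next
    case False
    then obtain l where l: "i' = Suc l" by (cases i') auto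
    have z: "\<not> f' j" if "i' < j" "j \<le> m" for j
      using that f1[of j] False by (auto simp: f'_def)
    have eq: "f' j = f j" "g' j = g j" if "0 < j" "j \<le> l" for j
      using that False l f1[of j] by (auto simp: f'_def g'_def)
    have pl: "prefix_list f' l = prefix_list f l" by (rule prefix_list_cong) (rule eq)
    have fi: "f' i'" "g' i' = v'" "\<not> f i'" using False i' by (auto simp: f'_def g'_def)
    \<comment> \<open>The new leaf goes left everywhere below the right sibling, so that sibling
      contributes its game value, while \<open>v'\<close> supplies the value of the left
      one.\<close>
    have "answer m \<Phi> f' g' m (\<Phi> (prefix_list f' m)) =
        answer m \<Phi> f' g' i' (game (m - i') \<Phi> (prefix_list f' i'))"
      by (rule answer_zeros[OF i'(1) z])
    also have "\<dots> = answer m \<Phi> f' g' l (\<not> (v' \<and> game (m - i') \<Phi> (prefix_list f l @ [True])))"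
      using fi by (simp add: l pl prefix_list_Suc)
    also have "\<dots> = answer m \<Phi> f g l (\<not> (v' \<and> game (m - i') \<Phi> (prefix_list f l @ [True])))"
      by (rule answer_cong) (use eq in auto)
    also have "\<dots> = answer m \<Phi> f g i' v'"
      using fi by (simp add: l)
    finally have A: "answer m \<Phi> f' g' m (\<Phi> (prefix_list f' m)) = answer m \<Phi> f g m u" using ans by simp
    have "num f' m = num f' i' * 2 ^ (m - i')" by (rule num_zeros[OF i'(1) z])
    also have "num f' i' = num f i' + 1"
      using fi num_cong[of l f' f] eq by (simp add: l)
    finally have "num f' m = Suc (num f m)" using n by simp
    with A run i'(1) False show ?thesis
      by (intro exI[of _ i'] exI[of _ f'] exI[of _ g'] exI[of _ v']) (simp add: u_def)
  qed
qed

lemma ev_wf_game_body: "eventually (\<lambda>K. wf_com K (game_body \<phi>)) at_top"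
  unfolding game_body_def up_prog_def set_flag_def ev_wf by (auto simp: ev_wf_evalF less_imp_diff_less)

text \<open>There may be exponentially many rounds, so the total time gives no space bound. But each
  round is polynomially short and starts with heads at most \<open>n + L\<close>, so the heads stay
  below \<open>H\<close> in every round. By \<open>m1\<close> the head of tape 2 starts away from
  the marker, on which the loop would stop.\<close>

theorem game_in_PSPACE:
  assumes "dp P" "pt m" and m1: "\<And>L. m (env1 L) \<ge> 1"
  shows "{x. game (m (env1 (length x))) (\<lambda>bs. P (arr x bs) (env1 (length x))) []} \<in> PSPACE"
proof -
  obtain \<phi> where \<phi>: "\<And>a e. fval a e \<phi> = P a e" using assms(1) unfolding dp_def by blast
  obtain t where t: "\<And>e. tval e t = m e" using assms(2) unfolding pt_def by blast
  obtain p where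
    p: "\<And>M k m d r e \<sigma>. env_ok k m e \<sigma> \<Longrightarrow> k \<le> m \<Longrightarrow> d < 5 \<or> lv k \<le> d \<and> d < lv m \<Longrightarrow>
     (\<forall>n. e n \<le> M) \<Longrightarrow> runs (addT k m d r t) \<sigma> (poly p M) (shifted d r (tval e t) \<sigma>)"
    using addT_correct[of t] by blast
  obtain q where q: "\<forall>M k a e \<sigma> b. env_ok k k e \<sigma> \<longrightarrow> arrays_ok a \<sigma> \<longrightarrow> \<sigma> 4 = flg b \<longrightarrow>
     (\<forall>n. e n \<le> M) \<longrightarrow> runs (evalF k \<phi>) \<sigma> (poly q M) (\<sigma>(4 := flg (fval a e \<phi>)))"
    using evalF_correct[of \<phi>] by blast
  define fill where "fill = While0 3 (Seq (Move 2 Right) (Act 2 (\<lambda>_. 1) Stay))"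
  define loop where "loop = Loop 2 (\<lambda>s. s \<noteq> 3) (game_body \<phi>)"
  define c where "c K = Seq (Seq (init_prog K) (Seq (addT 1 1 3 Right t) fill)) loop" for K
  have "eventually (\<lambda>K. wf_com K (addT 1 1 3 Right t) \<and> wf_com K fill \<and> wf_com K loop \<and> K \<ge> 7) at_top"
    unfolding eventually_conj_iff fill_def loop_def ev_wf
    by (auto simp: ev_wf_addT ev_wf_game_body eventually_ge_at_top)
  then obtain K where K: "wf_com K (addT 1 1 3 Right t)" "wf_com K fill" "wf_com K loop" "K \<ge> 7"
    unfolding eventually_at_top_linorder by blast
  then have wf: "wf_com K (c K)" unfolding c_def by (simp add: wf_init_prog)
  define V where "V L = tval (\<lambda>_. L) t" for L
  define T where "T L = K + 20 + 10 * L + (poly p L + (V L * 5 + 1))" for L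
  define T' where "T' L = poly q L + 20 * V L + 30" for L
  define H where "H L = T L + T' L + L + V L + 1" for L
  have "polyb H"
    unfolding H_def T_def T'_def V_def
    by (intro polyb_add polyb_mult polyb_const polyb_tval polyb_poly polyb_id)
  then obtain b :: "nat poly" where b: "\<And>L. H L \<le> poly b L" unfolding polyb_def by blast
  define I where "I x \<sigma> \<longleftrightarrow> (\<forall>j. snd (\<sigma> j) < poly b (length x))" for x :: "bool list" and \<sigma> :: store
  show ?thesis
  proof (rule PSPACE_I[OF _ wf, of I _ b])
    show "5 \<le> K" using K by simp
    show "snd (\<tau> j) < poly b (length x)" if "I x \<tau>" for x \<tau> j using that by (simp add: I_def)
    fix x :: "bool list"
    define L where "L = length x"
    define n where "n = m (env1 L)"
    define \<Phi> where "\<Phi> = (\<lambda>bs. fval (arr x bs) (env1 L) \<phi>)"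
    have nV: "n \<le> V L" unfolding n_def V_def t[symmetric] by (rule tval_le) (auto simp: env1_def split: nat.splits)
    have n1: "n \<ge> 1" using m1 by (simp add: n_def)
    have env: "env_ok 1 1 (env1 L) (ready x)"
      by (auto simp: env_ok_def ready_def L_def env1_def split: nat.splits)
    have lift: "\<exists>t. big (I x) c \<sigma> t \<tau>" if run: "runs c \<sigma> TT \<tau>" and H: "\<And>j. snd (\<sigma> j) + TT < H L" for c \<sigma> TT \<tau>
    proof -
      obtain t where t: "t \<le> TT" "big (\<lambda>_. True) c \<sigma> t \<tau>" using run unfolding runs_def by blast
      have "big (I x) c \<sigma> t \<tau>"
      proof (rule big_strengthen[OF t(2), of "\<lambda>j. snd (\<sigma> j)"])
        fix \<upsilon> :: store assume "\<forall>j. snd (\<upsilon> j) \<le> snd (\<sigma> j) + t"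
        moreover have "snd (\<sigma> j) + t < poly b L" for j
          using H[of j] t(1) b[of L] by linarith
        ultimately show "I x \<upsilon>"
          unfolding I_def L_def by (meson le_less_trans)
      qed simp
      then show ?thesis by blast
    qed
    have St_head: "snd (St x n f g i j v l) \<le> n + L" if "i \<le> n" "j \<le> n" for f g i j v l
      using that by (auto simp: St_def ready_def flg_def L_def)
    have St_I: "I x (St x n f g i j v)" if "i \<le> n" "j \<le> n" for f g i j v
      unfolding I_def L_def[symmetric]
    proof
      fix l
      show "snd (St x n f g i j v l) < poly b L"
        using St_head[OF that, of f g v l] nV b[of L] by (simp add: H_def)
    qed
    define S where "S i = (ready x)(2 := (bits_tape (n - i) (\<lambda>_. False), n - i), 3 := (ctr, i))" for i
    have "shifted 3 Right n (ready x) = S n"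
      by (auto simp: shifted_def S_def ready_def fun_eq_iff bits_tape_def ctr_def)
    then have 1: "runs (addT 1 1 3 Right t) (ready x) (poly p L) (S n)"
      using p[OF env, of 3 L Right] by (simp add: t n_def env1_def split: nat.splits)
    have 2: "runs fill (S n) (V L * 5 + 1) (S 0)"
      unfolding fill_def
    proof (rule runs_countdown[where c = ctr and B = 2])
      fix i assume i: "i < n"
      define \<sigma> where "\<sigma> = (S (Suc i))(3 := (ctr, i), 2 := (bits_tape (n - Suc i) (\<lambda>_. False), n - i))"
      have "runs (Move 2 Right) ((S (Suc i))(3 := (ctr, i))) 1 \<sigma>"
        by (rule runs_Move) (use i in \<open>auto simp: \<sigma>_def S_def fun_eq_iff\<close>)
      moreover have "runs (Act 2 (\<lambda>_. 1) Stay) \<sigma> 1 (S i)"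
        by (rule runs_Act) (use i in \<open>auto simp: \<sigma>_def S_def fun_eq_iff bits_tape_def\<close>)
      ultimately show "runs (Seq (Move 2 Right) (Act 2 (\<lambda>_. 1) Stay)) ((S (Suc i))(3 := (ctr, i))) 2 (S i)"
        by (rule runs_Seq) simp
    qed (use nV in \<open>auto simp: S_def\<close>)
    have S0: "S 0 = St x n (\<lambda>_. False) (\<lambda>_. False) n 0 False"
      by (auto simp: S_def St_def fun_eq_iff ready_def acc_tape_def ctr_def)
    have "runs (Seq (init_prog K) (Seq (addT 1 1 3 Right t) fill)) (init_store K x) (T L)
        (St x n (\<lambda>_. False) (\<lambda>_. False) n 0 False)"
      by (rule runs_Seq[OF runs_init_prog runs_Seq[OF 1 2[unfolded S0] order_refl]])
        (use K in \<open>simp_all add: T_def L_def\<close>)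
    then have init: "\<exists>t0. big (I x) (Seq (init_prog K) (Seq (addT 1 1 3 Right t) fill)) (init_store K x) t0
        (St x n (\<lambda>_. False) (\<lambda>_. False) n 0 False)"
      by (rule lift) (auto simp: init_store_def H_def)
    have main: "\<exists>t0 g' f' v'. big (I x) loop (St x n f g i j v) t0 (St x n f' g' 0 0 v') \<and>
        v' = answer n \<Phi> f g n (\<Phi> (prefix_list f n))" if "0 < i" "i \<le> n" "j \<le> n" for f g i j v
      using that
    \<comment> \<open>A round that does not finish raises \<open>num\<close>, which stays below
      \<open>2 ^ n\<close>.\<close>
    proof (induction "2 ^ n - num f n" arbitrary: f g i j v rule: less_induct)
      case less
      obtain i' f' g' v' where
        run: "runs (game_body \<phi>) (St x n f g i j v) (poly q L + 20 * n + 30) (St x n f' g' i' i' v')"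
        and i': "i' \<le> n" and r: "if i' = 0 then v' = answer n \<Phi> f g n (\<Phi> (prefix_list f n)) else
          answer n \<Phi> f' g' n (\<Phi> (prefix_list f' n)) = answer n \<Phi> f g n (\<Phi> (prefix_list f n)) \<and>
          num f' n = Suc (num f n)"
        using runs_game_body[where x = x and f = f and g = g and v = v, OF q less.prems(2,3)] unfolding L_def \<Phi>_def by blast
      have "\<exists>t. big (I x) (game_body \<phi>) (St x n f g i j v) t (St x n f' g' i' i' v')"
      proof (rule lift[OF run])
        fix l
        show "snd (St x n f g i j v l) + (poly q L + 20 * n + 30) < H L"
          using St_head[OF less.prems(2,3), of f g v l] nV by (simp add: H_def T'_def T_def)
      qed
      then obtain t1 where t1: "big (I x) (game_body \<phi>) (St x n f g i j v) t1 (St x n f' g' i' i' v')" by blast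
      have "\<exists>t g'' f'' v''. big (I x) loop (St x n f' g' i' i' v') t (St x n f'' g'' 0 0 v'') \<and>
          v'' = answer n \<Phi> f g n (\<Phi> (prefix_list f n))"
      proof (cases "i' = 0")
        case True
        have "big (I x) loop (St x n f' g' 0 0 v') 1 (St x n f' g' 0 0 v')"
          unfolding loop_def by (rule LoopF) (use St_I in \<open>auto simp: read_tape_def bits_tape_def\<close>)
        then show ?thesis using True r by auto
      next
        case False
        then have "num f' n = Suc (num f n)" using r by simp
        then have "2 ^ n - num f' n < 2 ^ n - num f n" using num_less[of f' n] by simp
        from less.hyps[OF this _ i' i', of g' v'] False r show ?thesis by auto
      qed
      then obtain t2 g'' f'' v'' where t2: "big (I x) loop (St x n f' g' i' i' v') t2 (St x n f'' g'' 0 0 v'')"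
        "v'' = answer n \<Phi> f g n (\<Phi> (prefix_list f n))" by blast
      have "big (I x) loop (St x n f g i j v) (t1 + t2 + 2) (St x n f'' g'' 0 0 v'')"
        unfolding loop_def
        by (rule LoopT[OF _ _ t1 _ t2(1)[unfolded loop_def]])
          (use less.prems St_I i' in \<open>auto simp: read_tape_def bits_tape_def\<close>)
      with t2(2) show ?case by blast
    qed
    obtain t1 where t1: "big (I x) (Seq (init_prog K) (Seq (addT 1 1 3 Right t) fill)) (init_store K x) t1
        (St x n (\<lambda>_. False) (\<lambda>_. False) n 0 False)" using init by blast
    obtain t2 g' f' v' where t2: "big (I x) loop (St x n (\<lambda>_. False) (\<lambda>_. False) n 0 False) t2 (St x n f' g' 0 0 v')"
      "v' = answer n \<Phi> (\<lambda>_. False) (\<lambda>_. False) n (\<Phi> (prefix_list (\<lambda>_. False) n))"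
      using main[of n 0 "\<lambda>_. False" "\<lambda>_. False" False] n1 by auto
    \<comment> \<open>The first leaf goes left everywhere, so depth 0 is allowed.\<close>
    have "v' = game n \<Phi> []"
      unfolding t2(2) by (subst answer_zeros[of 0]) auto
    then have "v' \<longleftrightarrow> x \<in> {x. game (m (env1 (length x))) (\<lambda>bs. P (arr x bs) (env1 (length x))) []}"
      by (simp add: n_def L_def \<Phi>_def \<phi>)
    moreover have "big (I x) (c K) (init_store K x) (t1 + t2) (St x n f' g' 0 0 v')"
      unfolding c_def by (rule Seq[OF t1 t2(1)])
    ultimately show "\<exists>t \<tau>. big (I x) (c K) (init_store K x) t \<tau> \<and> I x \<tau> \<and>
        (scan \<tau> 4 = 1 \<longleftrightarrow> x \<in> {x. game (m (env1 (length x))) (\<lambda>bs. P (arr x bs) (env1 (length x))) []})"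
      using St_I[of 0 0 f' g' v'] by (intro exI conjI) auto
  qed
qed

section \<open>Distances, encodings and reconfiguration sequences\<close>

lemma awalk_imp_relpow:
  assumes "pair_wf_digraph G" "pre_digraph.awalk (with_proj G) u p v"
  shows "(u, v) \<in> parcs G ^^ length p"
proof -
  interpret pair_wf_digraph G by fact
  show ?thesis using assms(2)
  proof (induction p arbitrary: u)
    case (Cons e p)
    then show ?case by (cases e) (auto simp: awalk_Cons_iff simp del: relpow.simps intro: relpow_Suc_I2)
  qed (simp add: awalk_Nil_iff)
qed

lemma relpow_imp_awalk:
  assumes "pair_wf_digraph G" "(u, v) \<in> parcs G ^^ k" "u \<in> pverts G"
  shows "\<exists>p. pre_digraph.awalk (with_proj G) u p v \<and> length p = k"
proof -
  interpret pair_wf_digraph G by fact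
  show ?thesis using assms(2,3)
  proof (induction k arbitrary: u)
    case 0
    then show ?case by (intro exI[of _ "[]"]) (simp add: awalk_Nil_iff)
  next
    case (Suc k)
    then obtain w where w: "(u, w) \<in> parcs G" "(w, v) \<in> parcs G ^^ k" by (meson relpow_Suc_D2)
    then obtain p where "awalk w p v" "length p = k" using Suc.IH[of w] in_arcsD2[of u w] by auto
    with w(1) show ?case by (intro exI[of _ "(u, w) # p"]) (simp add: awalk_Cons_iff)
  qed
qed

lemma graph_dist_le_iff:
  assumes "pair_wf_digraph G" "u \<in> pverts G"
  shows "graph_dist G u v \<le> ereal (real r) \<longleftrightarrow> (\<exists>k\<le>r. (u, v) \<in> parcs G ^^ k)"
proof -
  interpret pair_wf_digraph G by fact
  have cost: "awalk_cost (\<lambda>_. 1) p = real (length p)" for p :: "('a \<times> 'a) list"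
    by (induction p) (auto simp: awalk_cost_def)
  show ?thesis
  proof
    assume "graph_dist G u v \<le> ereal (real r)"
    then have "(INF p\<in>{p. awalk u p v}. ereal (awalk_cost (\<lambda>_. 1) p)) < ereal (real r + 1)"
      unfolding graph_dist_def \<mu>_def by (rule le_less_trans) simp
    then obtain p where p: "awalk u p v" "ereal (awalk_cost (\<lambda>_. 1) p) < ereal (real r + 1)"
      by (auto simp: INF_less_iff)
    then have "length p \<le> r" by (simp add: cost)
    with awalk_imp_relpow[OF assms(1) p(1)] show "\<exists>k\<le>r. (u, v) \<in> parcs G ^^ k" by blast
  next
    assume "\<exists>k\<le>r. (u, v) \<in> parcs G ^^ k"
    then obtain p where p: "awalk u p v" "length p \<le> r"
      using relpow_imp_awalk[OF assms(1) _ assms(2)] by blast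
    have "graph_dist G u v \<le> ereal (awalk_cost (\<lambda>_. 1) p)"
      unfolding graph_dist_def by (rule min_cost_le_walk_cost[OF p(1)])
    also have "\<dots> \<le> ereal (real r)" using p(2) by (simp add: cost)
    finally show "graph_dist G u v \<le> ereal (real r)" .
  qed
qed

text \<open>Position \<open>i\<close> is taken apart by bounded quantifiers because terms have no
  division.\<close>

definition encbit :: "nat \<Rightarrow> (nat \<Rightarrow> nat \<Rightarrow> bool) \<Rightarrow> (nat \<Rightarrow> bool) \<Rightarrow> (nat \<Rightarrow> bool) \<Rightarrow> nat \<Rightarrow> bool" where
  "encbit n E S T i \<longleftrightarrow> i < n \<or> (\<exists>u<n. \<exists>v<n. i = n + 1 + u * n + v \<and> E u v) \<or>
     (\<exists>v<n. i = n + 1 + n * n + v \<and> S v) \<or> (\<exists>v<n. i = n + 1 + n * n + n + v \<and> T v)"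

lemma mixed_radix_eq:
  fixes a b c d m :: nat
  assumes "b < m" "d < m"
  shows "a * m + b = c * m + d \<longleftrightarrow> a = c \<and> b = d"
proof
  assume *: "a * m + b = c * m + d"
  have "a = (a * m + b) div m" "c = (c * m + d) div m" using assms by auto
  with * show "a = c \<and> b = d" by simp
qed simp

lemma mixed_radix_less:
  fixes a b k m :: nat
  assumes "a < k" "b < m"
  shows "a * m + b < k * m"
proof -
  have "a * m + b < Suc a * m" using assms(2) by simp
  also have "\<dots> \<le> k * m" using assms(1) by (intro mult_le_mono1) simp
  finally show ?thesis .
qed

lemma mixed_radix_ex:
  fixes i k m :: nat
  assumes "i < k * m"
  shows "\<exists>a<k. \<exists>b<m. i = a * m + b"
proof -
  have "m > 0" using assms by (cases m) auto
  then have "i div m < k" "i mod m < m" "i = i div m * m + i mod m"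
    using assms by (auto simp: less_mult_imp_div_less)
  then show ?thesis by blast
qed

lemma encbit_simps:
  "i < n \<Longrightarrow> encbit n E S T i"
  "\<not> encbit n E S T n"
  "u < n \<Longrightarrow> v < n \<Longrightarrow> encbit n E S T (n + 1 + u * n + v) \<longleftrightarrow> E u v"
  "v < n \<Longrightarrow> encbit n E S T (n + 1 + n * n + v) \<longleftrightarrow> S v"
  "v < n \<Longrightarrow> encbit n E S T (n + 1 + n * n + n + v) \<longleftrightarrow> T v"
proof -
  have lt: "u * n + v < n * n" if "u < n" "v < n" for u v using mixed_radix_less[OF that] .
  have rad: "u * n + v = u' * n + v' \<longleftrightarrow> u = u' \<and> v = v'" if "v < n" "v' < n" for u v u' v'
    using mixed_radix_eq[OF that] .
  show "i < n \<Longrightarrow> encbit n E S T i" "\<not> encbit n E S T n"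
    unfolding encbit_def by auto
  show "encbit n E S T (n + 1 + u * n + v) \<longleftrightarrow> E u v" if "u < n" "v < n"
    using lt[OF that] rad that unfolding encbit_def
    by (auto simp: add.assoc)
  show "encbit n E S T (n + 1 + n * n + v) \<longleftrightarrow> S v" if "v < n"
    using that unfolding encbit_def by (auto simp: add.assoc dest: lt)
  show "encbit n E S T (n + 1 + n * n + n + v) \<longleftrightarrow> T v" if "v < n"
    using that unfolding encbit_def by (auto simp: add.assoc dest: lt)
qed

lemma enc_pos_cases:
  fixes i n :: nat
  assumes "i < n + 1 + n * n + n + n"
  obtains "i < n" | "i = n" | u v where "u < n" "v < n" "i = n + 1 + u * n + v" |
    v where "v < n" "i = n + 1 + n * n + v" | v where "v < n" "i = n + 1 + n * n + n + v"
proof -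
  consider "i < n" | "i = n" | "n + 1 \<le> i"
    by (cases i n rule: linorder_cases) auto
  then show thesis
  proof cases
    case 3
    show thesis
    proof (cases "i < n + 1 + n * n")
      case True
      then have "i - (n + 1) < n * n" using 3 by linarith
      then obtain u v where "u < n" "v < n" "i - (n + 1) = u * n + v" using mixed_radix_ex by blast
      then show thesis using 3 that(3)[of u v] by linarith
    next
      case False
      show thesis
      proof (cases "i < n + 1 + n * n + n")
        case True
        then show thesis using that(4)[of "i - (n + 1 + n * n)"] False by linarith
      next
        case False
        then show thesis using that(5)[of "i - (n + 1 + n * n + n)"] assms by linarith
      qed
    qed
  qed (use that in blast)+
qed

lemma concat_map_upt:
  "concat (map (\<lambda>u. map (f u) [0..<n]) [0..<m]) = map (\<lambda>i. f (i div n) (i mod n)) [0..<m * n]"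
proof (induction m)
  case (Suc m)
  have "map (f m) [0..<n] = map (\<lambda>i. f (i div n) (i mod n)) [m * n..<m * n + n]"
    by (rule nth_equalityI) auto
  moreover have "[0..<m * n + n] = [0..<m * n] @ [m * n..<m * n + n]"
    by (rule upt_add_eq_append) simp
  ultimately show ?case using Suc by (simp add: add.commute)
qed simp

lemma encode_instance_eq:
  assumes "pverts G = {..<n}"
  shows "encode_instance G S T =
    map (encbit n (\<lambda>u v. (u, v) \<in> parcs G) (\<lambda>v. v \<in> S) (\<lambda>v. v \<in> T)) [0..<n + 1 + n * n + n + n]"
    (is "_ = map ?b _")
proof -
  have split: "[0..<n + 1 + n * n + n + n] = [0..<n] @ [n] @ map (\<lambda>i. n + 1 + i) [0..<n * n] @
      map (\<lambda>v. n + 1 + n * n + v) [0..<n] @ map (\<lambda>v. n + 1 + n * n + n + v) [0..<n]"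
    by (rule nth_equalityI) (auto simp: nth_append nth_Cons split: nat.splits)
  have "map (\<lambda>i. ?b (n + 1 + i)) [0..<n * n] = map (\<lambda>i. (i div n, i mod n) \<in> parcs G) [0..<n * n]"
  proof (rule map_cong[OF refl])
    fix i assume "i \<in> set [0..<n * n]"
    then have "i < n * n" by simp
    then obtain u v where uv: "u < n" "v < n" "i = u * n + v" using mixed_radix_ex by blast
    then show "?b (n + 1 + i) = ((i div n, i mod n) \<in> parcs G)"
      using encbit_simps(3)[of u n v] by (simp add: add.assoc)
  qed
  moreover have "map ?b [0..<n] = replicate n True"
    by (rule nth_equalityI) (auto simp: encbit_simps(1))
  moreover have "map (\<lambda>v. ?b (n + 1 + n * n + v)) [0..<n] = map (\<lambda>v. v \<in> S) [0..<n]"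
    "map (\<lambda>v. ?b (n + 1 + n * n + n + v)) [0..<n] = map (\<lambda>v. v \<in> T) [0..<n]"
    using encbit_simps(4,5) by (auto intro!: map_cong)
  ultimately show ?thesis
    unfolding split encode_instance_def using assms
    by (simp add: concat_map_upt[of "\<lambda>u v. (u, v) \<in> parcs G"] comp_def encbit_simps(2))
qed

section \<open>Reconfiguration sequences as reachability\<close>

definition DS_move :: "nat \<Rightarrow> reconf_rule \<Rightarrow> 'a pair_pre_digraph \<Rightarrow> ('a set \<times> 'a set) set" where
  "DS_move r R G = {(D, D'). dist_dominating_set r G D \<and> dist_dominating_set r G D' \<and> reconf_move R G D D'}"

text \<open>The relation certifies only sets that take part in a move; the assumption supplies the
  start, which matters for the empty sequence.\<close>

lemma reconfigurable_iff:
  assumes "dist_dominating_set r G Ds"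
  shows "reconfigurable r R G Ds Dt \<longleftrightarrow> (Ds, Dt) \<in> (DS_move r R G)\<^sup>*"
proof
  assume "reconfigurable r R G Ds Dt"
  then obtain q D where "D 0 = Ds" "D q = Dt" "\<forall>i\<le>q. dist_dominating_set r G (D i)"
    "\<forall>i<q. reconf_move R G (D i) (D (Suc i))"
    unfolding reconfigurable_def by blast
  then have "(Ds, Dt) \<in> DS_move r R G ^^ q"
    unfolding relpow_fun_conv by (intro exI[of _ D]) (auto simp: DS_move_def)
  then show "(Ds, Dt) \<in> (DS_move r R G)\<^sup>*" by (rule relpow_imp_rtrancl)
next
  assume "(Ds, Dt) \<in> (DS_move r R G)\<^sup>*"
  then obtain q where "(Ds, Dt) \<in> DS_move r R G ^^ q" by (meson rtrancl_imp_relpow)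
  then obtain D where D: "D 0 = Ds" "D q = Dt" "\<forall>i<q. (D i, D (Suc i)) \<in> DS_move r R G"
    unfolding relpow_fun_conv by blast
  have "dist_dominating_set r G (D i)" if "i \<le> q" for i
    using that D assms by (cases i) (auto simp: DS_move_def Suc_le_eq)
  then show "reconfigurable r R G Ds Dt"
    unfolding reconfigurable_def using D by (intro exI[of _ q] exI[of _ D]) (auto simp: DS_move_def)
qed

section \<open>Membership in PSPACE\<close>

text \<open>
  Reading the moves of the game in pairs gives existential choices \<open>\<alpha>\<close> and universal choices \<open>\<beta>\<close>.
\<close>

fun eg :: "nat \<Rightarrow> nat \<Rightarrow> ((nat \<Rightarrow> bool) \<Rightarrow> (nat \<Rightarrow> bool) \<Rightarrow> bool) \<Rightarrow> (nat \<Rightarrow> bool) \<Rightarrow> (nat \<Rightarrow> bool) \<Rightarrow> bool" where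
  "eg t 0 \<Psi> \<alpha> \<beta> \<longleftrightarrow> \<Psi> \<alpha> \<beta>"
| "eg t (Suc k) \<Psi> \<alpha> \<beta> \<longleftrightarrow> (\<exists>a. \<forall>d. eg (Suc t) k \<Psi> (\<alpha>(t := a)) (\<beta>(t := d)))"

definition evens :: "bool list \<Rightarrow> nat \<Rightarrow> bool" where
  "evens bs t \<longleftrightarrow> 2 * t < length bs \<and> bs ! (2 * t)"

definition odds :: "bool list \<Rightarrow> nat \<Rightarrow> bool" where
  "odds bs t \<longleftrightarrow> 2 * t + 1 < length bs \<and> bs ! (2 * t + 1)"

text \<open>Two levels of negated conjunctions are one existential move followed by one universal
  move.\<close>

lemma game_eg:
  assumes "length bs = 2 * t"
  shows "game (2 * k) (\<lambda>bs. \<Psi> (evens bs) (odds bs)) bs \<longleftrightarrow> eg t k \<Psi> (evens bs) (odds bs)"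
  using assms
proof (induction k arbitrary: bs t)
  case (Suc k)
  have e: "evens (bs @ [a, d]) = (evens bs)(t := a)" "odds (bs @ [a, d]) = (odds bs)(t := d)" for a d
    using Suc.prems by (auto simp: evens_def odds_def fun_eq_iff nth_append)
  have "game (2 * k) (\<lambda>bs. \<Psi> (evens bs) (odds bs)) (bs @ [a, d]) \<longleftrightarrow>
      eg (Suc t) k \<Psi> ((evens bs)(t := a)) ((odds bs)(t := d))" for a d
    by (rule Suc.IH[of "bs @ [a, d]" "Suc t", unfolded e]) (simp add: Suc.prems)
  then show ?case by (auto simp: ex_bool_eq all_bool_eq)
qed simp

lemma eg_add: "eg t (k + l) \<Psi> \<alpha> \<beta> \<longleftrightarrow> eg t k (eg (t + k) l \<Psi>) \<alpha> \<beta>"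
  by (induction k arbitrary: t \<alpha> \<beta>) auto

lemma eg_False: "\<not> eg t k (\<lambda>_ _. False) \<alpha> \<beta>"
  by (induction k arbitrary: t \<alpha> \<beta>) auto

lemma eg_conj_const: "eg t k (\<lambda>\<alpha> \<beta>. b \<and> \<Psi> \<alpha> \<beta>) \<alpha> \<beta> \<longleftrightarrow> b \<and> eg t k \<Psi> \<alpha> \<beta>"
  using eg_False by (cases b) auto

lemma eg_cong:
  assumes "\<And>\<alpha>' \<beta>'. (\<forall>i<t. \<alpha>' i = \<alpha> i \<and> \<beta>' i = \<beta> i) \<Longrightarrow> \<Psi> \<alpha>' \<beta>' = \<Psi>' \<alpha>' \<beta>'"
  shows "eg t k \<Psi> \<alpha> \<beta> = eg t k \<Psi>' \<alpha> \<beta>"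
  using assms
proof (induction k arbitrary: t \<alpha> \<beta>)
  case (Suc k)
  have "eg (Suc t) k \<Psi> (\<alpha>(t := a)) (\<beta>(t := d)) = eg (Suc t) k \<Psi>' (\<alpha>(t := a)) (\<beta>(t := d))" for a d
    by (rule Suc.IH) (rule Suc.prems, simp)
  then show ?case by simp
qed simp

text \<open>Universal moves that the winning condition ignores are harmless, so a block of rounds
  collapses to the choice of one bit vector.\<close>

lemma eg_exists:
  assumes "\<And>\<alpha> \<beta> \<beta>'. (\<And>i. i < t \<or> t + k \<le> i \<Longrightarrow> \<beta> i = \<beta>' i) \<Longrightarrow> \<Psi> \<alpha> \<beta> = \<Psi> \<alpha> \<beta>'"
  shows "eg t k \<Psi> \<alpha> \<beta> \<longleftrightarrow> (\<exists>w. \<Psi> (\<lambda>i. if t \<le> i \<and> i < t + k then w i else \<alpha> i) \<beta>)"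
  using assms
proof (induction k arbitrary: t \<alpha> \<beta>)
  case (Suc k)
  have IH: "eg (Suc t) k \<Psi> (\<alpha>(t := a)) (\<beta>(t := d)) \<longleftrightarrow>
      (\<exists>w. \<Psi> (\<lambda>i. if Suc t \<le> i \<and> i < Suc t + k then w i else (\<alpha>(t := a)) i) \<beta>)" for a d
  proof -
    have "eg (Suc t) k \<Psi> (\<alpha>(t := a)) (\<beta>(t := d)) \<longleftrightarrow>
      (\<exists>w. \<Psi> (\<lambda>i. if Suc t \<le> i \<and> i < Suc t + k then w i else (\<alpha>(t := a)) i) (\<beta>(t := d)))"
    proof (rule Suc.IH)
      fix \<alpha> \<beta> \<beta>' :: "nat \<Rightarrow> bool"
      assume "\<And>i. i < Suc t \<or> Suc t + k \<le> i \<Longrightarrow> \<beta> i = \<beta>' i"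
      then show "\<Psi> \<alpha> \<beta> = \<Psi> \<alpha> \<beta>'" by (intro Suc.prems) (metis add_Suc_shift less_SucI)
    qed
    moreover have "\<Psi> \<alpha>' (\<beta>(t := d)) = \<Psi> \<alpha>' \<beta>" for \<alpha>' by (rule Suc.prems) auto
    ultimately show ?thesis by simp
  qed
  show ?case
  proof
    assume "eg t (Suc k) \<Psi> \<alpha> \<beta>"
    then obtain a w where "\<Psi> (\<lambda>i. if Suc t \<le> i \<and> i < Suc t + k then w i else (\<alpha>(t := a)) i) \<beta>"
      using IH by auto
    moreover have "(\<lambda>i. if Suc t \<le> i \<and> i < Suc t + k then w i else (\<alpha>(t := a)) i) =
        (\<lambda>i. if t \<le> i \<and> i < t + Suc k then (w(t := a)) i else \<alpha> i)"
      by (auto simp: fun_eq_iff)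
    ultimately show "\<exists>w. \<Psi> (\<lambda>i. if t \<le> i \<and> i < t + Suc k then w i else \<alpha> i) \<beta>" by metis
  next
    assume "\<exists>w. \<Psi> (\<lambda>i. if t \<le> i \<and> i < t + Suc k then w i else \<alpha> i) \<beta>"
    then obtain w where *: "\<Psi> (\<lambda>i. if t \<le> i \<and> i < t + Suc k then w i else \<alpha> i) \<beta>" by blast
    have "(\<lambda>i. if t \<le> i \<and> i < t + Suc k then w i else \<alpha> i) =
        (\<lambda>i. if Suc t \<le> i \<and> i < Suc t + k then w i else (\<alpha>(t := w t)) i)"
      by (auto simp: fun_eq_iff)
    from *[unfolded this] show "eg t (Suc k) \<Psi> \<alpha> \<beta>" unfolding eg.simps IH by blast
  qed
next
  case 0
  have "(\<lambda>i. if t \<le> i \<and> i < t + 0 then w i else \<alpha> i) = \<alpha>" for w :: "nat \<Rightarrow> bool" by auto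
  then show ?case by (simp only: eg.simps) blast
qed

text \<open>Only the universal bit of the last round counts: by then the whole vector has been
  named, so the reply may depend on it.\<close>

lemma eg_block:
  assumes "\<And>\<alpha> \<beta> \<beta>'. (\<And>i. i < t \<or> t + k \<le> i \<Longrightarrow> \<beta> i = \<beta>' i) \<Longrightarrow> \<Psi> \<alpha> \<beta> = \<Psi> \<alpha> \<beta>'"
  shows "eg t (Suc k) \<Psi> \<alpha> \<beta> \<longleftrightarrow>
    (\<exists>w. \<forall>d. \<Psi> (\<lambda>i. if t \<le> i \<and> i < t + Suc k then w i else \<alpha> i) (\<beta>(t + k := d)))"
proof -
  have "eg t (Suc k) \<Psi> \<alpha> \<beta> \<longleftrightarrow> eg t k (\<lambda>\<alpha> \<beta>. \<exists>a. \<forall>d. \<Psi> (\<alpha>(t + k := a)) (\<beta>(t + k := d))) \<alpha> \<beta>"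
  proof -
    have "eg (t + k) (Suc 0) \<Psi> = (\<lambda>\<alpha> \<beta>. \<exists>a. \<forall>d. \<Psi> (\<alpha>(t + k := a)) (\<beta>(t + k := d)))"
      by (intro ext) simp
    then show ?thesis using eg_add[of t k "Suc 0" \<Psi> \<alpha> \<beta>] by (metis Nat.add_0_right add_Suc_right)
  qed
  also have "\<dots> \<longleftrightarrow> (\<exists>w a. \<forall>d. \<Psi> ((\<lambda>i. if t \<le> i \<and> i < t + k then w i else \<alpha> i)(t + k := a)) (\<beta>(t + k := d)))"
  proof (subst eg_exists)
    fix \<alpha> \<beta> \<beta>' :: "nat \<Rightarrow> bool" assume *: "\<And>i. i < t \<or> t + k \<le> i \<Longrightarrow> \<beta> i = \<beta>' i"
    have "\<Psi> (\<alpha>(t + k := a)) (\<beta>(t + k := d)) = \<Psi> (\<alpha>(t + k := a)) (\<beta>'(t + k := d))" for a d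
      by (rule assms) (use * in auto)
    then show "(\<exists>a. \<forall>d. \<Psi> (\<alpha>(t + k := a)) (\<beta>(t + k := d))) = (\<exists>a. \<forall>d. \<Psi> (\<alpha>(t + k := a)) (\<beta>'(t + k := d)))"
      by simp
  qed simp
  also have "\<dots> \<longleftrightarrow> (\<exists>w. \<forall>d. \<Psi> (\<lambda>i. if t \<le> i \<and> i < t + Suc k then w i else \<alpha> i) (\<beta>(t + k := d)))"
  proof safe
    fix w a assume *: "\<forall>d. \<Psi> ((\<lambda>i. if t \<le> i \<and> i < t + k then w i else \<alpha> i)(t + k := a)) (\<beta>(t + k := d))"
    have "(\<lambda>i. if t \<le> i \<and> i < t + k then w i else \<alpha> i)(t + k := a) =
        (\<lambda>i. if t \<le> i \<and> i < t + Suc k then (w(t + k := a)) i else \<alpha> i)" by (auto simp: fun_eq_iff)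
    from *[unfolded this] show "\<exists>w. \<forall>d. \<Psi> (\<lambda>i. if t \<le> i \<and> i < t + Suc k then w i else \<alpha> i) (\<beta>(t + k := d))"
      by blast
  next
    fix w assume *: "\<forall>d. \<Psi> (\<lambda>i. if t \<le> i \<and> i < t + Suc k then w i else \<alpha> i) (\<beta>(t + k := d))"
    have "(\<lambda>i. if t \<le> i \<and> i < t + Suc k then w i else \<alpha> i) =
        (\<lambda>i. if t \<le> i \<and> i < t + k then w i else \<alpha> i)(t + k := w (t + k))" by (auto simp: fun_eq_iff)
    from *[unfolded this] show "\<exists>w a. \<forall>d. \<Psi> ((\<lambda>i. if t \<le> i \<and> i < t + k then w i else \<alpha> i)(t + k := a)) (\<beta>(t + k := d))"
      by blast
  qed
  finally show ?thesis .
qed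

text \<open>
  Savitch's algorithm as a quantified formula: the existential player names a midpoint and the
  universal player chooses the half that is examined next.
\<close>

fun reach :: "nat \<Rightarrow> ('a set \<Rightarrow> 'a set \<Rightarrow> bool) \<Rightarrow> 'a set \<Rightarrow> nat \<Rightarrow> 'a set \<Rightarrow> 'a set \<Rightarrow> bool" where
  "reach n E A 0 u v \<longleftrightarrow> E u v"
| "reach n E A (Suc k) u v \<longleftrightarrow> (\<exists>w\<subseteq>A. reach n E A k u w \<and> reach n E A k w v)"

text \<open>The rounds come in blocks of length \<open>B\<close>. Block 0 is kept for the colouring,
  block \<open>j + 1\<close> names midpoint \<open>j\<close> in its existential bits, and the
  universal bit of its last round, number \<open>(j + 2) * B - 1\<close>, selects the half.\<close>

locale savitch =
  fixes B n :: nat and S T :: "nat set"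
  assumes nB: "n \<le> B" and B: "B > 0"
begin

definition mid :: "(nat \<Rightarrow> bool) \<Rightarrow> nat \<Rightarrow> nat set" where
  "mid \<alpha> j = {i. i < n \<and> \<alpha> ((j + 1) * B + i)}"

definition side :: "(nat \<Rightarrow> bool) \<Rightarrow> nat \<Rightarrow> bool" where
  "side \<beta> j \<longleftrightarrow> \<beta> ((j + 2) * B - 1)"

fun ends :: "(nat \<Rightarrow> bool) \<Rightarrow> (nat \<Rightarrow> bool) \<Rightarrow> nat \<Rightarrow> nat set \<times> nat set" where
  "ends \<alpha> \<beta> 0 = (S, T)"
| "ends \<alpha> \<beta> (Suc j) = (if side \<beta> j then (mid \<alpha> j, snd (ends \<alpha> \<beta> j)) else (fst (ends \<alpha> \<beta> j), mid \<alpha> j))"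

text \<open>The recursion of \<open>ends\<close> is not a bounded formula, but this is: the left end
  is the midpoint where a right half was chosen last, and \<open>S\<close> if that never
  happened.\<close>

lemma ends_fst:
  "fst (ends \<alpha> \<beta> k) = {i. (\<exists>j<k. side \<beta> j \<and> (\<forall>j'<k. j < j' \<longrightarrow> \<not> side \<beta> j') \<and> i \<in> mid \<alpha> j) \<or>
     (\<forall>j<k. \<not> side \<beta> j) \<and> i \<in> S}"
  by (induction k) (auto simp: less_Suc_eq)

lemma ends_snd:
  "snd (ends \<alpha> \<beta> k) = {i. (\<exists>j<k. \<not> side \<beta> j \<and> (\<forall>j'<k. j < j' \<longrightarrow> side \<beta> j') \<and> i \<in> mid \<alpha> j) \<or>
     (\<forall>j<k. side \<beta> j) \<and> i \<in> T}"
  by (induction k) (auto simp: less_Suc_eq)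

lemma ends_cong:
  assumes "\<And>i. i < (k + 1) * B \<Longrightarrow> \<alpha> i = \<alpha>' i" "\<And>j. j < k \<Longrightarrow> side \<beta> j = side \<beta>' j"
  shows "ends \<alpha> \<beta> k = ends \<alpha>' \<beta>' k"
  using assms
proof (induction k)
  case (Suc k)
  have "mid \<alpha> k = mid \<alpha>' k"
  proof -
    have "(k + 1) * B + i < (Suc k + 1) * B" if "i < n" for i using that nB by simp
    then show ?thesis unfolding mid_def using Suc.prems(1) by blast
  qed
  moreover have "ends \<alpha> \<beta> k = ends \<alpha>' \<beta>' k" using Suc.prems by (intro Suc.IH) auto
  ultimately show ?case using Suc.prems(2)[of k] by simp
qed simp

text \<open>The induction goes backwards from the last block: at \<open>j = k\<close> no rounds are
  left and \<open>E\<close> is tested directly.\<close>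

lemma eg_ends:
  assumes "j \<le> k"
  shows "eg ((j + 1) * B) ((k - j) * B) (\<lambda>\<alpha> \<beta>. E (fst (ends \<alpha> \<beta> k)) (snd (ends \<alpha> \<beta> k))) \<alpha> \<beta> \<longleftrightarrow>
    reach n E {..<n} (k - j) (fst (ends \<alpha> \<beta> j)) (snd (ends \<alpha> \<beta> j))"
  using assms
proof (induction j arbitrary: \<alpha> \<beta> rule: inc_induct)
  case base
  then show ?case by simp
next
  case (step j)
  let ?\<Psi> = "\<lambda>\<alpha> \<beta>. E (fst (ends \<alpha> \<beta> k)) (snd (ends \<alpha> \<beta> k))"
  let ?R = "\<lambda>\<alpha> \<beta>. reach n E {..<n} (k - Suc j) (fst (ends \<alpha> \<beta> (Suc j))) (snd (ends \<alpha> \<beta> (Suc j)))"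
  define t where "t = (j + 1) * B"
  have kj: "k - j = Suc (k - Suc j)" using step.hyps by simp
  have tB: "t + B = (Suc j + 1) * B" by (simp add: t_def)
  have sB: "Suc (B - 1) = B" using B by simp
  have last: "t + (B - 1) = (j + 2) * B - 1" using B by (simp add: t_def)
  have "eg t ((k - j) * B) ?\<Psi> \<alpha> \<beta> \<longleftrightarrow> eg t B (eg (t + B) ((k - Suc j) * B) ?\<Psi>) \<alpha> \<beta>"
    using eg_add[of t B "(k - Suc j) * B" ?\<Psi> \<alpha> \<beta>] by (simp add: kj)
  also have "eg (t + B) ((k - Suc j) * B) ?\<Psi> = ?R"
    unfolding tB using step.IH by (intro ext) simp
  also have "eg t B ?R \<alpha> \<beta> \<longleftrightarrow> eg t (Suc (B - 1)) ?R \<alpha> \<beta>" unfolding sB ..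
  also have "\<dots> \<longleftrightarrow> (\<exists>w. \<forall>d. ?R (\<lambda>i. if t \<le> i \<and> i < t + Suc (B - 1) then w i else \<alpha> i) (\<beta>(t + (B - 1) := d)))"
  proof (rule eg_block)
    fix \<alpha> \<beta> \<beta>' :: "nat \<Rightarrow> bool" assume *: "\<And>i. i < t \<or> t + (B - 1) \<le> i \<Longrightarrow> \<beta> i = \<beta>' i"
    have "side \<beta> l = side \<beta>' l" if "l < Suc j" for l
    proof (cases "l = j")
      case True
      then show ?thesis using *[of "t + (B - 1)"] by (simp only: side_def last) simp
    next
      case False
      then have "(l + 2) * B \<le> (j + 1) * B" using that by (intro mult_le_mono1) simp
      then have "(l + 2) * B - 1 < t" using B by (simp add: t_def)
      then show ?thesis using * by (simp add: side_def)
    qed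
    then have "ends \<alpha> \<beta> (Suc j) = ends \<alpha> \<beta>' (Suc j)" by (intro ends_cong) auto
    then show "?R \<alpha> \<beta> = ?R \<alpha> \<beta>'" by simp
  qed
  also have "\<dots> \<longleftrightarrow> (\<exists>w\<subseteq>{..<n}. \<forall>d. reach n E {..<n} (k - Suc j)
      (if d then w else fst (ends \<alpha> \<beta> j)) (if d then snd (ends \<alpha> \<beta> j) else w))"
  proof -
    have e: "ends (\<lambda>i. if t \<le> i \<and> i < t + Suc (B - 1) then w i else \<alpha> i) (\<beta>(t + (B - 1) := d)) (Suc j) =
        (if d then ({i. i < n \<and> w (t + i)}, snd (ends \<alpha> \<beta> j)) else (fst (ends \<alpha> \<beta> j), {i. i < n \<and> w (t + i)}))" for w d
    proof -
      let ?\<alpha> = "\<lambda>i. if t \<le> i \<and> i < t + Suc (B - 1) then w i else \<alpha> i" and ?\<beta> = "\<beta>(t + (B - 1) := d)"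
      have "side ?\<beta> j = d" unfolding side_def last[symmetric] by simp
      moreover have "mid ?\<alpha> j = {i. i < n \<and> w (t + i)}"
        unfolding mid_def t_def[symmetric] sB using nB by auto
      moreover have "ends ?\<alpha> ?\<beta> j = ends \<alpha> \<beta> j"
      proof (rule ends_cong)
        show "?\<alpha> i = \<alpha> i" if "i < (j + 1) * B" for i using that by (simp add: t_def)
        show "side ?\<beta> l = side \<beta> l" if "l < j" for l
        proof -
          have "(l + 2) * B \<le> (j + 1) * B" using that by (intro mult_le_mono1) simp
          then have "(l + 2) * B - 1 < t + (B - 1)" using B by (simp add: t_def)
          then show ?thesis by (simp add: side_def)
        qed
      qed
      ultimately show ?thesis by (simp only: ends.simps)
    qed
    have "(\<exists>w :: nat \<Rightarrow> bool. Q {i. i < n \<and> w (t + i)}) \<longleftrightarrow> (\<exists>w\<subseteq>{..<n}. Q w)" for Q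
    proof
      assume "\<exists>w\<subseteq>{..<n}. Q w"
      then obtain w where "w \<subseteq> {..<n}" "Q w" by blast
      moreover from this have "{i. i < n \<and> (t \<le> t + i \<and> (t + i) - t \<in> w)} = w" by auto
      ultimately show "\<exists>w :: nat \<Rightarrow> bool. Q {i. i < n \<and> w (t + i)}"
        by (intro exI[of _ "\<lambda>i. t \<le> i \<and> i - t \<in> w"]) simp
    next
      assume "\<exists>w :: nat \<Rightarrow> bool. Q {i. i < n \<and> w (t + i)}"
      then obtain w where "Q {i. i < n \<and> w (t + i)}" by blast
      then show "\<exists>w\<subseteq>{..<n}. Q w" by (intro exI[of _ "{i. i < n \<and> w (t + i)}"]) auto
    qed
    from this[of "\<lambda>w. \<forall>d. reach n E {..<n} (k - Suc j)
      (if d then w else fst (ends \<alpha> \<beta> j)) (if d then snd (ends \<alpha> \<beta> j) else w)"]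
    show ?thesis unfolding e by (simp add: if_distrib cong: if_cong)
  qed
  also have "\<dots> \<longleftrightarrow> reach n E {..<n} (k - j) (fst (ends \<alpha> \<beta> j)) (snd (ends \<alpha> \<beta> j))"
    unfolding kj by (auto simp: all_bool_eq)
  finally show ?case unfolding t_def .
qed

end

text \<open>\<open>E\<close> is reflexive on valid sets, so halving covers all lengths up to
  \<open>2 ^ k\<close> and not only the power itself.\<close>

lemma reach_iff:
  assumes E: "\<And>u v. E u v \<longleftrightarrow> val u \<and> val v \<and> (u = v \<or> (u, v) \<in> R)"
    and R: "\<And>u v. (u, v) \<in> R \<Longrightarrow> val u \<and> val v" and A: "\<And>u. val u \<Longrightarrow> u \<subseteq> A"
  shows "reach n E A k u v \<longleftrightarrow> val u \<and> val v \<and> (\<exists>l\<le>2 ^ k. (u, v) \<in> R ^^ l)"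
proof (induction k arbitrary: u v)
  case 0
  have "(\<exists>l\<le>1. (u, v) \<in> R ^^ l) \<longleftrightarrow> u = v \<or> (u, v) \<in> R"
  proof
    assume "\<exists>l\<le>1. (u, v) \<in> R ^^ l"
    then obtain l :: nat where "l \<le> 1" "(u, v) \<in> R ^^ l" by blast
    then show "u = v \<or> (u, v) \<in> R" by (cases l) auto
  next
    assume "u = v \<or> (u, v) \<in> R"
    then show "\<exists>l\<le>1. (u, v) \<in> R ^^ l"
    proof
      assume "u = v" then show ?thesis by (intro exI[of _ 0]) simp
    next
      assume "(u, v) \<in> R" then show ?thesis by (intro exI[of _ 1]) simp
    qed
  qed
  then show ?case by (simp add: E)
next
  case (Suc k)
  show ?case
  proof
    assume "reach n E A (Suc k) u v"
    then obtain w l l' where "val u" "val v" "l \<le> 2 ^ k" "(u, w) \<in> R ^^ l" "l' \<le> 2 ^ k" "(w, v) \<in> R ^^ l'"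
      using Suc.IH by auto
    moreover from this have "(u, v) \<in> R ^^ (l + l')" by (auto simp: relpow_add)
    ultimately show "val u \<and> val v \<and> (\<exists>l\<le>2 ^ Suc k. (u, v) \<in> R ^^ l)"
      by (intro conjI exI[of _ "l + l'"]) auto
  next
    assume "val u \<and> val v \<and> (\<exists>l\<le>2 ^ Suc k. (u, v) \<in> R ^^ l)"
    then obtain l where v: "val u" "val v" and l: "l \<le> 2 ^ Suc k" "(u, v) \<in> R ^^ l" by blast
    \<comment> \<open>The path is cut after \<open>2 ^ k\<close> moves, or at its end if it is
      shorter.\<close>
    define a where "a = min l (2 ^ k)"
    have al: "a + (l - a) = l" "a \<le> 2 ^ k" "l - a \<le> 2 ^ k" using l(1) by (auto simp: a_def)
    have "(u, v) \<in> R ^^ a O R ^^ (l - a)" using l(2) unfolding relpow_add[symmetric] al(1) .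
    then obtain w where w: "(u, w) \<in> R ^^ a" "(w, v) \<in> R ^^ (l - a)" by blast
    have "val w"
    proof (cases a)
      case 0
      then show ?thesis using w(1) v(1) by simp
    next
      case (Suc b)
      then show ?thesis using w(1) R by auto
    qed
    with w al(2,3) v have "reach n E A k u w" "reach n E A k w v" using Suc.IH by blast+
    with A[OF \<open>val w\<close>] show "reach n E A (Suc k) u v" by auto
  qed
qed

text \<open>A reachable set is reached with at most \<open>card R\<close> moves, and there are
  \<open>2 ^ (2 * n)\<close> pairs of subsets.\<close>

lemma rtrancl_iff_bounded:
  fixes n k :: nat and R :: "(nat set \<times> nat set) set"
  assumes "R \<subseteq> Pow {..<n} \<times> Pow {..<n}" "2 * n \<le> k"
  shows "(u, v) \<in> R\<^sup>* \<longleftrightarrow> (\<exists>l\<le>2 ^ k. (u, v) \<in> R ^^ l)"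
proof -
  have fin: "finite R" using assms(1) by (rule finite_subset) simp
  have "card R \<le> card (Pow {..<n} \<times> Pow {..<n})" by (rule card_mono[OF _ assms(1)]) simp
  also have "\<dots> = 2 ^ (2 * n)" by (simp add: card_cartesian_product card_Pow power_add[symmetric] mult_2)
  also have "\<dots> \<le> 2 ^ k" using assms(2) by (intro power_increasing) auto
  finally have "card R \<le> 2 ^ k" .
  show ?thesis
  proof
    assume "(u, v) \<in> R\<^sup>*"
    then obtain l where "l \<le> card R" "(u, v) \<in> R ^^ l" unfolding rtrancl_finite_eq_relpow[OF fin] by blast
    with \<open>card R \<le> 2 ^ k\<close> show "\<exists>l\<le>2 ^ k. (u, v) \<in> R ^^ l" by (meson order_trans)
  qed (auto intro: relpow_imp_rtrancl)
qed

section \<open>Definability of the winning condition\<close>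

lemma dp2:
  assumes "dp (\<lambda>a e. Q a (e 0) (e 1))" "pt t0" "pt t1"
  shows "dp (\<lambda>a e. Q a (t0 e) (t1 e))"
  using dp_inst[OF assms(1), of "[t0, t1]"] assms(2-) by simp

lemma dp3:
  assumes "dp (\<lambda>a e. Q a (e 0) (e 1) (e 2))" "pt t0" "pt t1" "pt t2"
  shows "dp (\<lambda>a e. Q a (t0 e) (t1 e) (t2 e))"
  using dp_inst[OF assms(1), of "[t0, t1, t2]"] assms(2-) by simp

text \<open>
  In the following definitions \<open>\<xi>\<close> is the input word, read as an encoding of an instance with \<open>n\<close>
  vertices, and \<open>\<gamma>\<close> is the sequence of moves of the game.
\<close>

definition parse :: "(nat \<Rightarrow> bool) \<Rightarrow> nat \<Rightarrow> nat \<Rightarrow> bool" where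
  "parse \<xi> L n \<longleftrightarrow> L = n + 1 + n * n + n + n \<and> (\<forall>i<n. \<xi> i) \<and> \<not> \<xi> n"

definition edge :: "(nat \<Rightarrow> bool) \<Rightarrow> nat \<Rightarrow> nat \<Rightarrow> nat \<Rightarrow> bool" where
  "edge \<xi> n u v \<longleftrightarrow> \<xi> (n + 1 + u * n + v)"

definition srcv :: "(nat \<Rightarrow> bool) \<Rightarrow> nat \<Rightarrow> nat \<Rightarrow> bool" where
  "srcv \<xi> n v \<longleftrightarrow> \<xi> (n + 1 + n * n + v)"

definition tgtv :: "(nat \<Rightarrow> bool) \<Rightarrow> nat \<Rightarrow> nat \<Rightarrow> bool" where
  "tgtv \<xi> n v \<longleftrightarrow> \<xi> (n + 1 + n * n + n + v)"

definition graph_of :: "(nat \<Rightarrow> bool) \<Rightarrow> nat \<Rightarrow> nat pair_pre_digraph" where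
  "graph_of \<xi> n = \<lparr>pverts = {..<n}, parcs = {(u, v). u < n \<and> v < n \<and> edge \<xi> n u v}\<rparr>"

fun near :: "(nat \<Rightarrow> bool) \<Rightarrow> nat \<Rightarrow> nat \<Rightarrow> nat \<Rightarrow> nat \<Rightarrow> bool" where
  "near \<xi> n 0 u v \<longleftrightarrow> u = v"
| "near \<xi> n (Suc k) u v \<longleftrightarrow> (\<exists>w<n. (u = w \<or> edge \<xi> n u w) \<and> near \<xi> n k w v)"

definition simple :: "(nat \<Rightarrow> bool) \<Rightarrow> nat \<Rightarrow> bool" where
  "simple \<xi> n \<longleftrightarrow> (\<forall>u<n. \<forall>v<n. edge \<xi> n u v \<longrightarrow> edge \<xi> n v u \<and> u \<noteq> v)"

text \<open>Moves are numbered from 1, so the existential move of round \<open>t\<close> is at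
  \<open>2 * t + 1\<close> and the universal one at \<open>2 * t + 2\<close>. For the last round of
  block \<open>j + 1\<close> the latter is \<open>2 * ((j + 2) * B)\<close>.\<close>

definition choice :: "(nat \<Rightarrow> bool) \<Rightarrow> nat \<Rightarrow> bool" where
  "choice \<gamma> t \<longleftrightarrow> \<gamma> (2 * t + 1)"

definition switch :: "(nat \<Rightarrow> bool) \<Rightarrow> nat \<Rightarrow> nat \<Rightarrow> bool" where
  "switch \<gamma> B j \<longleftrightarrow> \<gamma> (2 * ((j + 2) * B))"

definition coloured :: "(nat \<Rightarrow> bool) \<Rightarrow> (nat \<Rightarrow> bool) \<Rightarrow> nat \<Rightarrow> bool" where
  "coloured \<xi> \<gamma> n \<longleftrightarrow> (\<forall>u<n. \<forall>v<n. edge \<xi> n u v \<longrightarrow> (choice \<gamma> u \<longleftrightarrow> \<not> choice \<gamma> v))"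

definition left_end :: "(nat \<Rightarrow> bool) \<Rightarrow> (nat \<Rightarrow> bool) \<Rightarrow> nat \<Rightarrow> nat \<Rightarrow> nat \<Rightarrow> bool" where
  "left_end \<xi> \<gamma> B n i \<longleftrightarrow>
     (\<exists>j<B. switch \<gamma> B j \<and> (\<forall>j'<B. j < j' \<longrightarrow> \<not> switch \<gamma> B j') \<and> choice \<gamma> ((j + 1) * B + i)) \<or>
     (\<forall>j<B. \<not> switch \<gamma> B j) \<and> srcv \<xi> n i"

definition right_end :: "(nat \<Rightarrow> bool) \<Rightarrow> (nat \<Rightarrow> bool) \<Rightarrow> nat \<Rightarrow> nat \<Rightarrow> nat \<Rightarrow> bool" where
  "right_end \<xi> \<gamma> B n i \<longleftrightarrow>
     (\<exists>j<B. \<not> switch \<gamma> B j \<and> (\<forall>j'<B. j < j' \<longrightarrow> switch \<gamma> B j') \<and> choice \<gamma> ((j + 1) * B + i)) \<or>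
     (\<forall>j<B. switch \<gamma> B j) \<and> tgtv \<xi> n i"

definition dominating :: "nat \<Rightarrow> (nat \<Rightarrow> bool) \<Rightarrow> nat \<Rightarrow> (nat \<Rightarrow> bool) \<Rightarrow> bool" where
  "dominating r \<xi> n D \<longleftrightarrow> (\<forall>v<n. \<exists>u<n. D u \<and> near \<xi> n r u v)"

definition one_step :: "reconf_rule \<Rightarrow> (nat \<Rightarrow> bool) \<Rightarrow> nat \<Rightarrow> (nat \<Rightarrow> bool) \<Rightarrow> (nat \<Rightarrow> bool) \<Rightarrow> bool" where
  "one_step R \<xi> n U V \<longleftrightarrow> (\<forall>z<n. U z \<longleftrightarrow> V z) \<or>
     (\<exists>x<n. \<exists>y<n. U x \<and> \<not> V x \<and> V y \<and> \<not> U y \<and> (\<forall>z<n. z = x \<or> z = y \<or> (U z \<longleftrightarrow> V z)) \<and>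
        (R = TS \<longrightarrow> edge \<xi> n x y))"

text \<open>The block length \<open>Suc L\<close> is a term in the input length, so the layout of
  the moves does not depend on how the input parses. Conditions that no move influences are simply
  tested at every leaf.\<close>

definition leaf :: "nat \<Rightarrow> reconf_rule \<Rightarrow> (nat \<Rightarrow> bool) \<Rightarrow> (nat \<Rightarrow> bool) \<Rightarrow> nat \<Rightarrow> bool" where
  "leaf r R \<xi> \<gamma> L \<longleftrightarrow> (\<exists>n<L. parse \<xi> L n \<and> simple \<xi> n \<and> coloured \<xi> \<gamma> n \<and>
     dominating r \<xi> n (left_end \<xi> \<gamma> (Suc L) n) \<and> dominating r \<xi> n (right_end \<xi> \<gamma> (Suc L) n) \<and>
     one_step R \<xi> n (left_end \<xi> \<gamma> (Suc L) n) (right_end \<xi> \<gamma> (Suc L) n))"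

lemma dp_edge: "pt n \<Longrightarrow> pt u \<Longrightarrow> pt v \<Longrightarrow> dp (\<lambda>a e. edge (a b) (n e) (u e) (v e))"
  unfolding edge_def by (intro dp_rules pt_rules)

text \<open>The radius is a constant, so the recursion unfolds into nested quantifiers. Passing
  through \<open>dp3\<close> makes the induction hypothesis available for the newly bound
  vertex.\<close>

lemma dp_near: "pt n \<Longrightarrow> pt u \<Longrightarrow> pt v \<Longrightarrow> dp (\<lambda>a e. near (a b) (n e) k (u e) (v e))"
proof (induction k arbitrary: n u v)
  case (Suc k)
  have "dp (\<lambda>a e. near (a b) (e 0) (Suc k) (e 1) (e 2))"
    unfolding near.simps by (intro dp_rules pt_rules dp_edge Suc.IH)
  from dp3[where Q = "\<lambda>a n u v. near (a b) n (Suc k) u v", OF this Suc.prems] show ?case .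
qed (simp, intro dp_rules)

lemma dp_left_end: "pt B \<Longrightarrow> pt n \<Longrightarrow> pt i \<Longrightarrow> dp (\<lambda>a e. left_end (a False) (a True) (B e) (n e) (i e))"
proof (rule dp3[where Q = "\<lambda>a B n i. left_end (a False) (a True) B n i"])
  show "dp (\<lambda>a e. left_end (a False) (a True) (e 0) (e 1) (e 2))"
    unfolding left_end_def switch_def choice_def srcv_def by (intro dp_rules pt_rules)
qed

lemma dp_right_end: "pt B \<Longrightarrow> pt n \<Longrightarrow> pt i \<Longrightarrow> dp (\<lambda>a e. right_end (a False) (a True) (B e) (n e) (i e))"
proof (rule dp3[where Q = "\<lambda>a B n i. right_end (a False) (a True) B n i"])
  show "dp (\<lambda>a e. right_end (a False) (a True) (e 0) (e 1) (e 2))"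
    unfolding right_end_def switch_def choice_def tgtv_def by (intro dp_rules pt_rules)
qed

lemma dp_leaf: "dp (\<lambda>a e. leaf r R (a False) (a True) (e 0))"
  unfolding leaf_def parse_def simple_def coloured_def dominating_def one_step_def choice_def
  by (intro dp_rules pt_rules dp_edge dp_near dp_left_end dp_right_end)

lemma near_iff:
  "v < n \<Longrightarrow> near \<xi> n k u v \<longleftrightarrow> u = v \<and> k = 0 \<or> u < n \<and> (\<exists>l\<le>k. (u, v) \<in> parcs (graph_of \<xi> n) ^^ l)"
  if "u < n" for u
  using that
proof (induction k arbitrary: u)
  case 0
  then show ?case by auto
next
  case (Suc k)
  let ?E = "parcs (graph_of \<xi> n)"
  show ?case
  proof
    assume "near \<xi> n (Suc k) u v"
    then obtain w where w: "w < n" "u = w \<or> edge \<xi> n u w" "near \<xi> n k w v" by auto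
    then obtain l where l: "l \<le> k" "(w, v) \<in> ?E ^^ l" using Suc.IH[of w] Suc.prems by force
    have "\<exists>l\<le>Suc k. (u, v) \<in> ?E ^^ l"
    proof (cases "u = w")
      case True
      then show ?thesis using l by (intro exI[of _ l]) simp
    next
      case False
      then have "(u, w) \<in> ?E" using w Suc.prems by (simp add: graph_of_def)
      then have "(u, v) \<in> ?E ^^ Suc l" using l(2) by (rule relpow_Suc_I2)
      then show ?thesis using l(1) by blast
    qed
    then show "u = v \<and> Suc k = 0 \<or> u < n \<and> (\<exists>l\<le>Suc k. (u, v) \<in> ?E ^^ l)" using Suc.prems by simp
  next
    assume "u = v \<and> Suc k = 0 \<or> u < n \<and> (\<exists>l\<le>Suc k. (u, v) \<in> ?E ^^ l)"
    then obtain l where l: "l \<le> Suc k" "(u, v) \<in> ?E ^^ l" by auto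
    show "near \<xi> n (Suc k) u v"
    proof (cases l)
      case 0
      then have "near \<xi> n k u v" using l Suc.IH[of u] Suc.prems by fastforce
      then show ?thesis using Suc.prems by auto
    next
      case (Suc m)
      then obtain w where w: "(u, w) \<in> ?E" "(w, v) \<in> ?E ^^ m" using l(2) by (meson relpow_Suc_D2)
      then have "w < n" "edge \<xi> n u w" by (auto simp: graph_of_def)
      moreover have "near \<xi> n k w v" using Suc.IH[of w] \<open>w < n\<close> w(2) l(1) Suc Suc.prems by auto
      ultimately show ?thesis by auto
    qed
  qed
qed

lemma pair_wf_graph_of: "pair_wf_digraph (graph_of \<xi> n)"
  by unfold_locales (auto simp: graph_of_def)

lemma pair_graph_graph_of: "pair_graph (graph_of \<xi> n) \<longleftrightarrow> simple \<xi> n"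
proof
  assume "pair_graph (graph_of \<xi> n)"
  then interpret pair_graph "graph_of \<xi> n" .
  have "(v, u) \<in> parcs (graph_of \<xi> n) \<and> u \<noteq> v" if "(u, v) \<in> parcs (graph_of \<xi> n)" for u v
    using that pair_sym_arcs pair_no_loops[OF that] by (auto simp: symmetric_def dest: symD)
  then show "simple \<xi> n" by (auto simp: simple_def graph_of_def)
next
  assume s: "simple \<xi> n"
  have "finite (parcs (graph_of \<xi> n))"
    by (rule finite_subset[of _ "{..<n} \<times> {..<n}"]) (auto simp: graph_of_def)
  then show "pair_graph (graph_of \<xi> n)"
    using s by unfold_locales (auto simp: graph_of_def simple_def symmetric_def sym_def)
qed

lemma bipartite_graph_of: "bipartite (graph_of \<xi> n) \<longleftrightarrow> (\<exists>c. \<forall>u<n. \<forall>v<n. edge \<xi> n u v \<longrightarrow> (c u \<longleftrightarrow> \<not> c v))"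
proof
  assume "bipartite (graph_of \<xi> n)"
  then obtain X Y where "pverts (graph_of \<xi> n) = X \<union> Y" "X \<inter> Y = {}"
    "parcs (graph_of \<xi> n) \<subseteq> X \<times> Y \<union> Y \<times> X" unfolding bipartite_def by blast
  then have "\<forall>u<n. \<forall>v<n. edge \<xi> n u v \<longrightarrow> (u \<in> X \<longleftrightarrow> \<not> v \<in> X)"
    by (fastforce simp: graph_of_def)
  then show "\<exists>c. \<forall>u<n. \<forall>v<n. edge \<xi> n u v \<longrightarrow> (c u \<longleftrightarrow> \<not> c v)" by (rule exI[of _ "\<lambda>u. u \<in> X"])
next
  assume "\<exists>c. \<forall>u<n. \<forall>v<n. edge \<xi> n u v \<longrightarrow> (c u \<longleftrightarrow> \<not> c v)"
  then obtain c where "\<forall>u<n. \<forall>v<n. edge \<xi> n u v \<longrightarrow> (c u \<longleftrightarrow> \<not> c v)" by blast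
  then show "bipartite (graph_of \<xi> n)" unfolding bipartite_def
    by (intro exI[of _ "{u. u < n \<and> c u}"] exI[of _ "{u. u < n \<and> \<not> c u}"]) (auto simp: graph_of_def)
qed

lemma dominating_iff:
  "dominating r \<xi> n D \<longleftrightarrow> dist_dominating_set r (graph_of \<xi> n) {i. i < n \<and> D i}"
proof -
  have "near \<xi> n r u v \<longleftrightarrow> graph_dist (graph_of \<xi> n) u v \<le> ereal (real r)" if "u < n" "v < n" for u v
  proof -
    have "u \<in> pverts (graph_of \<xi> n)" using that by (simp add: graph_of_def)
    from graph_dist_le_iff[OF pair_wf_graph_of this] show ?thesis
      unfolding near_iff[OF that] using that by (auto intro: exI[of _ 0])
  qed
  moreover have "pverts (graph_of \<xi> n) = {..<n}" by (simp add: graph_of_def)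
  ultimately show ?thesis unfolding dominating_def dist_dominating_set_def by auto blast+
qed

lemma one_step_iff:
  "one_step R \<xi> n U V \<longleftrightarrow> {i. i < n \<and> U i} = {i. i < n \<and> V i} \<or>
     reconf_move R (graph_of \<xi> n) {i. i < n \<and> U i} {i. i < n \<and> V i}"
proof -
  have diff: "(\<exists>x y. {i. i < n \<and> U i} - {i. i < n \<and> V i} = {x} \<and> {i. i < n \<and> V i} - {i. i < n \<and> U i} = {y} \<and> P x y) \<longleftrightarrow>
    (\<exists>x<n. \<exists>y<n. U x \<and> \<not> V x \<and> V y \<and> \<not> U y \<and> (\<forall>z<n. z = x \<or> z = y \<or> (U z \<longleftrightarrow> V z)) \<and> P x y)" for P
  proof
    assume "\<exists>x y. {i. i < n \<and> U i} - {i. i < n \<and> V i} = {x} \<and> {i. i < n \<and> V i} - {i. i < n \<and> U i} = {y} \<and> P x y"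
    then obtain x y where xy: "{i. i < n \<and> U i} - {i. i < n \<and> V i} = {x}"
      "{i. i < n \<and> V i} - {i. i < n \<and> U i} = {y}" "P x y" by blast
    have "\<And>z. z < n \<and> U z \<and> \<not> V z \<longleftrightarrow> z = x" "\<And>z. z < n \<and> V z \<and> \<not> U z \<longleftrightarrow> z = y"
      using xy(1,2) by (auto simp: set_eq_iff)
    with xy(3) show "\<exists>x<n. \<exists>y<n. U x \<and> \<not> V x \<and> V y \<and> \<not> U y \<and> (\<forall>z<n. z = x \<or> z = y \<or> (U z \<longleftrightarrow> V z)) \<and> P x y"
      by metis
  next
    assume "\<exists>x<n. \<exists>y<n. U x \<and> \<not> V x \<and> V y \<and> \<not> U y \<and> (\<forall>z<n. z = x \<or> z = y \<or> (U z \<longleftrightarrow> V z)) \<and> P x y"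
    then obtain x y where "x < n" "y < n" "U x" "\<not> V x" "V y" "\<not> U y" "\<forall>z<n. z = x \<or> z = y \<or> (U z \<longleftrightarrow> V z)" "P x y"
      by blast
    then show "\<exists>x y. {i. i < n \<and> U i} - {i. i < n \<and> V i} = {x} \<and> {i. i < n \<and> V i} - {i. i < n \<and> U i} = {y} \<and> P x y"
      by (intro exI[of _ x] exI[of _ y] conjI set_eqI) auto
  qed
  have eq: "(\<forall>z<n. U z \<longleftrightarrow> V z) \<longleftrightarrow> {i. i < n \<and> U i} = {i. i < n \<and> V i}" by blast
  show ?thesis
    unfolding one_step_def eq
  proof (cases R)
    case TS
    have "(x, y) \<in> parcs (graph_of \<xi> n) \<longleftrightarrow> edge \<xi> n x y" if "x < n" "y < n" for x y
      using that by (simp add: graph_of_def)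
    then show "({i. i < n \<and> U i} = {i. i < n \<and> V i} \<or> (\<exists>x<n. \<exists>y<n. U x \<and> \<not> V x \<and> V y \<and> \<not> U y \<and>
        (\<forall>z<n. z = x \<or> z = y \<or> (U z \<longleftrightarrow> V z)) \<and> (R = TS \<longrightarrow> edge \<xi> n x y))) \<longleftrightarrow>
      {i. i < n \<and> U i} = {i. i < n \<and> V i} \<or> reconf_move R (graph_of \<xi> n) {i. i < n \<and> U i} {i. i < n \<and> V i}"
      unfolding TS reconf_move.simps diff[of "\<lambda>x y. (x, y) \<in> parcs (graph_of \<xi> n)"] by auto
  next
    case TJ
    then show "({i. i < n \<and> U i} = {i. i < n \<and> V i} \<or> (\<exists>x<n. \<exists>y<n. U x \<and> \<not> V x \<and> V y \<and> \<not> U y \<and>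
        (\<forall>z<n. z = x \<or> z = y \<or> (U z \<longleftrightarrow> V z)) \<and> (R = TS \<longrightarrow> edge \<xi> n x y))) \<longleftrightarrow>
      {i. i < n \<and> U i} = {i. i < n \<and> V i} \<or> reconf_move R (graph_of \<xi> n) {i. i < n \<and> U i} {i. i < n \<and> V i}"
      using diff[of "\<lambda>_ _. True"] by simp
  qed
qed

lemma DrDSR_iff:
  "x \<in> DrDSR_bipartite r R \<longleftrightarrow> (\<exists>n<length x. parse (inp x False) (length x) n \<and>
     (let \<xi> = inp x False; G = graph_of \<xi> n; S = {i. i < n \<and> srcv \<xi> n i}; T = {i. i < n \<and> tgtv \<xi> n i}
      in pair_graph G \<and> bipartite G \<and> dist_dominating_set r G S \<and> dist_dominating_set r G T \<and>
         reconfigurable r R G S T))"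
proof
  assume "x \<in> DrDSR_bipartite r R"
  then obtain G S T n where x: "x = encode_instance G S T" and G: "pair_graph G" "pverts G = {..<n}"
    "bipartite G" "dist_dominating_set r G S" "dist_dominating_set r G T" "reconfigurable r R G S T"
    unfolding DrDSR_bipartite_def by blast
  interpret pair_graph G by fact
  let ?b = "encbit n (\<lambda>u v. (u, v) \<in> parcs G) (\<lambda>v. v \<in> S) (\<lambda>v. v \<in> T)"
  have len: "length x = n + 1 + n * n + n + n" by (simp add: x encode_instance_eq[OF G(2)])
  have nth: "inp x False i \<longleftrightarrow> ?b i" if "i < n + 1 + n * n + n + n" for i
    using that len by (simp add: inp_def x encode_instance_eq[OF G(2)] del: upt_Suc)
  have lt: "u * n + v < n * n" if "u < n" "v < n" for u v using mixed_radix_less[OF that] .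
  have S: "S \<subseteq> {..<n}" "T \<subseteq> {..<n}" using G(2,4,5) by (auto simp: dist_dominating_set_def)
  have arcs: "parcs G \<subseteq> {..<n} \<times> {..<n}" using in_arcsD1 in_arcsD2 G(2) by auto
  have p: "parse (inp x False) (length x) n"
    unfolding parse_def using len nth by (auto simp: encbit_simps)
  have "edge (inp x False) n u v \<longleftrightarrow> (u, v) \<in> parcs G" if "u < n" "v < n" for u v
    using nth[of "n + 1 + u * n + v"] lt[OF that] encbit_simps(3)[OF that] by (simp add: edge_def)
  then have "parcs (graph_of (inp x False) n) = parcs G" using arcs by (auto simp: graph_of_def)
  then have g: "graph_of (inp x False) n = G" using G(2) by (simp add: graph_of_def)
  have s: "{i. i < n \<and> srcv (inp x False) n i} = S"
    using S(1) nth[of "n + 1 + n * n + i" for i] encbit_simps(4)[of _ n] by (auto simp: srcv_def)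
  have t: "{i. i < n \<and> tgtv (inp x False) n i} = T"
    using S(2) nth[of "n + 1 + n * n + n + i" for i] encbit_simps(5)[of _ n] by (auto simp: tgtv_def)
  show "\<exists>n<length x. parse (inp x False) (length x) n \<and>
     (let \<xi> = inp x False; G = graph_of \<xi> n; S = {i. i < n \<and> srcv \<xi> n i}; T = {i. i < n \<and> tgtv \<xi> n i}
      in pair_graph G \<and> bipartite G \<and> dist_dominating_set r G S \<and> dist_dominating_set r G T \<and>
         reconfigurable r R G S T)"
    using p G len by (intro exI[of _ n]) (simp add: Let_def g s t)
next
  assume "\<exists>n<length x. parse (inp x False) (length x) n \<and>
     (let \<xi> = inp x False; G = graph_of \<xi> n; S = {i. i < n \<and> srcv \<xi> n i}; T = {i. i < n \<and> tgtv \<xi> n i}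
      in pair_graph G \<and> bipartite G \<and> dist_dominating_set r G S \<and> dist_dominating_set r G T \<and>
         reconfigurable r R G S T)"
  then obtain n where p: "parse (inp x False) (length x) n" and r: "let \<xi> = inp x False; G = graph_of \<xi> n;
      S = {i. i < n \<and> srcv \<xi> n i}; T = {i. i < n \<and> tgtv \<xi> n i}
      in pair_graph G \<and> bipartite G \<and> dist_dominating_set r G S \<and> dist_dominating_set r G T \<and>
         reconfigurable r R G S T" by blast
  define G S T where "G = graph_of (inp x False) n" and "S = {i. i < n \<and> srcv (inp x False) n i}"
    and "T = {i. i < n \<and> tgtv (inp x False) n i}"
  have len: "length x = n + 1 + n * n + n + n" using p by (simp add: parse_def)
  have Gn: "pverts G = {..<n}" by (simp add: G_def graph_of_def)
  have "x = encode_instance G S T"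
    unfolding encode_instance_eq[OF Gn]
  proof (rule nth_equalityI)
    fix i assume "i < length x"
    then have i: "i < n + 1 + n * n + n + n" using len by simp
    have "x ! i \<longleftrightarrow> inp x False i" using i len by (simp add: inp_def)
    also have "\<dots> \<longleftrightarrow> encbit n (\<lambda>u v. (u, v) \<in> parcs G) (\<lambda>v. v \<in> S) (\<lambda>v. v \<in> T) i"
      using i
    proof (cases rule: enc_pos_cases)
      case 1
      then show ?thesis using p encbit_simps(1) by (simp add: parse_def)
    next
      case 2
      then show ?thesis using p encbit_simps(2)[of n] by (simp add: parse_def)
    next
      case (3 u v)
      then show ?thesis using encbit_simps(3)[of u n v] by (simp add: G_def graph_of_def edge_def)
    next
      case (4 v)
      then show ?thesis using encbit_simps(4)[of v n] by (simp add: S_def srcv_def)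
    next
      case (5 v)
      then show ?thesis using encbit_simps(5)[of v n] by (simp add: T_def tgtv_def)
    qed
    finally show "x ! i = map (encbit n (\<lambda>u v. (u, v) \<in> parcs G) (\<lambda>v. v \<in> S) (\<lambda>v. v \<in> T))
        [0..<n + 1 + n * n + n + n] ! i"
      using i by (simp del: upt_Suc)
  qed (simp add: len)
  then show "x \<in> DrDSR_bipartite r R"
    unfolding DrDSR_bipartite_def using r[unfolded Let_def, folded G_def S_def T_def] Gn by blast
qed

theorem DrDSR_in_PSPACE: "DrDSR_bipartite r R \<in> PSPACE"
proof -
  \<comment> \<open>With \<open>B = Suc L\<close>: \<open>B\<close> rounds for the colouring and
    \<open>B\<close> rounds for each of \<open>B\<close> midpoints, with two moves per
    round.\<close>
  define m where "m L = 2 * (Suc L + Suc L * Suc L)" for L :: nat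
  define P where "P = (\<lambda>(a :: bool \<Rightarrow> nat \<Rightarrow> bool) (e :: nat \<Rightarrow> nat). leaf r R (a False) (a True) (e 0))"
  have "x \<in> DrDSR_bipartite r R \<longleftrightarrow> game (m (env1 (length x) 0)) (\<lambda>bs. P (arr x bs) (env1 (length x))) []" for x
  proof -
    define L B \<xi> where "L = length x" and "B = Suc L" and "\<xi> = inp x False"
    \<comment> \<open>The array that the formula sees, interleaved from the choices of both players;
      cell 0 is the marker.\<close>
    define \<gamma> where "\<gamma> \<alpha> \<beta> i = (if i = 0 then False else if odd i then \<alpha> ((i - 1) div 2) else \<beta> ((i - 2) div 2))"
      for \<alpha> \<beta> :: "nat \<Rightarrow> bool" and i :: nat
    define \<Psi> where "\<Psi> \<alpha> \<beta> = leaf r R \<xi> (\<gamma> \<alpha> \<beta>) L" for \<alpha> \<beta>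
    have "arr x bs True = \<gamma> (evens bs) (odds bs)" for bs
    proof
      fix i
      show "arr x bs True i = \<gamma> (evens bs) (odds bs) i"
      proof (cases "odd i")
        case True
        then obtain k where "i = 2 * k + 1" by (elim oddE)
        then show ?thesis by (simp add: arr_def \<gamma>_def evens_def Suc_le_eq)
      next
        case False
        then obtain k where k: "i = 2 * k" by (auto elim: evenE)
        show ?thesis
        proof (cases k)
          case (Suc l)
          then show ?thesis using k by (simp add: arr_def \<gamma>_def odds_def Suc_le_eq)
        qed (simp add: k arr_def \<gamma>_def)
      qed
    qed
    moreover have "arr x bs False = \<xi>" for bs
      by (auto simp: fun_eq_iff arr_def \<xi>_def inp_def)
    ultimately have leafeq: "P (arr x bs) (env1 (length x)) = \<Psi> (evens bs) (odds bs)" for bs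
      by (simp add: P_def \<Psi>_def L_def)
    have "evens [] = (\<lambda>_. False)" "odds [] = (\<lambda>_. False)" by (auto simp: evens_def odds_def)
    then have "game (m (env1 (length x) 0)) (\<lambda>bs. P (arr x bs) (env1 (length x))) [] \<longleftrightarrow>
        eg 0 (B + B * B) \<Psi> (\<lambda>_. False) (\<lambda>_. False)"
      unfolding leafeq using game_eg[of "[]" 0 "B + B * B" \<Psi>] by (simp only: env1_simps m_def B_def L_def) simp
    also have "\<dots> \<longleftrightarrow> x \<in> DrDSR_bipartite r R"
    proof (cases "\<exists>n<L. parse \<xi> L n")
      case False
      then have "\<Psi> = (\<lambda>_ _. False)" by (auto simp: fun_eq_iff \<Psi>_def leaf_def)
      then have "\<not> eg 0 (B + B * B) \<Psi> (\<lambda>_. False) (\<lambda>_. False)" using eg_False by simp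
      moreover have "x \<notin> DrDSR_bipartite r R" using False unfolding DrDSR_iff L_def \<xi>_def by blast
      ultimately show ?thesis by simp
    next
      case True
      then obtain n where n: "n < L" "parse \<xi> L n" by blast
      \<comment> \<open>The separator of a smaller candidate would lie inside the unary block of a
        larger one.\<close>
      have uniq: "n' = n" if "parse \<xi> L n'" for n'
        using n(2) that unfolding parse_def by (metis linorder_neqE_nat)
      define S T G where "S = {i. i < n \<and> srcv \<xi> n i}" and "T = {i. i < n \<and> tgtv \<xi> n i}" and "G = graph_of \<xi> n"
      interpret savitch B n S T by unfold_locales (use n(1) in \<open>auto simp: B_def\<close>)
      define E where "E u v \<longleftrightarrow> dist_dominating_set r G u \<and> dist_dominating_set r G v \<and> (u = v \<or> (u, v) \<in> DS_move r R G)" for u v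
      have ch: "choice (\<gamma> \<alpha> \<beta>) t = \<alpha> t" for \<alpha> \<beta> t by (simp add: choice_def \<gamma>_def)
      have sw: "switch (\<gamma> \<alpha> \<beta>) B j = side \<beta> j" for \<alpha> \<beta> j
      proof -
        have "(2 * ((j + 2) * B) - 2) div 2 = (j + 2) * B - 1" by simp
        then show ?thesis using B by (simp only: switch_def \<gamma>_def side_def) simp
      qed
      have mem: "i \<in> S \<longleftrightarrow> i < n \<and> srcv \<xi> n i" "i \<in> T \<longleftrightarrow> i < n \<and> tgtv \<xi> n i" for i
        by (simp_all add: S_def T_def)
      have le: "{i. i < n \<and> left_end \<xi> (\<gamma> \<alpha> \<beta>) B n i} = fst (ends \<alpha> \<beta> B)" for \<alpha> \<beta>
        unfolding ends_fst left_end_def ch sw mid_def by (auto simp: mem)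
      have re: "{i. i < n \<and> right_end \<xi> (\<gamma> \<alpha> \<beta>) B n i} = snd (ends \<alpha> \<beta> B)" for \<alpha> \<beta>
        unfolding ends_snd right_end_def ch sw mid_def by (auto simp: mem)
      define col where "col \<alpha> \<longleftrightarrow> (\<forall>u<n. \<forall>v<n. edge \<xi> n u v \<longrightarrow> (\<alpha> u \<longleftrightarrow> \<not> \<alpha> v))" for \<alpha> :: "nat \<Rightarrow> bool"
      have \<Psi>: "\<Psi> \<alpha> \<beta> \<longleftrightarrow> (simple \<xi> n \<and> col \<alpha>) \<and> E (fst (ends \<alpha> \<beta> B)) (snd (ends \<alpha> \<beta> B))" for \<alpha> \<beta>
      proof -
        have "\<Psi> \<alpha> \<beta> \<longleftrightarrow> simple \<xi> n \<and> coloured \<xi> (\<gamma> \<alpha> \<beta>) n \<and> dominating r \<xi> n (left_end \<xi> (\<gamma> \<alpha> \<beta>) B n) \<and>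
            dominating r \<xi> n (right_end \<xi> (\<gamma> \<alpha> \<beta>) B n) \<and>
            one_step R \<xi> n (left_end \<xi> (\<gamma> \<alpha> \<beta>) B n) (right_end \<xi> (\<gamma> \<alpha> \<beta>) B n)"
          unfolding \<Psi>_def leaf_def B_def using n uniq by blast
        then show ?thesis
          unfolding dominating_iff one_step_iff le re coloured_def ch col_def E_def DS_move_def G_def by auto
      qed
      have "eg 0 (B + B * B) \<Psi> (\<lambda>_. False) (\<lambda>_. False) \<longleftrightarrow>
          eg 0 B (eg B (B * B) \<Psi>) (\<lambda>_. False) (\<lambda>_. False)"
        using eg_add[of 0 B "B * B" \<Psi>] by simp
      also have "\<dots> \<longleftrightarrow> eg 0 B (\<lambda>\<alpha> \<beta>. (simple \<xi> n \<and> col \<alpha>) \<and> reach n E {..<n} B S T) (\<lambda>_. False) (\<lambda>_. False)"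
      proof -
        have "eg B (B * B) \<Psi> \<alpha> \<beta> \<longleftrightarrow> (simple \<xi> n \<and> col \<alpha>) \<and> reach n E {..<n} B S T" for \<alpha> \<beta>
        proof -
          \<comment> \<open>The colouring is named in block 0, which later rounds leave
            alone.\<close>
          have colc: "col \<alpha>' = col \<alpha>" if "\<forall>i<B. \<alpha>' i = \<alpha> i \<and> \<beta>' i = \<beta> i" for \<alpha>' \<beta>'
            unfolding col_def using that nB by (metis order_less_le_trans)
          have "eg B (B * B) \<Psi> \<alpha> \<beta> \<longleftrightarrow>
              eg B (B * B) (\<lambda>\<alpha>' \<beta>'. (simple \<xi> n \<and> col \<alpha>) \<and> E (fst (ends \<alpha>' \<beta>' B)) (snd (ends \<alpha>' \<beta>' B))) \<alpha> \<beta>"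
          proof (intro eg_cong)
            fix \<alpha>' \<beta>' assume *: "\<forall>i<B. \<alpha>' i = \<alpha> i \<and> \<beta>' i = \<beta> i"
            show "\<Psi> \<alpha>' \<beta>' \<longleftrightarrow> (simple \<xi> n \<and> col \<alpha>) \<and> E (fst (ends \<alpha>' \<beta>' B)) (snd (ends \<alpha>' \<beta>' B))"
              unfolding \<Psi> colc[OF *] ..
          qed
          also have "\<dots> \<longleftrightarrow> (simple \<xi> n \<and> col \<alpha>) \<and>
              eg B (B * B) (\<lambda>\<alpha>' \<beta>'. E (fst (ends \<alpha>' \<beta>' B)) (snd (ends \<alpha>' \<beta>' B))) \<alpha> \<beta>"
            by (rule eg_conj_const)
          also have "\<dots> \<longleftrightarrow> (simple \<xi> n \<and> col \<alpha>) \<and> reach n E {..<n} B S T"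
            using eg_ends[of 0 B E \<alpha> \<beta>] by simp
          finally show ?thesis .
        qed
        then show ?thesis by (simp cong: eg_cong)
      qed
      also have "\<dots> \<longleftrightarrow> (\<exists>w. (simple \<xi> n \<and> col (\<lambda>i. if 0 \<le> i \<and> i < 0 + B then w i else False)) \<and> reach n E {..<n} B S T)"
        by (rule eg_exists) simp
      also have "\<dots> \<longleftrightarrow> simple \<xi> n \<and> (\<exists>c. col c) \<and> reach n E {..<n} B S T"
      proof -
        have "col (\<lambda>i. if 0 \<le> i \<and> i < 0 + B then w i else False) = col w" for w
          unfolding col_def using nB by (auto simp: order_less_le_trans)
        then show ?thesis by auto
      qed
      also have "reach n E {..<n} B S T \<longleftrightarrow> dist_dominating_set r G S \<and> dist_dominating_set r G T \<and>
          (S, T) \<in> (DS_move r R G)\<^sup>*"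
      proof -
        have sub: "u \<subseteq> {..<n}" if "dist_dominating_set r G u" for u
          using that by (auto simp: dist_dominating_set_def G_def graph_of_def)
        have "reach n E {..<n} B S T \<longleftrightarrow> dist_dominating_set r G S \<and> dist_dominating_set r G T \<and>
            (\<exists>l\<le>2 ^ B. (S, T) \<in> DS_move r R G ^^ l)"
          by (rule reach_iff) (use sub in \<open>auto simp: E_def DS_move_def\<close>)
        moreover have "DS_move r R G \<subseteq> Pow {..<n} \<times> Pow {..<n}" using sub by (auto simp: DS_move_def)
        \<comment> \<open>An encoding has length \<open>n + 1 + n * n + 2 * n\<close>, so
          \<open>B\<close> halvings are enough.\<close>
        moreover have "2 * n \<le> B" using n(2) by (simp add: parse_def B_def)
        ultimately show ?thesis using rtrancl_iff_bounded by blast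
      qed
      also have "simple \<xi> n \<and> (\<exists>c. col c) \<and> dist_dominating_set r G S \<and> dist_dominating_set r G T \<and>
          (S, T) \<in> (DS_move r R G)\<^sup>* \<longleftrightarrow> x \<in> DrDSR_bipartite r R"
      proof -
        have "x \<in> DrDSR_bipartite r R \<longleftrightarrow> pair_graph G \<and> bipartite G \<and> dist_dominating_set r G S \<and>
            dist_dominating_set r G T \<and> reconfigurable r R G S T"
          unfolding DrDSR_iff Let_def L_def[symmetric] \<xi>_def[symmetric] G_def S_def T_def
          using n uniq by blast
        then show ?thesis
          unfolding G_def pair_graph_graph_of bipartite_graph_of col_def
          using reconfigurable_iff[of r "graph_of \<xi> n" S R T] by blast
      qed
      finally show ?thesis .
    qed
    finally show ?thesis by simp
  qed
  then have "DrDSR_bipartite r R = {x. game ((\<lambda>e. m (e 0)) (env1 (length x))) (\<lambda>bs. P (arr x bs) (env1 (length x))) []}"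
    by auto
  also have "\<dots> \<in> PSPACE"
  proof (rule game_in_PSPACE)
    show "dp P" unfolding P_def by (rule dp_leaf)
    show "pt (\<lambda>e. m (e 0))" unfolding m_def by (intro pt_rules)
    show "1 \<le> m (env1 L 0)" for L by (simp add: m_def)
  qed
  finally show ?thesis .
qed

section \<open>Deterministic local systems as reconfiguration of CNF formulas\<close>

definition lits :: "nat set \<Rightarrow> nat \<Rightarrow> bool option" where
  "lits A x = Some (x \<in> A)"

lemma lits_simps [simp]: "lits A x = Some True \<longleftrightarrow> x \<in> A" "lits A x = Some False \<longleftrightarrow> x \<notin> A"
  by (auto simp: lits_def)

text \<open>
  A configuration assigns a value below \<open>W\<close> to each of \<open>Gn\<close> groups; \<open>F1\<close> lists the forbidden
  triples of values within a configuration and \<open>F2\<close> those between a configuration (first two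
  arguments) and its successor (third argument). Two copies of the configuration are stored in
  one-hot encoding. A copy that is not free (variable \<open>fr y\<close>) must be valid, and since no
  single flip preserves a valid one-hot encoding, it is locked. If neither copy is free, one of them
  must be the successor of the other, the direction being given by variable 2. Variable 3 switches
  all other constraints off, and may be raised only at acceptance.
\<close>

locale local_system =
  fixes Gn W :: nat
    and F1 F2 :: "nat \<times> nat \<Rightarrow> nat \<times> nat \<Rightarrow> nat \<times> nat \<Rightarrow> bool"
    and acc :: "nat \<Rightarrow> bool"
  assumes Gn: "Gn > 0" and acc_ex: "\<exists>v<W. acc v"
begin

text \<open>Groups from \<open>Gn\<close> on are fixed to 0, so that configurations which agree on
  all groups are equal as functions.\<close>

definition valid :: "(nat \<Rightarrow> nat) \<Rightarrow> bool" where
  "valid z \<longleftrightarrow> (\<forall>g<Gn. z g < W) \<and> (\<forall>g\<ge>Gn. z g = 0) \<and>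
     (\<forall>g1<Gn. \<forall>g2<Gn. \<forall>g3<Gn. \<not> F1 (g1, z g1) (g2, z g2) (g3, z g3))"

definition stp :: "((nat \<Rightarrow> nat) \<times> (nat \<Rightarrow> nat)) set" where
  "stp = {(z, w). valid z \<and> valid w \<and>
     (\<forall>g1<Gn. \<forall>g2<Gn. \<forall>g3<Gn. \<not> F2 (g1, z g1) (g2, z g2) (g3, w g3))}"

definition accepts :: "(nat \<Rightarrow> nat) \<Rightarrow> bool" where
  "accepts z \<longleftrightarrow> (\<exists>w. (z, w) \<in> stp\<^sup>* \<and> valid w \<and> acc (w 0))"

text \<open>Variables below 4 are for control: 0 and 1 are the free flags, 2 is the direction, 3 the
  override. The contents of the two copies alternate from 4 on.\<close>

definition vr :: "bool \<Rightarrow> nat \<times> nat \<Rightarrow> nat" where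
  "vr y p = 4 + (of_bool y + 2 * (fst p + Gn * snd p))"

definition fr :: "bool \<Rightarrow> nat" where
  "fr y = of_bool y"

definition nv :: nat where
  "nv = 4 + 2 * (Gn * W)"

definition rng :: "nat \<times> nat \<Rightarrow> bool" where
  "rng p \<longleftrightarrow> fst p < Gn \<and> snd p < W"

text \<open>That a group has at most one value is phrased as a forbidden triple, to share the clause
  type of \<open>F1\<close>.\<close>

definition forb :: "nat \<times> nat \<Rightarrow> nat \<times> nat \<Rightarrow> nat \<times> nat \<Rightarrow> bool" where
  "forb p q s \<longleftrightarrow> fst p = fst q \<and> snd p \<noteq> snd q \<or> F1 p q s"

text \<open>The direction literal in the third conjunct switches off one of the two possible
  successor conditions. The fourth conjunct prevents both copies from being free, so one of them
  always carries a configuration.\<close>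

definition sat :: "(nat \<Rightarrow> bool option) \<Rightarrow> bool" where
  "sat L \<longleftrightarrow>
     (\<forall>y. \<forall>g<Gn. (\<exists>v<W. L (vr y (g, v)) = Some True) \<or> L (fr y) = Some True \<or> L 3 = Some True) \<and>
     (\<forall>y p q s. rng p \<longrightarrow> rng q \<longrightarrow> rng s \<longrightarrow> forb p q s \<longrightarrow>
        L (vr y p) = Some False \<or> L (vr y q) = Some False \<or> L (vr y s) = Some False \<or> L (fr y) = Some True \<or> L 3 = Some True) \<and>
     (\<forall>y p q s. rng p \<longrightarrow> rng q \<longrightarrow> rng s \<longrightarrow> F2 p q s \<longrightarrow>
        L (vr y p) = Some False \<or> L (vr y q) = Some False \<or> L (vr (\<not> y) s) = Some False \<or>
        L 0 = Some True \<or> L 1 = Some True \<or> L 2 = Some (\<not> y) \<or> L 3 = Some True) \<and>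
     (L 0 = Some False \<or> L 1 = Some False \<or> L 3 = Some True) \<and>
     (\<forall>y. L 3 = Some False \<or> (\<exists>v<W. acc v \<and> L (vr y (0, v)) = Some True))"

lemma vr_eq: "fst p < Gn \<Longrightarrow> fst q < Gn \<Longrightarrow> vr y p = vr y' q \<longleftrightarrow> y = y' \<and> p = q"
proof -
  assume lt: "fst p < Gn" "fst q < Gn"
  have "vr y p = vr y' q \<longleftrightarrow> y = y' \<and> fst p + Gn * snd p = fst q + Gn * snd q"
    unfolding vr_def by (cases y; cases y'; simp; presburger)
  also have "fst p + Gn * snd p = fst q + Gn * snd q \<longleftrightarrow> snd p = snd q \<and> fst p = fst q"
    using mixed_radix_eq[OF lt, of "snd p" "snd q"] by (simp add: ac_simps)
  finally show ?thesis by (auto simp: prod_eq_iff)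
qed

lemma vr_ge: "4 \<le> vr y p"
  by (simp add: vr_def)

lemma vr_less: "rng p \<Longrightarrow> vr y p < nv"
proof -
  assume "rng p"
  then have "snd p * Gn + fst p < W * Gn" unfolding rng_def by (intro mixed_radix_less) auto
  then show ?thesis unfolding vr_def nv_def by (cases y) (auto simp: ac_simps)
qed

lemma vr_neq [simp]: "vr y p \<noteq> fr y'" "fr y' \<noteq> vr y p" "vr y p \<noteq> 0" "vr y p \<noteq> 1" "vr y p \<noteq> 2" "vr y p \<noteq> 3"
  "vr y p \<noteq> Suc 0"
  using vr_ge[of y p] by (auto simp: fr_def of_bool_def split: if_splits)

lemma fr_eq [simp]: "fr y = fr y' \<longleftrightarrow> y = y'" "fr y \<noteq> 2" "fr y \<noteq> 3"
  by (auto simp: fr_def of_bool_def split: if_splits)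

lemma neq_sym [simp]: "0 \<noteq> vr y p" "1 \<noteq> vr y p" "2 \<noteq> vr y p" "3 \<noteq> vr y p" "Suc 0 \<noteq> vr y p"
  "2 \<noteq> fr y" "3 \<noteq> fr y"
  by (metis vr_neq fr_eq)+

section \<open>Decoding locked copies, and the invariant of a walk\<close>

definition dec :: "(nat \<Rightarrow> bool option) \<Rightarrow> bool \<Rightarrow> nat \<Rightarrow> nat" where
  "dec L y g = (if g < Gn then THE v. v < W \<and> L (vr y (g, v)) = Some True else 0)"

text \<open>A copy counts as locked unless its free flag is definitely true. Its variables then all
  have values: one per group is true by the at-least-one clause, and each other one is made false by
  the at-most-one clause with it.\<close>

lemma locked:
  assumes "sat L" "\<not> L 3 = Some True" "\<not> L (fr y) = Some True"
  shows "g < Gn \<Longrightarrow> v < W \<Longrightarrow> L (vr y (g, v)) = Some True \<longleftrightarrow> dec L y g = v"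
    and "g < Gn \<Longrightarrow> v < W \<Longrightarrow> L (vr y (g, v)) = Some False \<longleftrightarrow> dec L y g \<noteq> v"
    and "valid (dec L y)"
proof -
  have alo: "\<exists>v<W. L (vr y (g, v)) = Some True" if "g < Gn" for g
    using assms that unfolding sat_def by blast
  have fb: "L (vr y p) = Some False \<or> L (vr y q) = Some False \<or> L (vr y s) = Some False" if "rng p" "rng q" "rng s" "forb p q s" for p q s
    using assms that unfolding sat_def by blast
  have amo: "L (vr y (g, v)) = Some False \<or> L (vr y (g, w)) = Some False" if "g < Gn" "v < W" "w < W" "v \<noteq> w" for g v w
    using fb[of "(g, v)" "(g, w)" "(g, v)"] that by (auto simp: rng_def forb_def)
  have d: "dec L y g < W \<and> L (vr y (g, dec L y g)) = Some True" if g: "g < Gn" for g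
  proof -
    obtain v where v: "v < W" "L (vr y (g, v)) = Some True" using alo[OF g] by blast
    have "w = v" if w: "w < W" "L (vr y (g, w)) = Some True" for w
    proof (rule ccontr)
      assume "w \<noteq> v"
      then have "L (vr y (g, v)) = Some False \<or> L (vr y (g, w)) = Some False" using amo[OF g v(1) w(1)] by simp
      then show False using v(2) w(2) by simp
    qed
    then have "(THE v. v < W \<and> L (vr y (g, v)) = Some True) = v" using v by (intro the_equality) blast+
    then have "dec L y g = v" using g by (simp add: dec_def)
    with v show ?thesis by simp
  qed
  show F: "g < Gn \<Longrightarrow> v < W \<Longrightarrow> L (vr y (g, v)) = Some False \<longleftrightarrow> dec L y g \<noteq> v" for g v
    using d amo by (metis option.inject)
  show "g < Gn \<Longrightarrow> v < W \<Longrightarrow> L (vr y (g, v)) = Some True \<longleftrightarrow> dec L y g = v"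
    using d F by (metis option.inject)
  have "\<not> F1 (g1, dec L y g1) (g2, dec L y g2) (g3, dec L y g3)" if "g1 < Gn" "g2 < Gn" "g3 < Gn" for g1 g2 g3
    using fb[of "(g1, dec L y g1)" "(g2, dec L y g2)" "(g3, dec L y g3)"] d[of g1] d[of g2] d[of g3] that
    by (auto simp: rng_def forb_def)
  then show "valid (dec L y)" unfolding valid_def using d by (auto simp: dec_def)
qed

lemma locked_same:
  assumes "sat L" "\<not> L 3 = Some True" "\<not> L (fr y) = Some True"
    and "sat L'" "\<not> L' 3 = Some True" "\<not> L' (fr y) = Some True"
    and eq: "\<And>x. x \<noteq> x0 \<Longrightarrow> L' x = L x"
  shows "dec L' y = dec L y"
proof
  fix g
  show "dec L' y g = dec L y g"
  proof (cases "g < Gn")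
    case True
    define v w where "v = dec L y g" and "w = dec L' y g"
    have vw: "v < W" "w < W" using locked(3)[OF assms(1-3)] locked(3)[OF assms(4-6)] True
      by (auto simp: valid_def v_def w_def)
    show ?thesis
    proof (rule ccontr)
      assume "dec L' y g \<noteq> dec L y g"
      then have "v \<noteq> w" by (simp add: v_def w_def)
      have "L (vr y (g, v)) = Some True" "\<not> L' (vr y (g, v)) = Some True" "L' (vr y (g, w)) = Some True" "\<not> L (vr y (g, w)) = Some True"
        using locked(1)[OF assms(1-3) True] locked(1)[OF assms(4-6) True] vw \<open>v \<noteq> w\<close>
        by (auto simp: v_def[symmetric] w_def[symmetric])
      then have "x0 = vr y (g, v)" "x0 = vr y (g, w)" using eq by metis+
      then show False using \<open>v \<noteq> w\<close> True vr_eq[of "(g, v)" "(g, w)" y y] by simp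
    qed
  qed (simp add: dec_def)
qed

end

locale det_local_system = local_system +
  assumes det: "(z, w) \<in> stp \<Longrightarrow> (z, w') \<in> stp \<Longrightarrow> w = w'"
    and acc_stable: "(z, w) \<in> stp \<Longrightarrow> acc (z 0) \<Longrightarrow> acc (w 0)"
begin

lemma accepts_back: "(z, w) \<in> stp \<Longrightarrow> accepts w \<Longrightarrow> accepts z"
  unfolding accepts_def by (meson converse_rtrancl_into_rtrancl)

text \<open>By determinism the accepting path from \<open>z\<close> passes through \<open>w\<close>,
  unless it is empty; then \<open>acc_stable\<close> helps.\<close>

lemma accepts_forward:
  assumes "(z, w) \<in> stp" "accepts z"
  shows "accepts w"
proof -
  obtain u where u: "(z, u) \<in> stp\<^sup>*" "valid u" "acc (u 0)" using assms(2) unfolding accepts_def by blast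
  from u(1) show ?thesis
  proof (cases rule: converse_rtranclE)
    case base
    then show ?thesis using u(3) acc_stable[OF assms(1)] assms(1) unfolding accepts_def stp_def by blast
  next
    case (step y)
    then show ?thesis using det[OF assms(1)] u(2,3) unfolding accepts_def by blast
  qed
qed

text \<open>The invariant is pulled back from the final assignment, where variable 3 is true and
  nothing is claimed.\<close>

definition Inv :: "(nat \<Rightarrow> bool option) \<Rightarrow> bool" where
  "Inv L \<longleftrightarrow> (\<not> L 3 = Some True \<longrightarrow> (\<forall>y. \<not> L (fr y) = Some True \<longrightarrow> accepts (dec L y)))"

lemma both_locked_stp:
  assumes "sat L" "\<not> L 3 = Some True" "\<not> L 0 = Some True" "\<not> L 1 = Some True" "\<not> L 2 = Some (\<not> y)"
  shows "(dec L y, dec L (\<not> y)) \<in> stp"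
proof -
  have fr: "\<not> L (fr b) = Some True" for b using assms(3,4) by (cases b) (auto simp: fr_def)
  note l = locked[OF assms(1,2) fr]
  have d: "dec L b g < W" if "g < Gn" for b g using l(3)[of b] that by (auto simp: valid_def)
  have "\<not> F2 (g1, dec L y g1) (g2, dec L y g2) (g3, dec L (\<not> y) g3)" if g: "g1 < Gn" "g2 < Gn" "g3 < Gn" for g1 g2 g3
  proof
    assume F: "F2 (g1, dec L y g1) (g2, dec L y g2) (g3, dec L (\<not> y) g3)"
    have "rng (g1, dec L y g1)" "rng (g2, dec L y g2)" "rng (g3, dec L (\<not> y) g3)"
      using g d by (auto simp: rng_def)
    with F assms have "L (vr y (g1, dec L y g1)) = Some False \<or> L (vr y (g2, dec L y g2)) = Some False \<or>
        L (vr (\<not> y) (g3, dec L (\<not> y) g3)) = Some False" unfolding sat_def by blast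
    then show False using l(2) g d by blast
  qed
  then show ?thesis using l(3) unfolding stp_def by auto
qed

text \<open>A copy becomes relevant anew in two ways only. If variable 3 is lowered, the last
  conjunct of \<open>sat\<close> just before shows an accepting value in both copies. If its own
  free flag is lowered, the other copy is locked before and after and is its predecessor or
  successor. In all other cases a locked copy keeps its value.\<close>

lemma Inv_step:
  assumes L: "sat L" and L': "sat L'"
    and eq: "\<And>x. x \<noteq> x0 \<Longrightarrow> L' x = L x" and inv: "Inv L"
  shows "Inv L'"
  unfolding Inv_def
proof (intro impI allI)
  fix y assume e': "\<not> L' 3 = Some True" and fr': "\<not> L' (fr y) = Some True"
  note l' = locked[OF L' e' fr']
  show "accepts (dec L' y)"
  proof (cases "L 3 = Some True")
    case True
    then have x0: "x0 = 3" using eq[of 3] e' by metis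
    have "\<not> L 3 = Some False" using True by simp
    then obtain v where v: "v < W" "acc v" "L (vr y (0, v)) = Some True" using L unfolding sat_def by blast
    then have "L' (vr y (0, v)) = Some True" using eq[of "vr y (0, v)"] x0 by simp
    then have "dec L' y 0 = v" using l'(1)[OF Gn v(1)] by simp
    then show ?thesis using v(2) l'(3) unfolding accepts_def by blast
  next
    case e: False
    show ?thesis
    proof (cases "L (fr y) = Some True")
      case False
      then show ?thesis using inv e locked_same[OF L e False L' e' fr' eq] by (simp add: Inv_def)
    next
      case True
      then have x0: "x0 = fr y" using eq[of "fr y"] fr' by metis
      have "L 0 = Some False \<or> L 1 = Some False" using L e unfolding sat_def by blast
      then have "L (fr (\<not> y)) = Some False"
        using True by (cases y) (auto simp: fr_def)
      then have o: "\<not> L (fr (\<not> y)) = Some True" by simp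
      then have o': "\<not> L' (fr (\<not> y)) = Some True" using eq[of "fr (\<not> y)"] x0 by simp
      have a: "accepts (dec L' (\<not> y))"
        using inv e o locked_same[OF L e o L' e' o' eq] by (simp add: Inv_def)
      have z: "\<not> L' 0 = Some True" "\<not> L' 1 = Some True" using fr' o' by (cases y; simp add: fr_def)+
      \<comment> \<open>A direction without a value leaves both successor conditions active, so the
        cases are exhaustive.\<close>
      consider "\<not> L' 2 = Some (\<not> y)" | "\<not> L' 2 = Some y" by (cases "L' 2 = Some y") auto
      then show ?thesis
      proof cases
        case 1
        then show ?thesis using accepts_back[OF both_locked_stp[OF L' e' z] a] by blast
      next
        case 2
        then have "(dec L' (\<not> y), dec L' y) \<in> stp" using both_locked_stp[OF L' e' z, of "\<not> y"] by simp
        then show ?thesis using accepts_forward a by blast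
      qed
    qed
  qed
qed

definition pflip :: "((nat \<Rightarrow> bool option) \<times> (nat \<Rightarrow> bool option)) set" where
  "pflip = {(L, L'). sat L \<and> sat L' \<and> (\<exists>x0. \<forall>x. x \<noteq> x0 \<longrightarrow> L' x = L x)}"

lemma Inv_pflip: "(L, L') \<in> pflip\<^sup>* \<Longrightarrow> Inv L' \<Longrightarrow> Inv L"
proof (induction rule: converse_rtrancl_induct)
  case (step L L1)
  then obtain x0 where "sat L" "sat L1" "\<forall>x. x \<noteq> x0 \<longrightarrow> L1 x = L x"
    unfolding pflip_def by blast
  then show ?case using Inv_step[of L1 L x0] step by simp
qed

section \<open>Realising runs by flips\<close>

definition onehot :: "nat set \<Rightarrow> bool \<Rightarrow> (nat \<Rightarrow> nat) \<Rightarrow> bool" where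
  "onehot A y z \<longleftrightarrow> (\<forall>g<Gn. \<forall>v<W. vr y (g, v) \<in> A \<longleftrightarrow> z g = v)"

lemma onehot_alo: "onehot A y z \<Longrightarrow> valid z \<Longrightarrow> g < Gn \<Longrightarrow> \<exists>v<W. vr y (g, v) \<in> A"
  unfolding onehot_def valid_def by blast

lemma onehot_forb:
  assumes "onehot A y z" "valid z" "rng p" "rng q" "rng s" "forb p q s"
  shows "vr y p \<notin> A \<or> vr y q \<notin> A \<or> vr y s \<notin> A"
proof (rule ccontr)
  assume "\<not> (vr y p \<notin> A \<or> vr y q \<notin> A \<or> vr y s \<notin> A)"
  then have "z (fst p) = snd p" "z (fst q) = snd q" "z (fst s) = snd s"
    using assms(1,3-5) unfolding onehot_def rng_def by (metis prod.collapse)+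
  with assms(2-6) show False unfolding valid_def rng_def forb_def by (metis prod.collapse)
qed

lemma sat_phase:
  assumes "3 \<notin> A" "fr y \<notin> A" "fr (\<not> y) \<in> A" "onehot A y z" "valid z"
  shows "sat (lits A)"
proof -
  have f: "0 \<in> A \<or> 1 \<in> A" "0 \<notin> A \<or> 1 \<notin> A" using assms(2,3) by (cases y; auto simp: fr_def)+
  have y: "y' = y \<or> fr y' \<in> A" for y' using assms(3) by (cases y; cases y') auto
  have alo: "(\<exists>v<W. vr y' (g, v) \<in> A) \<or> fr y' \<in> A" if "g < Gn" for y' g
    using y[of y'] onehot_alo[OF assms(4,5) that] by blast
  have fb: "vr y' p \<notin> A \<or> vr y' q \<notin> A \<or> vr y' s \<notin> A \<or> fr y' \<in> A" if "rng p" "rng q" "rng s" "forb p q s" for y' p q s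
    using y[of y'] onehot_forb[OF assms(4,5) that] by blast
  show ?thesis unfolding sat_def lits_simps using alo fb f assms(1) by blast
qed

lemma sat_both:
  assumes "3 \<notin> A" "0 \<notin> A" "1 \<notin> A" "onehot A y z" "onehot A (\<not> y) w" "2 \<in> A \<longleftrightarrow> y" "(z, w) \<in> stp"
  shows "sat (lits A)"
proof -
  have v: "valid z" "valid w" using assms(7) by (auto simp: stp_def)
  have y: "y' = y \<or> y' = (\<not> y)" for y' by (cases y; cases y') auto
  have alo: "(\<exists>v<W. vr y' (g, v) \<in> A)" if "g < Gn" for y' g
    using y[of y'] onehot_alo[OF assms(4) v(1) that] onehot_alo[OF assms(5) v(2) that] by blast
  have fb: "vr y' p \<notin> A \<or> vr y' q \<notin> A \<or> vr y' s \<notin> A" if "rng p" "rng q" "rng s" "forb p q s" for y' p q s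
    using y[of y'] onehot_forb[OF assms(4) v(1) that] onehot_forb[OF assms(5) v(2) that] by blast
  have st: "vr y' p \<notin> A \<or> vr y' q \<notin> A \<or> vr (\<not> y') s \<notin> A \<or> lits A 2 = Some (\<not> y')" if r: "rng p" "rng q" "rng s" and F: "F2 p q s" for y' p q s
  proof (cases "y' = y")
    case True
    have "\<not> (vr y p \<in> A \<and> vr y q \<in> A \<and> vr (\<not> y) s \<in> A)"
    proof
      assume "vr y p \<in> A \<and> vr y q \<in> A \<and> vr (\<not> y) s \<in> A"
      then have "z (fst p) = snd p" "z (fst q) = snd q" "w (fst s) = snd s"
        using assms(4,5) r unfolding onehot_def rng_def by (metis prod.collapse)+
      then show False using assms(7) r F unfolding stp_def rng_def by (metis (no_types, lifting) case_prodD mem_Collect_eq prod.collapse)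
    qed
    then show ?thesis using True by blast
  next
    case False
    then show ?thesis using assms(6) by (auto simp: lits_def)
  qed
  show ?thesis unfolding sat_def lits_simps using alo fb st assms(1-3) by blast
qed

lemma sat_final:
  assumes "3 \<in> A" "\<And>y. \<exists>v<W. acc v \<and> vr y (0, v) \<in> A"
  shows "sat (lits A)"
  unfolding sat_def using assms by simp

definition flip :: "(nat set \<times> nat set) set" where
  "flip = {(A, A'). A \<subseteq> {..<nv} \<and> A' \<subseteq> {..<nv} \<and> sat (lits A) \<and> sat (lits A') \<and>
     (\<exists>x<nv. x \<notin> A \<and> A' = insert x A \<or> x \<notin> A' \<and> A = insert x A')}"

text \<open>If the whole interval between two assignments is satisfying, the variables in which they
  differ can be flipped in any order.\<close>

lemma flips:
  assumes "A \<subseteq> {..<nv}" "A' \<subseteq> {..<nv}" "\<And>B. A \<inter> A' \<subseteq> B \<Longrightarrow> B \<subseteq> A \<union> A' \<Longrightarrow> sat (lits B)"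
  shows "(A, A') \<in> flip\<^sup>*"
  using assms
proof (induction "card ((A - A') \<union> (A' - A))" arbitrary: A rule: less_induct)
  case less
  have fin: "finite ((A - A') \<union> (A' - A))" using finite_subset[OF less.prems(1)] finite_subset[OF less.prems(2)] by simp
  show ?case
  proof (cases "A = A'")
    case False
    then obtain x where x: "x \<in> (A - A') \<union> (A' - A)" by blast
    define B where "B = (if x \<in> A then A - {x} else insert x A)"
    have "(B - A') \<union> (A' - B) = ((A - A') \<union> (A' - A)) - {x}" using x by (auto simp: B_def)
    then have 1: "card ((B - A') \<union> (A' - B)) < card ((A - A') \<union> (A' - A))"
      using fin x by (metis card_Diff1_less)
    have xn: "x < nv" using x less.prems(1,2) by auto
    have 2: "B \<subseteq> {..<nv}" using less.prems(1) xn by (auto simp: B_def)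
    have bt: "A \<inter> A' \<subseteq> B" "B \<subseteq> A \<union> A'" "A \<inter> A' \<subseteq> B \<inter> A'" "B \<union> A' \<subseteq> A \<union> A'"
      using x by (auto simp: B_def)
    have "(B, A') \<in> flip\<^sup>*"
      by (rule less.hyps[OF 1 2 less.prems(2)]) (use bt less.prems(3) in \<open>meson order_trans\<close>)
    moreover have "(A, B) \<in> flip"
      unfolding flip_def using less.prems(1) less.prems(3)[of A] less.prems(3)[OF bt(1,2)] 2 xn
      by (auto simp: B_def insert_absorb)
    ultimately show ?thesis by (rule converse_rtrancl_into_rtrancl[rotated])
  qed simp
qed

text \<open>\<open>P\<close> tells which copies are free, \<open>d\<close> is the direction,
  \<open>e\<close> the override, and \<open>Z\<close> gives the contents of the copies.\<close>

definition asg :: "(bool \<Rightarrow> bool) \<Rightarrow> bool \<Rightarrow> bool \<Rightarrow> (bool \<Rightarrow> nat \<Rightarrow> nat \<Rightarrow> bool) \<Rightarrow> nat set" where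
  "asg P d e Z = {x. (\<exists>y. x = fr y \<and> P y) \<or> x = 2 \<and> d \<or> x = 3 \<and> e \<or>
     (\<exists>y. \<exists>g<Gn. \<exists>v<W. x = vr y (g, v) \<and> Z y g v)}"

lemma asg_simps [simp]:
  "fr y \<in> asg P d e Z \<longleftrightarrow> P y" "2 \<in> asg P d e Z \<longleftrightarrow> d" "3 \<in> asg P d e Z \<longleftrightarrow> e"
  "0 \<in> asg P d e Z \<longleftrightarrow> P False" "1 \<in> asg P d e Z \<longleftrightarrow> P True" "Suc 0 \<in> asg P d e Z \<longleftrightarrow> P True"
proof -
  have "fr False = 0" "fr True = 1" by (auto simp: fr_def)
  show *: "fr y \<in> asg P d e Z \<longleftrightarrow> P y" for y
    unfolding asg_def by simp
  show "2 \<in> asg P d e Z \<longleftrightarrow> d" "3 \<in> asg P d e Z \<longleftrightarrow> e"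
    unfolding asg_def by simp_all
  show "0 \<in> asg P d e Z \<longleftrightarrow> P False" "1 \<in> asg P d e Z \<longleftrightarrow> P True" "Suc 0 \<in> asg P d e Z \<longleftrightarrow> P True"
    using *[of False] *[of True] by (simp_all add: fr_def)
qed

lemma asg_vr [simp]: "g < Gn \<Longrightarrow> v < W \<Longrightarrow> vr y (g, v) \<in> asg P d e Z \<longleftrightarrow> Z y g v"
proof -
  assume gv: "g < Gn" "v < W"
  have e: "y = y' \<and> g = g' \<and> v = v'" if "vr y (g, v) = vr y' (g', v')" "g' < Gn" for y' g' v'
    using vr_eq[of "(g, v)" "(g', v')" y y'] gv that by simp
  show ?thesis unfolding asg_def using gv by (auto dest: e)
qed

lemma asg_subset: "asg P d e Z \<subseteq> {..<nv}"
proof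
  fix x assume "x \<in> asg P d e Z"
  then consider y where "x = fr y" | "x = 2" | "x = 3" | y g v where "x = vr y (g, v)" "g < Gn" "v < W"
    unfolding asg_def by blast
  then show "x \<in> {..<nv}"
  proof cases
    case 1
    then show ?thesis by (auto simp: nv_def fr_def of_bool_def)
  next
    case (4 y g v)
    then show ?thesis using vr_less[of "(g, v)" y] by (simp add: rng_def)
  qed (simp_all add: nv_def)
qed

definition St :: "bool \<Rightarrow> (nat \<Rightarrow> nat) \<Rightarrow> nat set" where
  "St y z = asg (\<lambda>y'. y' \<noteq> y) False False (\<lambda>y' g v. y' = y \<and> z g = v)"

text \<open>While copy \<open>y\<close> is locked on \<open>z\<close> and the other is free, the
  direction and the contents of the other are unconstrained.\<close>

lemma flips_phase:
  assumes "valid z" "\<not> e" "\<not> P y" "P (\<not> y)" "\<And>g v. Z y g v \<longleftrightarrow> z g = v" "\<And>g v. Z' y g v \<longleftrightarrow> z g = v"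
  shows "(asg P d e Z, asg P d' e Z') \<in> flip\<^sup>*"
proof (rule flips[OF asg_subset asg_subset])
  fix B assume B: "asg P d e Z \<inter> asg P d' e Z' \<subseteq> B" "B \<subseteq> asg P d e Z \<union> asg P d' e Z'"
  have m: "x \<in> asg P d e Z \<longleftrightarrow> x \<in> asg P d' e Z' \<Longrightarrow> x \<in> B \<longleftrightarrow> x \<in> asg P d e Z" for x using B by blast
  show "sat (lits B)"
  proof (rule sat_phase)
    show "3 \<notin> B" "fr y \<notin> B" "fr (\<not> y) \<in> B" using m[of 3] m[of "fr y"] m[of "fr (\<not> y)"] assms by auto
    show "onehot B y z" unfolding onehot_def
    proof (intro allI impI)
      fix g v assume "g < Gn" "v < W"
      then show "vr y (g, v) \<in> B \<longleftrightarrow> z g = v" using m[of "vr y (g, v)"] assms(5,6) by simp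
    qed
  qed fact
qed

lemma flip_1:
  assumes "sat (lits A)" "sat (lits A')" "A \<subseteq> {..<nv}" "A' \<subseteq> {..<nv}" "\<And>x. x \<noteq> x0 \<Longrightarrow> x \<in> A \<longleftrightarrow> x \<in> A'"
  shows "(A, A') \<in> flip\<^sup>*"
proof (rule flips[OF assms(3,4)])
  fix B assume B: "A \<inter> A' \<subseteq> B" "B \<subseteq> A \<union> A'"
  have m: "x \<in> A \<Longrightarrow> x \<in> A' \<Longrightarrow> x \<in> B" "x \<in> B \<Longrightarrow> x \<in> A \<or> x \<in> A'" for x using B by blast+
  have "B = A \<or> B = A'"
  proof (cases "x0 \<in> B \<longleftrightarrow> x0 \<in> A")
    case True
    have "x \<in> B \<longleftrightarrow> x \<in> A" for x using m[of x] assms(5)[of x] True by (cases "x = x0") auto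
    then have "B = A" by (intro set_eqI)
    then show ?thesis ..
  next
    case False
    have "x \<in> B \<longleftrightarrow> x \<in> A'" for x using m[of x] assms(5)[of x] False by (cases "x = x0") auto
    then have "B = A'" by (intro set_eqI)
    then show ?thesis ..
  qed
  then show "sat (lits B)" using assms(1,2) by auto
qed

text \<open>Write \<open>w\<close> into the free copy and set the direction, lock it, free the old
  copy, then erase that one and reset the direction. The assumption on \<open>z\<close> and
  \<open>w\<close> enters at the one moment when both copies are locked.\<close>

lemma St_step:
  assumes s: "(z, w) \<in> stp"
  shows "(St y z, St (\<not> y) w) \<in> flip\<^sup>*"
proof -
  have v: "valid z" "valid w" using s by (auto simp: stp_def)
  define Z where "Z y' g u \<longleftrightarrow> (if y' = y then z g = u else w g = u)" for y' :: bool and g u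
  have oh: "onehot (asg P d e Z) y z" "onehot (asg P d e Z) (\<not> y) w" for P d e
    unfolding onehot_def by (auto simp: Z_def)
  have 1: "(St y z, asg (\<lambda>y'. y' \<noteq> y) y False Z) \<in> flip\<^sup>*"
    unfolding St_def by (rule flips_phase[where y = y, OF v(1)]) (auto simp: Z_def)
  have s1: "sat (lits (asg (\<lambda>y'. y' \<noteq> y) y False Z))" by (rule sat_phase[OF _ _ _ oh(1) v(1)]) auto
  have s2: "sat (lits (asg (\<lambda>_. False) y False Z))" by (rule sat_both[OF _ _ _ oh _ s]) auto
  have s3: "sat (lits (asg (\<lambda>y'. y' = y) y False Z))" by (rule sat_phase[OF _ _ _ oh(2) v(2)]) auto
  have 2: "(asg (\<lambda>y'. y' \<noteq> y) y False Z, asg (\<lambda>_. False) y False Z) \<in> flip\<^sup>*"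
    by (rule flip_1[OF s1 s2 asg_subset asg_subset, of "fr (\<not> y)"]) (auto simp: asg_def)
  have 3: "(asg (\<lambda>_. False) y False Z, asg (\<lambda>y'. y' = y) y False Z) \<in> flip\<^sup>*"
    by (rule flip_1[OF s2 s3 asg_subset asg_subset, of "fr y"]) (auto simp: asg_def)
  have eq: "(\<lambda>y'. y' = y) = (\<lambda>y'. y' \<noteq> (\<not> y))" by auto
  have 4: "(asg (\<lambda>y'. y' = y) y False Z, St (\<not> y) w) \<in> flip\<^sup>*"
    unfolding St_def eq by (rule flips_phase[where y = "\<not> y", OF v(2)]) (auto simp: Z_def)
  from 1 2 3 4 show ?thesis by (meson rtrancl_trans)
qed

lemma St_steps: "(z, w) \<in> stp\<^sup>* \<Longrightarrow> \<exists>y'. (St y z, St y' w) \<in> flip\<^sup>*"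
proof (induction rule: rtrancl_induct)
  case (step w u)
  then show ?case using St_step by (meson rtrancl_trans)
qed blast

text \<open>Variable 3 requires an accepting value in both copies, so \<open>z\<close> is duplicated
  first. Once it is true, everything else may be raised; the target \<open>{..<nv}\<close> is the
  same for all runs.\<close>

lemma St_accept:
  assumes "valid z" "acc (z 0)"
  shows "(St y z, {..<nv}) \<in> flip\<^sup>*"
proof -
  define Z where "Z y' g u \<longleftrightarrow> z g = u" for y' :: bool and g u
  have "z 0 < W" using assms(1) Gn by (simp add: valid_def)
  then have ac: "\<exists>v<W. acc v \<and> vr y' (0, v) \<in> asg P d e Z" for y' P d e using assms(2) Gn by (auto simp: Z_def)
  have oh: "onehot (asg P d e Z) y z" for P d e unfolding onehot_def by (auto simp: Z_def)
  have 1: "(St y z, asg (\<lambda>y'. y' \<noteq> y) False False Z) \<in> flip\<^sup>*"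
    unfolding St_def by (rule flips_phase[where y = y, OF assms(1)]) (auto simp: Z_def)
  have s1: "sat (lits (asg (\<lambda>y'. y' \<noteq> y) False False Z))" by (rule sat_phase[OF _ _ _ oh assms(1)]) auto
  have s2: "sat (lits (asg (\<lambda>y'. y' \<noteq> y) False True Z))" by (rule sat_final[OF _ ac]) auto
  have 2: "(asg (\<lambda>y'. y' \<noteq> y) False False Z, asg (\<lambda>y'. y' \<noteq> y) False True Z) \<in> flip\<^sup>*"
    by (rule flip_1[OF s1 s2 asg_subset asg_subset, of 3]) (auto simp: asg_def)
  have 3: "(asg (\<lambda>y'. y' \<noteq> y) False True Z, {..<nv}) \<in> flip\<^sup>*"
  proof (rule flips[OF asg_subset order_refl])
    fix B assume "asg (\<lambda>y'. y' \<noteq> y) False True Z \<inter> {..<nv} \<subseteq> B"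
    then have sub: "asg (\<lambda>y'. y' \<noteq> y) False True Z \<subseteq> B" using asg_subset by blast
    show "sat (lits B)"
    proof (rule sat_final)
      show "3 \<in> B" using sub asg_simps(3)[of "\<lambda>y'. y' \<noteq> y" False True Z] by blast
      show "\<exists>v<W. acc v \<and> vr y' (0, v) \<in> B" for y' using ac[of y'] sub by blast
    qed
  qed
  from 1 2 3 show ?thesis by (meson rtrancl_trans)
qed

lemma sat_St: "valid z \<Longrightarrow> sat (lits (St y z))"
  unfolding St_def by (rule sat_phase[where y = y and z = z]) (auto simp: onehot_def)

lemma sat_full: "sat (lits {..<nv})"
proof (rule sat_final)
  show "3 \<in> {..<nv}" by (simp add: nv_def)
  show "\<exists>v<W. acc v \<and> vr y (0, v) \<in> {..<nv}" for y
    using acc_ex vr_less Gn by (auto simp: rng_def)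
qed

lemma forward: "accepts z \<Longrightarrow> (St False z, {..<nv}) \<in> flip\<^sup>*"
  unfolding accepts_def by (meson St_accept St_steps rtrancl_trans)

lemma backward:
  assumes "valid z" "(lits (St False z), lits {..<nv}) \<in> pflip\<^sup>*"
  shows "accepts z"
proof -
  have "Inv (lits {..<nv})" by (simp add: Inv_def nv_def)
  then have "Inv (lits (St False z))" using Inv_pflip[OF assms(2)] by blast
  moreover have "\<not> lits (St False z) 3 = Some True" "\<not> lits (St False z) (fr False) = Some True"
    by (simp_all add: St_def)
  ultimately have a: "accepts (dec (lits (St False z)) False)" unfolding Inv_def by blast
  have "dec (lits (St False z)) False g = z g" for g
  proof (cases "g < Gn")
    case True
    then have "z g < W" using assms(1) by (simp add: valid_def)
    then show ?thesis using True by (auto simp: dec_def St_def intro!: the_equality)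
  next
    case False
    then show ?thesis using assms(1) by (simp add: dec_def valid_def)
  qed
  then have "dec (lits (St False z)) False = z" by blast
  with a show ?thesis by simp
qed

end

section \<open>Reconfiguration of CNF formulas as reconfiguration of dominating sets\<close>

text \<open>
  Literal \<open>2 x + 1\<close> is the variable \<open>x\<close>, literal \<open>2 x\<close> its negation. The two literals of \<open>x\<close> are
  joined through \<open>Pen x 0\<close>, from which a pendant path of length \<open>r - 1\<close> hangs, and a token is
  needed around that path to dominate its end. The hub \<open>Pen nv 0\<close>, with a pendant path of length
  \<open>r\<close>, is adjacent to all literals. Every literal is the start of a path \<open>Pth\<close> for every clause,
  which reaches the clause after \<open>r\<close> steps if the literal occurs in it. The token at the hub
  dominates all inner vertices of these paths, but no clause. Numbers that do not encode a vertex
  of this construction are leaves attached to the hub.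
\<close>

datatype vtx = Opt nat | Pen nat nat | Cl nat | Pth nat nat nat | Junk nat

text \<open>\<open>no_taut\<close> matters while a token rests between the two literals of
  \<open>x\<close>: a clause that holds before and after the flip must then have a true literal
  elsewhere.\<close>

locale gadget =
  fixes r nv nc :: nat and act :: "nat \<Rightarrow> bool" and mem :: "nat \<Rightarrow> nat \<Rightarrow> bool"
  assumes r: "r \<ge> 2"
    and no_taut: "c < nc \<Longrightarrow> act c \<Longrightarrow> x < nv \<Longrightarrow> \<not> (mem c (2 * x) \<and> mem c (2 * x + 1))"
begin

fun ok :: "vtx \<Rightarrow> bool" where
  "ok (Opt l) \<longleftrightarrow> l < 2 * nv"
| "ok (Pen x i) \<longleftrightarrow> x < nv \<and> i < r \<or> x = nv \<and> i \<le> r"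
| "ok (Cl c) \<longleftrightarrow> c < nc \<and> act c"
| "ok (Pth l c j) \<longleftrightarrow> l < 2 * nv \<and> c < nc \<and> 1 \<le> j \<and> j < r"
| "ok (Junk u) \<longleftrightarrow> False"

text \<open>The residue modulo 4 gives the kind of vertex and the quotient its parameters in mixed
  radix. Only sums and products occur, so codes are terms.\<close>

fun cd :: "vtx \<Rightarrow> nat" where
  "cd (Opt l) = 4 * l"
| "cd (Pen x i) = 4 * (x * (r + 1) + i) + 1"
| "cd (Cl c) = 4 * c + 2"
| "cd (Pth l c j) = 4 * ((l * nc + c) * r + j) + 3"
| "cd (Junk u) = u"

text \<open>A generous bound on the codes. A numbering without gaps would have to be definable as
  well.\<close>

definition N :: nat where
  "N = 4 * (2 * nv * nc * r + (nv + 1) * (r + 1) + nc + 2 * nv + 1)"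

fun tag :: "vtx \<Rightarrow> nat" where
  "tag (Opt l) = 0"
| "tag (Pen x i) = 1"
| "tag (Cl c) = 2"
| "tag (Pth l c j) = 3"
| "tag (Junk u) = u mod 4"

lemma cd_tag: "cd v mod 4 = tag v"
proof -
  have "(4 * a) mod 4 = 0" "(4 * a + 1) mod 4 = 1" "(4 * a + 2) mod 4 = 2" "(4 * a + 3) mod 4 = 3" for a :: nat
    by presburger+
  then show ?thesis by (cases v) (simp_all only: cd.simps tag.simps)
qed

lemma cd_inj: "ok v \<Longrightarrow> ok w \<Longrightarrow> cd v = cd w \<Longrightarrow> v = w"
proof -
  assume v: "ok v" and w: "ok w" and eq: "cd v = cd w"
  have tag: "tag v = tag w" using eq by (metis cd_tag)
  show "v = w"
  proof (cases v)
    case (Opt l)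
    then show ?thesis using w eq tag by (cases w) auto
  next
    case (Pen x i)
    with tag w obtain x' i' where w': "w = Pen x' i'" by (cases w) auto
    have "i < r + 1" "i' < r + 1" using v w Pen w' by auto
    moreover have "x * (r + 1) + i = x' * (r + 1) + i'" using eq Pen w' by simp
    ultimately have "x = x' \<and> i = i'" using mixed_radix_eq by blast
    then show ?thesis using Pen w' by simp
  next
    case (Cl c)
    then show ?thesis using w eq tag by (cases w) auto
  next
    case (Pth l c j)
    with tag w obtain l' c' j' where w': "w = Pth l' c' j'" by (cases w) auto
    have b: "j < r" "j' < r" "c < nc" "c' < nc" using v w Pth w' by auto
    have "(l * nc + c) * r + j = (l' * nc + c') * r + j'" using eq Pth w' by simp
    then have "l * nc + c = l' * nc + c'" "j = j'" using mixed_radix_eq[OF b(1,2)] by blast+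
    then have "l = l'" "c = c'" "j = j'" using mixed_radix_eq[OF b(3,4)] by blast+
    then show ?thesis using Pth w' by simp
  qed (use v in simp)
qed

lemma cd_less: "ok v \<Longrightarrow> cd v < N"
proof (cases v)
  case (Pen x i)
  assume "ok v"
  then have "x * (r + 1) + i < (nv + 1) * (r + 1)" using Pen by (intro mixed_radix_less) auto
  then show ?thesis using Pen by (simp add: N_def)
next
  case (Pth l c j)
  assume "ok v"
  then have "(l * nc + c) * r + j < (2 * nv * nc) * r"
    using Pth by (intro mixed_radix_less) auto
  then show ?thesis using Pth by (simp add: N_def)
qed (auto simp: N_def)

definition dcd :: "nat \<Rightarrow> vtx" where
  "dcd u = (if u \<in> cd ` Collect ok then the_inv_into (Collect ok) cd u else Junk u)"

lemma dcd_cd [simp]: "ok v \<Longrightarrow> dcd (cd v) = v"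
  unfolding dcd_def using cd_inj by (auto intro!: the_inv_into_f_f inj_onI)

lemma dcd_eq: "v \<noteq> Junk u \<Longrightarrow> dcd u = v \<longleftrightarrow> ok v \<and> u = cd v"
proof
  assume "v \<noteq> Junk u" "dcd u = v"
  then have "u \<in> cd ` Collect ok" by (auto simp: dcd_def split: if_splits)
  then obtain w where "ok w" "u = cd w" by blast
  with \<open>dcd u = v\<close> show "ok v \<and> u = cd v" by simp
qed auto

lemma dcd_cases: "dcd u = Junk u \<or> ok (dcd u) \<and> cd (dcd u) = u"
  using dcd_eq[of "dcd u" u] by auto

fun adj :: "vtx \<Rightarrow> vtx \<Rightarrow> bool" where
  "adj (Opt l) (Pen x i) \<longleftrightarrow> i = 0 \<and> (x = l div 2 \<or> x = nv)"
| "adj (Opt l) (Pth l' c j) \<longleftrightarrow> l = l' \<and> j = 1"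
| "adj (Pth l c j) (Pth l' c' j') \<longleftrightarrow> l = l' \<and> c = c' \<and> j' = Suc j"
| "adj (Pth l c j) (Cl c') \<longleftrightarrow> c = c' \<and> Suc j = r \<and> mem c l"
| "adj (Pen x i) (Pen x' i') \<longleftrightarrow> x = x' \<and> i' = Suc i"
| "adj (Junk u) (Pen x i) \<longleftrightarrow> x = nv \<and> i = 0"
| "adj _ _ \<longleftrightarrow> False"

definition E :: "nat \<Rightarrow> nat \<Rightarrow> bool" where
  "E u v \<longleftrightarrow> adj (dcd u) (dcd v) \<or> adj (dcd v) (dcd u)"

definition G :: "nat pair_pre_digraph" where
  "G = \<lparr>pverts = {..<N}, parcs = {(u, v). u < N \<and> v < N \<and> E u v}\<rparr>"

lemma pverts_G: "pverts G = {..<N}"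
  by (simp add: G_def)

lemma arc_iff: "(u, v) \<in> parcs G \<longleftrightarrow> u < N \<and> v < N \<and> E u v"
  by (simp add: G_def)

lemma E_sym: "E u v \<longleftrightarrow> E v u"
  by (auto simp: E_def)

lemma arcI: "ok v \<Longrightarrow> ok w \<Longrightarrow> adj v w \<or> adj w v \<Longrightarrow> (cd v, cd w) \<in> parcs G"
  by (simp add: arc_iff cd_less E_def)

text \<open>The parity of the distance to the literals, which all lie on one side.\<close>

fun par :: "vtx \<Rightarrow> bool" where
  "par (Opt l) = True"
| "par (Pen x i) = odd i"
| "par (Pth l c j) = even j"
| "par (Cl c) = even r"
| "par (Junk u) = True"

lemma adj_par: "adj v w \<Longrightarrow> par v \<noteq> par w"
  by (induction v w rule: adj.induct) auto

lemma E_par: "E u v \<Longrightarrow> par (dcd u) \<noteq> par (dcd v)"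
  unfolding E_def using adj_par by blast

lemma pair_graph_G: "pair_graph G"
proof
  show "finite (parcs G)"
    by (rule finite_subset[of _ "{..<N} \<times> {..<N}"]) (auto simp: arc_iff)
  show "symmetric G" by (auto simp: symmetric_def sym_def arc_iff E_sym)
  show "fst e \<noteq> snd e" if "e \<in> parcs G" for e
    using that E_par by (cases e) (auto simp: arc_iff)
qed (auto simp: G_def)

lemma bipartite_G: "bipartite G"
  unfolding bipartite_def
  by (intro exI[of _ "{u. u < N \<and> par (dcd u)}"] exI[of _ "{u. u < N \<and> \<not> par (dcd u)}"])
    (use E_par in \<open>auto simp: arc_iff pverts_G\<close>)

lemma dist_le: "u < N \<Longrightarrow> graph_dist G u v \<le> ereal (real k) \<longleftrightarrow> (\<exists>j\<le>k. (u, v) \<in> parcs G ^^ j)"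
  using pair_graph_G graph_dist_le_iff[of G u v k]
  by (simp add: pair_graph_def pair_digraph_def pair_fin_digraph_def pverts_G)

text \<open>A function that changes by at most one along each edge bounds distances from below. It
  has to be checked on the clauses of \<open>adj\<close> only, which replaces all reasoning about
  walks.\<close>

lemma lipschitz:
  assumes "\<And>v w. adj v w \<Longrightarrow> ok v \<or> (\<exists>u. v = Junk u) \<Longrightarrow> ok w \<Longrightarrow> h v \<le> h w + 1 \<and> h w \<le> h v + (1 :: nat)"
    and "(u, v) \<in> parcs G ^^ k"
  shows "h (dcd u) \<le> h (dcd v) + k"
  using assms(2)
proof (induction k arbitrary: v)
  case (Suc k)
  then obtain w where w: "(u, w) \<in> parcs G ^^ k" "(w, v) \<in> parcs G" by auto
  have okj: "ok (dcd x) \<or> (\<exists>u. dcd x = Junk u)" for x using dcd_cases[of x] by auto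
  have nj: "\<not> (\<exists>u. y = Junk u)" if "adj x y" for x y using that by (cases x; cases y) auto
  have "h (dcd w) \<le> h (dcd v) + 1"
    using w(2) assms(1)[of "dcd w" "dcd v"] assms(1)[of "dcd v" "dcd w"] okj nj by (auto simp: arc_iff E_def)
  then show ?case using Suc.IH[OF w(1)] by simp
qed simp

section \<open>From assignments to dominating sets\<close>

definition satc :: "(nat \<Rightarrow> bool option) \<Rightarrow> bool" where
  "satc L \<longleftrightarrow> (\<forall>c<nc. act c \<longrightarrow> (\<exists>l<2 * nv. mem c l \<and> L (l div 2) = Some (odd l)))"

definition toks :: "(nat \<Rightarrow> vtx) \<Rightarrow> nat set" where
  "toks t = insert (cd (Pen nv 0)) ((\<lambda>x. cd (t x)) ` {..<nv})"

definition slot :: "nat \<Rightarrow> vtx set" where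
  "slot x = {Opt (2 * x), Opt (2 * x + 1), Pen x 0}"

lemma slot_ok: "x < nv \<Longrightarrow> v \<in> slot x \<Longrightarrow> ok v"
  using r by (auto simp: slot_def)

lemma pen_path: "ok (Pen x i) \<Longrightarrow> (cd (Pen x 0), cd (Pen x i)) \<in> parcs G ^^ i"
proof (induction i)
  case (Suc i)
  then have "ok (Pen x i)" by auto
  then have "(cd (Pen x i), cd (Pen x (Suc i))) \<in> parcs G" using Suc.prems by (intro arcI) auto
  then show ?case using Suc \<open>ok (Pen x i)\<close> by auto
qed simp

lemma pth_path: "ok (Pth l c j) \<Longrightarrow> (cd (Opt l), cd (Pth l c j)) \<in> parcs G ^^ j"
proof (induction j)
  case (Suc j)
  show ?case
  proof (cases "j = 0")
    case True
    have "(cd (Opt l), cd (Pth l c (Suc j))) \<in> parcs G" using Suc.prems True by (intro arcI) auto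
    then show ?thesis using True by auto
  next
    case False
    then have o: "ok (Pth l c j)" using Suc.prems by auto
    then have "(cd (Pth l c j), cd (Pth l c (Suc j))) \<in> parcs G" using Suc.prems by (intro arcI) auto
    then show ?thesis using Suc.IH[OF o] by auto
  qed
qed simp

lemma hub_ok: "ok (Pen nv 0)"
  by simp

lemma hub_near: "ok (Opt l) \<Longrightarrow> (cd (Pen nv 0), cd (Opt l)) \<in> parcs G"
  by (intro arcI) auto

text \<open>From the hub, the end of its own path is at distance \<open>r\<close> and
  \<open>Pth l c j\<close> within \<open>Suc j\<close>. From a literal, both the end of the pendant
  path of its variable and its clauses are within \<open>r\<close>.\<close>

lemma toks_dominating:
  assumes t: "\<And>x. x < nv \<Longrightarrow> t x \<in> slot x"
    and c: "\<And>c. c < nc \<Longrightarrow> act c \<Longrightarrow> \<exists>l<2 * nv. mem c l \<and> t (l div 2) = Opt l"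
  shows "dist_dominating_set r G (toks t)"
proof -
  have tN: "toks t \<subseteq> {..<N}"
    using slot_ok[OF _ t] cd_less cd_less[OF hub_ok] by (auto simp: toks_def simp del: cd.simps)
  have "\<exists>u\<in>toks t. \<exists>j\<le>r. (u, v) \<in> parcs G ^^ j" if v: "v < N" for v
  proof -
    have hub: "cd (Pen nv 0) \<in> toks t" by (simp add: toks_def)
    have tx: "cd (t x) \<in> toks t" if "x < nv" for x using that by (simp add: toks_def)
    consider u where "dcd v = Junk u" | "ok (dcd v)" "cd (dcd v) = v" using dcd_cases[of v] by auto
    then show ?thesis
    proof cases
      case 1
      have "(cd (Pen nv 0), v) \<in> parcs G"
        using 1 v cd_less[OF hub_ok] by (simp add: arc_iff E_def del: cd.simps)
      then have "(cd (Pen nv 0), v) \<in> parcs G ^^ 1" by simp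
      then show ?thesis using hub r by (metis one_le_numeral order_trans)
    next
      case 2
      show ?thesis
      proof (cases "dcd v")
        case (Opt l)
        then have "(cd (Pen nv 0), v) \<in> parcs G ^^ 1" using hub_near[of l] 2 by simp
        then show ?thesis using hub r by (metis one_le_numeral order_trans)
      next
        case (Pen x i)
        show ?thesis
        proof (cases "x < nv")
          case False
          then show ?thesis using pen_path[of x i] 2 Pen hub by auto
        next
          case True
          then have i: "i < r" using 2 Pen by auto
          have p: "(cd (Pen x 0), v) \<in> parcs G ^^ i" using pen_path[of x i] 2 Pen by simp
          show ?thesis
          proof (cases "t x = Pen x 0")
            case True
            then show ?thesis using p i tx[OF \<open>x < nv\<close>] by (metis less_imp_le)
          next
            case False
            then obtain l where l: "t x = Opt l" "l div 2 = x" "l < 2 * nv"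
              using t[OF True] True by (auto simp: slot_def)
            then have "(cd (t x), cd (Pen x 0)) \<in> parcs G" using True r by (intro arcI) auto
            then have "(cd (t x), v) \<in> parcs G ^^ Suc i" using p by (rule relpow_Suc_I2)
            then show ?thesis using tx[OF True] i by (metis Suc_leI)
          qed
        qed
      next
        case (Cl c)
        then obtain l where l: "l < 2 * nv" "mem c l" "t (l div 2) = Opt l" using 2 c by auto
        have r1: "Suc (r - 1) = r" using r by simp
        have o: "ok (Pth l c (r - 1))" using l r Cl 2 by auto
        have "(cd (Pth l c (r - 1)), v) \<in> parcs G"
          using arcI[OF o, of "Cl c"] 2 Cl l r1 by (simp del: cd.simps)
        then have "(cd (Opt l), v) \<in> parcs G ^^ r"
          using pth_path[OF o] r1 by (metis relpow_Suc_I)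
        moreover have "cd (Opt l) \<in> toks t" using tx[of "l div 2"] l by auto
        ultimately show ?thesis by blast
      next
        case (Pth l c j)
        then have j: "Suc j \<le> r" "ok (Opt l)" using 2 by auto
        have "(cd (Opt l), v) \<in> parcs G ^^ j" using pth_path[of l c j] 2 Pth by simp
        then have "(cd (Pen nv 0), v) \<in> parcs G ^^ Suc j" using hub_near[OF j(2)] by (rule relpow_Suc_I2[rotated])
        then show ?thesis using hub j(1) by blast
      qed (use 2 in simp)
    qed
  qed
  then show ?thesis unfolding dist_dominating_set_def pverts_G using tN dist_le by (meson lessThan_iff subsetD)
qed

text \<open>The old and the new place are adjacent, so the move is legal under both rules.\<close>

lemma toks_move:
  assumes t: "\<And>y. y < nv \<Longrightarrow> t y \<in> slot y" and x: "x < nv" and v: "v \<in> slot x" "v \<noteq> t x"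
    and a: "adj (t x) v \<or> adj v (t x)"
  shows "reconf_move R G (toks t) (toks (t(x := v)))"
proof -
  have inj: "cd (t' y) = cd (t'' z) \<longleftrightarrow> y = z \<and> t' y = t'' z"
    if "t' y \<in> slot y" "t'' z \<in> slot z" "y < nv" "z < nv" for t' t'' :: "nat \<Rightarrow> vtx" and y z
  proof
    assume "cd (t' y) = cd (t'' z)"
    then have "t' y = t'' z" using cd_inj slot_ok that by blast
    then show "y = z \<and> t' y = t'' z" using that by (auto simp: slot_def)
  qed auto
  have nh: "cd (t' y) \<noteq> cd (Pen nv 0)" if "t' y \<in> slot y" "y < nv" for t' y
    using cd_inj[OF slot_ok hub_ok, of y "t' y"] that by (auto simp: slot_def)
  have 1: "cd (t x) \<notin> toks (t(x := v))"
  proof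
    assume "cd (t x) \<in> toks (t(x := v))"
    then obtain y where y: "y < nv" "cd (t x) = cd ((t(x := v)) y)"
      using nh[of t x] t x by (auto simp: toks_def simp del: cd.simps)
    have "(t(x := v)) y \<in> slot y" using t v y by auto
    from inj[of t x "t(x := v)" y, OF t[OF x] this x y(1)] y(2) v(2) show False by auto
  qed
  have 2: "cd v \<notin> toks t"
  proof
    assume "cd v \<in> toks t"
    then obtain y where y: "y < nv" "cd ((t(x := v)) x) = cd (t y)"
      using nh[of "t(x := v)" x] v x by (auto simp: toks_def simp del: cd.simps)
    from inj[of "t(x := v)" x t y] v t[OF y(1)] x y show False by auto
  qed
  have "toks t - toks (t(x := v)) = {cd (t x)}"
  proof -
    have "toks t - {cd (t x)} \<subseteq> toks (t(x := v))" by (auto simp: toks_def)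
    moreover have "cd (t x) \<in> toks t" using x by (simp add: toks_def)
    ultimately show ?thesis using 1 by blast
  qed
  moreover have "toks (t(x := v)) - toks t = {cd v}"
  proof -
    have "toks (t(x := v)) \<subseteq> insert (cd v) (toks t)" by (auto simp: toks_def)
    moreover have "cd v \<in> toks (t(x := v))" using x by (auto simp: toks_def)
    ultimately show ?thesis using 2 by blast
  qed
  moreover have "(cd (t x), cd v) \<in> parcs G"
    using a slot_ok[OF x t[OF x]] slot_ok[OF x v(1)] by (intro arcI)
  ultimately show ?thesis by (cases R) auto
qed

definition tok :: "nat set \<Rightarrow> nat \<Rightarrow> vtx" where
  "tok A x = Opt (2 * x + of_bool (x \<in> A))"

definition DS :: "nat set \<Rightarrow> nat set" where
  "DS A = toks (tok A)"

lemma tok_slot: "tok A x \<in> slot x"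
  by (auto simp: tok_def slot_def)

lemma lit_of: "tok A (l div 2) = Opt l \<longleftrightarrow> lits A (l div 2) = Some (odd l)"
proof -
  have l: "2 * (l div 2) + of_bool (odd l) = l" by (cases "odd l") simp_all
  have "tok A k = Opt (2 * k + of_bool b) \<longleftrightarrow> (k \<in> A) = b" for k b
    by (cases b) (auto simp: tok_def)
  from this[of "l div 2" "odd l"] show ?thesis unfolding l lits_def by auto
qed

lemma DS_dominating: "satc (lits A) \<Longrightarrow> dist_dominating_set r G (DS A)"
  unfolding DS_def by (rule toks_dominating[OF tok_slot]) (auto simp: satc_def lit_of)

text \<open>The two literals of \<open>x\<close> are not adjacent, so a flip takes two slides with a
  stop on \<open>Pen x 0\<close>, where \<open>x\<close> satisfies no clause. A clause supported by
  \<open>x\<close> both before and after would contain both literals.\<close>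

lemma DS_flip:
  assumes A: "satc (lits A)" "satc (lits A')" and x: "x < nv"
    and d: "x \<notin> A \<and> A' = insert x A \<or> x \<notin> A' \<and> A = insert x A'"
  shows "(DS A, DS A') \<in> (DS_move r R G)\<^sup>*"
proof -
  define t where "t = (tok A)(x := Pen x 0)"
  have ts: "t y \<in> slot y" for y using tok_slot by (auto simp: t_def slot_def)
  have same: "tok A' y = tok A y" if "y \<noteq> x" for y using d that by (auto simp: tok_def)
  have t': "tok A' = t(x := tok A' x)" using same by (auto simp: t_def fun_eq_iff)
  have ne: "tok A x \<noteq> tok A' x" using d by (auto simp: tok_def)
  have dt: "dist_dominating_set r G (toks t)"
  proof (rule toks_dominating[OF ts])
    fix c assume c: "c < nc" "act c"
    obtain l where l: "l < 2 * nv" "mem c l" "tok A (l div 2) = Opt l" using A(1) c by (auto simp: satc_def lit_of)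
    obtain l' where l': "l' < 2 * nv" "mem c l'" "tok A' (l' div 2) = Opt l'" using A(2) c by (auto simp: satc_def lit_of)
    show "\<exists>l<2 * nv. mem c l \<and> t (l div 2) = Opt l"
    proof (cases "l div 2 = x \<and> l' div 2 = x")
      case True
      then have "{l, l'} = {2 * x, 2 * x + 1}" using l(3) l'(3) ne d by (auto simp: tok_def)
      then have "mem c (2 * x)" "mem c (2 * x + 1)" using l(2) l'(2) by (auto simp: doubleton_eq_iff)
      then show ?thesis using no_taut[OF c x] by blast
    next
      case False
      then consider "l div 2 \<noteq> x" | "l' div 2 \<noteq> x" by blast
      then show ?thesis
      proof cases
        assume "l div 2 \<noteq> x"
        then show ?thesis using l by (intro exI[of _ l]) (simp add: t_def)
      next
        assume "l' div 2 \<noteq> x"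
        then show ?thesis using l' same[of "l' div 2"] by (intro exI[of _ l']) (simp add: t_def)
      qed
    qed
  qed
  have 1: "reconf_move R G (toks (tok A)) (toks t)"
    unfolding t_def by (rule toks_move[OF tok_slot x]) (auto simp: slot_def tok_def)
  have "reconf_move R G (toks t) (toks (t(x := tok A' x)))"
    by (rule toks_move[OF ts x tok_slot]) (auto simp: t_def tok_def)
  then have 2: "reconf_move R G (toks t) (toks (tok A'))" using t' by simp
  have "(DS A, toks t) \<in> DS_move r R G" "(toks t, DS A') \<in> DS_move r R G"
    using 1 2 dt DS_dominating[OF A(1)] DS_dominating[OF A(2)] by (auto simp: DS_move_def DS_def)
  then show ?thesis by (meson r_into_rtrancl rtrancl.rtrancl_into_rtrancl)
qed

section \<open>From dominating sets back to partial assignments\<close>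

definition zone :: "nat \<Rightarrow> nat set" where
  "zone x = {u. u < N \<and> (\<exists>i. dcd u = Pen x i) \<or> u < N \<and> x < nv \<and> (dcd u = Opt (2 * x) \<or> dcd u = Opt (2 * x + 1))}"

lemma zone_disjoint: "u \<in> zone x \<Longrightarrow> u \<in> zone y \<Longrightarrow> x = y"
  by (auto simp: zone_def)

text \<open>\<open>zone x\<close> is the ball of radius \<open>r\<close> around the end of the
  pendant path at \<open>Pen x 0\<close>. The path of the hub is longer by one, which keeps the
  literals out of its ball and makes all zones disjoint.\<close>

lemma zone_hit:
  assumes "dist_dominating_set r G D" "x \<le> nv"
  shows "\<exists>u\<in>D. u \<in> zone x"
proof -
  define e where "e = (if x = nv then r else r - 1)"
  \<comment> \<open>The distance to the end of the path, cut off at \<open>r + 1\<close>.\<close>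
  define h where "h v = (case v of Pen y i \<Rightarrow> if y = x then e - i else r + 1
    | Opt l \<Rightarrow> if l div 2 = x \<and> x < nv then r else r + 1 | _ \<Rightarrow> r + 1)" for v
  have oke: "ok (Pen x e)" using assms(2) r by (auto simp: e_def)
  obtain u where u: "u \<in> D" "graph_dist G u (cd (Pen x e)) \<le> ereal (real r)"
    using assms(1) cd_less[OF oke] unfolding dist_dominating_set_def pverts_G by blast
  have uN: "u < N" using assms(1) u(1) by (auto simp: dist_dominating_set_def pverts_G)
  obtain j where j: "j \<le> r" "(u, cd (Pen x e)) \<in> parcs G ^^ j" using u(2) dist_le[OF uN] by blast
  have "h (dcd u) \<le> h (dcd (cd (Pen x e))) + j"
  proof (rule lipschitz[OF _ j(2)])
    fix v w assume "adj v w" "ok v \<or> (\<exists>u. v = Junk u)" "ok w"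
    then show "h v \<le> h w + 1 \<and> h w \<le> h v + 1"
      using r assms(2) by (induction v w rule: adj.induct) (auto simp: h_def e_def)
  qed
  then have "h (dcd u) \<le> r" using j(1) dcd_cd[OF oke] by (simp add: h_def del: cd.simps)
  then have "u \<in> zone x"
    using uN by (auto simp: h_def zone_def split: vtx.splits if_splits)
  with u(1) show ?thesis by blast
qed

lemma clause_hit:
  assumes "dist_dominating_set r G D" "c < nc" "act c"
  shows "\<exists>u\<in>D. dcd u = Cl c \<or> (\<exists>l j. dcd u = Pth l c j) \<or> (\<exists>l<2 * nv. mem c l \<and> dcd u = Opt l)"
proof -
  \<comment> \<open>A lower bound for the distance to \<open>Cl c\<close>, cut off at
    \<open>r + 1\<close>. The hub and literals that do not occur in \<open>c\<close> get
    \<open>r + 1\<close>.\<close>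
  define h where "h v = (case v of Cl c' \<Rightarrow> if c' = c then 0 else r + 1
    | Pth l c' j \<Rightarrow> if c' = c \<and> mem c l then r - j else r + 1
    | Opt l \<Rightarrow> if mem c l then r else r + 1 | _ \<Rightarrow> r + 1)" for v
  have okc: "ok (Cl c)" using assms by simp
  obtain u where u: "u \<in> D" "graph_dist G u (cd (Cl c)) \<le> ereal (real r)"
    using assms(1) cd_less[OF okc] unfolding dist_dominating_set_def pverts_G by blast
  have uN: "u < N" using assms(1) u(1) by (auto simp: dist_dominating_set_def pverts_G)
  obtain j where j: "j \<le> r" "(u, cd (Cl c)) \<in> parcs G ^^ j" using u(2) dist_le[OF uN] by blast
  have "h (dcd u) \<le> h (dcd (cd (Cl c))) + j"
  proof (rule lipschitz[OF _ j(2)])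
    fix v w assume "adj v w" "ok v \<or> (\<exists>u. v = Junk u)" "ok w"
    then show "h v \<le> h w + 1 \<and> h w \<le> h v + 1"
      using r by (induction v w rule: adj.induct) (auto simp: h_def)
  qed
  then have h: "h (dcd u) \<le> r" using j(1) dcd_cd[OF okc] by (simp add: h_def del: cd.simps)
  have "ok (dcd u) \<or> dcd u = Junk u" using dcd_cases by blast
  with h have "dcd u = Cl c \<or> (\<exists>l j. dcd u = Pth l c j) \<or> (\<exists>l<2 * nv. mem c l \<and> dcd u = Opt l)"
    by (cases "dcd u") (auto simp: h_def split: if_splits)
  with u(1) show ?thesis by blast
qed

text \<open>With this number of tokens, no zone can have two. A move exchanges one vertex for one,
  so the number never changes.\<close>

definition good :: "nat set \<Rightarrow> bool" where
  "good D \<longleftrightarrow> dist_dominating_set r G D \<and> card D = nv + 1"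

text \<open>A choice of one token from each zone is injective and hence exhausts
  \<open>D\<close>.\<close>

lemma good_zones:
  assumes "good D"
  shows "u \<in> D \<Longrightarrow> \<exists>x\<le>nv. u \<in> zone x" and "u \<in> D \<Longrightarrow> w \<in> D \<Longrightarrow> u \<in> zone x \<Longrightarrow> w \<in> zone x \<Longrightarrow> u = w"
proof -
  have D: "dist_dominating_set r G D" "card D = nv + 1" using assms by (auto simp: good_def)
  have "\<forall>x. \<exists>u. x \<le> nv \<longrightarrow> u \<in> D \<and> u \<in> zone x" using zone_hit[OF D(1)] by blast
  then obtain f where f: "\<And>x. x \<le> nv \<Longrightarrow> f x \<in> D \<and> f x \<in> zone x" by metis
  have inj: "inj_on f {..nv}" using f zone_disjoint by (intro inj_onI) (metis atMost_iff)
  have "finite D" using D(2) by (metis Suc_eq_plus1 card.infinite nat.distinct(1))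
  moreover have "f ` {..nv} \<subseteq> D" using f by auto
  moreover have "card (f ` {..nv}) = card D" using card_image[OF inj] D(2) by simp
  ultimately have im: "f ` {..nv} = D" by (metis card_subset_eq)
  show "u \<in> D \<Longrightarrow> \<exists>x\<le>nv. u \<in> zone x" using im f by blast
  have uf: "u = f x" if "u \<in> D" "u \<in> zone x" for u x
    using im that f zone_disjoint by (metis atMost_iff imageE)
  show "u \<in> D \<Longrightarrow> w \<in> D \<Longrightarrow> u \<in> zone x \<Longrightarrow> w \<in> zone x \<Longrightarrow> u = w" using uf by metis
qed

text \<open>A token on the pendant path gives no value. From \<open>nv\<close> on the value agrees
  with \<open>lits A\<close> for \<open>A \<subseteq> {..<nv}\<close>.\<close>

definition lit :: "nat set \<Rightarrow> nat \<Rightarrow> bool option" where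
  "lit D x = (if x < nv then if cd (Opt (2 * x + 1)) \<in> D then Some True
     else if cd (Opt (2 * x)) \<in> D then Some False else None else Some False)"

lemma Opt_zone: "l < 2 * nv \<Longrightarrow> cd (Opt l) \<in> zone (l div 2)"
proof -
  assume l: "l < 2 * nv"
  then have "dcd (cd (Opt l)) = Opt l" "cd (Opt l) < N" using dcd_cd cd_less by (simp_all del: cd.simps)
  moreover have "l = 2 * (l div 2) \<or> l = 2 * (l div 2) + 1" by presburger
  ultimately show ?thesis using l unfolding zone_def by auto
qed

lemma good_lit:
  assumes "good D" "l < 2 * nv" "cd (Opt l) \<in> D"
  shows "lit D (l div 2) = Some (odd l)"
proof -
  define x where "x = l div 2"
  have x: "x < nv" using assms(2) by (simp add: x_def)
  have "l = 2 * x \<or> l = 2 * x + 1" unfolding x_def by presburger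
  then show ?thesis
  proof
    assume l: "l = 2 * x + 1"
    then show ?thesis using assms(3) x by (simp add: lit_def)
  next
    assume l: "l = 2 * x"
    have "cd (Opt (2 * x + 1)) \<notin> D"
    proof
      assume "cd (Opt (2 * x + 1)) \<in> D"
      then have "cd (Opt (2 * x + 1)) = cd (Opt (2 * x))"
        using good_zones(2)[OF assms(1), of "cd (Opt (2 * x + 1))" "cd (Opt (2 * x))" x]
          Opt_zone[of "2 * x + 1"] Opt_zone[of "2 * x"] assms(3) x l by simp
      then show False by simp
    qed
    then show ?thesis using assms(3) x l by (simp add: lit_def)
  qed
qed

text \<open>The token that dominates a clause lies in some zone. Zones contain neither clauses nor
  vertices of the paths \<open>Pth\<close>, so it is a literal of the clause.\<close>

lemma good_satc: "good D \<Longrightarrow> satc (lit D)"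
  unfolding satc_def
proof (intro allI impI)
  fix c assume D: "good D" and c: "c < nc" "act c"
  obtain u where u: "u \<in> D" and *: "dcd u = Cl c \<or> (\<exists>l j. dcd u = Pth l c j) \<or> (\<exists>l<2 * nv. mem c l \<and> dcd u = Opt l)"
    using clause_hit D c unfolding good_def by blast
  obtain x where "u \<in> zone x" using good_zones(1)[OF D u] by blast
  with * obtain l where l: "l < 2 * nv" "mem c l" "dcd u = Opt l" by (auto simp: zone_def)
  then have "u = cd (Opt l)" using dcd_eq[of "Opt l" u] by simp
  then show "\<exists>l<2 * nv. mem c l \<and> lit D (l div 2) = Some (odd l)"
    using good_lit[OF D l(1)] u l by blast
qed

text \<open>A token that jumps out of a zone leaves it empty, so the new one has to land in the same
  zone. All other zones keep their token, and with it the value of their variable.\<close>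

lemma good_move:
  assumes D: "good D" and m: "(D, D') \<in> DS_move r R G"
  shows "good D'" "\<exists>x0. \<forall>x. x \<noteq> x0 \<longrightarrow> lit D' x = lit D x"
proof -
  have "\<exists>a b. D - D' = {a} \<and> D' - D = {b}" using m by (cases R) (auto simp: DS_move_def)
  then obtain a b where ab: "D - D' = {a}" "D' - D = {b}" by blast
  have fin: "finite D" using D unfolding good_def by (metis Suc_eq_plus1 card.infinite nat.distinct(1))
  have D': "D' = insert b (D - {a})" "a \<in> D" "b \<notin> D - {a}" using ab by blast+
  have "card D' = card D" unfolding D'(1) using D'(2,3) fin by (simp add: card_Diff_singleton) (metis Suc_pred card_gt_0_iff empty_iff)
  then show g: "good D'" using D m by (simp add: good_def DS_move_def)
  obtain x0 where x0: "a \<in> zone x0" using good_zones(1)[OF D D'(2)] by blast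
  have "lit D' x = lit D x" if "x \<noteq> x0" for x
  proof (cases "x < nv")
    case True
    obtain w where w: "w \<in> D" "w \<in> zone x" using zone_hit[of D x] D True by (auto simp: good_def)
    have "w \<noteq> a" using zone_disjoint w(2) x0 that by blast
    then have w': "w \<in> D'" using w ab by blast
    have "u \<in> D \<longleftrightarrow> u \<in> D'" if "u \<in> zone x" for u
      using good_zones(2)[OF D _ w(1) that w(2)] good_zones(2)[OF g _ w' that w(2)] w(1) w' by blast
    then show ?thesis
      using Opt_zone[of "2 * x"] Opt_zone[of "2 * x + 1"] True by (simp add: lit_def del: cd.simps)
  qed (simp add: lit_def)
  then show "\<exists>x0. \<forall>x. x \<noteq> x0 \<longrightarrow> lit D' x = lit D x" by blast
qed

lemma good_DS: "satc (lits A) \<Longrightarrow> good (DS A)"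
proof -
  assume "satc (lits A)"
  have "cd (tok A y) = cd (tok A z) \<longleftrightarrow> y = z" if "y < nv" "z < nv" for y z
    by (auto simp: tok_def of_bool_def split: if_splits)
  then have "inj_on (\<lambda>x. cd (tok A x)) {..<nv}" by (auto intro!: inj_onI)
  moreover have "cd (Pen nv 0) \<notin> (\<lambda>x. cd (tok A x)) ` {..<nv}"
    by (auto simp: tok_def) presburger
  ultimately have "card (DS A) = nv + 1" unfolding DS_def toks_def by (simp add: card_image del: cd.simps)
  with DS_dominating[OF \<open>satc (lits A)\<close>] show ?thesis by (simp add: good_def)
qed

lemma lit_DS: "A \<subseteq> {..<nv} \<Longrightarrow> satc (lits A) \<Longrightarrow> lit (DS A) = lits A"
proof
  fix x assume A: "A \<subseteq> {..<nv}" "satc (lits A)"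
  show "lit (DS A) x = lits A x"
  proof (cases "x < nv")
    case True
    define l where "l = 2 * x + of_bool (x \<in> A)"
    have "cd (Opt l) \<in> DS A" using True by (auto simp: DS_def toks_def tok_def l_def)
    moreover have "l < 2 * nv" "l div 2 = x" "odd l = (x \<in> A)" using True by (auto simp: l_def of_bool_def)
    ultimately show ?thesis using good_lit[OF good_DS[OF A(2)], of l] by (simp add: lits_def)
  next
    case False
    then show ?thesis using A(1) by (auto simp: lit_def lits_def)
  qed
qed

definition pflipc :: "((nat \<Rightarrow> bool option) \<times> (nat \<Rightarrow> bool option)) set" where
  "pflipc = {(L, L'). satc L \<and> satc L' \<and> (\<exists>x0. \<forall>x. x \<noteq> x0 \<longrightarrow> L' x = L x)}"

lemma good_path: "(D, D') \<in> (DS_move r R G)\<^sup>* \<Longrightarrow> good D \<Longrightarrow> good D' \<and> (lit D, lit D') \<in> pflipc\<^sup>*"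
proof (induction rule: rtrancl_induct)
  case (step D1 D2)
  then have 1: "good D1" "(lit D, lit D1) \<in> pflipc\<^sup>*" by auto
  have "good D2" "(lit D1, lit D2) \<in> pflipc"
    using good_move[OF 1(1) step(2)] good_satc[OF 1(1)] good_satc by (auto simp: pflipc_def)
  with 1(2) show ?case by (meson rtrancl.rtrancl_into_rtrancl)
qed simp

end

section \<open>Turing machines as local systems\<close>

text \<open>
  Group 0 holds the index of the state together with the scanned symbols, group \<open>Suc j\<close> the
  head position of tape \<open>j\<close>, and the remaining groups the tape cells below the space bound \<open>s\<close>.
\<close>

locale tm_system =
  fixes M :: tm and s :: nat and th :: "nat \<Rightarrow> nat \<times> nat list" and n\<theta> :: nat
  assumes wf: "wf_tm M" and s: "s > 0"
    and th: "bij_betw th {..<n\<theta>}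
      ({..<num_states M} \<times> {ss. length ss = num_tapes M \<and> set ss \<subseteq> {..<num_symbols M}})"
begin

abbreviation k :: nat where "k \<equiv> num_tapes M"

text \<open>Halted states idle, as they do in \<open>step\<close>; this makes acceptance
  persist.\<close>

definition act_of :: "nat \<Rightarrow> nat \<times> (nat \<times> direction) list" where
  "act_of \<theta> = (if fst (th \<theta>) \<in> {accept_state M, reject_state M}
     then (fst (th \<theta>), map (\<lambda>a. (a, Stay)) (snd (th \<theta>))) else delta M (fst (th \<theta>)) (snd (th \<theta>)))"

definition mvd :: "direction \<Rightarrow> nat \<Rightarrow> nat" where
  "mvd d i = (case d of Left \<Rightarrow> i - 1 | Stay \<Rightarrow> i | Right \<Rightarrow> Suc i)"

definition cell :: "nat \<Rightarrow> nat \<Rightarrow> nat" where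
  "cell j i = 1 + k + (j + k * i)"

definition Gn :: nat where "Gn = 1 + k + k * s"

text \<open>A common bound for head positions, indices and symbols; a sum is a term, a maximum is
  not.\<close>

definition W :: nat where "W = s + n\<theta> + num_symbols M"

text \<open>Having the scanned symbols inside group 0 keeps every constraint ternary: it relates
  group 0, one head and one cell.\<close>

definition F1 :: "nat \<times> nat \<Rightarrow> nat \<times> nat \<Rightarrow> nat \<times> nat \<Rightarrow> bool" where
  "F1 p q u \<longleftrightarrow> fst p = 0 \<and> n\<theta> \<le> snd p \<or> (\<exists>j<k. fst p = Suc j \<and> s \<le> snd p) \<or>
     fst p = 0 \<and> snd p < n\<theta> \<and>
       (\<exists>j<k. fst q = Suc j \<and> fst u = cell j (snd q) \<and> snd u \<noteq> snd (th (snd p)) ! j)"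

text \<open>A head about to leave the first \<open>s\<close> cells has no valid successor position,
  so such a configuration is stuck; the space bound excludes this on actual runs.\<close>

definition F2 :: "nat \<times> nat \<Rightarrow> nat \<times> nat \<Rightarrow> nat \<times> nat \<Rightarrow> bool" where
  "F2 p q u \<longleftrightarrow>
     fst p = 0 \<and> snd p < n\<theta> \<and> fst u = 0 \<and> snd u < n\<theta> \<and> fst (th (snd u)) \<noteq> fst (act_of (snd p)) \<or>
     fst p = 0 \<and> snd p < n\<theta> \<and> (\<exists>j<k. fst q = Suc j \<and>
       (fst u = Suc j \<and> snd u \<noteq> mvd (snd (snd (act_of (snd p)) ! j)) (snd q) \<or>
        fst u = cell j (snd q) \<and> snd u \<noteq> fst (snd (act_of (snd p)) ! j))) \<or>
     (\<exists>j<k. fst p = Suc j \<and> (\<exists>i<s. i \<noteq> snd p \<and> fst q = cell j i \<and> fst u = cell j i \<and> snd u \<noteq> snd q))"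

definition acc :: "nat \<Rightarrow> bool" where
  "acc \<theta> \<longleftrightarrow> \<theta> < n\<theta> \<and> fst (th \<theta>) = accept_state M"

lemma wf_facts: "k \<ge> 1" "num_symbols M \<ge> 3" "start_state M < num_states M" "accept_state M < num_states M"
  "accept_state M \<noteq> reject_state M"
  using wf by (auto simp: wf_tm_def)

lemma th_ex: "q < num_states M \<Longrightarrow> length ss = k \<Longrightarrow> set ss \<subseteq> {..<num_symbols M} \<Longrightarrow> \<exists>\<theta><n\<theta>. th \<theta> = (q, ss)"
proof -
  assume "q < num_states M" "length ss = k" "set ss \<subseteq> {..<num_symbols M}"
  then have "(q, ss) \<in> th ` {..<n\<theta>}" unfolding bij_betw_imp_surj_on[OF th] by simp
  then show ?thesis by auto
qed

lemma th_in: "\<theta> < n\<theta> \<Longrightarrow> fst (th \<theta>) < num_states M \<and> length (snd (th \<theta>)) = k \<and> set (snd (th \<theta>)) \<subseteq> {..<num_symbols M}"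
proof -
  assume "\<theta> < n\<theta>"
  then have "th \<theta> \<in> {..<num_states M} \<times> {ss. length ss = k \<and> set ss \<subseteq> {..<num_symbols M}}"
    using bij_betwE[OF th] by blast
  then show ?thesis by (cases "th \<theta>") simp
qed

lemma th_inj: "\<theta> < n\<theta> \<Longrightarrow> \<theta>' < n\<theta> \<Longrightarrow> th \<theta> = th \<theta>' \<Longrightarrow> \<theta> = \<theta>'"
  using bij_betw_imp_inj_on[OF th] by (auto dest: inj_onD)

lemma act_of_wf:
  assumes "\<theta> < n\<theta>"
  shows "fst (act_of \<theta>) < num_states M" "length (snd (act_of \<theta>)) = k"
    "\<And>j. j < k \<Longrightarrow> fst (snd (act_of \<theta>) ! j) < num_symbols M"
proof -
  note t = th_in[OF assms]
  have "fst (act_of \<theta>) < num_states M \<and> length (snd (act_of \<theta>)) = k \<and> fst ` set (snd (act_of \<theta>)) \<subseteq> {..<num_symbols M}"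
    using wf t unfolding wf_tm_def act_of_def by (auto simp: image_subset_iff)
  then show "fst (act_of \<theta>) < num_states M" "length (snd (act_of \<theta>)) = k"
    "\<And>j. j < k \<Longrightarrow> fst (snd (act_of \<theta>) ! j) < num_symbols M"
    by (auto simp: image_subset_iff)
qed

lemma group_cases:
  assumes "g < Gn"
  obtains "g = 0" | j where "j < k" "g = Suc j" | j i where "j < k" "i < s" "g = cell j i"
proof -
  consider "g = 0" | "0 < g" "g \<le> k" | "k < g" by linarith
  then show thesis
  proof cases
    case 2
    then show thesis using that(2)[of "g - 1"] by simp
  next
    case 3
    then have "g - (1 + k) < s * k" using assms by (simp add: Gn_def mult.commute)
    then obtain i j where "i < s" "j < k" "g - (1 + k) = i * k + j" using mixed_radix_ex by blast
    then show thesis using that(3)[of j i] 3 by (simp add: cell_def mult.commute)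
  qed (use that in blast)
qed

lemma cell_less: "j < k \<Longrightarrow> i < s \<Longrightarrow> cell j i < Gn"
  using mixed_radix_less[of i s j k] by (simp add: cell_def Gn_def ac_simps)

lemma cell_eq: "j < k \<Longrightarrow> j' < k \<Longrightarrow> cell j i = cell j' i' \<longleftrightarrow> j = j' \<and> i = i'"
  using mixed_radix_eq[of j k j' i i'] by (auto simp: cell_def ac_simps)

lemma cell_pos [simp]: "0 < cell j i"
  by (simp add: cell_def)

lemma cell_neq: "j < k \<Longrightarrow> cell l i \<noteq> Suc j" "cell l i \<noteq> 0" "j < k \<Longrightarrow> Suc j \<noteq> cell l i"
  by (auto simp: cell_def)

lemma head_less: "j < k \<Longrightarrow> Suc j < Gn"
  by (simp add: Gn_def)

sublocale local_system Gn W F1 F2 acc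
proof
  show "Gn > 0" by (simp add: Gn_def)
  obtain \<theta> where "\<theta> < n\<theta>" "th \<theta> = (accept_state M, replicate k 0)"
    using th_ex[of "accept_state M" "replicate k 0"] wf_facts by auto
  then show "\<exists>v<W. acc v" by (intro exI[of _ \<theta>]) (simp add: acc_def W_def)
qed

lemma validD:
  assumes "valid z"
  shows "z 0 < n\<theta>" "\<And>j. j < k \<Longrightarrow> z (Suc j) < s"
    "\<And>j. j < k \<Longrightarrow> snd (th (z 0)) ! j = z (cell j (z (Suc j)))"
proof -
  have F: "\<not> F1 (g1, z g1) (g2, z g2) (g3, z g3)" if "g1 < Gn" "g2 < Gn" "g3 < Gn" for g1 g2 g3
    using assms that unfolding valid_def by blast
  have 0: "0 < Gn" by (simp add: Gn_def)
  show z0: "z 0 < n\<theta>" using F[OF 0 0 0] by (simp add: F1_def not_le)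
  show h: "z (Suc j) < s" if "j < k" for j
    using F[OF head_less[OF that] 0 0] that by (auto simp: F1_def not_le)
  show "snd (th (z 0)) ! j = z (cell j (z (Suc j)))" if j: "j < k" for j
    using F[OF 0 head_less[OF j] cell_less[OF j h[OF j]]] j z0 by (auto simp: F1_def)
qed

lemma stpD:
  assumes "(z, w) \<in> stp"
  shows "fst (th (w 0)) = fst (act_of (z 0))"
    "\<And>j. j < k \<Longrightarrow> w (Suc j) = mvd (snd (snd (act_of (z 0)) ! j)) (z (Suc j))"
    "\<And>j i. j < k \<Longrightarrow> i < s \<Longrightarrow> w (cell j i) = (if i = z (Suc j) then fst (snd (act_of (z 0)) ! j) else z (cell j i))"
proof -
  have v: "valid z" "valid w" using assms by (auto simp: stp_def)
  have F: "\<not> F2 (g1, z g1) (g2, z g2) (g3, w g3)" if "g1 < Gn" "g2 < Gn" "g3 < Gn" for g1 g2 g3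
    using assms that unfolding stp_def by blast
  have 0: "0 < Gn" by (simp add: Gn_def)
  note vz = validD[OF v(1)] and vw = validD[OF v(2)]
  show "fst (th (w 0)) = fst (act_of (z 0))" using F[OF 0 0 0] vz(1) vw(1) by (simp add: F2_def)
  show "w (Suc j) = mvd (snd (snd (act_of (z 0)) ! j)) (z (Suc j))" if j: "j < k" for j
    using F[OF 0 head_less[OF j] head_less[OF j]] vz(1) j by (auto simp: F2_def)
  show "w (cell j i) = (if i = z (Suc j) then fst (snd (act_of (z 0)) ! j) else z (cell j i))" if ji: "j < k" "i < s" for j i
  proof (cases "i = z (Suc j)")
    case True
    then show ?thesis
      using F[OF 0 head_less[OF ji(1)] cell_less[OF ji]] vz(1) ji by (auto simp: F2_def)
  next
    case False
    then show ?thesis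
      using F[OF head_less[OF ji(1)] cell_less[OF ji] cell_less[OF ji]] ji by (auto simp: F2_def)
  qed
qed

text \<open>\<open>F2\<close> determines only the state in the next group 0. The scanned symbols
  there follow from validity, once heads and cells are known.\<close>

sublocale det_local_system Gn W F1 F2 acc
proof
  show "acc (w 0)" if "(z, w) \<in> stp" "acc (z 0)" for z w
  proof -
    have "valid w" using that(1) by (simp add: stp_def)
    moreover have "fst (act_of (z 0)) = accept_state M" using that(2) by (simp add: acc_def act_of_def)
    ultimately show ?thesis using stpD(1)[OF that(1)] validD(1) by (simp add: acc_def)
  qed
  show "w = w'" if zw: "(z, w) \<in> stp" "(z, w') \<in> stp" for z w w'
  proof -
    have v: "valid w" "valid w'" using zw by (auto simp: stp_def)
    have h: "w (Suc j) = w' (Suc j)" if "j < k" for j using stpD(2)[OF zw(1) that] stpD(2)[OF zw(2) that] by simp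
    have c: "w (cell j i) = w' (cell j i)" if "j < k" "i < s" for j i
      using stpD(3)[OF zw(1) that] stpD(3)[OF zw(2) that] by simp
    have "th (w 0) = th (w' 0)"
    proof (rule prod_eqI)
      show "fst (th (w 0)) = fst (th (w' 0))" using stpD(1)[OF zw(1)] stpD(1)[OF zw(2)] by simp
      show "snd (th (w 0)) = snd (th (w' 0))"
      proof (rule nth_equalityI)
        show "length (snd (th (w 0))) = length (snd (th (w' 0)))"
          using th_in validD(1) v by metis
        fix j assume "j < length (snd (th (w 0)))"
        then have j: "j < k" using th_in validD(1) v by metis
        show "snd (th (w 0)) ! j = snd (th (w' 0)) ! j"
          using validD(3)[OF v(1) j] validD(3)[OF v(2) j] h[OF j] c[OF j validD(2)[OF v(1) j]] by simp
      qed
    qed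
    then have 0: "w 0 = w' 0" using th_inj validD(1) v by blast
    show "w = w'"
    proof
      fix g
      show "w g = w' g"
      proof (cases "g < Gn")
        case True
        then show ?thesis by (rule group_cases) (use 0 h c in auto)
      next
        case False
        then show ?thesis using v by (simp add: valid_def)
      qed
    qed
  qed
qed

section \<open>Runs of the machine as paths of the local system\<close>

definition idx :: "config \<Rightarrow> nat" where
  "idx cf = (SOME \<theta>. \<theta> < n\<theta> \<and> th \<theta> = (fst cf, map read_tape (snd cf)))"

definition enc :: "config \<Rightarrow> nat \<Rightarrow> nat" where
  "enc cf g = (if g = 0 then idx cf else if g \<le> k then snd (snd cf ! (g - 1))
     else if g < Gn then fst (snd cf ! ((g - 1 - k) mod k)) ((g - 1 - k) div k) else 0)"

definition conf_ok :: "config \<Rightarrow> bool" where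
  "conf_ok cf \<longleftrightarrow> fst cf < num_states M \<and> length (snd cf) = k \<and>
     (\<forall>j<k. snd (snd cf ! j) < s \<and> (\<forall>i. fst (snd cf ! j) i < num_symbols M))"

lemma idx: "conf_ok cf \<Longrightarrow> idx cf < n\<theta> \<and> th (idx cf) = (fst cf, map read_tape (snd cf))"
proof -
  assume c: "conf_ok cf"
  then have "\<forall>i<k. read_tape (snd cf ! i) < num_symbols M" "length (snd cf) = k"
    by (simp_all add: conf_ok_def read_tape_def)
  then have "read_tape tp < num_symbols M" if "tp \<in> set (snd cf)" for tp
    using that by (auto simp: in_set_conv_nth simp del: split_paired_Ex split_paired_All)
  then have "set (map read_tape (snd cf)) \<subseteq> {..<num_symbols M}"
    by (simp add: image_subset_iff)
  then have "\<exists>\<theta>. \<theta> < n\<theta> \<and> th \<theta> = (fst cf, map read_tape (snd cf))"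
    using th_ex[of "fst cf" "map read_tape (snd cf)"] c by (simp add: conf_ok_def del: set_map)
  then show ?thesis unfolding idx_def by (rule someI_ex)
qed

lemma enc_simps:
  "enc cf 0 = idx cf" "j < k \<Longrightarrow> enc cf (Suc j) = snd (snd cf ! j)"
  "j < k \<Longrightarrow> i < s \<Longrightarrow> enc cf (cell j i) = fst (snd cf ! j) i"
proof -
  show "enc cf 0 = idx cf" "j < k \<Longrightarrow> enc cf (Suc j) = snd (snd cf ! j)" by (simp_all add: enc_def)
  assume ji: "j < k" "i < s"
  have "cell j i - 1 - k = j + k * i" by (simp add: cell_def)
  moreover have "(j + k * i) mod k = j" "(j + k * i) div k = i" using ji by auto
  ultimately show "enc cf (cell j i) = fst (snd cf ! j) i"
    using cell_less[OF ji] by (simp add: enc_def cell_def)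
qed

lemma enc_valid:
  assumes c: "conf_ok cf"
  shows "valid (enc cf)"
  unfolding valid_def
proof (intro conjI allI impI)
  show "enc cf g < W" if "g < Gn" for g
    using that
  proof (rule group_cases)
    show "g = 0 \<Longrightarrow> enc cf g < W" using idx[OF c] by (simp add: enc_simps W_def)
    show "j < k \<Longrightarrow> g = Suc j \<Longrightarrow> enc cf g < W" for j
      using c by (auto simp: enc_simps W_def conf_ok_def intro: trans_less_add1)
    show "j < k \<Longrightarrow> i < s \<Longrightarrow> g = cell j i \<Longrightarrow> enc cf g < W" for j i
      using c by (auto simp: enc_simps W_def conf_ok_def intro: trans_less_add2)
  qed
  show "enc cf g = 0" if "Gn \<le> g" for g using that by (auto simp: enc_def Gn_def)
  fix g1 g2 g3 assume g: "g1 < Gn" "g2 < Gn" "g3 < Gn"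
  have hs: "enc cf (Suc j) < s" if "j < k" for j using c that by (simp add: enc_simps conf_ok_def)
  have cl: "enc cf (cell j (enc cf (Suc j))) = snd (th (idx cf)) ! j" if j: "j < k" for j
    using idx[OF c] c j hs[OF j] by (simp add: enc_simps read_tape_def conf_ok_def)
  have hs': "\<not> s \<le> enc cf (Suc j)" if "j < k" for j using hs[OF that] by simp
  have i': "\<not> n\<theta> \<le> idx cf" using idx[OF c] by simp
  show "\<not> F1 (g1, enc cf g1) (g2, enc cf g2) (g3, enc cf g3)"
    by (auto simp: F1_def enc_simps(1) hs' i' cl)
qed

lemma step_eq:
  assumes c: "conf_ok cf"
  shows "step M cf = (fst (act_of (idx cf)), map2 act_tape (snd (act_of (idx cf))) (snd cf))"
proof (cases "halted M cf")
  case True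
  have "map2 act_tape (map (\<lambda>a. (a, Stay)) (map read_tape tps)) tps = tps" for tps
    by (induction tps) simp_all
  then have "map2 act_tape (snd (act_of (idx cf))) (snd cf) = snd cf" "fst (act_of (idx cf)) = fst cf"
    using idx[OF c] True by (simp_all add: halted_def act_of_def)
  then show ?thesis using True by (simp add: step_def)
next
  case False
  then have "act_of (idx cf) = delta M (fst cf) (map read_tape (snd cf))"
    using idx[OF c] by (simp add: halted_def act_of_def)
  then show ?thesis using False by (simp add: step_def case_prod_beta)
qed

lemma step_tape:
  assumes c: "conf_ok cf" and j: "j < k"
  shows "snd (step M cf) ! j = ((fst (snd cf ! j))(snd (snd cf ! j) := fst (snd (act_of (idx cf)) ! j)),
    mvd (snd (snd (act_of (idx cf)) ! j)) (snd (snd cf ! j)))"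
proof -
  have "length (snd (act_of (idx cf))) = k" "length (snd cf) = k" using act_of_wf idx[OF c] c by (auto simp: conf_ok_def)
  then have "snd (step M cf) ! j = act_tape (snd (act_of (idx cf)) ! j) (snd cf ! j)" using step_eq[OF c] j by simp
  then show ?thesis
    by (cases "snd (act_of (idx cf)) ! j"; cases "snd cf ! j") (simp add: mvd_def)
qed

lemma enc_step:
  assumes c: "conf_ok cf" "conf_ok (step M cf)"
  shows "(enc cf, enc (step M cf)) \<in> stp"
proof -
  have i: "idx (step M cf) < n\<theta>" "fst (th (idx (step M cf))) = fst (act_of (idx cf))"
    using idx[OF c(2)] step_eq[OF c(1)] by auto
  have h: "enc (step M cf) (Suc j) = mvd (snd (snd (act_of (idx cf)) ! j)) (enc cf (Suc j))" if "j < k" for j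
    using that step_tape[OF c(1) that] by (simp add: enc_simps)
  have cl: "enc (step M cf) (cell j i) = (if i = enc cf (Suc j) then fst (snd (act_of (idx cf)) ! j) else enc cf (cell j i))"
    if "j < k" "i < s" for j i
    using that step_tape[OF c(1) that(1)] by (simp add: enc_simps)
  have hs: "enc cf (Suc j) < s" if "j < k" for j using c(1) that by (simp add: enc_simps conf_ok_def)
  have "\<not> F2 (g1, enc cf g1) (g2, enc cf g2) (g3, enc (step M cf) g3)" for g1 g2 g3
    using h cl hs i by (cases "g3 = 0"; cases "g1 = 0") (auto simp: F2_def enc_simps(1))
  then show ?thesis using enc_valid c unfolding stp_def by simp
qed

lemma conf_ok_step:
  assumes c: "conf_ok cf" and "\<forall>tp \<in> set (snd (step M cf)). snd tp < s"
  shows "conf_ok (step M cf)"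
proof -
  have l: "length (snd (step M cf)) = k" using act_of_wf(2) idx[OF c] c step_eq[OF c] by (simp add: conf_ok_def)
  then have "snd (snd (step M cf) ! j) < s" if "j < k" for j using assms(2) that by simp
  moreover have "fst (snd (step M cf) ! j) i < num_symbols M" if "j < k" for j i
    using step_tape[OF c that] act_of_wf(3)[of "idx cf" j] idx[OF c] c that by (auto simp: conf_ok_def)
  moreover have "fst (step M cf) < num_states M" using step_eq[OF c] act_of_wf(1) idx[OF c] by simp
  ultimately show ?thesis using l by (simp add: conf_ok_def)
qed

lemma conf_ok_run:
  assumes "runs_in_space M x s"
  shows "conf_ok (run M x n)"
proof (induction n)
  case 0
  have "string_contents x i < num_symbols M" for i using wf_facts(2) by (auto simp: string_contents_def)
  then show ?case using wf_facts s
    by (auto simp: run_def conf_ok_def init_config_def nth_Cons split: nat.splits)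
next
  case (Suc n)
  have "run M x (Suc n) = step M (run M x n)" by (simp add: run_def)
  then show ?case using conf_ok_step[OF Suc] assms unfolding runs_in_space_def by metis
qed

text \<open>Determinism forces every path from the initial configuration to follow the run, and a
  run that halts in one state never reaches the other.\<close>

lemma accepts_iff:
  assumes sp: "runs_in_space M x s" and dc: "\<exists>t. fst (run M x t) = (if b then accept_state M else reject_state M)"
  shows "accepts (enc (init_config M x)) \<longleftrightarrow> b"
proof -
  note ok = conf_ok_run[OF sp]
  have i: "init_config M x = run M x 0" by (simp add: run_def)
  have st: "(enc (run M x n), enc (run M x (Suc n))) \<in> stp" for n
    using enc_step[OF ok[of n]] ok[of "Suc n"] by (simp add: run_def)
  have path: "(enc (run M x 0), enc (run M x n)) \<in> stp\<^sup>*" for n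
    by (induction n) (auto intro: rtrancl.rtrancl_into_rtrancl[OF _ st])
  have ac: "acc (enc (run M x n) 0) \<longleftrightarrow> fst (run M x n) = accept_state M" for n
    using idx[OF ok[of n]] by (simp add: enc_simps acc_def)
  show ?thesis
  proof
    assume b
    then obtain t where "fst (run M x t) = accept_state M" using dc by auto
    then show "accepts (enc (init_config M x))"
      unfolding accepts_def i using path[of t] enc_valid[OF ok] ac by blast
  next
    assume "accepts (enc (init_config M x))"
    then obtain w where w: "(enc (run M x 0), w) \<in> stp\<^sup>*" "acc (w 0)" unfolding accepts_def i by blast
    from w(1) have "\<exists>n. w = enc (run M x n)"
    proof (induction rule: rtrancl_induct)
      case (step y z)
      then obtain n where "y = enc (run M x n)" by blast
      then have "z = enc (run M x (Suc n))" using det[OF st[of n]] step(2) by simp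
      then show ?case by blast
    qed blast
    then obtain n where n: "fst (run M x n) = accept_state M" using w(2) ac by blast
    show b
    proof (rule ccontr)
      assume "\<not> b"
      then obtain t where t: "fst (run M x t) = reject_state M" using dc by auto
      have "run M x (max n t) = run M x n" "run M x (max n t) = run M x t"
        using run_halted_le[of M x n "max n t"] run_halted_le[of M x t "max n t"] n t by (auto simp: halted_def)
      then show False using n t wf_facts(5) by simp
    qed
  qed
qed

end

section \<open>Numbering the clauses and the vertices\<close>

context local_system
begin

text \<open>A clause is encoded by its kind \<open>t\<close> and by three of the variables that occur in it.\<close>

definition isc :: "nat \<Rightarrow> nat \<Rightarrow> nat \<Rightarrow> nat \<Rightarrow> nat \<Rightarrow> bool" where
  "isc c t v1 v2 v3 \<longleftrightarrow> c = t + 5 * (v1 + nv * (v2 + nv * v3))"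

definition nc :: nat where
  "nc = 5 * (nv * (nv * nv))"

text \<open>The five kinds are the five conjuncts of \<open>sat\<close>. A kind that involves fewer
  than three variables leaves the others open, so its clauses have several codes; repetition is
  harmless.\<close>

definition clact :: "nat \<Rightarrow> nat \<Rightarrow> nat \<Rightarrow> nat \<Rightarrow> bool" where
  "clact t v1 v2 v3 \<longleftrightarrow>
     t = 0 \<and> (\<exists>y. \<exists>g<Gn. v1 = vr y (g, 0)) \<or>
     t = 1 \<and> (\<exists>y. \<exists>g1<Gn. \<exists>w1<W. \<exists>g2<Gn. \<exists>w2<W. \<exists>g3<Gn. \<exists>w3<W. forb (g1, w1) (g2, w2) (g3, w3) \<and>
       v1 = vr y (g1, w1) \<and> v2 = vr y (g2, w2) \<and> v3 = vr y (g3, w3)) \<or>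
     t = 2 \<and> (\<exists>y. \<exists>g1<Gn. \<exists>w1<W. \<exists>g2<Gn. \<exists>w2<W. \<exists>g3<Gn. \<exists>w3<W. F2 (g1, w1) (g2, w2) (g3, w3) \<and>
       v1 = vr y (g1, w1) \<and> v2 = vr y (g2, w2) \<and> v3 = vr (\<not> y) (g3, w3)) \<or>
     t = 3 \<or>
     t = 4 \<and> (\<exists>y. v1 = fr y)"

text \<open>Literals 7 and 6 are the override and its negation, 1 and 3 the free flags, 0 and 2
  their negations, 4 and 5 the two directions. Kinds 0 to 2 recover the copy from
  \<open>v1\<close>.\<close>

definition clm :: "nat \<Rightarrow> nat \<Rightarrow> nat \<Rightarrow> nat \<Rightarrow> nat \<Rightarrow> bool" where
  "clm t v1 v2 v3 l \<longleftrightarrow>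
     t = 0 \<and> (\<exists>y. \<exists>g<Gn. v1 = vr y (g, 0) \<and> ((\<exists>v<W. l = 2 * vr y (g, v) + 1) \<or> l = 2 * fr y + 1 \<or> l = 7)) \<or>
     t = 1 \<and> (l = 2 * v1 \<or> l = 2 * v2 \<or> l = 2 * v3 \<or> l = 7 \<or>
       (\<exists>y. \<exists>g<Gn. \<exists>v<W. v1 = vr y (g, v) \<and> l = 2 * fr y + 1)) \<or>
     t = 2 \<and> (l = 2 * v1 \<or> l = 2 * v2 \<or> l = 2 * v3 \<or> l = 1 \<or> l = 3 \<or> l = 7 \<or>
       (\<exists>y. \<exists>g<Gn. \<exists>v<W. v1 = vr y (g, v) \<and> l = 4 + of_bool (\<not> y))) \<or>
     t = 3 \<and> (l = 0 \<or> l = 2 \<or> l = 7) \<or>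
     t = 4 \<and> (\<exists>y. v1 = fr y \<and> (l = 6 \<or> (\<exists>v<W. acc v \<and> l = 2 * vr y (0, v) + 1)))"

definition act :: "nat \<Rightarrow> bool" where
  "act c \<longleftrightarrow> (\<exists>t<5. \<exists>v1<nv. \<exists>v2<nv. \<exists>v3<nv. isc c t v1 v2 v3 \<and> clact t v1 v2 v3)"

definition mem :: "nat \<Rightarrow> nat \<Rightarrow> bool" where
  "mem c l \<longleftrightarrow> (\<exists>t<5. \<exists>v1<nv. \<exists>v2<nv. \<exists>v3<nv. isc c t v1 v2 v3 \<and> clm t v1 v2 v3 l)"

lemma isc_unique:
  assumes "t < 5" "v1 < nv" "v2 < nv" "t' < 5" "v1' < nv" "v2' < nv" "isc c t v1 v2 v3" "isc c t' v1' v2' v3'"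
  shows "t = t' \<and> v1 = v1' \<and> v2 = v2' \<and> v3 = v3'"
proof -
  have "(v1 + nv * (v2 + nv * v3)) * 5 + t = (v1' + nv * (v2' + nv * v3')) * 5 + t'"
    using assms(7,8) by (simp add: isc_def)
  then have 1: "v1 + nv * (v2 + nv * v3) = v1' + nv * (v2' + nv * v3')" "t = t'"
    using mixed_radix_eq[OF assms(1,4)] by blast+
  then have "(v2 + nv * v3) * nv + v1 = (v2' + nv * v3') * nv + v1'" by (simp add: ac_simps)
  then have 2: "v2 + nv * v3 = v2' + nv * v3'" "v1 = v1'" using mixed_radix_eq[OF assms(2,5)] by blast+
  then have "v3 * nv + v2 = v3' * nv + v2'" by (simp add: ac_simps)
  then have "v3 = v3'" "v2 = v2'" using mixed_radix_eq[OF assms(3,6)] by blast+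
  with 1 2 show ?thesis by simp
qed

lemma isc_less:
  assumes "t < 5" "v1 < nv" "v2 < nv" "v3 < nv" "isc c t v1 v2 v3"
  shows "c < nc"
proof -
  have "v3 * nv + v2 < nv * nv" by (rule mixed_radix_less[OF assms(4,3)])
  from mixed_radix_less[OF this assms(2)] have "(v3 * nv + v2) * nv + v1 < nv * nv * nv" .
  from mixed_radix_less[OF this assms(1)] show ?thesis using assms(5) by (simp add: isc_def nc_def ac_simps)
qed

lemma mem_iff:
  "t < 5 \<Longrightarrow> v1 < nv \<Longrightarrow> v2 < nv \<Longrightarrow> v3 < nv \<Longrightarrow> isc c t v1 v2 v3 \<Longrightarrow> mem c l \<longleftrightarrow> clm t v1 v2 v3 l"
  unfolding mem_def using isc_unique by blast

lemma four_nv: "4 \<le> nv"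
  by (simp add: nv_def)

lemma fr_less: "fr y < 2"
  by (simp add: fr_def)

lemma W_pos: "0 < W"
  using acc_ex by auto

lemma parity_simps: "2 * a = 2 * b' + 1 \<longleftrightarrow> False" "2 * a + 1 = 2 * b' \<longleftrightarrow> False" "2 * a = 7 \<longleftrightarrow> False"
  "2 * a + 1 = 7 \<longleftrightarrow> a = 3" "2 * a = 1 \<longleftrightarrow> False" "2 * a = 3 \<longleftrightarrow> False" "2 * a + 1 = 1 \<longleftrightarrow> a = 0"
  "2 * a + 1 = 3 \<longleftrightarrow> a = 1" "2 * a + 1 = 0 \<longleftrightarrow> False" "2 * a + 1 = 2 \<longleftrightarrow> False" "2 * a + 1 = 6 \<longleftrightarrow> False"
  "2 * a = 6 \<longleftrightarrow> a = 3" "2 * a = 4 + of_bool b \<longleftrightarrow> a = 2 \<and> \<not> b" "2 * a + 1 = 4 + of_bool b \<longleftrightarrow> a = 2 \<and> b"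
  for a b' :: nat and b :: bool
  by (presburger | (cases b; (simp; presburger?)))+

text \<open>Within one kind, all content variables have the same sign and each control variable has
  one sign. For the direction in kind 2, that sign is fixed by the copy to which \<open>v1\<close>
  belongs.\<close>

lemma no_taut:
  assumes "act c"
  shows "\<not> (mem c (2 * x) \<and> mem c (2 * x + 1))"
proof
  assume m: "mem c (2 * x) \<and> mem c (2 * x + 1)"
  obtain t v1 v2 v3 where b: "t < 5" "v1 < nv" "v2 < nv" "v3 < nv" "isc c t v1 v2 v3" and a: "clact t v1 v2 v3"
    using assms unfolding act_def by blast
  have 0: "clm t v1 v2 v3 (2 * x)" and 1: "clm t v1 v2 v3 (2 * x + 1)"
    using m mem_iff[OF b] by blast+
  have ge: "4 \<le> v1 \<and> 4 \<le> v2 \<and> 4 \<le> v3" if "t = 1 \<or> t = 2"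
    using a that vr_ge unfolding clact_def by auto
  have "t = 0 \<or> t = 1 \<or> t = 2 \<or> t = 3 \<or> t = 4" using b(1) by linarith
  then consider "t = 0" | "t = 1" | "t = 2" | "t = 3" | "t = 4" by blast
  then show False
  proof cases
    case 1
    then show False using 0 unfolding clm_def parity_simps by simp
  next
    case 2
    then have "x = v1 \<or> x = v2 \<or> x = v3" using 0 unfolding clm_def parity_simps by auto
    moreover have "x = 3 \<or> (\<exists>y. x = fr y)" using 1 2 unfolding clm_def parity_simps by auto
    then have "x < 4" by (elim disjE exE) (auto simp: fr_def of_bool_def)
    ultimately show False using ge 2 by auto
  next
    case 3
    then have A: "x = v1 \<or> x = v2 \<or> x = v3 \<or> x = 2 \<and> (\<exists>y g v. g < Gn \<and> v1 = vr y (g, v) \<and> y)"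
      using 0 unfolding clm_def parity_simps by auto
    moreover have B: "x = 0 \<or> x = 1 \<or> x = 3 \<or> x = 2 \<and> (\<exists>y g v. g < Gn \<and> v1 = vr y (g, v) \<and> \<not> y)"
      using 1 3 unfolding clm_def parity_simps by auto
    moreover have "4 \<le> v1 \<and> 4 \<le> v2 \<and> 4 \<le> v3" using ge 3 by blast
    ultimately have "x = 2" by linarith
    with \<open>4 \<le> v1 \<and> 4 \<le> v2 \<and> 4 \<le> v3\<close> have ne: "x \<noteq> v1" "x \<noteq> v2" "x \<noteq> v3" "x \<noteq> 0" "x \<noteq> 1" "x \<noteq> 3"
      by simp_all
    obtain g v where 4: "g < Gn" "v1 = vr True (g, v)" using A ne by auto
    obtain g' v' where 5: "g' < Gn" "v1 = vr False (g', v')" using B ne by auto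
    show False using vr_eq[of "(g, v)" "(g', v')" True False] 4 5 by simp
  next
    case 4
    then show False using 0 1 unfolding clm_def parity_simps by auto
  next
    case 5
    then show False using 0 1 vr_ge unfolding clm_def parity_simps by auto
  qed
qed

lemma satc_iff_sat:
  "(\<forall>c<nc. act c \<longrightarrow> (\<exists>l<2 * nv. mem c l \<and> L (l div 2) = Some (odd l))) \<longleftrightarrow> sat L"
proof -
  define hold where "hold l \<longleftrightarrow> l < 2 * nv \<and> L (l div 2) = Some (odd l)" for l
  define cls where "cls t v1 v2 v3 \<longleftrightarrow> (\<exists>l. clm t v1 v2 v3 l \<and> hold l)" for t v1 v2 v3
  have hold2: "hold (2 * x) \<longleftrightarrow> L x = Some False" "hold (2 * x + 1) \<longleftrightarrow> L x = Some True" if "x < nv" for x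
    using that by (auto simp: hold_def)
  have holdn: "hold 0 \<longleftrightarrow> L 0 = Some False" "hold 1 \<longleftrightarrow> L 0 = Some True" "hold 2 \<longleftrightarrow> L 1 = Some False"
    "hold 3 \<longleftrightarrow> L 1 = Some True" "hold 6 \<longleftrightarrow> L 3 = Some False" "hold 7 \<longleftrightarrow> L 3 = Some True"
    "hold (4 + of_bool b) \<longleftrightarrow> L 2 = Some b" for b
    using hold2[of 0] hold2[of 1] hold2[of 2] hold2[of 3] four_nv by (cases b; simp add: numeral_eq_Suc)+
  have frn: "fr y < nv" for y using fr_less[of y] four_nv by simp
  have vrn: "vr y (g, v) < nv" if "g < Gn" "v < W" for y g v using vr_less that by (simp add: rng_def)
  have step1: "(\<forall>c<nc. act c \<longrightarrow> (\<exists>l<2 * nv. mem c l \<and> L (l div 2) = Some (odd l))) \<longleftrightarrow>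
      (\<forall>t<5. \<forall>v1<nv. \<forall>v2<nv. \<forall>v3<nv. clact t v1 v2 v3 \<longrightarrow> cls t v1 v2 v3)"
  proof (intro iffI allI impI)
    fix t v1 v2 v3 assume *: "\<forall>c<nc. act c \<longrightarrow> (\<exists>l<2 * nv. mem c l \<and> L (l div 2) = Some (odd l))"
      and b: "t < 5" "v1 < nv" "v2 < nv" "v3 < nv" "clact t v1 v2 v3"
    have i: "isc (t + 5 * (v1 + nv * (v2 + nv * v3))) t v1 v2 v3" by (simp add: isc_def)
    have "act (t + 5 * (v1 + nv * (v2 + nv * v3)))" unfolding act_def using b i by blast
    with * isc_less[OF b(1-4) i] obtain l where "l < 2 * nv" "mem (t + 5 * (v1 + nv * (v2 + nv * v3))) l"
      "L (l div 2) = Some (odd l)" by blast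
    then show "cls t v1 v2 v3" unfolding cls_def hold_def using mem_iff[OF b(1-4) i] by blast
  next
    fix c assume *: "\<forall>t<5. \<forall>v1<nv. \<forall>v2<nv. \<forall>v3<nv. clact t v1 v2 v3 \<longrightarrow> cls t v1 v2 v3" and c: "act c"
    then obtain t v1 v2 v3 where b: "t < 5" "v1 < nv" "v2 < nv" "v3 < nv" "isc c t v1 v2 v3" "clact t v1 v2 v3"
      unfolding act_def by blast
    then have "cls t v1 v2 v3" using * by blast
    then show "\<exists>l<2 * nv. mem c l \<and> L (l div 2) = Some (odd l)"
      unfolding cls_def hold_def using mem_iff[OF b(1-5)] by blast
  qed
  \<comment> \<open>Injectivity of \<open>vr\<close> removes the quantifiers by which a clause
    recovers copy and group from \<open>v1\<close>.\<close>
  have vy0: "(\<exists>y'. \<exists>g'<Gn. vr y (g, 0) = vr y' (g', 0) \<and> Q y' g') \<longleftrightarrow> Q y g" if "g < Gn" for y g Q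
  proof
    assume "\<exists>y'. \<exists>g'<Gn. vr y (g, 0) = vr y' (g', 0) \<and> Q y' g'"
    then obtain y' g' where "g' < Gn" "vr y (g, 0) = vr y' (g', 0)" "Q y' g'" by blast
    then show "Q y g" using vr_eq[of "(g, 0)" "(g', 0)" y y'] that by simp
  next
    assume Q: "Q y g"
    show "\<exists>y'. \<exists>g'<Gn. vr y (g, 0) = vr y' (g', 0) \<and> Q y' g'"
      by (rule exI[of _ y], rule exI[of _ g], intro conjI that refl Q)
  qed
  have ex0: "cls 0 (vr y (g, 0)) v2 v3 \<longleftrightarrow> (\<exists>v<W. L (vr y (g, v)) = Some True) \<or> L (fr y) = Some True \<or> L 3 = Some True"
    if g: "g < Gn" for y g v2 v3
  proof -
    have "clm 0 (vr y (g, 0)) v2 v3 l \<longleftrightarrow> (\<exists>v<W. l = 2 * vr y (g, v) + 1) \<or> l = 2 * fr y + 1 \<or> l = 7" for l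
      unfolding clm_def vy0[OF g, of y "\<lambda>y g. (\<exists>v<W. l = 2 * vr y (g, v) + 1) \<or> l = 2 * fr y + 1 \<or> l = 7"] by simp
    then have "cls 0 (vr y (g, 0)) v2 v3 \<longleftrightarrow> (\<exists>v<W. hold (2 * vr y (g, v) + 1)) \<or> hold (2 * fr y + 1) \<or> hold 7"
      by (simp only: cls_def) blast
    then show ?thesis using hold2(2)[OF vrn[OF g]] hold2(2)[OF frn] holdn by auto
  qed
  have vy: "(\<exists>y'. \<exists>g'<Gn. \<exists>v'<W. vr y (g, v) = vr y' (g', v') \<and> Q y') \<longleftrightarrow> Q y" if "g < Gn" "v < W" for y g v Q
  proof
    assume "\<exists>y'. \<exists>g'<Gn. \<exists>v'<W. vr y (g, v) = vr y' (g', v') \<and> Q y'"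
    then obtain y' g' v' where "g' < Gn" "vr y (g, v) = vr y' (g', v')" "Q y'" by blast
    then show "Q y" using vr_eq[of "(g, v)" "(g', v')" y y'] that(1) by simp
  next
    assume Q: "Q y"
    show "\<exists>y'. \<exists>g'<Gn. \<exists>v'<W. vr y (g, v) = vr y' (g', v') \<and> Q y'"
      by (rule exI[of _ y], rule exI[of _ g], intro conjI that refl Q exI[of _ v])
  qed
  have ex1: "cls 1 (vr y (g1, w1)) (vr y (g2, w2)) (vr y (g3, w3)) \<longleftrightarrow> L (vr y (g1, w1)) = Some False \<or>
      L (vr y (g2, w2)) = Some False \<or> L (vr y (g3, w3)) = Some False \<or> L (fr y) = Some True \<or> L 3 = Some True"
    if g: "g1 < Gn" "w1 < W" "g2 < Gn" "w2 < W" "g3 < Gn" "w3 < W" for y g1 w1 g2 w2 g3 w3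
  proof -
    have "clm 1 (vr y (g1, w1)) (vr y (g2, w2)) (vr y (g3, w3)) l \<longleftrightarrow> l = 2 * vr y (g1, w1) \<or>
        l = 2 * vr y (g2, w2) \<or> l = 2 * vr y (g3, w3) \<or> l = 7 \<or> l = 2 * fr y + 1" for l
      unfolding clm_def vy[OF g(1,2), of y "\<lambda>y. l = 2 * fr y + 1"] by simp
    then have "cls 1 (vr y (g1, w1)) (vr y (g2, w2)) (vr y (g3, w3)) \<longleftrightarrow> hold (2 * vr y (g1, w1)) \<or>
        hold (2 * vr y (g2, w2)) \<or> hold (2 * vr y (g3, w3)) \<or> hold 7 \<or> hold (2 * fr y + 1)"
      by (simp only: cls_def) blast
    then show ?thesis using hold2(1)[OF vrn[OF g(1,2)]] hold2(1)[OF vrn[OF g(3,4)]] hold2(1)[OF vrn[OF g(5,6)]]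
        hold2(2)[OF frn] holdn by auto
  qed
  have ex2: "cls 2 (vr y (g1, w1)) (vr y (g2, w2)) (vr (\<not> y) (g3, w3)) \<longleftrightarrow> L (vr y (g1, w1)) = Some False \<or>
      L (vr y (g2, w2)) = Some False \<or> L (vr (\<not> y) (g3, w3)) = Some False \<or> L 0 = Some True \<or> L 1 = Some True \<or>
      L 2 = Some (\<not> y) \<or> L 3 = Some True"
    if g: "g1 < Gn" "w1 < W" "g2 < Gn" "w2 < W" "g3 < Gn" "w3 < W" for y g1 w1 g2 w2 g3 w3
  proof -
    have "clm 2 (vr y (g1, w1)) (vr y (g2, w2)) (vr (\<not> y) (g3, w3)) l \<longleftrightarrow> l = 2 * vr y (g1, w1) \<or>
        l = 2 * vr y (g2, w2) \<or> l = 2 * vr (\<not> y) (g3, w3) \<or> l = 1 \<or> l = 3 \<or> l = 7 \<or> l = 4 + of_bool (\<not> y)" for l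
      unfolding clm_def vy[OF g(1,2), of y "\<lambda>y. l = 4 + of_bool (\<not> y)"] by simp
    then have "cls 2 (vr y (g1, w1)) (vr y (g2, w2)) (vr (\<not> y) (g3, w3)) \<longleftrightarrow> hold (2 * vr y (g1, w1)) \<or>
        hold (2 * vr y (g2, w2)) \<or> hold (2 * vr (\<not> y) (g3, w3)) \<or> hold 1 \<or> hold 3 \<or> hold 7 \<or> hold (4 + of_bool (\<not> y))"
      by (simp only: cls_def) blast
    then show ?thesis using hold2(1)[OF vrn[OF g(1,2)]] hold2(1)[OF vrn[OF g(3,4)]] hold2(1)[OF vrn[OF g(5,6)]]
        holdn by auto
  qed
  have ex3: "cls 3 v1 v2 v3 \<longleftrightarrow> L 0 = Some False \<or> L 1 = Some False \<or> L 3 = Some True" for v1 v2 v3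
  proof -
    have "cls 3 v1 v2 v3 \<longleftrightarrow> hold 0 \<or> hold 2 \<or> hold 7" unfolding cls_def clm_def by auto
    then show ?thesis using holdn by simp
  qed
  have ex4: "cls 4 (fr y) v2 v3 \<longleftrightarrow> L 3 = Some False \<or> (\<exists>v<W. acc v \<and> L (vr y (0, v)) = Some True)" for y v2 v3
  proof -
    have "cls 4 (fr y) v2 v3 \<longleftrightarrow> hold 6 \<or> (\<exists>v<W. acc v \<and> hold (2 * vr y (0, v) + 1))"
      unfolding cls_def clm_def by auto
    then show ?thesis using holdn hold2(2)[OF vrn[OF Gn]] by auto
  qed
  have "sat L \<longleftrightarrow> (\<forall>t<5. \<forall>v1<nv. \<forall>v2<nv. \<forall>v3<nv. clact t v1 v2 v3 \<longrightarrow> cls t v1 v2 v3)" (is "_ \<longleftrightarrow> ?R")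
  proof
    assume s: "sat L"
    show ?R
    proof (intro allI impI)
      fix t v1 v2 v3 assume "clact t v1 v2 v3"
      then consider y g where "t = 0" "g < Gn" "v1 = vr y (g, 0)"
        | y g1 w1 g2 w2 g3 w3 where "t = 1" "g1 < Gn" "w1 < W" "g2 < Gn" "w2 < W" "g3 < Gn" "w3 < W"
          "forb (g1, w1) (g2, w2) (g3, w3)" "v1 = vr y (g1, w1)" "v2 = vr y (g2, w2)" "v3 = vr y (g3, w3)"
        | y g1 w1 g2 w2 g3 w3 where "t = 2" "g1 < Gn" "w1 < W" "g2 < Gn" "w2 < W" "g3 < Gn" "w3 < W"
          "F2 (g1, w1) (g2, w2) (g3, w3)" "v1 = vr y (g1, w1)" "v2 = vr y (g2, w2)" "v3 = vr (\<not> y) (g3, w3)"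
        | "t = 3" | y where "t = 4" "v1 = fr y"
        unfolding clact_def by blast
      then show "cls t v1 v2 v3"
      proof cases
        case 1
        have "(\<exists>v<W. L (vr y (g, v)) = Some True) \<or> L (fr y) = Some True \<or> L 3 = Some True"
          using s[unfolded sat_def, THEN conjunct1, rule_format, OF 1(2), of y] .
        then show ?thesis unfolding 1 ex0[OF 1(2)] .
      next
        case 2
        then have "rng (g1, w1)" "rng (g2, w2)" "rng (g3, w3)" by (auto simp: rng_def)
        from s[unfolded sat_def, THEN conjunct2, THEN conjunct1, rule_format, OF this 2(8), of y]
        show ?thesis unfolding 2 ex1[OF 2(2-7)] .
      next
        case 3
        then have "rng (g1, w1)" "rng (g2, w2)" "rng (g3, w3)" by (auto simp: rng_def)
        from s[unfolded sat_def, THEN conjunct2, THEN conjunct2, THEN conjunct1, rule_format, OF this 3(8), of y]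
        show ?thesis unfolding 3 ex2[OF 3(2-7)] .
      next
        case 4
        from s[unfolded sat_def, THEN conjunct2, THEN conjunct2, THEN conjunct2, THEN conjunct1]
        show ?thesis unfolding 4 ex3 .
      next
        case 5
        from s[unfolded sat_def, THEN conjunct2, THEN conjunct2, THEN conjunct2, THEN conjunct2, rule_format, of y]
        show ?thesis unfolding 5 ex4 .
      qed
    qed
  next
    assume R: ?R
    have EXI: "cls t v1 v2 v3" if "t < 5" "v1 < nv" "v2 < nv" "v3 < nv" "clact t v1 v2 v3" for t v1 v2 v3
      using R that by blast
    have nv0: "0 < nv" using four_nv by simp
    show "sat L" unfolding sat_def
    proof (intro conjI allI impI)
      fix y g assume g: "g < Gn"
      have "cls 0 (vr y (g, 0)) 0 0"
      proof (rule EXI)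
        show "clact 0 (vr y (g, 0)) 0 0" unfolding clact_def
          by (rule disjI1, intro conjI refl, rule exI[of _ y], rule exI[of _ g], intro conjI g refl)
      qed (use g nv0 vrn W_pos in auto)
      then show "(\<exists>v<W. L (vr y (g, v)) = Some True) \<or> L (fr y) = Some True \<or> L 3 = Some True" unfolding ex0[OF g] .
    next
      fix y p q u assume r: "rng p" "rng q" "rng u" and F: "forb p q u"
      obtain g1 w1 g2 w2 g3 w3 where p: "p = (g1, w1)" "q = (g2, w2)" "u = (g3, w3)" by (metis surj_pair)
      have g: "g1 < Gn" "w1 < W" "g2 < Gn" "w2 < W" "g3 < Gn" "w3 < W" using r by (auto simp: p rng_def)
      have "cls 1 (vr y (g1, w1)) (vr y (g2, w2)) (vr y (g3, w3))"
      proof (rule EXI)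
        show "clact 1 (vr y (g1, w1)) (vr y (g2, w2)) (vr y (g3, w3))" unfolding clact_def
          by (rule disjI2, rule disjI1, intro conjI refl, rule exI[of _ y], rule exI[of _ g1], rule conjI[OF g(1)],
              rule exI[of _ w1], rule conjI[OF g(2)], rule exI[of _ g2], rule conjI[OF g(3)], rule exI[of _ w2],
              rule conjI[OF g(4)], rule exI[of _ g3], rule conjI[OF g(5)], rule exI[of _ w3], rule conjI[OF g(6)],
              intro conjI refl F[unfolded p])
      qed (use g vrn in auto)
      then show "L (vr y p) = Some False \<or> L (vr y q) = Some False \<or> L (vr y u) = Some False \<or> L (fr y) = Some True \<or> L 3 = Some True"
        unfolding p ex1[OF g] .
    next
      fix y p q u assume r: "rng p" "rng q" "rng u" and F: "F2 p q u"
      obtain g1 w1 g2 w2 g3 w3 where p: "p = (g1, w1)" "q = (g2, w2)" "u = (g3, w3)" by (metis surj_pair)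
      have g: "g1 < Gn" "w1 < W" "g2 < Gn" "w2 < W" "g3 < Gn" "w3 < W" using r by (auto simp: p rng_def)
      have "cls 2 (vr y (g1, w1)) (vr y (g2, w2)) (vr (\<not> y) (g3, w3))"
      proof (rule EXI)
        show "clact 2 (vr y (g1, w1)) (vr y (g2, w2)) (vr (\<not> y) (g3, w3))" unfolding clact_def
          by (rule disjI2, rule disjI2, rule disjI1, intro conjI refl, rule exI[of _ y], rule exI[of _ g1], rule conjI[OF g(1)],
              rule exI[of _ w1], rule conjI[OF g(2)], rule exI[of _ g2], rule conjI[OF g(3)], rule exI[of _ w2],
              rule conjI[OF g(4)], rule exI[of _ g3], rule conjI[OF g(5)], rule exI[of _ w3], rule conjI[OF g(6)],
              intro conjI refl F[unfolded p])
      qed (use g vrn in auto)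
      then show "L (vr y p) = Some False \<or> L (vr y q) = Some False \<or> L (vr (\<not> y) u) = Some False \<or>
        L 0 = Some True \<or> L 1 = Some True \<or> L 2 = Some (\<not> y) \<or> L 3 = Some True"
        unfolding p ex2[OF g] .
    next
      have "cls 3 0 0 0" by (rule EXI) (use nv0 in \<open>auto simp: clact_def\<close>)
      then show "L 0 = Some False \<or> L 1 = Some False \<or> L 3 = Some True" unfolding ex3 .
    next
      fix y
      have "cls 4 (fr y) 0 0" by (rule EXI) (use nv0 frn in \<open>auto simp: clact_def\<close>)
      then show "L 3 = Some False \<or> (\<exists>v<W. acc v \<and> L (vr y (0, v)) = Some True)" unfolding ex4 .
    qed
  qed
  with step1 show ?thesis by simp
qed

end

section \<open>The graph in arithmetic form\<close>

context gadget
begin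

text \<open>Decoding is no term, so \<open>dcd\<close> is eliminated: each constructor becomes the
  existence of parameters with the right code, \<open>l div 2\<close> becomes an \<open>x\<close>
  with \<open>l = 2 * x\<close> or \<open>l = 2 * x + 1\<close>, and a leaf at the hub is a number
  that matches no code.\<close>

lemma adj_flat:
  "adj (dcd u) (dcd v) \<longleftrightarrow>
    (\<exists>l<2 * nv. u = 4 * l \<and> (v = 4 * (nv * (r + 1)) + 1 \<or>
      (\<exists>x<nv. (l = 2 * x \<or> l = 2 * x + 1) \<and> v = 4 * (x * (r + 1)) + 1) \<or>
      (\<exists>c<nc. v = 4 * ((l * nc + c) * r + 1) + 3))) \<or>
    (\<exists>l<2 * nv. \<exists>c<nc. \<exists>j<r. 1 \<le> j \<and> u = 4 * ((l * nc + c) * r + j) + 3 \<and>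
      (Suc j < r \<and> v = 4 * ((l * nc + c) * r + Suc j) + 3 \<or> Suc j = r \<and> act c \<and> mem c l \<and> v = 4 * c + 2)) \<or>
    (\<exists>x<nv. \<exists>i<r. Suc i < r \<and> u = 4 * (x * (r + 1) + i) + 1 \<and> v = 4 * (x * (r + 1) + Suc i) + 1) \<or>
    (\<exists>i<r. u = 4 * (nv * (r + 1) + i) + 1 \<and> v = 4 * (nv * (r + 1) + Suc i) + 1) \<or>
    (\<not> (\<exists>l<2 * nv. u = 4 * l) \<and> \<not> (\<exists>x<nv. \<exists>i<r. u = 4 * (x * (r + 1) + i) + 1) \<and>
      \<not> (\<exists>i<Suc r. u = 4 * (nv * (r + 1) + i) + 1) \<and> \<not> (\<exists>c<nc. act c \<and> u = 4 * c + 2) \<and>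
      \<not> (\<exists>l<2 * nv. \<exists>c<nc. \<exists>j<r. 1 \<le> j \<and> u = 4 * ((l * nc + c) * r + j) + 3) \<and>
      v = 4 * (nv * (r + 1)) + 1)" (is "_ \<longleftrightarrow> ?A \<or> ?B \<or> ?C \<or> ?D \<or> ?J")
proof -
  have oD: "dcd w = Opt l \<longleftrightarrow> l < 2 * nv \<and> w = 4 * l" for w l using dcd_eq[of "Opt l" w] by simp
  have pD: "dcd w = Pen x i \<longleftrightarrow> (x < nv \<and> i < r \<or> x = nv \<and> i \<le> r) \<and> w = 4 * (x * (r + 1) + i) + 1" for w x i
    using dcd_eq[of "Pen x i" w] by simp
  have cD: "dcd w = Cl c \<longleftrightarrow> (c < nc \<and> act c) \<and> w = 4 * c + 2" for w c using dcd_eq[of "Cl c" w] by simp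
  have tD: "dcd w = Pth l c j \<longleftrightarrow> (l < 2 * nv \<and> c < nc \<and> 1 \<le> j \<and> j < r) \<and> w = 4 * ((l * nc + c) * r + j) + 3" for w l c j
    using dcd_eq[of "Pth l c j" w] by simp
  have jD: "(\<exists>w. dcd u = Junk w) \<longleftrightarrow> \<not> (\<exists>l. dcd u = Opt l) \<and> \<not> (\<exists>x i. dcd u = Pen x i) \<and> \<not> (\<exists>c. dcd u = Cl c) \<and>
      \<not> (\<exists>l c j. dcd u = Pth l c j)"
    by (cases "dcd u") auto
  have adj: "adj (dcd u) (dcd v) \<longleftrightarrow>
      (\<exists>l. dcd u = Opt l \<and> (dcd v = Pen nv 0 \<or> dcd v = Pen (l div 2) 0 \<or> (\<exists>c. dcd v = Pth l c 1))) \<or>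
      (\<exists>l c j. dcd u = Pth l c j \<and> (dcd v = Pth l c (Suc j) \<or> Suc j = r \<and> mem c l \<and> dcd v = Cl c)) \<or>
      (\<exists>x i. dcd u = Pen x i \<and> dcd v = Pen x (Suc i)) \<or> ((\<exists>w. dcd u = Junk w) \<and> dcd v = Pen nv 0)"
    by (cases "dcd u"; cases "dcd v") auto
  have A: "(\<exists>l. dcd u = Opt l \<and> (dcd v = Pen nv 0 \<or> dcd v = Pen (l div 2) 0 \<or> (\<exists>c. dcd v = Pth l c 1))) \<longleftrightarrow> ?A"
  proof -
    have "(dcd v = Pen nv 0 \<or> dcd v = Pen (l div 2) 0 \<or> (\<exists>c. dcd v = Pth l c 1)) \<longleftrightarrow>
        v = 4 * (nv * (r + 1)) + 1 \<or> (\<exists>x<nv. (l = 2 * x \<or> l = 2 * x + 1) \<and> v = 4 * (x * (r + 1)) + 1) \<or>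
        (\<exists>c<nc. v = 4 * ((l * nc + c) * r + 1) + 3)" if l: "l < 2 * nv" for l
    proof -
      have 1: "dcd v = Pen nv 0 \<longleftrightarrow> v = 4 * (nv * (r + 1)) + 1" using pD[of v nv 0] by simp
      have "l = 2 * x \<or> l = 2 * x + 1 \<longleftrightarrow> x = l div 2" for x by presburger
      then have 2: "dcd v = Pen (l div 2) 0 \<longleftrightarrow> (\<exists>x<nv. (l = 2 * x \<or> l = 2 * x + 1) \<and> v = 4 * (x * (r + 1)) + 1)"
        using pD[of v "l div 2" 0] l r by auto
      have 3: "(\<exists>c. dcd v = Pth l c 1) \<longleftrightarrow> (\<exists>c<nc. v = 4 * ((l * nc + c) * r + 1) + 3)"
        unfolding tD using l r by auto
      show ?thesis unfolding 1 2 3 ..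
    qed
    then show ?thesis unfolding oD by blast
  qed
  have B: "(\<exists>l c j. dcd u = Pth l c j \<and> (dcd v = Pth l c (Suc j) \<or> Suc j = r \<and> mem c l \<and> dcd v = Cl c)) \<longleftrightarrow> ?B"
    unfolding tD cD using Suc_leI by auto
  have C: "(\<exists>x i. dcd u = Pen x i \<and> dcd v = Pen x (Suc i)) \<longleftrightarrow> ?C \<or> ?D"
  proof -
    have "(x < nv \<and> i < r \<or> x = nv \<and> i \<le> r) \<and> (x < nv \<and> Suc i < r \<or> x = nv \<and> Suc i \<le> r) \<longleftrightarrow>
        x < nv \<and> i < r \<and> Suc i < r \<or> x = nv \<and> i < r" for x i by auto
    then show ?thesis unfolding pD by blast
  qed
  have J: "((\<exists>w. dcd u = Junk w) \<and> dcd v = Pen nv 0) \<longleftrightarrow> ?J"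
  proof -
    have p: "(\<exists>x i. dcd u = Pen x i) \<longleftrightarrow> (\<exists>x<nv. \<exists>i<r. u = 4 * (x * (r + 1) + i) + 1) \<or>
        (\<exists>i<Suc r. u = 4 * (nv * (r + 1) + i) + 1)"
      unfolding pD less_Suc_eq_le by blast
    have q: "dcd v = Pen nv 0 \<longleftrightarrow> v = 4 * (nv * (r + 1)) + 1" using pD[of v nv 0] by simp
    show ?thesis unfolding jD p q oD cD tD by blast
  qed
  show ?thesis unfolding adj A B C J by blast
qed

lemma toks_flat: "u \<in> DS A \<longleftrightarrow> u = 4 * (nv * (r + 1)) + 1 \<or>
    (\<exists>x<nv. x \<in> A \<and> u = 4 * (2 * x + 1) \<or> x \<notin> A \<and> u = 4 * (2 * x))"
  unfolding DS_def toks_def tok_def by (auto simp: image_iff)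

end

section \<open>Definability of the reduction\<close>

text \<open>The range is a constant and is unrolled, so \<open>P j\<close> may depend on
  \<open>j\<close> in ways that no formula expresses, such as
  \<open>snd (th \<theta>) ! j\<close>.\<close>

lemma dp_ex_fin:
  "(\<And>j. j < (K :: nat) \<Longrightarrow> dp (P j)) \<Longrightarrow> dp (\<lambda>a e. \<exists>j<K. P j a e)"
proof (induction K)
  case 0
  then show ?case using dp_const[of False] by simp
next
  case (Suc K)
  have "dp (\<lambda>a e. \<exists>j<K. P j a e)" "dp (P K)" using Suc by simp_all
  from dp_disj[OF this] show ?case by (rule dp_cong) (auto simp: less_Suc_eq)
qed

lemma dp_ex_bool: "(\<And>y. dp (P y)) \<Longrightarrow> dp (\<lambda>a e. \<exists>y::bool. P y a e)"
  by (rule dp_cong[OF dp_disj[of "P True" "P False"]]) (auto simp: ex_bool_eq)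

lemma dp7:
  assumes "dp (\<lambda>a e. Q a (e 0) (e 1) (e 2) (e 3) (e 4) (e 5) (e 6))"
    "pt t0" "pt t1" "pt t2" "pt t3" "pt t4" "pt t5" "pt t6"
  shows "dp (\<lambda>a e. Q a (t0 e) (t1 e) (t2 e) (t3 e) (t4 e) (t5 e) (t6 e))"
  using dp_inst[OF assms(1), of "[t0, t1, t2, t3, t4, t5, t6]"] assms(2-) by simp

text \<open>Machine, polynomial and enumeration are fixed and only the input length \<open>L\<close>
  varies. Hence states and tapes can be treated by finite case distinctions, while all other
  quantities are terms in \<open>L\<close>.\<close>

locale tm_reduction =
  fixes M :: tm and p :: "nat poly" and th :: "nat \<Rightarrow> nat \<times> nat list" and n\<theta> r :: nat
  assumes sys: "\<And>L. tm_system M (poly p L) th n\<theta>" and r2: "r \<ge> 2"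
begin

interpretation T: tm_system M "poly p L" th n\<theta> for L
  by (rule sys)

interpretation Gd: gadget r "T.nv L" "T.nc L" "T.act L" "T.mem L" for L
  by unfold_locales (use r2 T.no_taut in auto)

lemma pt_Gn: "pt t \<Longrightarrow> pt (\<lambda>e. T.Gn (t e))"
  unfolding T.Gn_def by (intro pt_rules)

lemma pt_W: "pt t \<Longrightarrow> pt (\<lambda>e. T.W (t e))"
  unfolding T.W_def by (intro pt_rules)

lemma pt_vr: "pt t \<Longrightarrow> pt g \<Longrightarrow> pt v \<Longrightarrow> pt (\<lambda>e. T.vr (t e) y (g e, v e))"
  unfolding T.vr_def fst_conv snd_conv by (intro pt_Gn pt_rules)

lemma pt_nv: "pt t \<Longrightarrow> pt (\<lambda>e. T.nv (t e))"
  unfolding T.nv_def by (intro pt_Gn pt_W pt_rules)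

lemma pt_nc: "pt t \<Longrightarrow> pt (\<lambda>e. T.nc (t e))"
  unfolding T.nc_def by (intro pt_nv pt_rules)

lemma pt_N: "pt t \<Longrightarrow> pt (\<lambda>e. Gd.N (t e))"
  unfolding Gd.N_def by (intro pt_nv pt_nc pt_rules)

lemmas pts = pt_Gn pt_W pt_vr pt_nv pt_nc pt_N pt_rules

text \<open>The predecessor is no term, so the equation for a move to the left is solved for the old
  position.\<close>

lemma dp_mvd: "pt u \<Longrightarrow> pt t \<Longrightarrow> dp (\<lambda>a e. u e \<noteq> T.mvd d (t e))"
proof (cases d)
  case Left
  assume t: "pt u" "pt t"
  have "dp (\<lambda>a e. \<not> (t e = 0 \<and> u e = 0 \<or> t e = Suc (u e)))" by (intro dp_rules pts t)
  then show ?thesis by (rule dp_cong) (auto simp: T.mvd_def Left)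
next
  case Stay
  assume t: "pt u" "pt t"
  show ?thesis unfolding T.mvd_def Stay direction.case by (intro dp_rules t)
next
  case Right
  assume t: "pt u" "pt t"
  show ?thesis unfolding T.mvd_def Right direction.case by (intro dp_rules pts t)
qed

lemma dp_acc: "pt t \<Longrightarrow> dp (\<lambda>a e. T.acc (t e))"
  unfolding T.acc_def by (rule dp_fin[where P = "\<lambda>\<theta> a e. fst (th \<theta>) = accept_state M"], assumption, rule dp_const)

lemma dp_F1:
  assumes "pt g1" "pt w1" "pt g2" "pt w2" "pt g3" "pt w3" "pt t"
  shows "dp (\<lambda>a e. T.F1 (t e) (g1 e, w1 e) (g2 e, w2 e) (g3 e, w3 e))"
proof (rule dp7[where Q = "\<lambda>a g1 w1 g2 w2 g3 w3 L. T.F1 L (g1, w1) (g2, w2) (g3, w3)", OF _ assms])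
  have C: "dp (\<lambda>a e. e 1 < n\<theta> \<and>
      (\<exists>j<num_tapes M. e 2 = Suc j \<and> e 4 = T.cell j (e 3) \<and> e 5 \<noteq> snd (th (e 1)) ! j))"
    by (rule dp_fin[where P = "\<lambda>\<theta> a e. \<exists>j<num_tapes M. e 2 = Suc j \<and> e 4 = T.cell j (e 3) \<and> e 5 \<noteq> snd (th \<theta>) ! j"],
        rule pt_var, rule dp_ex_fin, unfold T.cell_def, intro dp_rules pts)
  have A: "dp (\<lambda>a e. e 0 = 0 \<and> n\<theta> \<le> e 1)" and Z: "dp (\<lambda>a e. e 0 = 0)"
    and B: "dp (\<lambda>a e. \<exists>j<num_tapes M. e 0 = Suc j \<and> poly p (e 6) \<le> e 1)"
    by (intro dp_rules pts)+
  show "dp (\<lambda>a e. T.F1 (e 6) (e 0, e 1) (e 2, e 3) (e 4, e 5))"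
    unfolding T.F1_def fst_conv snd_conv by (rule dp_disj[OF A dp_disj[OF B dp_conj[OF Z C]]])
qed

lemma dp_F2:
  assumes "pt g1" "pt w1" "pt g2" "pt w2" "pt g3" "pt w3" "pt t"
  shows "dp (\<lambda>a e. T.F2 (t e) (g1 e, w1 e) (g2 e, w2 e) (g3 e, w3 e))"
proof (rule dp7[where Q = "\<lambda>a g1 w1 g2 w2 g3 w3 L. T.F2 L (g1, w1) (g2, w2) (g3, w3)", OF _ assms])
  have I: "dp (\<lambda>a e. e 5 < n\<theta> \<and> fst (th (e 5)) \<noteq> q)" for q
    by (rule dp_fin[where P = "\<lambda>\<theta> a e. fst (th \<theta>) \<noteq> q"], rule pt_var, rule dp_const)
  have A: "dp (\<lambda>a e. e 1 < n\<theta> \<and> (e 4 = 0 \<and> e 5 < n\<theta> \<and> fst (th (e 5)) \<noteq> fst (T.act_of (e 1))))"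
    by (rule dp_fin[where P = "\<lambda>\<theta> a e. e 4 = 0 \<and> e 5 < n\<theta> \<and> fst (th (e 5)) \<noteq> fst (T.act_of \<theta>)"],
        rule pt_var, rule dp_conj[OF dp_eq[OF pt_var pt_const] I])
  have B: "dp (\<lambda>a e. e 1 < n\<theta> \<and> (\<exists>j<num_tapes M. e 2 = Suc j \<and>
       (e 4 = Suc j \<and> e 5 \<noteq> T.mvd (snd (snd (T.act_of (e 1)) ! j)) (e 3) \<or>
        e 4 = T.cell j (e 3) \<and> e 5 \<noteq> fst (snd (T.act_of (e 1)) ! j))))"
    by (rule dp_fin[where P = "\<lambda>\<theta> a e. \<exists>j<num_tapes M. e 2 = Suc j \<and>
       (e 4 = Suc j \<and> e 5 \<noteq> T.mvd (snd (snd (T.act_of \<theta>) ! j)) (e 3) \<or>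
        e 4 = T.cell j (e 3) \<and> e 5 \<noteq> fst (snd (T.act_of \<theta>) ! j))"],
        rule pt_var, rule dp_ex_fin, unfold T.cell_def,
        intro dp_conj dp_disj dp_mvd dp_eq dp_neg[OF dp_eq[OF _ pt_const]] pts)
  have C: "dp (\<lambda>a e. \<exists>j<num_tapes M. e 0 = Suc j \<and>
      (\<exists>i<poly p (e 6). i \<noteq> e 1 \<and> e 2 = T.cell j i \<and> e 4 = T.cell j i \<and> e 5 \<noteq> e 3))"
    unfolding T.cell_def by (intro dp_rules pts)
  have Z: "dp (\<lambda>a e. e 0 = 0)" by (intro dp_rules pts)
  show "dp (\<lambda>a e. T.F2 (e 6) (e 0, e 1) (e 2, e 3) (e 4, e 5))"
    unfolding T.F2_def fst_conv snd_conv by (rule dp_disj[OF dp_conj[OF Z A] dp_disj[OF dp_conj[OF Z B] C]])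
qed

lemma dp_act: "pt c \<Longrightarrow> pt t \<Longrightarrow> dp (\<lambda>a e. T.act (t e) (c e))"
proof (rule dp2[where Q = "\<lambda>a c L. T.act L c"])
  show "dp (\<lambda>a e. T.act (e 1) (e 0))"
    unfolding T.act_def T.isc_def T.clact_def T.forb_def T.fr_def fst_conv snd_conv
    by (intro dp_ex_bool dp_F1 dp_F2 dp_rules pts)
qed

lemma dp_mem: "pt c \<Longrightarrow> pt l \<Longrightarrow> pt t \<Longrightarrow> dp (\<lambda>a e. T.mem (t e) (c e) (l e))"
proof (rule dp3[where Q = "\<lambda>a c l L. T.mem L c l"])
  show "dp (\<lambda>a e. T.mem (e 2) (e 0) (e 1))"
    unfolding T.mem_def T.isc_def T.clm_def T.fr_def
    by (intro dp_ex_bool dp_acc dp_rules pts)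
qed

lemma dp_E: "pt u \<Longrightarrow> pt v \<Longrightarrow> pt t \<Longrightarrow> dp (\<lambda>a e. Gd.E (t e) (u e) (v e))"
proof (rule dp3[where Q = "\<lambda>a u v L. Gd.E L u v"])
  show "dp (\<lambda>a e. Gd.E (e 2) (e 0) (e 1))"
    unfolding Gd.E_def Gd.adj_flat by (intro dp_act dp_mem dp_rules pts)
qed

text \<open>The initial group 0 depends on the input only through its first symbol, so three
  constants describe it.\<close>

definition start_idx :: "nat \<Rightarrow> nat" where
  "start_idx b = (SOME \<theta>. \<theta> < n\<theta> \<and> th \<theta> = (start_state M, b # replicate (num_tapes M - 1) 0))"

definition ini :: "(nat \<Rightarrow> bool) \<Rightarrow> nat \<Rightarrow> nat \<Rightarrow> nat \<Rightarrow> bool" where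
  "ini \<xi> L g v \<longleftrightarrow>
     g = 0 \<and> (0 < L \<and> \<xi> 0 \<and> v = start_idx 2 \<or> 0 < L \<and> \<not> \<xi> 0 \<and> v = start_idx 1 \<or> L = 0 \<and> v = start_idx 0) \<or>
     (\<exists>j<num_tapes M. g = Suc j \<and> v = 0) \<or>
     (\<exists>i<poly p L. g = T.cell 0 i \<and> (i < L \<and> \<xi> i \<and> v = 2 \<or> i < L \<and> \<not> \<xi> i \<and> v = 1 \<or> L \<le> i \<and> v = 0)) \<or>
     (\<exists>j<num_tapes M. \<exists>i<poly p L. 1 \<le> j \<and> g = T.cell j i \<and> v = 0)"

definition src :: "(nat \<Rightarrow> bool) \<Rightarrow> nat \<Rightarrow> nat \<Rightarrow> bool" where
  "src \<xi> L x \<longleftrightarrow> x = 1 \<or> (\<exists>g<T.Gn L. \<exists>v<T.W L. x = T.vr L False (g, v) \<and> ini \<xi> L g v)"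

definition out :: "(nat \<Rightarrow> bool) \<Rightarrow> nat \<Rightarrow> nat \<Rightarrow> bool" where
  "out \<xi> L = encbit (Gd.N L) (Gd.E L)
     (\<lambda>u. u = 4 * (T.nv L * (r + 1)) + 1 \<or>
       (\<exists>x<T.nv L. src \<xi> L x \<and> u = 4 * (2 * x + 1) \<or> \<not> src \<xi> L x \<and> u = 4 * (2 * x)))
     (\<lambda>u. u = 4 * (T.nv L * (r + 1)) + 1 \<or> (\<exists>x<T.nv L. u = 4 * (2 * x + 1)))"

lemma dp_src: "pt x \<Longrightarrow> pt t \<Longrightarrow> dp (\<lambda>a e. src (a False) (t e) (x e))"
proof (rule dp2[where Q = "\<lambda>a x L. src (a False) L x"])
  show "dp (\<lambda>a e. src (a False) (e 1) (e 0))"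
    unfolding src_def ini_def T.cell_def by (intro dp_rules pts)
qed

lemma dp_out: "dp (\<lambda>a e. out (a False) (e 1) (e 0))"
  unfolding out_def encbit_def by (intro dp_rules dp_E dp_src pts)

definition red :: "bool list \<Rightarrow> bool list" where
  "red x = map (\<lambda>i. out (inp x False) (length x) i)
     [0..<Gd.N (length x) + 1 + Gd.N (length x) * Gd.N (length x) + Gd.N (length x) + Gd.N (length x)]"

lemma red_polytime: "polytime_computable red"
proof -
  have "pt (\<lambda>e. Gd.N (e 0) + 1 + Gd.N (e 0) * Gd.N (e 0) + Gd.N (e 0) + Gd.N (e 0))" by (intro pts)
  from polytime_computable_definable[OF dp_out this] show ?thesis
    by (simp add: red_def[abs_def])
qed

lemma ini_iff:
  assumes "g < T.Gn (length x)"
  shows "ini (inp x False) (length x) g v \<longleftrightarrow> T.enc (length x) (init_config M x) g = v"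
  using assms
proof (rule T.group_cases)
  have k: "num_tapes M = Suc (num_tapes M - 1)" using T.wf_facts(1) by simp
  have hd: "snd (init_config M x) ! j = (if j = 0 then string_contents x else (\<lambda>_. 0), 0)" if "j < num_tapes M" for j
    using that by (simp add: init_config_def nth_Cons' )
  have "T.idx (init_config M x) = start_idx (string_contents x 0)"
    by (simp add: T.idx_def start_idx_def init_config_def read_tape_def)
  then show "?thesis" if "g = 0"
    using that by (auto simp: ini_def T.enc_simps T.cell_neq string_contents_def inp_def)
  show ?thesis if "j < num_tapes M" "g = Suc j" for j
    using that hd by (auto simp: ini_def T.enc_simps T.cell_neq)
  show ?thesis if "j < num_tapes M" "i < poly p (length x)" "g = T.cell j i" for j i
  proof (cases "j = 0")
    case True
    then show ?thesis using that hd
      by (auto simp: ini_def T.enc_simps T.cell_neq T.cell_eq string_contents_def inp_def)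
  next
    case False
    then show ?thesis using that hd
      by (auto simp: ini_def T.enc_simps T.cell_neq T.cell_eq)
  qed
qed

lemma src_iff: "src (inp x False) (length x) v \<longleftrightarrow> v \<in> T.St (length x) False (T.enc (length x) (init_config M x))"
proof -
  have "(\<exists>y. v = T.fr y \<and> y \<noteq> False) \<longleftrightarrow> v = 1" by (auto simp: T.fr_def)
  moreover have "(\<exists>y. \<exists>g<T.Gn (length x). \<exists>w<T.W (length x). v = T.vr (length x) y (g, w) \<and> y = False \<and>
      T.enc (length x) (init_config M x) g = w) \<longleftrightarrow>
    (\<exists>g<T.Gn (length x). \<exists>w<T.W (length x). v = T.vr (length x) False (g, w) \<and> ini (inp x False) (length x) g w)"
    using ini_iff by blast
  ultimately show ?thesis unfolding T.St_def T.asg_def src_def by simp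
qed

lemma red_eq: "red x = encode_instance (Gd.G (length x))
    (Gd.DS (length x) (T.St (length x) False (T.enc (length x) (init_config M x))))
    (Gd.DS (length x) {..<T.nv (length x)})"
proof -
  have "encbit n (\<lambda>u v. u < n \<and> v < n \<and> E u v) S T i = encbit n E S T i" for n E S T i
    unfolding encbit_def by blast
  then show ?thesis
    unfolding red_def encode_instance_eq[OF Gd.pverts_G] Gd.arc_iff Gd.toks_flat src_iff[symmetric] out_def
    by (simp cong: conj_cong)
qed

section \<open>Correctness of the reduction\<close>

lemma red_correct:
  assumes dec: "decides M A" and space: "\<And>x. runs_in_space M x (poly p (length x))"
  shows "x \<in> A \<longleftrightarrow> red x \<in> DrDSR_bipartite r R"
proof -
  define L where "L = length x"
  define z where "z = T.enc L (init_config M x)"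
  let ?G = "Gd.G L" and ?S = "Gd.DS L (T.St L False z)" and ?T = "Gd.DS L {..<T.nv L}"
  have satc: "Gd.satc L l \<longleftrightarrow> T.sat L l" for l
    unfolding Gd.satc_def by (rule T.satc_iff_sat)
  have "T.conf_ok L (run M x 0)" by (rule T.conf_ok_run) (use space in \<open>simp add: L_def\<close>)
  then have valid: "T.valid L z" unfolding z_def run_def by (intro T.enc_valid) simp
  have satS: "Gd.satc L (lits (T.St L False z))" and satT: "Gd.satc L (lits {..<T.nv L})"
    unfolding satc using T.sat_St[OF valid] T.sat_full by blast+
  have "x \<in> A \<longleftrightarrow> T.accepts L z"
    unfolding z_def by (rule T.accepts_iff[symmetric]) (use space dec in \<open>auto simp: L_def decides_def\<close>)
  also have "\<dots> \<longleftrightarrow> (?S, ?T) \<in> (DS_move r R ?G)\<^sup>*"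
  proof
    assume "T.accepts L z"
    then have "(T.St L False z, {..<T.nv L}) \<in> (T.flip L)\<^sup>*" by (rule T.forward)
    then show "(?S, ?T) \<in> (DS_move r R ?G)\<^sup>*"
    proof (induction rule: rtrancl_induct)
      case (step B C)
      from step(2) obtain y where "T.sat L (lits B)" "T.sat L (lits C)" "y < T.nv L"
        "y \<notin> B \<and> C = insert y B \<or> y \<notin> C \<and> B = insert y C"
        unfolding T.flip_def by blast
      then have "(Gd.DS L B, Gd.DS L C) \<in> (DS_move r R ?G)\<^sup>*" by (intro Gd.DS_flip) (simp_all add: satc)
      with step(3) show ?case by (rule rtrancl_trans)
    qed simp
  next
    assume "(?S, ?T) \<in> (DS_move r R ?G)\<^sup>*"
    from Gd.good_path[OF this Gd.good_DS[OF satS]]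
    have "(Gd.lit L ?S, Gd.lit L ?T) \<in> (Gd.pflipc L)\<^sup>*" by blast
    moreover have "Gd.lit L ?S = lits (T.St L False z)" unfolding T.St_def
      by (rule Gd.lit_DS[OF T.asg_subset satS[unfolded T.St_def]])
    moreover have "Gd.lit L ?T = lits {..<T.nv L}" by (rule Gd.lit_DS[OF order_refl satT])
    moreover have "Gd.pflipc L = T.pflip L" unfolding Gd.pflipc_def T.pflip_def satc ..
    ultimately show "T.accepts L z" using T.backward[OF valid] by simp
  qed
  also have "\<dots> \<longleftrightarrow> reconfigurable r R ?G ?S ?T"
    using reconfigurable_iff[OF Gd.DS_dominating[OF satS]] by blast
  also have "\<dots> \<longleftrightarrow> red x \<in> DrDSR_bipartite r R"
  proof
    assume "reconfigurable r R ?G ?S ?T"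
    then show "red x \<in> DrDSR_bipartite r R"
      unfolding DrDSR_bipartite_def red_eq L_def[symmetric] z_def[symmetric]
      using Gd.pair_graph_G[of L] Gd.pverts_G[of L] Gd.bipartite_G[of L]
        Gd.DS_dominating[OF satS] Gd.DS_dominating[OF satT] by blast
  next
    assume "red x \<in> DrDSR_bipartite r R"
    then obtain H Ds Dt n where H: "encode_instance ?G ?S ?T = encode_instance H Ds Dt"
      "pair_graph H" "pverts H = {..<n}" "dist_dominating_set r H Ds" "dist_dominating_set r H Dt"
      "reconfigurable r R H Ds Dt"
      unfolding DrDSR_bipartite_def red_eq L_def[symmetric] z_def[symmetric] by blast
    have wf: "pair_wf_digraph K" if "pair_graph K" for K :: "nat pair_pre_digraph"
    proof -
      interpret pair_graph K by fact
      show ?thesis by unfold_locales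
    qed
    have sub: "D \<subseteq> {..<m}" if "dist_dominating_set r K D" "pverts K = {..<m}" for K D and m :: nat
      using that by (simp add: dist_dominating_set_def)
    \<comment> \<open>The word could a priori belong to the language as the encoding of another
      instance.\<close>
    have "?G = H \<and> ?S = Ds \<and> ?T = Dt"
      by (rule encode_instance_inject[OF wf[OF Gd.pair_graph_G] Gd.pverts_G sub[OF Gd.DS_dominating[OF satS] Gd.pverts_G]
            sub[OF Gd.DS_dominating[OF satT] Gd.pverts_G] wf[OF H(2)] H(3) sub[OF H(4,3)] sub[OF H(5,3)] H(1)])
    with H(6) show "reconfigurable r R ?G ?S ?T" by simp
  qed
  finally show ?thesis .
qed

end

lemma DrDSR_bipartite_hard:
  assumes r: "r \<ge> 2" and A: "A \<in> PSPACE"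
  shows "A \<le>\<^sub>P DrDSR_bipartite r R"
proof -
  obtain M p where M: "wf_tm M" "decides M A" "\<And>x. runs_in_space M x (poly p (length x))"
    using A unfolding PSPACE_def by blast
  let ?K = "{..<num_states M} \<times> {ss. length ss = num_tapes M \<and> set ss \<subseteq> {..<num_symbols M}}"
  have "finite ?K"
    using finite_lists_length_eq[of "{..<num_symbols M}" "num_tapes M"] by (simp add: conj_commute)
  then obtain th where th: "bij_betw th {..<card ?K} ?K"
    using ex_bij_betw_nat_finite[of ?K] by (auto simp: atLeast0LessThan)
  \<comment> \<open>Already the initial head position, cell 0, has to lie below the space
    bound.\<close>
  have "0 < poly p L" for L
  proof -
    have "\<forall>tp\<in>set (snd (run M (replicate L True) 0)). snd tp < poly p L"
      using M(3)[of "replicate L True"] unfolding runs_in_space_def by simp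
    then show ?thesis by (simp add: run_def init_config_def)
  qed
  then have red: "tm_reduction M p th (card ?K) r"
    using M(1) th r by (simp add: tm_reduction_def tm_system_def)
  show ?thesis unfolding polytime_reducible_def
    using tm_reduction.red_polytime[OF red] tm_reduction.red_correct[OF red M(2,3)] by blast
qed

theorem theorem21:
  fixes r :: nat and R :: reconf_rule
  assumes "r \<ge> 2"
  shows "PSPACE_complete (DrDSR_bipartite r R)"
  unfolding PSPACE_complete_def using DrDSR_in_PSPACE DrDSR_bipartite_hard[OF assms] by blast

end
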